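(* Let $0<\alpha<\pi$ and let $K=\{(r\cos\theta,r\sin\theta): r>0,\ -\alpha<\theta<\alpha\}$. Consider self-similar (SS) solutions $\boldsymbol u$ of the steady Navier--Stokes equations in $K$ with the no-slip boundary condition $\boldsymbol u=0$ on $\partial K\setminus\{0\}$ and with flux $\Phi\in\mathbb R$ (see context). The following statements hold. (1) Every SS solution $\boldsymbol u$ satisfies $u^\theta\equiv 0$. (2) (Type $(1,0)$.) If $\frac{\pi}{2}\le\alpha<\pi$, there is no SS solution of type $(1,0)$. If $0<\alpha<\frac{\pi}{2}$, there exists a number (maximum flux) $\Phi^{(1,0)}_{max}(\alpha)>0$ such that: (a) if $0<\Phi<\Phi^{(1,0)}_{max}(\alpha)$, then there exists an SS solution of type $(1,0)$ with flux $\Phi$; (b) if $\Phi>\Phi^{(1,0)}_{max}(\alpha)$, then there exists no SS solution of type $(1,0)$ with flux $\Phi$. (3) Let $(m_+,m_-)$ be a pair of non-negative integers with $|m_+-m_-|\le 1$ and $(m_+,m_-)\ne(0,0),(1,0),(2,1)$. For any $\alpha\in(0,\pi)$ there exists a number (maximum flux) $\Phi^{(m_+,m_-)}_{max}(\alpha)\in\mathbb R$ such that: (a) if $\Phi<\Phi^{(m_+,m_-)}_{max}(\alpha)$, then there exists an SS solution of type $(m_+,m_-)$ with flux $\Phi$; (b) if $\Phi>\Phi^{(m_+,m_-)}_{max}(\alpha)$, then there exists no SS solution of type $(m_+,m_-)$ with flux $\Phi$. (4) For $(m_+,m_-)=(2,1)$ and $0<\alpha\le\frac{\pi}{2}$,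 there exists a number (maximum flux) $\Phi^{(2,1)}_{max}(\alpha)\in\mathbb R$ such that: (a) if $\Phi<\Phi^{(2,1)}_{max}(\alpha)$, then there exists an SS solution of type $(2,1)$ with flux $\Phi$; (b) if $\Phi>\Phi^{(2,1)}_{max}(\alpha)$, then there exists no SS solution of type $(2,1)$ with flux $\Phi$.
   Context: In polar coordinates $x_1=r\cos\theta$, $x_2=r\sin\theta$ put $\boldsymbol e_r=(\cos\theta,\sin\theta)$, $\boldsymbol e_\theta=(-\sin\theta,\cos\theta)$ and write $\boldsymbol u=u^r\boldsymbol e_r+u^\theta\boldsymbol e_\theta$. The steady Navier--Stokes equations are $-\Delta\boldsymbol u+\boldsymbol u\cdot\nabla\boldsymbol u+\nabla p=0$, $\operatorname{div}\boldsymbol u=0$ in $K$; solutions are understood classically (smooth in $\overline K\setminus\{0\}$, where the two sides of $\partial K$ correspond to $\theta=\pm\alpha$). A solution $(\boldsymbol u,p)$ is self-similar (SS) if $\boldsymbol u(x)=\lambda\boldsymbol u(\lambda x)$ and $p(x)=\lambda^2p(\lambda x)$ for all $x\in K$, $\lambda>0$. The flux of $\boldsymbol u$ is $\Phi=\int_{-\alpha}^{\alpha}u^r(1,\theta)\,d\theta=\int_{-\alpha}^{\alpha}u^r(r,\theta)\,r\,d\theta$ for all $r>0$. Type: let $(m_+,m_-)\neq(0,0)$ be a pair of non-negative integers and let $\boldsymbol u=u^r\boldsymbol e_r$ be a non-trivial SS solution in $K$ with the no-slip condition. Put $f(\theta)=r\,u^r$ (a function of $\theta$ only). Then $\boldsymbol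 u$ is of type $(m_+,m_-)$ if the number of (maximal) intervals of $\theta\in(-\alpha,\alpha)$ where $f>0$ is $m_+$ and the number of (maximal) intervals where $f<0$ is $m_-$. The trivial solution $\boldsymbol u\equiv0$ has no type. *)

theory Defs
  imports "HOL-Analysis.Analysis"
begin

section \<open>Smooth functions\<close>

text \<open>For open \<open>S\<close> in a finite-dimensional space this is membership in \<open>C\<^sup>k(S)\<close>: all iterated
  directional derivatives of order at most \<open>k\<close> exist and are continuous on \<open>S\<close>.\<close>

primrec Ck_on :: "nat \<Rightarrow> ('a::real_normed_vector \<Rightarrow> 'b::real_normed_vector) \<Rightarrow> 'a set \<Rightarrow> bool" where
  "Ck_on 0 f S \<longleftrightarrow> continuous_on S f"
| "Ck_on (Suc k) f S \<longleftrightarrow>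
     (\<forall>x\<in>S. f differentiable (at x)) \<and> (\<forall>v. Ck_on k (\<lambda>x. frechet_derivative f (at x) v) S)"

definition smooth_on_open :: "('a::real_normed_vector \<Rightarrow> 'b::real_normed_vector) \<Rightarrow> 'a set \<Rightarrow> bool" where
  "smooth_on_open f U \<longleftrightarrow> open U \<and> (\<forall>k. Ck_on k f U)"

text \<open>On a set that is not open, smoothness means that the function is the restriction of a smooth
  function on an open neighbourhood. The values of \<open>f\<close> off \<open>S\<close> play no role.\<close>

definition smooth_up_to :: "('a::real_normed_vector \<Rightarrow> 'b::real_normed_vector) \<Rightarrow> 'a set \<Rightarrow> bool" where
  "smooth_up_to f S \<longleftrightarrow> (\<exists>U g. S \<subseteq> U \<and> smooth_on_open g U \<and> (\<forall>x\<in>S. g x = f x))"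


section \<open>Polar coordinates and the sector\<close>

definition e_r :: "real \<Rightarrow> real^2" where
  "e_r \<theta> = vector [cos \<theta>, sin \<theta>]"

definition e_theta :: "real \<Rightarrow> real^2" where
  "e_theta \<theta> = vector [- sin \<theta>, cos \<theta>]"

definition polar :: "real \<Rightarrow> real \<Rightarrow> real^2" where
  "polar r \<theta> = vector [r * cos \<theta>, r * sin \<theta>]"

definition sector :: "real \<Rightarrow> (real^2) set" where
  "sector \<alpha> = {polar r \<theta> | r \<theta>. r > 0 \<and> - \<alpha> < \<theta> \<and> \<theta> < \<alpha>}"

text \<open>Since \<open>e_r \<theta>, e_theta \<theta>\<close> is an orthonormal basis, the components of
  \<open>u = u\<^sup>r e\<^sub>r + u\<^sup>\<theta> e\<^sub>\<theta>\<close> are inner products with the basis vectors.\<close>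

definition u_rad :: "(real^2 \<Rightarrow> real^2) \<Rightarrow> real \<Rightarrow> real \<Rightarrow> real" where
  "u_rad u r \<theta> = u (polar r \<theta>) \<bullet> e_r \<theta>"

definition u_ang :: "(real^2 \<Rightarrow> real^2) \<Rightarrow> real \<Rightarrow> real \<Rightarrow> real" where
  "u_ang u r \<theta> = u (polar r \<theta>) \<bullet> e_theta \<theta>"

lemma polar_decomposition:
  "u (polar r \<theta>) = u_rad u r \<theta> *\<^sub>R e_r \<theta> + u_ang u r \<theta> *\<^sub>R e_theta \<theta>"
proof -
  have *: "cos \<theta> * (cos \<theta> * a) + sin \<theta> * (sin \<theta> * a) = a" for a :: real
    using sin_cos_squared_add[of \<theta>]
    by (metis add.commute distrib_right mult.assoc mult_1 power2_eq_square)
  show ?thesis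
    by (simp add: vec_eq_iff forall_2 u_rad_def u_ang_def e_r_def e_theta_def inner_vec_def
        sum_2 algebra_simps) (simp add: *)
qed


section \<open>The steady Navier--Stokes equations\<close>

definition pderiv_at :: "2 \<Rightarrow> (real^2 \<Rightarrow> 'b::real_normed_vector) \<Rightarrow> real^2 \<Rightarrow> 'b" where
  "pderiv_at i f x = frechet_derivative f (at x) (axis i 1)"

definition laplacian :: "(real^2 \<Rightarrow> real^2) \<Rightarrow> real^2 \<Rightarrow> real^2" where
  "laplacian u x = (\<Sum>i\<in>UNIV. pderiv_at i (pderiv_at i u) x)"

definition convection :: "(real^2 \<Rightarrow> real^2) \<Rightarrow> real^2 \<Rightarrow> real^2" where
  "convection u x = (\<Sum>i\<in>UNIV. (u x $ i) *\<^sub>R pderiv_at i u x)"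

definition gradient :: "(real^2 \<Rightarrow> real) \<Rightarrow> real^2 \<Rightarrow> real^2" where
  "gradient p x = (\<chi> i. pderiv_at i p x)"

definition divergence :: "(real^2 \<Rightarrow> real^2) \<Rightarrow> real^2 \<Rightarrow> real" where
  "divergence u x = (\<Sum>i\<in>UNIV. pderiv_at i u x $ i)"

definition NS_solution :: "real \<Rightarrow> (real^2 \<Rightarrow> real^2) \<Rightarrow> (real^2 \<Rightarrow> real) \<Rightarrow> bool" where
  "NS_solution \<alpha> u p \<longleftrightarrow>
     smooth_up_to u (closure (sector \<alpha>) - {0}) \<and>
     smooth_up_to p (closure (sector \<alpha>) - {0}) \<and>
     (\<forall>x\<in>sector \<alpha>. - laplacian u x + convection u x + gradient p x = 0) \<and>
     (\<forall>x\<in>sector \<alpha>. divergence u x = 0)"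

definition no_slip :: "real \<Rightarrow> (real^2 \<Rightarrow> real^2) \<Rightarrow> bool" where
  "no_slip \<alpha> u \<longleftrightarrow> (\<forall>x \<in> frontier (sector \<alpha>) - {0}. u x = 0)"

definition self_similar :: "real \<Rightarrow> (real^2 \<Rightarrow> real^2) \<Rightarrow> (real^2 \<Rightarrow> real) \<Rightarrow> bool" where
  "self_similar \<alpha> u p \<longleftrightarrow>
     (\<forall>x\<in>sector \<alpha>. \<forall>c>0. u x = c *\<^sub>R u (c *\<^sub>R x) \<and> p x = c\<^sup>2 * p (c *\<^sub>R x))"

definition SS_solution :: "real \<Rightarrow> (real^2 \<Rightarrow> real^2) \<Rightarrow> bool" where
  "SS_solution \<alpha> u \<longleftrightarrow> (\<exists>p. NS_solution \<alpha> u p \<and> no_slip \<alpha> u \<and> self_similar \<alpha> u p)"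


section \<open>Flux and type\<close>

text \<open>Both the flux and the function \<open>f(\<theta>) = r u\<^sup>r\<close> are read off at \<open>r = 1\<close>; the lemmas below
  show that for self-similar \<open>u\<close> any other \<open>r > 0\<close> gives the same result.\<close>

definition flux :: "real \<Rightarrow> (real^2 \<Rightarrow> real^2) \<Rightarrow> real" where
  "flux \<alpha> u = integral {- \<alpha>..\<alpha>} (\<lambda>\<theta>. u_rad u 1 \<theta>)"

definition profile :: "(real^2 \<Rightarrow> real^2) \<Rightarrow> real \<Rightarrow> real" where
  "profile u \<theta> = u_rad u 1 \<theta>"

lemma profile_eq:
  assumes "SS_solution \<alpha> u" "r > 0" "- \<alpha> < \<theta>" "\<theta> < \<alpha>"
  shows "profile u \<theta> = r * u_rad u r \<theta>"
proof -
  have "polar 1 \<theta> \<in> sector \<alpha>"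
    unfolding sector_def using assms by (blast intro: zero_less_one)
  moreover have "r *\<^sub>R polar 1 \<theta> = polar r \<theta>"
    by (simp add: polar_def vec_eq_iff forall_2)
  ultimately have "u (polar 1 \<theta>) = r *\<^sub>R u (polar r \<theta>)"
    using assms unfolding SS_solution_def self_similar_def by metis
  then show ?thesis by (simp add: profile_def u_rad_def)
qed

lemma flux_eq:
  assumes "SS_solution \<alpha> u" "r > 0"
  shows "flux \<alpha> u = integral {- \<alpha>..\<alpha>} (\<lambda>\<theta>. u_rad u r \<theta> * r)"
proof -
  have "integral {- \<alpha><..<\<alpha>} (\<lambda>\<theta>. u_rad u 1 \<theta>) = integral {- \<alpha><..<\<alpha>} (\<lambda>\<theta>. u_rad u r \<theta> * r)"
    using profile_eq[OF assms] by (intro integral_cong) (auto simp: profile_def mult.commute)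
  then show ?thesis
    unfolding flux_def
    using integral_open_interval[of "- \<alpha>" \<alpha> "\<lambda>\<theta>. u_rad u 1 \<theta>"]
      integral_open_interval[of "- \<alpha>" \<alpha> "\<lambda>\<theta>. u_rad u r \<theta> * r"]
    by simp
qed

definition maximal_intervals :: "real set \<Rightarrow> real set set" where
  "maximal_intervals S =
     {I. I \<noteq> {} \<and> is_interval I \<and> I \<subseteq> S \<and> (\<forall>J. is_interval J \<and> I \<subseteq> J \<and> J \<subseteq> S \<longrightarrow> J = I)}"

lemma maximal_intervals_eq_components: "maximal_intervals S = components S"
proof (intro set_eqI)
  fix I
  show "I \<in> maximal_intervals S \<longleftrightarrow> I \<in> components S"
    unfolding maximal_intervals_def mem_Collect_eq in_components_maximal is_interval_connected_1
    by (metis subset_empty)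
qed

text \<open>Finiteness has to be required separately, since \<open>card\<close> of an infinite set is \<open>0\<close>.\<close>

definition has_type :: "real \<Rightarrow> (real^2 \<Rightarrow> real^2) \<Rightarrow> nat \<Rightarrow> nat \<Rightarrow> bool" where
  "has_type \<alpha> u mp mn \<longleftrightarrow>
     (mp, mn) \<noteq> (0, 0) \<and>
     SS_solution \<alpha> u \<and>
     (\<forall>r \<theta>. r > 0 \<and> - \<alpha> < \<theta> \<and> \<theta> < \<alpha> \<longrightarrow> u (polar r \<theta>) = u_rad u r \<theta> *\<^sub>R e_r \<theta>) \<and>
     (\<exists>x\<in>sector \<alpha>. u x \<noteq> 0) \<and>
     finite (maximal_intervals {\<theta>\<in>{- \<alpha><..<\<alpha>}. profile u \<theta> > 0}) \<and>
     card (maximal_intervals {\<theta>\<in>{- \<alpha><..<\<alpha>}. profile u \<theta> > 0}) = mp \<and>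
     finite (maximal_intervals {\<theta>\<in>{- \<alpha><..<\<alpha>}. profile u \<theta> < 0}) \<and>
     card (maximal_intervals {\<theta>\<in>{- \<alpha><..<\<alpha>}. profile u \<theta> < 0}) = mn"

end

theory Submission
  imports Defs
begin

text \<open>Vanishing divergence, self-similarity and the no-slip condition give \<open>u\<^sup>\<theta> = 0\<close>, and the equations
  reduce to \<open>f'' = c - 4 f - f\<^sup>2\<close>, \<open>f (\<plusminus> \<alpha>) = 0\<close>, for \<open>f = r u\<^sup>r\<close>, with first integral
  \<open>f'\<^sup>2 = d + 2 c f - 4 f\<^sup>2 - 2/3 f\<^sup>3\<close>. Hence \<open>f\<close> is a chain of positive bumps of equal height \<open>a\<close>
  and negative bumps of equal depth \<open>b\<close>, and \<open>\<alpha>\<close> and the flux become elliptic integrals in the parameters.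
  If both signs occur, the parameters \<open>(a, b)\<close> with \<open>0 < b < 3 + a / 2\<close> determine \<open>c\<close> and \<open>d\<close>. This domain is
  foliated by curves along which the total length of \<open>m\<^sub>+\<close> positive and \<open>m\<^sub>-\<close> negative half bumps takes
  the value \<open>\<alpha>\<close> at most once: it decreases unless \<open>m\<^sub>+ = m\<^sub>- + 1\<close>, and in that case it exceeds \<open>\<alpha>\<close>
  wherever it might fail to decrease, which is where \<open>\<alpha> \<le> m\<^sub>- \<pi> / 2\<close> enters. So the level set of \<open>\<alpha>\<close> is a
  connected curve; on it the flux is continuous, bounded above, and tends to minus infinity at one end, so its range is a half line
  up to the end point. Single bumps are treated in the same way, with height and energy as parameters.\<close>

section \<open>The integrals of a single bump\<close>

text \<open>The number pi / 2 in the statement is the half period of the linearised equation f'' = c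
  - 4 f. The quadratic term shortens a lone positive bump, whose half length stays below pi / 2,
  whereas a half period from maximum to minimum has length at least pi / sqrt (4 + a - b), which is
  pi / 2 or more as soon as the minimum is at least as deep as the maximum is high. No elliptic
  integral is ever differentiated in its parameters. After scaling to the unit interval the
  parameters enter only through a quadratic under the root, so lengths are compared by comparing
  quadratics pointwise, and the curves in the parameter domain are chosen so that this comparison
  works along each of them. What is needed of the length on such a curve is only that it cannot
  return to the level \<alpha> once it is at or below it; then the level set is the graph of a
  continuous function of the curve index. Neither uniqueness of a solution with given flux nor
  monotonicity of the flux enters: the maximum flux is a supremum, and the intermediate value
  theorem fills in everything below it.\<close>

lemma integral_strict_mono:
  fixes f g :: "real \<Rightarrow> real"
  assumes f: "f integrable_on {a<..<b}" and g: "g integrable_on {a<..<b}" and "a < b"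
    and cf: "continuous_on {a<..<b} f" and cg: "continuous_on {a<..<b} g"
    and less: "\<And>x. x \<in> {a<..<b} \<Longrightarrow> f x < g x"
  shows "integral {a<..<b} f < integral {a<..<b} g"
proof -
  let ?h = "\<lambda>x. g x - f x"
  \<comment> \<open>The integrands may be singular at both end points, so the strict inequality is
    extracted from the compact middle third.\<close>
  define l r where "l = (2 * a + b) / 3" and "r = (a + 2 * b) / 3"
  have lr: "a < l" "l < r" "r < b"
    using \<open>a < b\<close> by (auto simp: l_def r_def)
  have sub: "{l..r} \<subseteq> {a<..<b}" using lr by auto
  have h: "?h integrable_on {a<..<b}"
    using f g by (intro integrable_diff)
  have ch: "continuous_on {l..r} ?h"
    by (intro continuous_intros continuous_on_subset[OF cf sub] continuous_on_subset[OF cg sub])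
  have "integral {l..r} (\<lambda>x. 0::real) < integral {l..r} ?h"
    using lr less sub by (intro integral_less_real ch) auto
  also have "\<dots> \<le> integral {a<..<b} ?h"
    using less sub h
    by (intro integral_subset_le integrable_continuous_real ch) (auto intro: less_imp_le)
  finally show ?thesis
    using f g by (simp add: integral_diff)
qed

section \<open>Comparison integrals with singular end points\<close>

lemma has_integral_inverse_sqrt_arcsine:
  "((\<lambda>s::real. 1 / sqrt ((1 - s) * s)) has_integral pi) {0<..<1}"
proof -
  have "((\<lambda>s::real. 1 / sqrt ((1 - s) * s)) has_integral (arcsin (2 * 1 - 1) - arcsin (2 * 0 - 1))) {0..1}"
  proof (rule fundamental_theorem_of_calculus_interior)
    show "continuous_on {0..1} (\<lambda>s::real. arcsin (2 * s - 1))"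
      by (intro continuous_intros) auto
  next
    fix s :: real assume s: "s \<in> {0<..<1}"
    have "1 - (2 * s - 1)\<^sup>2 = 2\<^sup>2 * ((1 - s) * s)"
      by (simp add: power2_eq_square algebra_simps)
    then have "sqrt (1 - (2 * s - 1)\<^sup>2) = 2 * sqrt ((1 - s) * s)"
      by (simp only: real_sqrt_mult real_sqrt_abs abs_numeral)
    moreover have "((\<lambda>s. arcsin (2 * s - 1)) has_real_derivative inverse (sqrt (1 - (2 * s - 1)\<^sup>2)) * 2) (at s)"
      by (rule derivative_eq_intros refl | use s in simp)+
    ultimately show "((\<lambda>s. arcsin (2 * s - 1)) has_vector_derivative 1 / sqrt ((1 - s) * s)) (at s)"
      by (simp add: has_real_derivative_iff_has_vector_derivative[symmetric] divide_simps)
  qed simp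
  then show ?thesis
    by (simp add: has_integral_Icc_iff_Ioo)
qed

lemma has_integral_arcsine_moment:
  "((\<lambda>s::real. s / sqrt ((1 - s) * s)) has_integral pi / 2) {0<..<1}"
proof -
  let ?F = "\<lambda>s::real. arcsin (2 * s - 1) / 2 - sqrt ((1 - s) * s)"
  have "((\<lambda>s::real. s / sqrt ((1 - s) * s)) has_integral (?F 1 - ?F 0)) {0..1}"
  proof (rule fundamental_theorem_of_calculus_interior)
    show "continuous_on {0..1} ?F"
      by (intro continuous_intros) auto
  next
    fix s :: real assume s: "s \<in> {0<..<1}"
    have "1 - (2 * s - 1)\<^sup>2 = 2\<^sup>2 * ((1 - s) * s)"
      by (simp add: power2_eq_square algebra_simps)
    then have sq: "sqrt (1 - (2 * s - 1)\<^sup>2) = 2 * sqrt ((1 - s) * s)"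
      by (simp only: real_sqrt_mult real_sqrt_abs abs_numeral)
    have pos: "(1 - s) * s > 0" using s by simp
    have "(?F has_real_derivative (inverse (sqrt (1 - (2 * s - 1)\<^sup>2)) * 2) / 2
        - (1 - 2 * s) * (inverse (sqrt ((1 - s) * s)) / 2)) (at s)"
      by (rule derivative_eq_intros refl | use s pos in \<open>simp add: algebra_simps\<close>)+
    moreover have alg: "inverse (2 * w) * 2 / 2 - (1 - 2 * s) * (inverse w / 2) = s / w" if "w > 0" for w :: real
      using that by (simp add: field_simps)
    have "inverse (sqrt (1 - (2 * s - 1)\<^sup>2)) * 2 / 2 - (1 - 2 * s) * (inverse (sqrt ((1 - s) * s)) / 2)
        = s / sqrt ((1 - s) * s)"
      unfolding sq by (rule alg) (use pos in simp)
    ultimately show "(?F has_vector_derivative s / sqrt ((1 - s) * s)) (at s)"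
      unfolding has_real_derivative_iff_has_vector_derivative[symmetric] by (simp only:)
  qed simp
  then show ?thesis
    by (simp add: has_integral_Icc_iff_Ioo)
qed

lemma has_integral_inverse_sqrt_one_minus:
  "((\<lambda>s::real. 1 / sqrt (1 - s)) has_integral 2) {0<..<1}"
proof -
  have "((\<lambda>s::real. 1 / sqrt (1 - s)) has_integral ((- 2 * sqrt (1 - 1)) - (- 2 * sqrt (1 - 0)))) {0..1}"
  proof (rule fundamental_theorem_of_calculus_interior)
    show "continuous_on {0..1} (\<lambda>s::real. - 2 * sqrt (1 - s))"
      by (intro continuous_intros)
  next
    fix s :: real assume s: "s \<in> {0<..<1}"
    have "((\<lambda>s. - 2 * sqrt (1 - s)) has_real_derivative 1 / sqrt (1 - s)) (at s)"
      by (rule derivative_eq_intros refl | use s in \<open>simp add: field_simps\<close>)+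
    then show "((\<lambda>s. - 2 * sqrt (1 - s)) has_vector_derivative 1 / sqrt (1 - s)) (at s)"
      by (simp add: has_real_derivative_iff_has_vector_derivative)
  qed simp
  then show ?thesis
    by (simp add: has_integral_Icc_iff_Ioo)
qed

text \<open>On a bump \<open>f\<close> of height \<open>a\<close>, the quotient \<open>s = f / a\<close> satisfies \<open>s'\<^sup>2 = 2/3 (1 - s) quadr A B C s\<close>, so \<open>bint\<close> and
  \<open>bmom\<close> are, up to constants, its length and its integral.\<close>
definition quadr :: "real \<Rightarrow> real \<Rightarrow> real \<Rightarrow> real \<Rightarrow> real" where
  "quadr A B C s = A * s\<^sup>2 + B * s + C"

text \<open>The constant of the linear minorant \<open>slope A B C * s\<close> on the unit interval,
  for \<open>C \<ge> 0\<close>. If \<open>A \<le> 0\<close>, the quadratic is concave, lies above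
  its chord, and \<open>slope\<close> is its value at 1; if \<open>A > 0\<close>, the term with s^2
  is discarded.\<close>

definition slope :: "real \<Rightarrow> real \<Rightarrow> real \<Rightarrow> real" where
  "slope A B C = B + C + min A 0"

text \<open>The case \<open>C = 0\<close> is included on purpose: the kernel is then singular at 0
  as well, as for the half period from maximum to minimum or for a bump of zero energy, which meets
  the axis with slope zero.\<close>

definition admissible :: "real \<Rightarrow> real \<Rightarrow> real \<Rightarrow> bool" where
  "admissible A B C \<longleftrightarrow> 0 \<le> C \<and> 0 < slope A B C"

definition bint :: "real \<Rightarrow> real \<Rightarrow> real \<Rightarrow> real" where
  "bint A B C = integral {0<..<1} (\<lambda>s. 1 / sqrt ((1 - s) * quadr A B C s))"

definition bmom :: "real \<Rightarrow> real \<Rightarrow> real \<Rightarrow> real" where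
  "bmom A B C = integral {0<..<1} (\<lambda>s. s / sqrt ((1 - s) * quadr A B C s))"

lemma quadr_ge:
  assumes "0 \<le> C" "0 \<le> s" "s \<le> 1"
  shows "slope A B C * s \<le> quadr A B C s"
proof (cases "A \<le> 0")
  case True
  have "quadr A B C s - slope A B C * s = (1 - s) * (C - A * s)"
    using True by (simp add: quadr_def slope_def power2_eq_square algebra_simps min_def)
  also have "\<dots> \<ge> 0"
    using assms True by (intro mult_nonneg_nonneg) (auto simp: mult_nonpos_nonneg intro: order_trans[of _ 0])
  finally show ?thesis by simp
next
  case False
  have "quadr A B C s - slope A B C * s = A * s\<^sup>2 + C * (1 - s)"
    using False by (simp add: quadr_def slope_def power2_eq_square algebra_simps min_def)
  also have "\<dots> \<ge> 0"
    using assms False by (intro add_nonneg_nonneg mult_nonneg_nonneg) auto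
  finally show ?thesis by simp
qed

lemma quadr_pos:
  assumes "admissible A B C" "0 < s" "s \<le> 1"
  shows "0 < quadr A B C s"
proof -
  have "0 < slope A B C * s" using assms by (simp add: admissible_def)
  also have "\<dots> \<le> quadr A B C s" using assms by (intro quadr_ge) (auto simp: admissible_def)
  finally show ?thesis .
qed

text \<open>One majorant serves for integrability, for the upper bounds of \<open>bint\<close> and
  \<open>bmom\<close>, and for dominated convergence: the coefficients enter it only through
  \<open>h\<close>.\<close>

lemma kernel_bound:
  assumes "0 \<le> C" "0 < h" "h \<le> slope A B C" "s \<in> {0<..<1}"
  shows "1 / sqrt ((1 - s) * quadr A B C s) \<le> (1 / sqrt h) * (1 / sqrt ((1 - s) * s))"
proof -
  have "h * s \<le> quadr A B C s"
    using quadr_ge[of C s A B] mult_right_mono[of h "slope A B C" s] assms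
    by (meson greaterThanLessThan_iff less_imp_le order_trans)
  then have "h * ((1 - s) * s) \<le> (1 - s) * quadr A B C s"
    using assms mult_left_mono[of "h * s" "quadr A B C s" "1 - s"] by (simp add: mult_ac)
  then have "sqrt h * sqrt ((1 - s) * s) \<le> sqrt ((1 - s) * quadr A B C s)"
    by (metis real_sqrt_le_mono real_sqrt_mult)
  moreover have "0 < sqrt h * sqrt ((1 - s) * s)" using assms by simp
  ultimately have "1 / sqrt ((1 - s) * quadr A B C s) \<le> 1 / (sqrt h * sqrt ((1 - s) * s))"
    by (intro frac_le) auto
  then show ?thesis by simp
qed

lemma continuous_on_quadr [continuous_intros]: "continuous_on S (quadr A B C)"
  unfolding quadr_def by (intro continuous_intros)

lemma kernel_continuous:
  assumes "admissible A B C"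
  shows "continuous_on {0<..<1} (\<lambda>s. 1 / sqrt ((1 - s) * quadr A B C s))"
  using quadr_pos[OF assms] by (intro continuous_intros) (auto simp: less_imp_neq[symmetric])

lemma moment_kernel_continuous:
  assumes "admissible A B C"
  shows "continuous_on {0<..<1} (\<lambda>s. s / sqrt ((1 - s) * quadr A B C s))"
  using quadr_pos[OF assms] by (intro continuous_intros) (auto simp: less_imp_neq[symmetric])

lemma kernel_integrable:
  assumes "admissible A B C"
  shows "(\<lambda>s. 1 / sqrt ((1 - s) * quadr A B C s)) integrable_on {0<..<1}"
proof (rule measurable_bounded_by_integrable_imp_integrable_real)
  show "(\<lambda>s. 1 / sqrt ((1 - s) * quadr A B C s)) \<in> borel_measurable (lebesgue_on {0<..<1})"
    by (intro continuous_imp_measurable_on_sets_lebesgue kernel_continuous assms) auto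
  show "(\<lambda>s. (1 / sqrt (slope A B C)) * (1 / sqrt ((1 - s) * s))) integrable_on {0<..<1}"
    using has_integral_mult_right[OF has_integral_inverse_sqrt_arcsine] by blast
next
  fix s :: real assume s: "s \<in> {0<..<1}"
  then have "0 < quadr A B C s" using quadr_pos[OF assms] by auto
  then show "\<bar>1 / sqrt ((1 - s) * quadr A B C s)\<bar> \<le> (1 / sqrt (slope A B C)) * (1 / sqrt ((1 - s) * s))"
    using kernel_bound[OF _ _ order_refl s, of C A B] assms s by (simp add: admissible_def)
qed auto

lemma moment_kernel_integrable:
  assumes "admissible A B C"
  shows "(\<lambda>s. s / sqrt ((1 - s) * quadr A B C s)) integrable_on {0<..<1}"
proof (rule measurable_bounded_by_integrable_imp_integrable_real)
  show "(\<lambda>s. s / sqrt ((1 - s) * quadr A B C s)) \<in> borel_measurable (lebesgue_on {0<..<1})"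
    by (intro continuous_imp_measurable_on_sets_lebesgue moment_kernel_continuous assms) auto
  show "(\<lambda>s. 1 / sqrt ((1 - s) * quadr A B C s)) integrable_on {0<..<1}"
    by (rule kernel_integrable[OF assms])
next
  fix s :: real assume s: "s \<in> {0<..<1}"
  then have "0 < quadr A B C s" using quadr_pos[OF assms] by auto
  then show "\<bar>s / sqrt ((1 - s) * quadr A B C s)\<bar> \<le> 1 / sqrt ((1 - s) * quadr A B C s)"
    using s by (simp add: divide_right_mono abs_mult)
qed auto

section \<open>Monotonicity and bounds of the bump integrals\<close>

lemma bint_strict_antimono:
  assumes "admissible A B C" "admissible A' B' C'"
    and less: "\<And>s. 0 < s \<Longrightarrow> s < 1 \<Longrightarrow> quadr A B C s < quadr A' B' C' s"
  shows "bint A' B' C' < bint A B C"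
  unfolding bint_def
proof (intro integral_strict_mono kernel_integrable kernel_continuous assms)
  fix s :: real assume s: "s \<in> {0<..<1}"
  have "0 < quadr A B C s" using quadr_pos[OF assms(1)] s by auto
  then show "1 / sqrt ((1 - s) * quadr A' B' C' s) < 1 / sqrt ((1 - s) * quadr A B C s)"
    using less[of s] s by (intro divide_strict_left_mono mult_pos_pos) auto
qed simp

lemma bint_antimono:
  assumes "admissible A B C" "admissible A' B' C'"
    and less: "\<And>s. 0 < s \<Longrightarrow> s < 1 \<Longrightarrow> quadr A B C s \<le> quadr A' B' C' s"
  shows "bint A' B' C' \<le> bint A B C"
  unfolding bint_def
proof (intro integral_le kernel_integrable assms)
  fix s :: real assume s: "s \<in> {0<..<1}"
  have "0 < quadr A B C s" using quadr_pos[OF assms(1)] s by auto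
  then show "1 / sqrt ((1 - s) * quadr A' B' C' s) \<le> 1 / sqrt ((1 - s) * quadr A B C s)"
    using less[of s] s by (intro divide_left_mono mult_pos_pos) auto
qed

lemma bint_ge:
  assumes "admissible A B C" and M: "\<And>s. 0 < s \<Longrightarrow> s < 1 \<Longrightarrow> quadr A B C s \<le> M"
  shows "2 / sqrt M \<le> bint A B C"
proof -
  have "0 < quadr A B C (1/2)" using quadr_pos[OF assms(1)] by auto
  with M[of "1/2"] have "0 < M" by simp
  have *: "((\<lambda>s::real. (1 / sqrt M) * (1 / sqrt (1 - s))) has_integral (1 / sqrt M) * 2) {0<..<1}"
    by (intro has_integral_mult_right has_integral_inverse_sqrt_one_minus)
  have "(1 / sqrt M) * 2 \<le> bint A B C"
    unfolding bint_def
  proof (rule has_integral_le[OF * integrable_integral[OF kernel_integrable[OF assms(1)]]])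
    fix s :: real assume s: "s \<in> {0<..<1}"
    have q: "0 < quadr A B C s" using quadr_pos[OF assms(1)] s by auto
    have "1 / (sqrt M * sqrt (1 - s)) \<le> 1 / sqrt ((1 - s) * quadr A B C s)"
      unfolding real_sqrt_mult[symmetric] using s q M[of s] \<open>0 < M\<close>
      by (intro divide_left_mono mult_pos_pos) (auto simp: mult.commute)
    then show "(1 / sqrt M) * (1 / sqrt (1 - s)) \<le> 1 / sqrt ((1 - s) * quadr A B C s)"
      by simp
  qed
  then show ?thesis by simp
qed

lemma bint_le:
  assumes "0 \<le> C" "0 < h" "h \<le> slope A B C"
  shows "bint A B C \<le> pi / sqrt h"
proof -
  have adm: "admissible A B C" using assms by (simp add: admissible_def)
  have *: "((\<lambda>s::real. (1 / sqrt h) * (1 / sqrt ((1 - s) * s))) has_integral (1 / sqrt h) * pi) {0<..<1}"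
    by (intro has_integral_mult_right has_integral_inverse_sqrt_arcsine)
  have "bint A B C \<le> (1 / sqrt h) * pi"
    unfolding bint_def
    by (rule has_integral_le[OF integrable_integral[OF kernel_integrable[OF adm]] *])
       (rule kernel_bound[OF assms])
  then show ?thesis by simp
qed

lemma bmom_le:
  assumes "0 \<le> C" "0 < h" "h \<le> slope A B C"
  shows "bmom A B C \<le> pi / 2 / sqrt h"
proof -
  have adm: "admissible A B C" using assms by (simp add: admissible_def)
  have *: "((\<lambda>s::real. (1 / sqrt h) * (s / sqrt ((1 - s) * s))) has_integral (1 / sqrt h) * (pi / 2)) {0<..<1}"
    by (intro has_integral_mult_right has_integral_arcsine_moment)
  have "bmom A B C \<le> (1 / sqrt h) * (pi / 2)"
    unfolding bmom_def
  proof (rule has_integral_le[OF integrable_integral[OF moment_kernel_integrable[OF adm]] *])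
    fix s :: real assume s: "s \<in> {0<..<1}"
    have "s * (1 / sqrt ((1 - s) * quadr A B C s)) \<le> s * ((1 / sqrt h) * (1 / sqrt ((1 - s) * s)))"
      using s kernel_bound[OF assms s] by (intro mult_left_mono) auto
    then show "s / sqrt ((1 - s) * quadr A B C s) \<le> (1 / sqrt h) * (s / sqrt ((1 - s) * s))"
      by (simp add: mult_ac)
  qed
  then show ?thesis by simp
qed

lemma bint_pos:
  assumes "admissible A B C"
  shows "0 < bint A B C"
proof -
  have "integral {0<..<1} (\<lambda>s::real. 0) < bint A B C"
    unfolding bint_def
    using quadr_pos[OF assms]
    by (intro integral_strict_mono kernel_integrable kernel_continuous assms integrable_0) auto
  then show ?thesis by simp
qed

lemma bmom_pos:
  assumes "admissible A B C"
  shows "0 < bmom A B C"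
proof -
  have "integral {0<..<1} (\<lambda>s::real. 0) < bmom A B C"
    unfolding bmom_def
    using quadr_pos[OF assms]
    by (intro integral_strict_mono moment_kernel_integrable moment_kernel_continuous assms integrable_0) auto
  then show ?thesis by simp
qed

lemma bmom_le_bint:
  assumes "admissible A B C"
  shows "bmom A B C \<le> bint A B C"
  unfolding bmom_def bint_def
proof (intro integral_le moment_kernel_integrable kernel_integrable assms)
  fix s :: real assume s: "s \<in> {0<..<1}"
  then have "0 < quadr A B C s" using quadr_pos[OF assms] by auto
  then show "s / sqrt ((1 - s) * quadr A B C s) \<le> 1 / sqrt ((1 - s) * quadr A B C s)"
    using s by (simp add: divide_right_mono)
qed

text \<open>Chebyshev's inequality: the kernel is \<open>1 / sqrt s\<close> times an increasing function, and
  the mean of \<open>s\<close> with respect to \<open>1 / sqrt s\<close> on the unit interval is \<open>1 / 3\<close>.\<close>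
lemma bmom_ge:
  assumes adm: "admissible A B C" and "A \<le> 0"
  shows "bint A B C / 3 \<le> bmom A B C"
proof -
  define w where "w = (\<lambda>s. 1 / sqrt ((1 - s) * quadr A B C s))"
  define p where "p = (\<lambda>s. (1 - s) * (quadr A B C s / s))"
  \<comment> \<open>The value at 1/3 of the increasing factor. With it
    \<open>(s - 1/3) * (1 / sqrt (p s) - k)\<close> is nonnegative on both sides of 1/3, while s -
    1/3 integrates to zero against 1 / sqrt s, so subtracting \<open>k\<close> costs
    nothing.\<close>
  define k where "k = 1 / sqrt (p (1/3))"
  have "((\<lambda>s::real. (s - 1/3) * (1 / sqrt s)) has_integral
      ((2/3) * (1 * sqrt 1) - (2/3) * sqrt 1) - ((2/3) * (0 * sqrt 0) - (2/3) * sqrt 0)) {0..1}"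
  proof (rule fundamental_theorem_of_calculus_interior)
    show "continuous_on {0..1} (\<lambda>s::real. (2/3) * (s * sqrt s) - (2/3) * sqrt s)"
      by (intro continuous_intros)
  next
    fix s :: real assume s: "s \<in> {0<..<1}"
    have "((\<lambda>s. (2/3) * (s * sqrt s) - (2/3) * sqrt s) has_real_derivative
       (2/3) * (1 * sqrt s + inverse (sqrt s) / 2 * s) - (2/3) * (inverse (sqrt s) / 2)) (at s)"
      by (rule derivative_eq_intros refl | use s in simp)+
    then have "((\<lambda>s. (2/3) * (s * sqrt s) - (2/3) * sqrt s) has_real_derivative (s - 1/3) * (1 / sqrt s)) (at s)"
      by (rule DERIV_cong) (use s in \<open>simp add: field_simps\<close>)
    then show "((\<lambda>s. (2/3) * (s * sqrt s) - (2/3) * sqrt s) has_vector_derivative (s - 1/3) * (1 / sqrt s)) (at s)"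
      by (simp add: has_real_derivative_iff_has_vector_derivative)
  qed simp
  then have "((\<lambda>s::real. (s - 1/3) * (1 / sqrt s)) has_integral 0) {0<..<1}"
    by (simp add: has_integral_Icc_iff_Ioo)
  from has_integral_mult_right[OF this, of k]
  have 0: "((\<lambda>s. k * ((s - 1/3) * (1 / sqrt s))) has_integral 0) {0<..<1}" by simp
  have int: "((\<lambda>s. s / sqrt ((1 - s) * quadr A B C s) - (1/3) * w s) has_integral
      bmom A B C - (1/3) * bint A B C) {0<..<1}"
    unfolding w_def bint_def bmom_def
    by (intro has_integral_diff has_integral_mult_right integrable_integral
        kernel_integrable moment_kernel_integrable adm)
  have "0 \<le> bmom A B C - (1/3) * bint A B C"
  proof (rule has_integral_le[OF 0 int])
    fix s :: real assume s: "s \<in> {0<..<1}"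
    have ppos: "0 < p x" if "x \<in> {0<..<1}" for x
      using quadr_pos[OF adm, of x] that by (auto simp: p_def)
    have anti: "p y \<le> p x" if "0 < x" "x \<le> y" "y < 1" for x y
      unfolding p_def
    proof (rule mult_mono)
      have "C / y \<le> C / x" using adm that by (intro divide_left_mono) (auto simp: admissible_def)
      moreover have "A * y \<le> A * x" using that \<open>A \<le> 0\<close> by (intro mult_left_mono_neg) auto
      moreover have "quadr A B C z / z = A * z + B + C / z" if "z > 0" for z
        using that by (simp add: quadr_def power2_eq_square field_simps)
      ultimately show "quadr A B C y / y \<le> quadr A B C x / x" using that by simp
      show "0 \<le> quadr A B C y / y" using quadr_pos[OF adm, of y] that by simp
    qed (use that in auto)
    have w: "w s = (1 / sqrt s) * (1 / sqrt (p s))"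
    proof -
      have "(1 - s) * quadr A B C s = s * p s" using s by (simp add: p_def)
      then show ?thesis by (simp add: w_def flip: real_sqrt_mult)
    qed
    have "0 \<le> (s - 1/3) * (1 / sqrt (p s) - k)"
    proof (cases "s \<le> 1/3")
      case True
      then have "p (1/3) \<le> p s" using anti[of s "1/3"] s by auto
      then have "1 / sqrt (p s) \<le> k"
        unfolding k_def using ppos[of "1/3"] ppos[OF s] by (intro divide_left_mono) auto
      then show ?thesis using True by (simp add: mult_nonpos_nonpos)
    next
      case False
      then have "p s \<le> p (1/3)" using anti[of "1/3" s] s by auto
      then have "k \<le> 1 / sqrt (p s)"
        unfolding k_def using ppos[of "1/3"] ppos[OF s] by (intro divide_left_mono) auto
      then show ?thesis using False by simp
    qed
    then have "0 \<le> (1 / sqrt s) * ((s - 1/3) * (1 / sqrt (p s) - k))"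
      using s by (intro mult_nonneg_nonneg[of "1 / sqrt s"]) auto
    moreover have sw: "s / sqrt ((1 - s) * quadr A B C s) = s * w s" by (simp add: w_def)
    ultimately show "k * ((s - 1/3) * (1 / sqrt s)) \<le> s / sqrt ((1 - s) * quadr A B C s) - (1/3) * w s"
      unfolding sw unfolding w by (simp add: algebra_simps)
  qed
  then show ?thesis by simp
qed

text \<open>When the quadratic almost vanishes at s = 1, its zero nearly merges with that of 1 - s,
  and the kernel is at least of the size 1 / (1 - s + h), which integrates to a logarithm. Bumps
  therefore become arbitrarily long near a double root.\<close>

lemma bint_ge_log:
  assumes adm: "admissible A B C" and h: "0 < h" and M: "0 < M"
    and q: "\<And>s. 0 < s \<Longrightarrow> s < 1 \<Longrightarrow> quadr A B C s \<le> M * (1 - s + h)"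
  shows "ln (1 / h) / sqrt M \<le> bint A B C"
proof -
  have "((\<lambda>s::real. 1 / (1 - s + h)) has_integral (- ln (1 - 1 + h)) - (- ln (1 - 0 + h))) {0..1}"
  proof (rule fundamental_theorem_of_calculus_interior)
    show "continuous_on {0..1} (\<lambda>s::real. - ln (1 - s + h))"
      using h by (intro continuous_intros) auto
  next
    fix s :: real assume s: "s \<in> {0<..<1}"
    have "((\<lambda>s. - ln (1 - s + h)) has_real_derivative 1 / (1 - s + h)) (at s)"
      by (rule derivative_eq_intros refl | use s h in \<open>simp add: field_simps\<close>)+
    then show "((\<lambda>s. - ln (1 - s + h)) has_vector_derivative 1 / (1 - s + h)) (at s)"
      by (simp add: has_real_derivative_iff_has_vector_derivative)
  qed simp
  then have *: "((\<lambda>s::real. (1 / sqrt M) * (1 / (1 - s + h))) has_integral (1 / sqrt M) * (ln (1 + h) - ln h)) {0<..<1}"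
    by (intro has_integral_mult_right) (simp add: has_integral_Icc_iff_Ioo)
  have "(1 / sqrt M) * (ln (1 + h) - ln h) \<le> bint A B C"
    unfolding bint_def
  proof (rule has_integral_le[OF * integrable_integral[OF kernel_integrable[OF adm]]])
    fix s :: real assume s: "s \<in> {0<..<1}"
    have q0: "0 < quadr A B C s" using quadr_pos[OF adm] s by auto
    have "(1 - s) * quadr A B C s \<le> (1 - s + h) * (M * (1 - s + h))"
      using q[of s] q0 s h M by (intro mult_mono) auto
    then have "sqrt ((1 - s) * quadr A B C s) \<le> sqrt (M * (1 - s + h)\<^sup>2)"
      by (simp add: power2_eq_square mult_ac)
    also have "\<dots> = sqrt M * (1 - s + h)"
      using s h by (simp add: real_sqrt_mult)
    finally have "1 / (sqrt M * (1 - s + h)) \<le> 1 / sqrt ((1 - s) * quadr A B C s)"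
      using s q0 M h by (intro divide_left_mono mult_pos_pos) auto
    then show "(1 / sqrt M) * (1 / (1 - s + h)) \<le> 1 / sqrt ((1 - s) * quadr A B C s)"
      by simp
  qed
  moreover have "(1 / sqrt M) * ln (1 / h) \<le> (1 / sqrt M) * (ln (1 + h) - ln h)"
    using h M by (intro mult_left_mono) (auto simp: ln_div)
  ultimately show ?thesis by simp
qed

text \<open>Dominated convergence, with half of the limiting \<open>slope\<close> as a lower bound
  that is uniform from some index on. The weight \<open>v\<close> is 1 for \<open>bint\<close> and s
  for \<open>bmom\<close>.\<close>

lemma kernel_integral_tendsto:
  fixes A B C :: "nat \<Rightarrow> real" and v :: "real \<Rightarrow> real"
  assumes lim: "A \<longlonglongrightarrow> A0" "B \<longlonglongrightarrow> B0" "C \<longlonglongrightarrow> C0"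
    and adm: "admissible A0 B0 C0" "\<And>n. admissible (A n) (B n) (C n)"
    and int: "\<And>n. (\<lambda>s. v s / sqrt ((1 - s) * quadr (A n) (B n) (C n) s)) integrable_on {0<..<1}"
    and v: "\<And>s. 0 < s \<Longrightarrow> s < 1 \<Longrightarrow> \<bar>v s\<bar> \<le> 1"
  shows "(\<lambda>n. integral {0<..<1} (\<lambda>s. v s / sqrt ((1 - s) * quadr (A n) (B n) (C n) s)))
    \<longlonglongrightarrow> integral {0<..<1} (\<lambda>s. v s / sqrt ((1 - s) * quadr A0 B0 C0 s))"
proof -
  define h where "h = slope A0 B0 C0 / 2"
  have h: "0 < h" "h < slope A0 B0 C0" using adm(1) by (auto simp: h_def admissible_def)
  have "(\<lambda>n. slope (A n) (B n) (C n)) \<longlonglongrightarrow> slope A0 B0 C0"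
    unfolding slope_def by (intro tendsto_intros lim)
  then have "eventually (\<lambda>n. h < slope (A n) (B n) (C n)) sequentially"
    using h(2) by (simp add: order_tendsto_iff)
  then obtain N where N: "\<And>n. n \<ge> N \<Longrightarrow> h < slope (A n) (B n) (C n)"
    by (auto simp: eventually_sequentially)
  have "(\<lambda>n. integral {0<..<1} (\<lambda>s. v s / sqrt ((1 - s) * quadr (A (n + N)) (B (n + N)) (C (n + N)) s)))
    \<longlonglongrightarrow> integral {0<..<1} (\<lambda>s. v s / sqrt ((1 - s) * quadr A0 B0 C0 s))"
  proof (rule dominated_convergence(2)[where h = "\<lambda>s. (1 / sqrt h) * (1 / sqrt ((1 - s) * s))"])
    show "(\<lambda>s. (1 / sqrt h) * (1 / sqrt ((1 - s) * s))) integrable_on {0<..<1::real}"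
      using has_integral_mult_right[OF has_integral_inverse_sqrt_arcsine] by blast
  next
    fix n and s :: real assume s: "s \<in> {0<..<1}"
    let ?w = "1 / sqrt ((1 - s) * quadr (A (n + N)) (B (n + N)) (C (n + N)) s)"
    have "0 < quadr (A (n + N)) (B (n + N)) (C (n + N)) s"
      using quadr_pos[OF adm(2)] s by auto
    then have "0 \<le> ?w" using s by simp
    moreover have "?w \<le> (1 / sqrt h) * (1 / sqrt ((1 - s) * s))"
      using adm(2) N[of "n + N"] h s by (intro kernel_bound) (auto simp: admissible_def less_imp_le)
    moreover have "\<bar>v s\<bar> \<le> 1" using v s by auto
    ultimately have "\<bar>v s\<bar> * ?w \<le> 1 * ((1 / sqrt h) * (1 / sqrt ((1 - s) * s)))"
      by (intro mult_mono) auto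
    moreover have "norm (v s / sqrt ((1 - s) * quadr (A (n + N)) (B (n + N)) (C (n + N)) s)) = \<bar>v s\<bar> * ?w"
      using \<open>0 \<le> ?w\<close> by (metis abs_mult abs_of_nonneg mult.right_neutral real_norm_def times_divide_eq_right)
    ultimately show "norm (v s / sqrt ((1 - s) * quadr (A (n + N)) (B (n + N)) (C (n + N)) s))
        \<le> (1 / sqrt h) * (1 / sqrt ((1 - s) * s))" by linarith
  next
    fix s :: real assume s: "s \<in> {0<..<1}"
    have "0 < quadr A0 B0 C0 s" using quadr_pos[OF adm(1)] s by auto
    then have "sqrt ((1 - s) * quadr A0 B0 C0 s) \<noteq> 0" using s by simp
    moreover have "(\<lambda>n. quadr (A (n + N)) (B (n + N)) (C (n + N)) s) \<longlonglongrightarrow> quadr A0 B0 C0 s"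
      unfolding quadr_def by (intro tendsto_intros lim[THEN LIMSEQ_ignore_initial_segment])
    ultimately show "(\<lambda>n. v s / sqrt ((1 - s) * quadr (A (n + N)) (B (n + N)) (C (n + N)) s))
        \<longlonglongrightarrow> v s / sqrt ((1 - s) * quadr A0 B0 C0 s)"
      by (intro tendsto_intros)
  qed (rule int)
  then show ?thesis by (rule LIMSEQ_offset)
qed

lemma continuous_on_bint:
  fixes A B C :: "'a::metric_space \<Rightarrow> real"
  assumes "continuous_on X A" "continuous_on X B" "continuous_on X C"
    and "\<And>z. z \<in> X \<Longrightarrow> admissible (A z) (B z) (C z)"
  shows "continuous_on X (\<lambda>z. bint (A z) (B z) (C z))"
  unfolding continuous_on_sequentially
proof (intro ballI allI impI, elim conjE)
  fix x z assume x: "\<forall>n. x n \<in> X" and z: "z \<in> X" and lim: "x \<longlonglongrightarrow> z"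
  have "(\<lambda>n. A (x n)) \<longlonglongrightarrow> A z" "(\<lambda>n. B (x n)) \<longlonglongrightarrow> B z" "(\<lambda>n. C (x n)) \<longlonglongrightarrow> C z"
    using assms(1-3)[unfolded continuous_on_sequentially] x z lim by (auto simp: o_def)
  then show "((\<lambda>z. bint (A z) (B z) (C z)) \<circ> x) \<longlonglongrightarrow> bint (A z) (B z) (C z)"
    unfolding o_def bint_def using x z assms(4)
    by (intro kernel_integral_tendsto kernel_integrable) auto
qed

lemma continuous_on_bmom:
  fixes A B C :: "'a::metric_space \<Rightarrow> real"
  assumes "continuous_on X A" "continuous_on X B" "continuous_on X C"
    and "\<And>z. z \<in> X \<Longrightarrow> admissible (A z) (B z) (C z)"
  shows "continuous_on X (\<lambda>z. bmom (A z) (B z) (C z))"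
  unfolding continuous_on_sequentially
proof (intro ballI allI impI, elim conjE)
  fix x z assume x: "\<forall>n. x n \<in> X" and z: "z \<in> X" and lim: "x \<longlonglongrightarrow> z"
  have "(\<lambda>n. A (x n)) \<longlonglongrightarrow> A z" "(\<lambda>n. B (x n)) \<longlonglongrightarrow> B z" "(\<lambda>n. C (x n)) \<longlonglongrightarrow> C z"
    using assms(1-3)[unfolded continuous_on_sequentially] x z lim by (auto simp: o_def)
  then show "((\<lambda>z. bmom (A z) (B z) (C z)) \<circ> x) \<longlonglongrightarrow> bmom (A z) (B z) (C z)"
    unfolding o_def bmom_def using x z assms(4)
    by (intro kernel_integral_tendsto moment_kernel_integrable) auto
qed

section \<open>The quadratics in terms of maximum and minimum\<close>

lemma admissible_pos:
  assumes "0 < a" "0 < b" "b < 3 + a / 2"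
  shows "admissible a (6 + a) (b * (6 + a - b) / a)"
proof -
  have "0 \<le> b * (6 + a - b) / a" using assms by (intro divide_nonneg_nonneg mult_nonneg_nonneg) auto
  then show ?thesis using assms by (simp add: admissible_def slope_def add_pos_nonneg)
qed

lemma admissible_neg:
  assumes "0 < a" "0 < b" "b < 3 + a / 2"
  shows "admissible (- b) (6 - b) (a * (6 + a - b) / b)"
proof -
  \<comment> \<open>This is the value of the quadratic at s = 1, where f = - b. Its last factor is
    the gap between - b and the third root - 6 - a + b.\<close>
  have "6 - 2 * b + a * (6 + a - b) / b = (a / b + 1) * (6 + a - 2 * b)"
    using assms by (simp add: field_simps)
  also have "\<dots> > 0" using assms by (intro mult_pos_pos add_pos_pos) auto
  finally have "0 < slope (- b) (6 - b) (a * (6 + a - b) / b)"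
    using assms by (simp add: slope_def)
  moreover have "0 \<le> a * (6 + a - b) / b" using assms by (intro divide_nonneg_nonneg mult_nonneg_nonneg) auto
  ultimately show ?thesis by (simp add: admissible_def)
qed

lemma admissible_per:
  assumes "0 < a + b" "b < 3 + a / 2"
  shows "admissible (- (a + b)) (6 + 2 * a - b) 0"
  using assms by (simp add: admissible_def slope_def)

lemma quadr_pos_eq:
  assumes "a \<noteq> 0"
  shows "quadr a (6 + a) (b * (6 + a - b) / a) s = (s + b / a) * (a * s + 6 + a - b)"
  using assms by (simp add: quadr_def power2_eq_square field_simps)

lemma quadr_neg_eq:
  assumes "b \<noteq> 0"
  shows "quadr (- b) (6 - b) (a * (6 + a - b) / b) s = (a / b + s) * (6 + a - b - b * s)"
  using assms by (simp add: quadr_def power2_eq_square field_simps)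

lemma quadr_per_eq:
  "quadr (- (a + b)) (6 + 2 * a - b) 0 s = s * (6 + 2 * a - b - (a + b) * s)"
  by (simp add: quadr_def power2_eq_square algebra_simps)

section \<open>Lengths of positive and negative bumps\<close>

text \<open>Half the length of a positive and of a negative bump of a profile with maximum \<open>a\<close> and minimum \<open>- b\<close>;
  \<open>tper\<close> is half the period.\<close>
definition tpos :: "real \<Rightarrow> real \<Rightarrow> real" where
  "tpos a b = sqrt (3/2) * bint a (6 + a) (b * (6 + a - b) / a)"

definition tneg :: "real \<Rightarrow> real \<Rightarrow> real" where
  "tneg a b = sqrt (3/2) * bint (- b) (6 - b) (a * (6 + a - b) / b)"

definition tper :: "real \<Rightarrow> real \<Rightarrow> real" where
  "tper a b = sqrt (3/2) * bint (- (a + b)) (6 + 2 * a - b) 0"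

lemma tpos_pos: "0 < a \<Longrightarrow> 0 < b \<Longrightarrow> b < 3 + a / 2 \<Longrightarrow> 0 < tpos a b"
  unfolding tpos_def by (intro mult_pos_pos bint_pos admissible_pos) auto

lemma tneg_pos: "0 < a \<Longrightarrow> 0 < b \<Longrightarrow> b < 3 + a / 2 \<Longrightarrow> 0 < tneg a b"
  unfolding tneg_def by (intro mult_pos_pos bint_pos admissible_neg) auto

text \<open>All three integrals have the integrand \<open>1 / sqrt ((a - f) (f + b) (f + 6 + a - b))\<close> in the
  variable \<open>f\<close>, over \<open>[0, a]\<close>, \<open>[- b, 0]\<close> and \<open>[- b, a]\<close>.\<close>
lemma tpos_add_tneg:
  assumes ab: "0 < a" "0 < b" "b < 3 + a / 2"
  shows "tpos a b + tneg a b = tper a b"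
proof -
  define g where "g = (\<lambda>x. 1 / sqrt ((1 - x) * quadr (- (a + b)) (6 + 2 * a - b) 0 x))"
  \<comment> \<open>In the variable x = (a - f) / (a + b), which runs from the maximum to the
    minimum, \<open>x0\<close> is the place where f = 0. The two affine maps below turn s = f / a
    and s = - f / b into x.\<close>
  define x0 where "x0 = a / (a + b)"
  have x0: "0 < x0" "x0 < 1" "1 - x0 = b / (a + b)" using ab by (auto simp: x0_def field_simps)
  have adm: "admissible (- (a + b)) (6 + 2 * a - b) 0" using ab by (intro admissible_per) auto
  have gi: "g integrable_on {0..1}"
    unfolding g_def using kernel_integrable[OF adm] by (simp add: integrable_on_Icc_iff_Ioo)
  have gi1: "g integrable_on cbox 0 x0" and gi2: "g integrable_on cbox x0 1"
    using x0 by (auto intro!: integrable_on_subinterval[OF gi])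
  have xa: "x0 * (b / a) = 1 - x0" and xb: "(1 - x0) * (a / b) = x0"
    unfolding x0(3) using ab by (auto simp: x0_def)
  have split: "integral {0..1} g = integral {0..x0} g + integral {x0..1} g"
    using x0 gi Henstock_Kurzweil_Integration.integral_combine[where a = 0 and c = x0 and b = 1 and f = g] by auto
  have im1: "(\<lambda>x. (1 / - x0) *\<^sub>R x + - ((1 / - x0) *\<^sub>R x0)) ` cbox 0 x0 = {0..1}"
    unfolding image_affinity_cbox using x0 by (simp add: field_simps)
  have im2: "(\<lambda>x. (1 / (1 - x0)) *\<^sub>R x + - ((1 / (1 - x0)) *\<^sub>R x0)) ` cbox x0 1 = {0..1}"
    unfolding image_affinity_cbox using x0(1,2) by (auto simp: field_simps)
  have "((\<lambda>x. g (- x0 *\<^sub>R x + x0)) has_integral (1 / (\<bar>- x0\<bar> ^ DIM(real))) *\<^sub>R integral (cbox 0 x0) g) {0..1}"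
    using has_integral_affinity[OF integrable_integral[OF gi1], of "- x0" x0] x0 unfolding im1 by simp
  then have "((\<lambda>x. x0 * g (- x0 * x + x0)) has_integral x0 * ((1 / x0) * integral {0..x0} g)) {0..1}"
    using x0 by (intro has_integral_mult_right) simp
  then have 1: "((\<lambda>s. x0 * g (- x0 * s + x0)) has_integral integral {0..x0} g) {0<..<1}"
    using x0 by (simp add: has_integral_Icc_iff_Ioo)
  have "((\<lambda>x. g ((1 - x0) *\<^sub>R x + x0)) has_integral (1 / (\<bar>1 - x0\<bar> ^ DIM(real))) *\<^sub>R integral (cbox x0 1) g) {0..1}"
    using has_integral_affinity[OF integrable_integral[OF gi2], of "1 - x0" x0] x0(1,2) unfolding im2 by simp
  then have "((\<lambda>x. (1 - x0) * g ((1 - x0) * x + x0)) has_integral (1 - x0) * ((1 / (1 - x0)) * integral {x0..1} g)) {0..1}"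
    using x0(1,2) by (intro has_integral_mult_right) simp
  then have 2: "((\<lambda>s. (1 - x0) * g ((1 - x0) * s + x0)) has_integral integral {x0..1} g) {0<..<1}"
    using x0(1,2) by (simp add: has_integral_Icc_iff_Ioo)
  have scale: "c * (1 / sqrt X) = 1 / sqrt Y" if "0 < c" "X = c\<^sup>2 * Y" for c X Y :: real
    using that by (simp add: real_sqrt_mult)
  have k1: "x0 * g (- x0 * s + x0) = 1 / sqrt ((1 - s) * quadr a (6 + a) (b * (6 + a - b) / a) s)"
    if s: "s \<in> {0<..<1}" for s
  proof -
    have "(1 - (- x0 * s + x0)) * quadr (- (a + b)) (6 + 2 * a - b) 0 (- x0 * s + x0)
      = x0\<^sup>2 * ((1 - s) * quadr a (6 + a) (b * (6 + a - b) / a) s)"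
    proof -
      have z1: "1 - (- x0 * s + x0) = x0 * (s + b / a)"
        using xa by (simp add: algebra_simps)
      have "(a + b) * (- x0 * s + x0) = ((a + b) * x0) * (1 - s)"
        by (simp add: algebra_simps)
      also have "(a + b) * x0 = a" using ab by (simp add: x0_def)
      finally have z2: "6 + 2 * a - b - (a + b) * (- x0 * s + x0) = a * s + 6 + a - b"
        by (simp add: algebra_simps)
      have z3: "- x0 * s + x0 = x0 * (1 - s)" by (simp add: algebra_simps)
      have "a \<noteq> 0" using ab by simp
      show ?thesis
        unfolding quadr_per_eq quadr_pos_eq[OF \<open>a \<noteq> 0\<close>] z1 z2 unfolding z3
        by (simp add: power2_eq_square)
    qed
    then show ?thesis
      unfolding g_def by (rule scale[OF x0(1)])
  qed
  have k2: "(1 - x0) * g ((1 - x0) * s + x0) = 1 / sqrt ((1 - s) * quadr (- b) (6 - b) (a * (6 + a - b) / b) s)"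
    if s: "s \<in> {0<..<1}" for s
  proof -
    have "(1 - ((1 - x0) * s + x0)) * quadr (- (a + b)) (6 + 2 * a - b) 0 ((1 - x0) * s + x0)
      = (1 - x0)\<^sup>2 * ((1 - s) * quadr (- b) (6 - b) (a * (6 + a - b) / b) s)"
    proof -
      have z3: "(1 - x0) * s + x0 = (1 - x0) * (a / b + s)"
        using xb by (simp add: algebra_simps)
      have "(a + b) * ((1 - x0) * (a / b + s)) = ((a + b) * (b / (a + b))) * (a / b + s)"
        unfolding x0(3) by (simp only: mult.assoc)
      also have "(a + b) * (b / (a + b)) = b" using ab by simp
      also have "b * (a / b + s) = a + b * s" using ab by (simp add: algebra_simps)
      finally have "(a + b) * ((1 - x0) * (a / b + s)) = a + b * s" .
      then have z2: "6 + 2 * a - b - (a + b) * ((1 - x0) * (a / b + s)) = 6 + a - b - b * s"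
        by simp
      have z1: "1 - (1 - x0) * (a / b + s) = (1 - x0) * (1 - s)"
        using xb by (simp add: algebra_simps)
      have "b \<noteq> 0" using ab by simp
      show ?thesis
        unfolding quadr_per_eq quadr_neg_eq[OF \<open>b \<noteq> 0\<close>] z3 z2 z1
        by (simp add: power2_eq_square)
    qed
    then show ?thesis
      unfolding g_def using x0(2) by (intro scale) auto
  qed
  have "bint a (6 + a) (b * (6 + a - b) / a) = integral {0..x0} g"
    unfolding bint_def by (rule integral_unique) (rule has_integral_eq[OF k1 1])
  moreover have "bint (- b) (6 - b) (a * (6 + a - b) / b) = integral {x0..1} g"
    unfolding bint_def by (rule integral_unique) (rule has_integral_eq[OF k2 2])
  moreover have "bint (- (a + b)) (6 + 2 * a - b) 0 = integral {0..1} g"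
    unfolding bint_def g_def by (simp add: integral_open_interval_real)
  ultimately show ?thesis
    unfolding tpos_def tneg_def tper_def split by (simp add: distrib_left)
qed

text \<open>Tangent line bound for \<open>1 / sqrt y\<close> at the mean value of \<open>y\<close> with respect to the arcsine law.\<close>
lemma tper_ge:
  assumes ab: "0 < a + b" "b < 3 + a / 2"
  shows "pi / sqrt (4 + a - b) \<le> tper a b"
proof -
  \<comment> \<open>The arcsine law has mean 1/2, and \<open>y0\<close> is the value of y = 6 + 2 a
    - b - (a + b) s there. It equals 3/2 (4 + a - b), so the factor sqrt (3/2) of
    \<open>tper\<close> cancels in the end.\<close>
  define y0 where "y0 = 6 + 3/2 * (a - b)"
  have "0 < 4 + a - b" using ab by (simp add: field_simps)
  then have y0: "0 < y0" by (simp add: y0_def field_simps)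
  have adm: "admissible (- (a + b)) (6 + 2 * a - b) 0" using ab by (intro admissible_per) auto
  let ?L = "\<lambda>s. (1 / sqrt y0) * ((1 - (a + b) / (4 * y0)) * (1 / sqrt ((1 - s) * s))
      + (a + b) / (2 * y0) * (s / sqrt ((1 - s) * s)))"
  have "(?L has_integral (1 / sqrt y0) * ((1 - (a + b) / (4 * y0)) * pi + (a + b) / (2 * y0) * (pi / 2))) {0<..<1}"
    by (intro has_integral_mult_right has_integral_add has_integral_inverse_sqrt_arcsine has_integral_arcsine_moment)
  moreover have "(1 / sqrt y0) * ((1 - (a + b) / (4 * y0)) * pi + (a + b) / (2 * y0) * (pi / 2)) = pi / sqrt y0"
    using y0 by (simp add: field_simps)
  ultimately have L: "(?L has_integral pi / sqrt y0) {0<..<1}" by (simp only:)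
  have tangent: "(1 / sqrt y0) * (1 - (y - y0) / (2 * y0)) \<le> 1 / sqrt y" if "0 < y" for y
  proof -
    define r where "r = sqrt y / sqrt y0"
    have r: "0 < r" "r\<^sup>2 = y / y0" using that y0 by (auto simp: r_def power_divide)
    \<comment> \<open>In terms of r = sqrt (y / y0) the tangent bound reads r (3 - r^2) <= 2, and
      this product is r^3 - 3 r + 2.\<close>
    have "(r - 1)\<^sup>2 * (r + 2) \<ge> 0" using r by (intro mult_nonneg_nonneg) auto
    then have "r * (3 - r\<^sup>2) \<le> 2" by (simp add: power2_eq_square algebra_simps)
    then have "(3 - r\<^sup>2) / 2 \<le> 1 / r" using r by (simp add: field_simps)
    moreover have "(3 - r\<^sup>2) / 2 = 1 - (y - y0) / (2 * y0)"
      unfolding r(2) using y0 by (simp add: field_simps)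
    ultimately have "(1 / sqrt y0) * (1 - (y - y0) / (2 * y0)) \<le> (1 / sqrt y0) * (1 / r)"
      using y0 by (intro mult_left_mono) auto
    also have "\<dots> = 1 / sqrt y" using y0 that by (simp add: r_def)
    finally show ?thesis .
  qed
  have "pi / sqrt y0 \<le> bint (- (a + b)) (6 + 2 * a - b) 0"
    unfolding bint_def
  proof (rule has_integral_le[OF L integrable_integral[OF kernel_integrable[OF adm]]])
    fix s :: real assume s: "s \<in> {0<..<1}"
    define y where "y = 6 + 2 * a - b - (a + b) * s"
    have "(a + b) * s \<le> (a + b) * 1" using ab s by (intro mult_left_mono) auto
    moreover have "0 < 6 + 2 * a - b - (a + b) * 1" using ab by simp
    ultimately have y: "0 < y" unfolding y_def by linarith
    have yy: "y - y0 = (a + b) / 2 - (a + b) * s" by (simp add: y_def y0_def field_simps)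
    have "(1 - (a + b) / (4 * y0)) + (a + b) / (2 * y0) * s = 1 - (y - y0) / (2 * y0)"
      unfolding yy using y0 by (simp add: field_simps)
    moreover have "k * (c * (1 / w) + d * (s / w)) = (1 / w) * (k * (c + d * s))" for k c d w :: real
      by (simp add: algebra_simps add_divide_distrib)
    ultimately have "?L s = (1 / sqrt ((1 - s) * s)) * ((1 / sqrt y0) * (1 - (y - y0) / (2 * y0)))"
      by metis
    also have "\<dots> \<le> (1 / sqrt ((1 - s) * s)) * (1 / sqrt y)"
      using s tangent[OF y] by (intro mult_left_mono) auto
    also have "\<dots> = 1 / sqrt ((1 - s) * quadr (- (a + b)) (6 + 2 * a - b) 0 s)"
      unfolding quadr_per_eq y_def by (simp add: real_sqrt_mult mult_ac)
    finally show "?L s \<le> 1 / sqrt ((1 - s) * quadr (- (a + b)) (6 + 2 * a - b) 0 s)" .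
  qed
  then have "sqrt (3/2) * (pi / sqrt y0) \<le> tper a b"
    unfolding tper_def by (intro mult_left_mono) auto
  moreover have "y0 = 3/2 * (4 + a - b)" by (simp add: y0_def)
  then have "sqrt y0 = sqrt (3/2) * sqrt (4 + a - b)" by (simp only: real_sqrt_mult)
  ultimately show ?thesis by simp
qed

section \<open>Level curves of the opening angle\<close>

text \<open>For \<open>m \<le> 1/2\<close> the curve is the ray b = m a, for larger \<open>m\<close>
  the line b = a / 2 + (m - 1/2), parallel to the edge b = 3 + a / 2, which corresponds to
  \<open>m = 7/2\<close>. Steeper rays would leave the domain, and the shifted lines alone cover
  only b >= a / 2.\<close>

definition bcur :: "real \<Rightarrow> real \<Rightarrow> real" where
  "bcur m a = min m (1/2) * a + max 0 (m - 1/2)"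

lemma bcur_cases:
  assumes "0 < m" "m < 7/2"
  obtains l \<beta> where "\<And>a. bcur m a = l * a + \<beta>" "0 < l" "l \<le> 1/2" "0 \<le> \<beta>" "\<beta> < 3" "\<beta> = 0 \<or> l = 1/2"
proof -
  have "min m (1/2) > 0" "min m (1/2) \<le> 1/2" "0 \<le> max 0 (m - 1/2)" "max 0 (m - 1/2) < 3"
    "max 0 (m - 1/2) = 0 \<or> min m (1/2) = 1/2"
    using assms by (auto simp: min_def max_def)
  then show ?thesis using that[of "min m (1/2)" "max 0 (m - 1/2)"] by (simp add: bcur_def)
qed

context
  fixes l \<beta> :: real
  assumes lb: "0 < l" "l \<le> 1/2" "0 \<le> \<beta>" "\<beta> < 3"
begin

lemma path_dom: "0 < a \<Longrightarrow> 0 < l * a + \<beta> \<and> l * a + \<beta> < 3 + a / 2"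
proof -
  assume "0 < a"
  then have "l * a \<le> 1/2 * a" "0 < l * a" using lb by (auto intro: mult_right_mono)
  then show ?thesis using lb by (simp add: add_pos_nonneg)
qed

lemma path_coeff:
  assumes "0 < s" "s < 1"
  shows "0 < 2 - l - (1 + l) * s" "0 < 1 - l * (1 + s)" "0 < 6 - \<beta> * (1 + s)"
proof -
  have ls: "l * s < l" "\<beta> * s \<le> \<beta>" using assms lb by (auto simp: mult_left_le)
  show "0 < 2 - l - (1 + l) * s" "0 < 1 - l * (1 + s)" "0 < 6 - \<beta> * (1 + s)"
    using ls assms lb unfolding distrib_left distrib_right mult_1 mult_1_right by linarith+
qed

text \<open>The quadratic is (a / b + s) (6 + a - b - b s). Along b = l a + \<beta> the first factor
  does not decrease because \<open>\<beta> \<ge> 0\<close>, and the second is affine in a with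
  coefficient 1 - l (1 + s), which is positive because \<open>l \<le> 1/2\<close>.\<close>

lemma tneg_path_strict_antimono:
  assumes "0 < a" "a < a'"
  shows "tneg a' (l * a' + \<beta>) < tneg a (l * a + \<beta>)"
  unfolding tneg_def
proof (intro mult_strict_left_mono bint_strict_antimono)
  show "admissible (- (l * a + \<beta>)) (6 - (l * a + \<beta>)) (a * (6 + a - (l * a + \<beta>)) / (l * a + \<beta>))"
    "admissible (- (l * a' + \<beta>)) (6 - (l * a' + \<beta>)) (a' * (6 + a' - (l * a' + \<beta>)) / (l * a' + \<beta>))"
    by (rule admissible_neg; use path_dom[of a] path_dom[of a'] assms in simp)+
next
  fix s :: real assume s: "0 < s" "s < 1"
  have pos: "0 < l * a + \<beta>" "0 < l * a' + \<beta>" using path_dom[of a] path_dom[of a'] assms by auto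
  have "a / (l * a + \<beta>) \<le> a' / (l * a' + \<beta>)"
    using pos assms lb mult_right_mono[of a a' \<beta>] by (simp add: divide_simps algebra_simps)
  then have x: "a / (l * a + \<beta>) + s \<le> a' / (l * a' + \<beta>) + s" by simp
  have e: "6 + z - (l * z + \<beta>) - (l * z + \<beta>) * s = (6 - \<beta> * (1 + s)) + z * (1 - l * (1 + s))" for z
    by (simp add: algebra_simps)
  note c = path_coeff[OF s]
  have y: "6 + a - (l * a + \<beta>) - (l * a + \<beta>) * s < 6 + a' - (l * a' + \<beta>) - (l * a' + \<beta>) * s"
    unfolding e using mult_strict_right_mono[OF assms(2) c(2)] by linarith
  have "0 \<le> 6 + a - (l * a + \<beta>) - (l * a + \<beta>) * s"
    unfolding e using c assms by (intro add_nonneg_nonneg mult_nonneg_nonneg) auto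
  moreover have "0 < a / (l * a + \<beta>) + s" using pos assms s by (intro add_pos_pos[of "a / (l * a + \<beta>)" s] divide_pos_pos)
  ultimately show "quadr (- (l * a + \<beta>)) (6 - (l * a + \<beta>)) (a * (6 + a - (l * a + \<beta>)) / (l * a + \<beta>)) s
      < quadr (- (l * a' + \<beta>)) (6 - (l * a' + \<beta>)) (a' * (6 + a' - (l * a' + \<beta>)) / (l * a' + \<beta>)) s"
    using pos by (subst (1 2) quadr_neg_eq) (auto intro!: mult_le_less_imp_less[OF x y])
qed simp

lemma quadr_per_path:
  "quadr (- (a + (l * a + \<beta>))) (6 + 2 * a - (l * a + \<beta>)) 0 s
     = s * ((6 - \<beta> * (1 + s)) + a * (2 - l - (1 + l) * s))"
  unfolding quadr_per_eq by (simp add: algebra_simps)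

lemma quadr_per_path_strict_mono:
  assumes "0 < a" "a < a'" "0 < s" "s < 1"
  shows "quadr (- (a + (l * a + \<beta>))) (6 + 2 * a - (l * a + \<beta>)) 0 s
     < quadr (- (a' + (l * a' + \<beta>))) (6 + 2 * a' - (l * a' + \<beta>)) 0 s"
  unfolding quadr_per_path using assms path_coeff[of s]
  by (intro mult_strict_left_mono add_strict_left_mono mult_strict_right_mono) auto

lemma admissible_per_path:
  "0 < a \<Longrightarrow> admissible (- (a + (l * a + \<beta>))) (6 + 2 * a - (l * a + \<beta>)) 0"
  using path_dom[of a] by (intro admissible_per) auto

lemma tper_path_strict_antimono:
  assumes "0 < a" "a < a'"
  shows "tper a' (l * a' + \<beta>) < tper a (l * a + \<beta>)"
  unfolding tper_def using assms
  by (intro mult_strict_left_mono bint_strict_antimono admissible_per_path quadr_per_path_strict_mono) auto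

text \<open>The integrand at a = 1 dominates all later ones, and pointwise the quadratic grows
  linearly in a since 2 - l - (1 + l) s is positive for s < 1.\<close>

lemma tper_path_tendsto_0: "(\<lambda>n. tper (1 + real n) (l * (1 + real n) + \<beta>)) \<longlonglongrightarrow> 0"
proof -
  let ?A = "\<lambda>n. - ((1 + real n) + (l * (1 + real n) + \<beta>))"
  let ?B = "\<lambda>n. 6 + 2 * (1 + real n) - (l * (1 + real n) + \<beta>)"
  have adm: "admissible (?A n) (?B n) 0" for n
    by (intro admissible_per_path) simp
  have "(\<lambda>n. integral {0<..<1} (\<lambda>s. 1 / sqrt ((1 - s) * quadr (?A n) (?B n) 0 s))) \<longlonglongrightarrow> integral {0<..<1} (\<lambda>s::real. 0::real)"
  proof (rule dominated_convergence(2)[where h = "\<lambda>s. 1 / sqrt ((1 - s) * quadr (?A 0) (?B 0) 0 s)"])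
    fix n and s :: real assume s: "s \<in> {0<..<1}"
    have q: "0 < quadr (?A 0) (?B 0) 0 s" using quadr_pos[OF adm[of 0]] s by auto
    moreover have "quadr (?A 0) (?B 0) 0 s \<le> quadr (?A n) (?B n) 0 s"
      using quadr_per_path_strict_mono[of 1 "1 + real n" s] s by (cases "n = 0") auto
    ultimately show "norm (1 / sqrt ((1 - s) * quadr (?A n) (?B n) 0 s)) \<le> 1 / sqrt ((1 - s) * quadr (?A 0) (?B 0) 0 s)"
      using s by (auto intro!: divide_left_mono)
  next
    fix s :: real assume s: "s \<in> {0<..<1}"
    define p q where "p = (1 - s) * (s * (6 - \<beta> * (1 + s)))" and "q = (1 - s) * (s * (2 - l - (1 + l) * s))"
    have e: "(1 - s) * quadr (?A n) (?B n) 0 s = p + (1 + real n) * q" for n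
      unfolding quadr_per_path p_def q_def by (simp add: algebra_simps)
    have "0 < q" using s path_coeff[of s] by (auto simp: q_def)
    have "filterlim (\<lambda>n. 1 + real n) at_top sequentially"
      by (intro filterlim_tendsto_add_at_top[OF tendsto_const] filterlim_real_sequentially)
    then have "filterlim (\<lambda>n. (1 + real n) * q) at_top sequentially"
      using \<open>0 < q\<close> by (intro filterlim_at_top_mult_tendsto_pos[OF tendsto_const])
    then have "filterlim (\<lambda>n. p + (1 + real n) * q) at_top sequentially"
      by (intro filterlim_tendsto_add_at_top[OF tendsto_const])
    then have "filterlim (\<lambda>n. sqrt (p + (1 + real n) * q)) at_top sequentially"
      by (intro filterlim_compose[OF sqrt_at_top])
    then show "(\<lambda>n. 1 / sqrt ((1 - s) * quadr (?A n) (?B n) 0 s)) \<longlonglongrightarrow> 0"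
      unfolding e by (intro tendsto_divide_0[OF tendsto_const] filterlim_at_top_imp_at_infinity)
  qed (intro kernel_integrable adm)+
  then have "(\<lambda>n. bint (?A n) (?B n) 0) \<longlonglongrightarrow> 0" unfolding bint_def by simp
  then have "(\<lambda>n. sqrt (3/2) * bint (?A n) (?B n) 0) \<longlonglongrightarrow> sqrt (3/2) * 0" by (rule tendsto_mult_left)
  then show ?thesis unfolding tper_def by simp
qed

text \<open>Along the path the quadratic is a (s + l) (s + 1 - l) + \<beta> (6 - \<beta>) / a plus a
  term free of a. Only the second summand decreases. For l = 1/2 the product in the first is (s +
  1/2)^2 > 1/4, which outweighs it beyond the threshold; this is the origin of the factor 4.\<close>

lemma tpos_path_strict_antimono:
  assumes "0 < a" "a < a'" and lb2: "\<beta> = 0 \<or> l = 1/2" and thr: "4 * (\<beta> * (6 - \<beta>)) \<le> a\<^sup>2"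
  shows "tpos a' (l * a' + \<beta>) < tpos a (l * a + \<beta>)"
  unfolding tpos_def
proof (intro mult_strict_left_mono bint_strict_antimono)
  show "admissible a (6 + a) ((l * a + \<beta>) * (6 + a - (l * a + \<beta>)) / a)"
    "admissible a' (6 + a') ((l * a' + \<beta>) * (6 + a' - (l * a' + \<beta>)) / a')"
    by (rule admissible_pos; use path_dom[of a] path_dom[of a'] assms in simp)+
next
  fix s :: real assume s: "0 < s" "s < 1"
  have e: "quadr z (6 + z) ((l * z + \<beta>) * (6 + z - (l * z + \<beta>)) / z) s
      = z * ((s + l) * (s + 1 - l)) + \<beta> * (6 - \<beta>) / z + ((s + l) * (6 - \<beta>) + \<beta> * (s + 1 - l))" if "z > 0" for z
    using that by (simp add: quadr_pos_eq) (simp add: field_simps)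
  have "\<beta> * (6 - \<beta>) / a - \<beta> * (6 - \<beta>) / a' < (a' - a) * ((s + l) * (s + 1 - l))"
  proof (cases "\<beta> = 0")
    case True
    then show ?thesis using assms s lb by simp
  next
    case False
    then have l: "l = 1/2" using lb2 by simp
    have "0 \<le> \<beta> * (6 - \<beta>)" using lb by simp
    then have "\<beta> * (6 - \<beta>) \<le> a\<^sup>2 / 4" using thr by simp
    also have "\<dots> \<le> (a * a') * (1/4)"
      using assms mult_left_mono[of a a' a] by (simp add: power2_eq_square)
    also have "\<dots> < (a * a') * ((s + l) * (s + 1 - l))"
    proof (rule mult_strict_left_mono)
      have "(s + l) * (s + 1 - l) = s * s + s + 1/4" by (simp add: l algebra_simps)
      then show "1/4 < (s + l) * (s + 1 - l)" using s by (simp add: add_pos_pos)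
    qed (use assms in simp)
    finally have "\<beta> * (6 - \<beta>) / (a * a') < (s + l) * (s + 1 - l)"
      using assms by (simp add: divide_simps mult_ac)
    then have "(a' - a) * (\<beta> * (6 - \<beta>) / (a * a')) < (a' - a) * ((s + l) * (s + 1 - l))"
      using assms by (intro mult_strict_left_mono) auto
    moreover have "(a' - a) * (\<beta> * (6 - \<beta>) / (a * a')) = \<beta> * (6 - \<beta>) / a - \<beta> * (6 - \<beta>) / a'"
      using assms by (simp add: field_simps)
    ultimately show ?thesis by simp
  qed
  then show "quadr a (6 + a) ((l * a + \<beta>) * (6 + a - (l * a + \<beta>)) / a) s
      < quadr a' (6 + a') ((l * a' + \<beta>) * (6 + a' - (l * a' + \<beta>)) / a') s"
    using assms(1,2) unfolding left_diff_distrib by (subst (1 2) e) linarith+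
qed simp

end

lemma tper_strict_mono:
  assumes "0 < a" "0 < b" "b < b'" "b' < 3 + a / 2"
  shows "tper a b < tper a b'"
  unfolding tper_def
proof (intro mult_strict_left_mono bint_strict_antimono admissible_per)
  fix s :: real assume s: "0 < s" "s < 1"
  have "b * (1 + s) < b' * (1 + s)" using assms s by (intro mult_strict_right_mono) auto
  then have "s * (6 + 2 * a - b' - (a + b') * s) < s * (6 + 2 * a - b - (a + b) * s)"
    using s by (intro mult_strict_left_mono) (auto simp: algebra_simps)
  then show "quadr (- (a + b')) (6 + 2 * a - b') 0 s < quadr (- (a + b)) (6 + 2 * a - b) 0 s"
    unfolding quadr_per_eq .
qed (use assms in auto)

lemma tneg_strict_mono:
  assumes "0 < a" "0 < b" "b < b'" "b' < 3 + a / 2"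
  shows "tneg a b < tneg a b'"
  unfolding tneg_def
proof (intro mult_strict_left_mono bint_strict_antimono admissible_neg)
  fix s :: real assume s: "0 < s" "s < 1"
  have "a / b' \<le> a / b" using assms by (intro divide_left_mono) auto
  then have x: "a / b' + s \<le> a / b + s" by simp
  have "b * (1 + s) < b' * (1 + s)" using assms s by (intro mult_strict_right_mono) auto
  then have y: "6 + a - b' - b' * s < 6 + a - b - b * s" by (simp add: algebra_simps)
  have "b' * s \<le> b'" using assms s by (simp add: mult_left_le)
  then have "0 \<le> 6 + a - b' - b' * s" using assms by linarith
  moreover have "0 < a / b' + s" using assms s by (intro add_pos_pos divide_pos_pos) auto
  ultimately show "quadr (- b') (6 - b') (a * (6 + a - b') / b') s < quadr (- b) (6 - b) (a * (6 + a - b) / b) s"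
    using assms by (subst (1 2) quadr_neg_eq) (auto intro!: mult_le_less_imp_less[OF x y])
qed (use assms in auto)

lemma bcur_mono: "0 < a \<Longrightarrow> m < m' \<Longrightarrow> bcur m a < bcur m' a"
proof -
  assume "0 < a" "m < m'"
  consider "m' \<le> 1/2" | "1/2 \<le> m" | "m < 1/2" "1/2 < m'" by linarith
  then show ?thesis
  proof cases
    case 3
    then have "m * a < 1/2 * a" using \<open>0 < a\<close> by (intro mult_strict_right_mono)
    then show ?thesis using 3 by (simp add: bcur_def)
  next
    case 1
    then have "bcur m a = m * a" "bcur m' a = m' * a"
      using \<open>m < m'\<close> by (auto simp: bcur_def min.absorb1 max.absorb1)
    then show ?thesis using \<open>0 < a\<close> \<open>m < m'\<close> by simp
  next
    case 2
    then have "bcur m a = 1/2 * a + (m - 1/2)" "bcur m' a = 1/2 * a + (m' - 1/2)"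
      using \<open>m < m'\<close> by (auto simp: bcur_def min.absorb2 max.absorb2)
    then show ?thesis using \<open>m < m'\<close> by simp
  qed
qed

lemma bcur_dom: "0 < m \<Longrightarrow> m < 7/2 \<Longrightarrow> 0 < a \<Longrightarrow> 0 < bcur m a \<and> bcur m a < 3 + a / 2"
  by (rule bcur_cases[of m]) (auto simp: path_dom)

text \<open>The curves \<open>b = bcur m a\<close> foliate the parameter domain.\<close>
lemma bcur_exhaust:
  assumes "0 < a" "0 < b" "b < 3 + a / 2"
  obtains m where "0 < m" "m < 7/2" "bcur m a = b"
proof (cases "b \<le> a / 2")
  case True
  then show ?thesis using assms by (intro that[of "b / a"]) (auto simp: bcur_def min_def field_simps)
next
  case False
  then show ?thesis using assms by (intro that[of "b - a / 2 + 1/2"]) (auto simp: bcur_def min_def)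
qed

text \<open>By \<open>cross\<close>, on each vertical line h can pass zero only downwards and hence
  only once. So the zero set over [x0, x1] is the graph of a function Y; it is continuous, and the
  intermediate value theorem applies to F along it. \<open>E\<close> is open only relative to the
  half plane y >= 0, because the energy parameter of a single bump may vanish.\<close>

lemma level_curve_intermediate_value:
  fixes E :: "(real \<times> real) set" and h F :: "real \<times> real \<Rightarrow> real"
  assumes ch: "continuous_on E h" and cF: "continuous_on E F"
    and nonneg: "\<And>x y. (x, y) \<in> E \<Longrightarrow> 0 \<le> y"
    and op: "\<And>x y. (x, y) \<in> E \<Longrightarrow>
      \<exists>d>0. \<forall>x' y'. \<bar>x' - x\<bar> < d \<and> \<bar>y' - y\<bar> < d \<and> 0 \<le> y' \<longrightarrow> (x', y') \<in> E"
    and up: "\<And>x y y'. (x, y) \<in> E \<Longrightarrow> y < y' \<Longrightarrow> (x, y') \<in> E"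
    and cross: "\<And>x y y'. (x, y) \<in> E \<Longrightarrow> h (x, y) \<le> 0 \<Longrightarrow> y < y' \<Longrightarrow> h (x, y') < 0"
    and neg: "\<And>x y. (x, y) \<in> E \<Longrightarrow> \<exists>y'>y. h (x, y') < 0"
    and ex: "\<And>x. x0 < x \<Longrightarrow> x < x1 \<Longrightarrow> \<exists>y. (x, y) \<in> E \<and> 0 \<le> h (x, y)"
    and p0: "(x0, y0) \<in> E" "h (x0, y0) = 0" and p1: "(x1, y1) \<in> E" "h (x1, y1) = 0"
    and less: "x0 < x1" and v: "F (x1, y1) < v" "v < F (x0, y0)"
  shows "\<exists>x y. x0 < x \<and> x < x1 \<and> (x, y) \<in> E \<and> h (x, y) = 0 \<and> F (x, y) = v"
proof -
  have "\<exists>y. (x, y) \<in> E \<and> h (x, y) = 0" if x: "x \<in> {x0..x1}" for x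
  proof -
    have "\<exists>y. (x, y) \<in> E \<and> 0 \<le> h (x, y)"
      using x ex[of x] p0 p1 by (cases "x = x0 \<or> x = x1") (auto intro: order_eq_refl)
    then obtain y where y: "(x, y) \<in> E" "0 \<le> h (x, y)" by blast
    obtain y' where y': "y < y'" "h (x, y') < 0" using neg[OF y(1)] by blast
    have inE: "(x, z) \<in> E" if "z \<in> {y..y'}" for z
      using that y(1) up[OF y(1), of z] by (cases "z = y") auto
    have "continuous_on {y..y'} (\<lambda>z. h (x, z))"
      by (rule continuous_on_compose2[OF ch]) (auto intro!: continuous_intros inE)
    then obtain z where "y \<le> z" "z \<le> y'" "h (x, z) = 0"
      using IVT2'[of "\<lambda>z. h (x, z)" y' 0 y] y y' by auto
    then show ?thesis using inE[of z] by auto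
  qed
  then obtain Y where Y: "\<And>x. x \<in> {x0..x1} \<Longrightarrow> (x, Y x) \<in> E \<and> h (x, Y x) = 0"
    by metis
  have uniq: "y = Y x" if "x \<in> {x0..x1}" "(x, y) \<in> E" "h (x, y) = 0" for x y
    using that Y[OF that(1)] cross[of x y "Y x"] cross[of x "Y x" y] by (cases y "Y x" rule: linorder_cases) auto
  have hcont: "isCont (\<lambda>x'. h (x', c)) x" if c: "(x, c) \<in> E" for x c
  proof -
    obtain d where d: "d > 0" "\<forall>x' y'. \<bar>x' - x\<bar> < d \<and> \<bar>y' - c\<bar> < d \<and> 0 \<le> y' \<longrightarrow> (x', y') \<in> E"
      using op[OF c] by blast
    have "continuous_on {x - d<..<x + d} (\<lambda>x'. h (x', c))"
      by (rule continuous_on_compose2[OF ch]) (use d nonneg[OF c] in \<open>auto intro!: continuous_intros\<close>)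
    then show ?thesis using d(1) by (simp add: continuous_on_eq_continuous_at)
  qed
  have near: "eventually (\<lambda>x'. (x', c) \<in> E) (at x)" if c: "(x, c) \<in> E" for x c
  proof -
    obtain d where d: "d > 0" "\<forall>x' y'. \<bar>x' - x\<bar> < d \<and> \<bar>y' - c\<bar> < d \<and> 0 \<le> y' \<longrightarrow> (x', y') \<in> E"
      using op[OF c] by blast
    show ?thesis
      unfolding eventually_at using d nonneg[OF c] by (auto simp: dist_real_def intro!: exI[of _ d])
  qed
  \<comment> \<open>At a level c slightly above or below Y x the sign of h (x, c) is strict and
    persists for x' near x; by \<open>cross\<close> it keeps Y x' on the same side of c.\<close>
  have contY: "continuous_on {x0..x1} Y"
    unfolding continuous_on_eq_continuous_within continuous_within
  proof (intro ballI)
    fix x assume x: "x \<in> {x0..x1}"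
    have Yx: "(x, Y x) \<in> E" "h (x, Y x) = 0" using Y[OF x] by auto
    show "(Y \<longlongrightarrow> Y x) (at x within {x0..x1})"
    proof (rule order_tendstoI)
      fix c assume c: "Y x < c"
      have cE: "(x, c) \<in> E" using up[OF Yx(1) c] .
      have "h (x, c) < 0" using cross[OF Yx(1) _ c] Yx(2) by simp
      then have "eventually (\<lambda>x'. h (x', c) < 0) (at x)"
        using hcont[OF cE] by (simp add: isCont_def order_tendstoD)
      with near[OF cE] have "eventually (\<lambda>x'. (x', c) \<in> E \<and> h (x', c) < 0) (at x)"
        by eventually_elim simp
      then have "eventually (\<lambda>x'. (x', c) \<in> E \<and> h (x', c) < 0) (at x within {x0..x1})"
        by (rule filter_leD[OF at_le, rotated]) simp
      moreover have "eventually (\<lambda>x'. x' \<in> {x0..x1}) (at x within {x0..x1})"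
        by (simp add: eventually_at_filter)
      ultimately show "eventually (\<lambda>x'. Y x' < c) (at x within {x0..x1})"
      proof eventually_elim
        case (elim x')
        have "\<not> c \<le> Y x'"
        proof
          assume "c \<le> Y x'"
          then have "h (x', Y x') < 0"
            using elim cross[of x' c "Y x'"] by (cases "c = Y x'") auto
          then show False using Y[of x'] elim by auto
        qed
        then show ?case by simp
      qed
    next
      fix c assume c: "c < Y x"
      show "eventually (\<lambda>x'. c < Y x') (at x within {x0..x1})"
      proof (cases "c < 0")
        case True
        have "c < Y x'" if "x' \<in> {x0..x1}" for x'
          using nonneg[of x' "Y x'"] Y[OF that] True by auto
        then show ?thesis by (simp add: eventually_at_filter)
      next
        case False
        obtain d where d: "d > 0" "\<forall>x' y'. \<bar>x' - x\<bar> < d \<and> \<bar>y' - Y x\<bar> < d \<and> 0 \<le> y' \<longrightarrow> (x', y') \<in> E"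
          using op[OF Yx(1)] by blast
        \<comment> \<open>\<open>E\<close> is not closed downwards, so the comparison level is
          raised into the neighbourhood of (x, Y x) that is known to lie in
          \<open>E\<close>.\<close>
        define c' where "c' = max c (Y x - d / 2)"
        have c': "c \<le> c'" "c' < Y x" "(x, c') \<in> E"
          using c d False by (auto simp: c'_def max_def)
        have "0 < h (x, c')"
          using cross[OF c'(3) _ c'(2)] Yx(2) by (cases "h (x, c') \<le> 0") auto
        then have "eventually (\<lambda>x'. 0 < h (x', c')) (at x)"
          using hcont[OF c'(3)] by (simp add: isCont_def order_tendstoD)
        with near[OF c'(3)] have "eventually (\<lambda>x'. (x', c') \<in> E \<and> 0 < h (x', c')) (at x)"
          by eventually_elim simp
        then have "eventually (\<lambda>x'. (x', c') \<in> E \<and> 0 < h (x', c')) (at x within {x0..x1})"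
          by (rule filter_leD[OF at_le, rotated]) simp
        moreover have "eventually (\<lambda>x'. x' \<in> {x0..x1}) (at x within {x0..x1})"
          by (simp add: eventually_at_filter)
        ultimately show ?thesis
        proof eventually_elim
          case (elim x')
          have "\<not> Y x' \<le> c'"
          proof
            assume "Y x' \<le> c'"
            then have "h (x', c') \<le> 0"
              using elim cross[of x' "Y x'" c'] Y[of x'] by (cases "c' = Y x'") auto
            then show False using elim by auto
          qed
          then show ?case using c'(1) by simp
        qed
      qed
    qed
  qed
  have "continuous_on {x0..x1} (\<lambda>x. F (x, Y x))"
    by (rule continuous_on_compose2[OF cF]) (use Y in \<open>auto intro!: continuous_intros contY\<close>)
  moreover have "Y x0 = y0" "Y x1 = y1" using uniq[of x0 y0] uniq[of x1 y1] p0 p1 less by auto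
  ultimately obtain x where x: "x0 \<le> x" "x \<le> x1" "F (x, Y x) = v"
    using IVT2'[of "\<lambda>x. F (x, Y x)" x1 v x0] v less by auto
  moreover have "x \<noteq> x0" "x \<noteq> x1" using x v \<open>Y x0 = y0\<close> \<open>Y x1 = y1\<close> by auto
  ultimately show ?thesis using Y[of x] by (intro exI[of _ x] exI[of _ "Y x"]) auto
qed

section \<open>Growth of the flux on a level set\<close>

definition fpos :: "real \<Rightarrow> real \<Rightarrow> real" where
  "fpos a b = sqrt (3/2) * (a * bmom a (6 + a) (b * (6 + a - b) / a))"

definition fneg :: "real \<Rightarrow> real \<Rightarrow> real" where
  "fneg a b = - (sqrt (3/2) * (b * bmom (- b) (6 - b) (a * (6 + a - b) / b)))"

text \<open>The opening angle is 2 \<alpha> and a bump has length 2 \<open>tpos\<close> or 2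
  \<open>tneg\<close>, so \<alpha> itself is a sum of half lengths. In \<open>ftot\<close> the
  factor 2 remains.\<close>

definition ttot :: "nat \<Rightarrow> nat \<Rightarrow> real \<Rightarrow> real \<Rightarrow> real" where
  "ttot i j a b = real i * tpos a b + real j * tneg a b"

definition ftot :: "nat \<Rightarrow> nat \<Rightarrow> real \<Rightarrow> real \<Rightarrow> real" where
  "ftot i j a b = 2 * (real i * fpos a b + real j * fneg a b)"

lemma ttot_le:
  assumes "0 < a" "0 < b" "b < 3 + a / 2"
  shows "ttot i j a b \<le> real (i + j) * tper a b"
proof -
  have "ttot i j a b \<le> real i * tper a b + real j * tper a b"
    unfolding ttot_def using tpos_add_tneg[OF assms] tpos_pos[OF assms] tneg_pos[OF assms]
    by (intro add_mono mult_left_mono) auto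
  then show ?thesis by (simp add: algebra_simps)
qed

lemma tpos_le: "0 < a \<Longrightarrow> 0 < b \<Longrightarrow> b < 3 + a / 2 \<Longrightarrow> tpos a b \<le> sqrt (3/2) * pi / sqrt a"
  unfolding tpos_def using bint_le[of "b * (6 + a - b) / a" a a "6 + a"]
    mult_left_mono[of "bint a (6 + a) (b * (6 + a - b) / a)" "pi / sqrt a" "sqrt (3/2)"]
  by (simp add: slope_def)

lemma fpos_le: "0 < a \<Longrightarrow> 0 < b \<Longrightarrow> b < 3 + a / 2 \<Longrightarrow> fpos a b \<le> sqrt (3/2) * pi / 2 * sqrt a"
proof -
  assume ab: "0 < a" "0 < b" "b < 3 + a / 2"
  have "bmom a (6 + a) (b * (6 + a - b) / a) \<le> pi / 2 / sqrt a"
    using ab by (intro bmom_le) (simp_all add: slope_def)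
  then have "sqrt (3/2) * (a * bmom a (6 + a) (b * (6 + a - b) / a)) \<le> sqrt (3/2) * (a * (pi / 2 / sqrt a))"
    using ab by (intro mult_left_mono) auto
  also have "a * (pi / 2 / sqrt a) = pi / 2 * (a / sqrt a)" by simp
  also have "a / sqrt a = sqrt a" using ab by (simp add: real_div_sqrt)
  finally show ?thesis by (simp add: fpos_def)
qed

text \<open>By \<open>bmom_ge\<close>, the mean depth of a negative bump is at least a third of its
  greatest depth.\<close>

lemma fneg_le:
  assumes "0 < a" "0 < b" "b < 3 + a / 2"
  shows "fneg a b \<le> - (b / 3 * tneg a b)"
proof -
  have "bint (- b) (6 - b) (a * (6 + a - b) / b) / 3 \<le> bmom (- b) (6 - b) (a * (6 + a - b) / b)"
    using assms by (intro bmom_ge admissible_neg) auto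
  then have "sqrt (3/2) * (b * (bint (- b) (6 - b) (a * (6 + a - b) / b) / 3)) \<le> - fneg a b"
    using assms unfolding fneg_def by (auto intro!: mult_left_mono)
  then show ?thesis by (simp add: tneg_def mult_ac)
qed

lemma tper_le:
  assumes "0 < a" "0 < b" "b < a / 4"
  shows "tper a b \<le> sqrt 3 * pi / sqrt a"
proof -
  have "bint (- (a + b)) (6 + 2 * a - b) 0 \<le> pi / sqrt (a / 2)"
    using assms by (intro bint_le) (auto simp: slope_def)
  then have "tper a b \<le> sqrt (3/2) * (pi / sqrt (a / 2))"
    unfolding tper_def by (intro mult_left_mono) auto
  also have "\<dots> = sqrt 3 * pi / sqrt a"
    using assms by (simp add: real_sqrt_divide)
  finally show ?thesis .
qed

text \<open>Positive bumps contribute at most of the order sqrt a. For large a they are also short,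
  and b < a / 4 would make even the half period too short to add up to \<alpha>. So b >= a / 4, the
  negative half bumps take up at least \<alpha> / 2, and their contribution is at most - 2 (a / 12)
  (\<alpha> / 2), which is linear in a.\<close>

lemma ftot_upper_bound:
  assumes "0 < \<alpha>" "0 < i" "0 < j"
  obtains c R where "0 < c" "0 < R"
    "\<And>a b. 0 < a \<Longrightarrow> 0 < b \<Longrightarrow> b < 3 + a / 2 \<Longrightarrow> ttot i j a b = \<alpha> \<Longrightarrow>
       ftot i j a b \<le> c * sqrt a \<and> (R \<le> a \<longrightarrow> ftot i j a b \<le> c * sqrt a - \<alpha> / 12 * a)"
proof -
  define c where "c = real i * (sqrt (3/2) * pi)"
  define e where "e = real (i + j) * (sqrt 3 * pi)"
  \<comment> \<open>Beyond \<open>R\<close> both c / sqrt a < \<alpha> / 2 and e / sqrt a < \<alpha>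
    hold: short positive bumps, and a short half period whenever b < a / 4.\<close>
  define R where "R = ((2 * c + e + 1) / \<alpha>)\<^sup>2"
  have ce: "0 < c" "0 < e" using assms by (auto simp: c_def e_def)
  show ?thesis
  proof (rule that[of c R])
    show "0 < c" by (rule ce)
    show "0 < R" unfolding R_def using assms ce
      by (intro zero_less_power divide_pos_pos add_pos_pos) auto
  next
    fix a b assume ab: "0 < a" "0 < b" "b < 3 + a / 2" and T: "ttot i j a b = \<alpha>"
    have t: "real i * tpos a b \<le> c / sqrt a"
      unfolding c_def using tpos_le[OF ab] mult_left_mono[of "tpos a b" _ "real i"] by fastforce
    have f: "2 * (real i * fpos a b) \<le> c * sqrt a"
      unfolding c_def using mult_left_mono[OF fpos_le[OF ab], of "2 * real i"] by (simp add: mult_ac)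
    define N where "N = b / 3 * (real j * tneg a b)"
    define f1 f2 where "f1 = real i * fpos a b" and "f2 = real j * fneg a b"
    have n: "f2 \<le> - N"
      using mult_left_mono[OF fneg_le[OF ab], of "real j"] by (simp add: N_def f2_def mult_ac)
    have jn: "0 \<le> real j * tneg a b" using tneg_pos[OF ab] by simp
    have "0 \<le> N" unfolding N_def using ab jn by (intro mult_nonneg_nonneg[of "b / 3"]) auto
    then have 1: "ftot i j a b \<le> c * sqrt a"
      unfolding ftot_def f1_def[symmetric] f2_def[symmetric] using f[folded f1_def] n by simp
    have "ftot i j a b \<le> c * sqrt a - \<alpha> / 12 * a" if "R \<le> a"
    proof -
      have "(2 * c + e + 1) / \<alpha> = sqrt R" using assms ce by (simp add: R_def)
      also have "\<dots> \<le> sqrt a" using that by simp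
      finally have r: "2 * c + e < \<alpha> * sqrt a" using assms(1) ab by (simp add: divide_le_eq mult.commute)
      then have "2 * c < \<alpha> * sqrt a" "e < \<alpha> * sqrt a" using ce by linarith+
      then have small: "c / sqrt a < \<alpha> / 2" "e / sqrt a < \<alpha>" using ab by (auto simp: field_simps)
      have "\<not> b < a / 4"
      proof
        assume "b < a / 4"
        then have "real (i + j) * tper a b \<le> e / sqrt a"
          unfolding e_def using ab tper_le[of a b] mult_left_mono[of "tper a b" _ "real (i + j)"] by fastforce
        then show False using ttot_le[OF ab, of i j] T small by linarith
      qed
      then have b: "a / 4 \<le> b" by simp
      have "\<alpha> / 2 \<le> real j * tneg a b" using T t small(1) unfolding ttot_def by linarith
      then have "(a / 4 / 3) * (\<alpha> / 2) \<le> N"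
        unfolding N_def using b ab assms(1) by (intro mult_mono) auto
      then have "\<alpha> / 24 * a \<le> N" by (simp add: mult.commute)
      then show ?thesis
        unfolding ftot_def f1_def[symmetric] f2_def[symmetric] using f[folded f1_def] n by (simp add: algebra_simps)
    qed
    with 1 show "ftot i j a b \<le> c * sqrt a \<and> (R \<le> a \<longrightarrow> ftot i j a b \<le> c * sqrt a - \<alpha> / 12 * a)"
      by blast
  qed
qed

lemma ftot_bounds:
  assumes "0 < \<alpha>" "0 < i" "0 < j"
  obtains K L where "\<And>a b. 0 < a \<Longrightarrow> 0 < b \<Longrightarrow> b < 3 + a / 2 \<Longrightarrow> ttot i j a b = \<alpha> \<Longrightarrow> ftot i j a b \<le> K"
    "\<And>a b v. 0 < a \<Longrightarrow> 0 < b \<Longrightarrow> b < 3 + a / 2 \<Longrightarrow> ttot i j a b = \<alpha> \<Longrightarrow> L v \<le> a \<Longrightarrow> ftot i j a b < v"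
proof -
  obtain c R where c: "0 < c" "0 < R" and bd:
    "\<And>a b. 0 < a \<Longrightarrow> 0 < b \<Longrightarrow> b < 3 + a / 2 \<Longrightarrow> ttot i j a b = \<alpha> \<Longrightarrow>
       ftot i j a b \<le> c * sqrt a \<and> (R \<le> a \<longrightarrow> ftot i j a b \<le> c * sqrt a - \<alpha> / 12 * a)"
    using ftot_upper_bound[OF assms] by metis
  \<comment> \<open>If sqrt a >= X v, then c sqrt a - (\<alpha> / 12) a <= - sqrt a, and - sqrt a
    lies below v.\<close>
  define X where "X v = 12 * (c + 1) / \<alpha> + \<bar>v\<bar> + 1" for v
  have Xpos: "0 < X v" for v unfolding X_def using assms c by (intro add_nonneg_pos add_nonneg_nonneg) auto
  define L where "L v = max R ((X v)\<^sup>2)" for v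
  have lo: "ftot i j a b < v" if ab: "0 < a" "0 < b" "b < 3 + a / 2" "ttot i j a b = \<alpha>" and L: "L v \<le> a" for a b v
  proof -
    have "(X v)\<^sup>2 \<le> a" using L by (simp add: L_def)
    then have x: "X v \<le> sqrt a" by (simp add: real_le_rsqrt)
    have "0 \<le> \<bar>v\<bar> + 1" by simp
    then have "12 * (c + 1) / \<alpha> \<le> sqrt a" using x by (simp add: X_def)
    then have "12 * (c + 1) \<le> \<alpha> * sqrt a" using assms by (simp add: divide_le_eq mult.commute)
    then have "12 * (c + 1) * sqrt a \<le> \<alpha> * sqrt a * sqrt a" using ab by (intro mult_right_mono) auto
    then have "c * sqrt a - \<alpha> / 12 * a \<le> - sqrt a" using ab by (simp add: algebra_simps)
    moreover have "0 \<le> 12 * (c + 1) / \<alpha>" using assms c by auto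
    then have "\<bar>v\<bar> + 1 \<le> sqrt a" using x by (simp add: X_def)
    moreover have "R \<le> a" using L by (simp add: L_def)
    ultimately show ?thesis using bd[OF ab] by linarith
  qed
  show ?thesis
  proof (rule that[of "max 0 (c * sqrt (L 0))" L])
    fix a b assume ab: "0 < a" "0 < b" "b < 3 + a / 2" "ttot i j a b = \<alpha>"
    show "ftot i j a b \<le> max 0 (c * sqrt (L 0))"
    proof (cases "L 0 \<le> a")
      case True
      then show ?thesis using lo[OF ab True] by simp
    next
      case False
      then have "c * sqrt a \<le> c * sqrt (L 0)" using c by (intro mult_left_mono) auto
      then show ?thesis using bd[OF ab] by linarith
    qed
  qed (use lo in auto)
qed

lemma tpos_ge:
  assumes "0 < a" "0 < b" "b \<le> a" "b < 3 + a / 2"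
  shows "sqrt 6 / sqrt (12 + 3 * a) \<le> tpos a b"
proof -
  have "2 / sqrt (12 + 3 * a) \<le> bint a (6 + a) (b * (6 + a - b) / a)"
  proof (rule bint_ge)
    show "admissible a (6 + a) (b * (6 + a - b) / a)" using assms by (intro admissible_pos) auto
    fix s :: real assume s: "0 < s" "s < 1"
    have "a * s\<^sup>2 \<le> a * 1" using assms s by (intro mult_left_mono power_le_one) auto
    moreover have "(6 + a) * s \<le> (6 + a) * 1" using assms s by (intro mult_left_mono) auto
    moreover have "b * (6 + a - b) \<le> a * (6 + a)" using assms by (intro mult_mono) auto
    then have "b * (6 + a - b) / a \<le> 6 + a" using assms by (simp add: divide_le_eq mult.commute)
    ultimately have "quadr a (6 + a) (b * (6 + a - b) / a) s \<le> a * 1 + (6 + a) * 1 + (6 + a)"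
      unfolding quadr_def by (intro add_mono)
    then show "quadr a (6 + a) (b * (6 + a - b) / a) s \<le> 12 + 3 * a" by simp
  qed
  then have "sqrt (3/2) * (2 / sqrt (12 + 3 * a)) \<le> tpos a b"
    unfolding tpos_def by (intro mult_left_mono) auto
  moreover have "sqrt (3/2) * 2 = sqrt 6"
    by (rule real_sqrt_unique[symmetric]) (simp_all add: power_mult_distrib)
  ultimately show ?thesis by simp
qed

text \<open>Where \<open>tpos\<close> fails to decrease along a curve, the total time already exceeds \<open>\<alpha>\<close>.\<close>
lemma ttot_gt_bad_region:
  assumes \<beta>: "0 \<le> \<beta>" "\<beta> < 3" and a: "0 < a" "a\<^sup>2 < 4 * (\<beta> * (6 - \<beta>))"
    and j: "0 < j" and \<alpha>: "\<alpha> < pi" "\<alpha> \<le> real j * (pi / 2)"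
  shows "\<alpha> < ttot (Suc j) j a (1/2 * a + \<beta>)"
proof -
  define b where "b = 1/2 * a + \<beta>"
  have ab: "0 < a" "0 < b" "b < 3 + a / 2" using \<beta> a by (auto simp: b_def)
  have tt: "ttot (Suc j) j a b = tpos a b + real j * tper a b"
    unfolding ttot_def using tpos_add_tneg[OF ab, symmetric] by (simp add: algebra_simps)
  have P: "pi / sqrt (4 + a - b) \<le> tper a b" using ab by (intro tper_ge) auto
  show ?thesis
  proof (cases "a \<le> b")
    case True
    \<comment> \<open>Each half period is now at least pi / 2, so j of them reach \<alpha>, and the
      additional \<open>tpos\<close> makes the inequality strict.\<close>
    have "sqrt (4 + a - b) \<le> sqrt 4" using True by (intro real_sqrt_le_mono) auto
    then have "pi / 2 \<le> pi / sqrt (4 + a - b)" using ab by (intro divide_left_mono) auto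
    then have "pi / 2 \<le> tper a b" using P by (rule order_trans)
    then have "real j * (pi / 2) \<le> real j * tper a b" by (intro mult_left_mono) auto
    then show ?thesis using tpos_pos[OF ab] \<alpha> tt unfolding b_def[symmetric] by linarith
  next
    case False
    have "\<beta> * (6 - \<beta>) \<le> 9" using sum_squares_ge_zero[of "\<beta> - 3" 0] by (simp add: algebra_simps)
    then have "a\<^sup>2 \<le> 6\<^sup>2" using a by simp
    then have a6: "a \<le> 6" by (rule power2_le_imp_le) simp
    \<comment> \<open>Otherwise 5/4 + \<beta> <= a / 2, and squaring against the bound on a^2 makes
      a quadratic in \<beta> negative whose minimum is 1/32.\<close>
    have y: "a - b < 5/4"
    proof (rule ccontr)
      assume "\<not> a - b < 5/4"
      then have y: "5/4 \<le> a / 2 - \<beta>" by (simp add: b_def)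
      have "(5/4 + \<beta>)\<^sup>2 \<le> (a / 2)\<^sup>2" using y \<beta> by (intro power_mono) auto
      also have "(a / 2)\<^sup>2 = a\<^sup>2 / 4" by (simp add: power_divide)
      also have "\<dots> < \<beta> * (6 - \<beta>)" using a by simp
      finally have "2 * \<beta>\<^sup>2 - 7/2 * \<beta> + 25/16 < 0"
        by (simp add: power2_eq_square algebra_simps)
      moreover have "2 * \<beta>\<^sup>2 - 7/2 * \<beta> + 25/16 = 2 * (\<beta> - 7/8)\<^sup>2 + 1/32"
        by (simp add: power2_eq_square algebra_simps)
      ultimately show False using zero_le_power2[of "\<beta> - 7/8"] by linarith
    qed
    \<comment> \<open>A rational number slightly above sqrt (21/4), the value at a - b = 5/4.
      Likewise 447/1000 below is slightly less than sqrt (1/5).\<close>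
    have "sqrt (4 + a - b) \<le> sqrt ((22915/10000)\<^sup>2)"
      using y by (intro real_sqrt_le_mono) (simp add: power2_eq_square)
    then have "sqrt (4 + a - b) \<le> 22915/10000" by simp
    then have "pi / (22915/10000) \<le> pi / sqrt (4 + a - b)" using ab False by (intro divide_left_mono) auto
    then have P2: "pi / (22915/10000) \<le> tper a b" using P by linarith
    then have jP: "real j * (pi / (22915/10000)) \<le> real j * tper a b" by (intro mult_left_mono) auto
    have tp: "447/1000 \<le> tpos a b"
    proof -
      have "sqrt 6 / sqrt 30 \<le> sqrt 6 / sqrt (12 + 3 * a)"
        using a6 ab by (intro divide_left_mono mult_pos_pos) auto
      moreover have "sqrt 6 / sqrt 30 = sqrt (1/5)" by (simp flip: real_sqrt_divide)
      moreover have "447/1000 \<le> sqrt (1/5)" by (rule real_le_rsqrt) (simp add: power2_eq_square)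
      ultimately show ?thesis using tpos_ge[of a b] ab False by linarith
    qed
    show ?thesis
    \<comment> \<open>For j <= 2 the half periods fall short of j pi / 2 by less than 447/1000,
      which one \<open>tpos\<close> makes up. From j = 3 on they reach pi by themselves.\<close>
    proof (cases "j \<le> 2")
      case True
      have "real j * (pi / 2 - pi / (22915/10000)) \<le> 2 * (pi / 2 - pi / (22915/10000))"
        using True by (intro mult_right_mono) auto
      also have "\<dots> < 447/1000" using pi_approx by (simp add: field_simps)
      finally have "real j * (pi / 2) < real j * (pi / (22915/10000)) + 447/1000"
        unfolding right_diff_distrib by linarith
      then show ?thesis using tt jP tp \<alpha> unfolding b_def[symmetric] by linarith
    next
      case False
      then have "3 * (pi / (22915/10000)) \<le> real j * (pi / (22915/10000))"
        by (intro mult_right_mono) auto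
      then have "3 * (pi / (22915/10000)) \<le> real j * tper a b" using jP by (rule order_trans)
      moreover have "pi \<le> 3 * (pi / (22915/10000))" by (simp add: field_simps)
      ultimately have "pi \<le> real j * tper a b" by (rule order_trans[rotated])
      then show ?thesis using tt tp \<alpha>(1) unfolding b_def[symmetric] by linarith
    qed
  qed
qed

text \<open>Here h = 7/2 - m is the distance of b from 3 + a / 2, where - b turns into a double root
  and a negative bump becomes infinitely long. The logarithmic bound is uniform in
  \<open>a \<le> a1\<close>, so close to \<open>m = 7/2\<close> a given length can occur only at
  large a.\<close>

lemma tneg_unbounded:
  assumes "0 < a1" "0 < K"
  obtains m0 where "0 < m0" "m0 < 7/2"
    "\<And>m a. m0 < m \<Longrightarrow> m < 7/2 \<Longrightarrow> 0 < a \<Longrightarrow> a \<le> a1 \<Longrightarrow> K < tneg a (bcur m a)"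
proof -
  define M where "M = 9 + 3/2 * a1"
  have M: "9 \<le> M" using assms by (simp add: M_def)
  \<comment> \<open>The exponential makes ln (1 / h) / sqrt M exceed K, and the bound 3 keeps m
    above 1/2, where \<open>bcur\<close> is a shifted line.\<close>
  define e0 where "e0 = min 3 (exp (- (K * sqrt M)))"
  have e0: "0 < e0" "e0 \<le> 3" by (auto simp: e0_def)
  show ?thesis
  proof (rule that[of "7/2 - e0"])
    show "0 < 7/2 - e0" "7/2 - e0 < 7/2" using e0 by auto
    fix m a assume m: "7/2 - e0 < m" "m < 7/2" and a: "0 < a" "a \<le> a1"
    define h where "h = 7/2 - m"
    define b where "b = bcur m a"
    have h: "0 < h" "h < e0" using m by (auto simp: h_def)
    have b: "b = a / 2 + 3 - h" using m e0 by (simp add: b_def bcur_def h_def)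
    have ab: "0 < b" "b < 3 + a / 2" using bcur_dom[of m a] m e0 a by (auto simp: b_def)
    have ba: "a / 2 \<le> b" using h e0 by (simp add: b)
    have "ln (1 / h) / sqrt M \<le> bint (- b) (6 - b) (a * (6 + a - b) / b)"
    proof (rule bint_ge_log)
      show "admissible (- b) (6 - b) (a * (6 + a - b) / b)" using ab a by (intro admissible_neg) auto
      fix s :: real assume s: "0 < s" "s < 1"
      have e: "6 + a - b - b * s = (3 + a / 2) * (1 - s) + h * (1 + s)" by (simp add: b field_simps)
      have "a / b \<le> 2" using ba ab by (simp add: divide_le_eq)
      then have ab2: "a / b + s \<le> 3" using s by linarith
      have "quadr (- b) (6 - b) (a * (6 + a - b) / b) s \<le> 3 * ((3 + a / 2) * (1 - s) + h * (1 + s))"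
      proof -
        have "0 \<le> (3 + a / 2) * (1 - s) + h * (1 + s)" using s a h by (intro add_nonneg_nonneg mult_nonneg_nonneg) auto
        then have "(a / b + s) * ((3 + a / 2) * (1 - s) + h * (1 + s)) \<le> 3 * ((3 + a / 2) * (1 - s) + h * (1 + s))"
          using ab2 by (intro mult_right_mono)
        then show ?thesis using ab by (simp add: quadr_neg_eq e)
      qed
      also have "\<dots> = (3 * (3 + a / 2)) * (1 - s) + (3 * (1 + s)) * h" by (simp add: algebra_simps)
      also have "\<dots> \<le> M * (1 - s) + M * h"
        using s a h M by (intro add_mono mult_right_mono) (auto simp: M_def)
      finally show "quadr (- b) (6 - b) (a * (6 + a - b) / b) s \<le> M * (1 - s + h)" by (simp add: distrib_left)
    qed (use h M in auto)
    moreover have "K < ln (1 / h) / sqrt M"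
    proof -
      have "h < exp (- (K * sqrt M))" using h by (simp add: e0_def)
      then have "ln h < - (K * sqrt M)" using h(1) by (metis ln_exp ln_less_cancel_iff exp_gt_zero)
      then have "K * sqrt M < ln (1 / h)" using h by (simp add: ln_div)
      then show ?thesis using M by (simp add: less_divide_eq)
    qed
    ultimately have K: "K < bint (- b) (6 - b) (a * (6 + a - b) / b)" by linarith
    have "bint (- b) (6 - b) (a * (6 + a - b) / b) \<le> tneg a b"
    proof -
      have "1 \<le> sqrt (3/2)" by simp
      then show ?thesis unfolding tneg_def using K assms
        mult_right_mono[of 1 "sqrt (3/2)" "bint (- b) (6 - b) (a * (6 + a - b) / b)"] by simp
    qed
    then show "K < tneg a (bcur m a)" using K b_def by simp
  qed
qed

section \<open>Crossing the level \<alpha> along the curves\<close>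

definition curve_dom :: "(real \<times> real) set" where
  "curve_dom = {0<..<7/2} \<times> {0<..}"

lemma continuous_on_bcur [continuous_intros]:
  "continuous_on S f \<Longrightarrow> continuous_on S g \<Longrightarrow> continuous_on S (\<lambda>z. bcur (f z) (g z))"
  unfolding bcur_def by (intro continuous_intros)

lemma curve_domD:
  assumes "z \<in> curve_dom"
  shows "0 < snd z" "0 < bcur (fst z) (snd z)" "bcur (fst z) (snd z) < 3 + snd z / 2"
  using assms bcur_dom[of "fst z" "snd z"] by (auto simp: curve_dom_def)

lemma continuous_on_ttot: "continuous_on curve_dom (\<lambda>z. ttot i j (snd z) (bcur (fst z) (snd z)))"
  unfolding ttot_def tpos_def tneg_def
  by (intro continuous_intros continuous_on_bint admissible_pos admissible_neg)
     (auto dest: curve_domD)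

lemma continuous_on_ftot: "continuous_on curve_dom (\<lambda>z. ftot i j (snd z) (bcur (fst z) (snd z)))"
  unfolding ftot_def fpos_def fneg_def
  by (intro continuous_intros continuous_on_bmom admissible_pos admissible_neg)
     (auto dest: curve_domD)

text \<open>Pairing positive with negative half bumps gives half periods and leaves at most one half
  bump over. Hence \<open>tpos\<close>, whose monotonicity is the delicate one, matters only if
  there is one more positive bump.\<close>

lemma ttot_eq:
  assumes "0 < a" "0 < b" "b < 3 + a / 2"
  shows "ttot i i a b = real i * tper a b"
    "ttot i (Suc i) a b = real i * tper a b + tneg a b"
    "ttot (Suc i) i a b = tpos a b + real i * tper a b"
  unfolding ttot_def tpos_add_tneg[OF assms, symmetric] by (auto simp: algebra_simps)

text \<open>\<open>tper\<close> and \<open>tneg\<close> always decrease. For \<open>tpos\<close> the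
  assumption that the total length is at most \<alpha> is essential: it excludes the bad region of
  \<open>ttot_gt_bad_region\<close>, so the threshold of \<open>tpos_path_strict_antimono\<close> is
  met.\<close>

lemma ttot_curve_crossing:
  assumes m: "0 < m" "m < 7/2" and a: "0 < a" "a < a'" and i: "0 < i" and j: "0 < j"
    and \<alpha>: "\<alpha> < pi" and ij: "i = j \<or> j = Suc i \<or> i = Suc j \<and> \<alpha> \<le> real j * (pi / 2)"
    and le: "ttot i j a (bcur m a) \<le> \<alpha>"
  shows "ttot i j a' (bcur m a') < \<alpha>"
proof -
  obtain l \<beta> where lb: "\<And>a. bcur m a = l * a + \<beta>" "0 < l" "l \<le> 1/2" "0 \<le> \<beta>" "\<beta> < 3" "\<beta> = 0 \<or> l = 1/2"
    using bcur_cases[OF m] by metis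
  note dom = bcur_dom[OF m a(1)] bcur_dom[OF m, of a']
  have a': "0 < a'" using a by simp
  have P: "tper a' (bcur m a') < tper a (bcur m a)"
    unfolding lb(1) using tper_path_strict_antimono[OF lb(2-5) a] .
  have N: "tneg a' (bcur m a') < tneg a (bcur m a)"
    unfolding lb(1) using tneg_path_strict_antimono[OF lb(2-5) a] .
  have "ttot i j a' (bcur m a') < ttot i j a (bcur m a)"
    using ij
  proof (elim disjE conjE)
    assume "i = j"
    then show ?thesis using dom a P i by (simp add: ttot_eq)
  next
    assume "j = Suc i"
    then show ?thesis using dom a N mult_left_mono[OF less_imp_le[OF P], of "real i"] by (simp add: ttot_eq)
  next
    assume ij: "i = Suc j" and \<alpha>2: "\<alpha> \<le> real j * (pi / 2)"
    have "4 * (\<beta> * (6 - \<beta>)) \<le> a\<^sup>2"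
    proof (rule ccontr)
      assume neg: "\<not> 4 * (\<beta> * (6 - \<beta>)) \<le> a\<^sup>2"
      then have "\<beta> \<noteq> 0" by auto
      then have l: "l = 1/2" using lb(6) by simp
      have "\<alpha> < ttot (Suc j) j a (1/2 * a + \<beta>)"
        using neg by (intro ttot_gt_bad_region[OF lb(4,5) a(1) _ j \<alpha> \<alpha>2]) simp
      then show False using le[unfolded lb(1) l ij] by simp
    qed
    then have "tpos a' (bcur m a') < tpos a (bcur m a)"
      unfolding lb(1) using tpos_path_strict_antimono[OF lb(2-5) a lb(6)] by simp
    then show ?thesis using ij dom a mult_left_mono[OF less_imp_le[OF P], of "real j"] by (simp add: ttot_eq)
  qed
  with le show ?thesis by simp
qed

lemma ttot_curve_eventually_less:
  assumes m: "0 < m" "m < 7/2" and \<alpha>: "0 < \<alpha>"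
  shows "\<exists>a'>a. 0 < a' \<and> ttot i j a' (bcur m a') < \<alpha>"
proof -
  obtain l \<beta> where lb: "\<And>a. bcur m a = l * a + \<beta>" "0 < l" "l \<le> 1/2" "0 \<le> \<beta>" "\<beta> < 3"
    using bcur_cases[OF m] by metis
  have "(\<lambda>n. real (i + j) * tper (1 + real n) (l * (1 + real n) + \<beta>)) \<longlonglongrightarrow> real (i + j) * 0"
    by (intro tendsto_mult_left tper_path_tendsto_0 lb)
  then have "eventually (\<lambda>n. real (i + j) * tper (1 + real n) (bcur m (1 + real n)) < \<alpha>) sequentially"
    unfolding lb(1) using \<alpha> by (auto dest: order_tendstoD(2))
  moreover have "eventually (\<lambda>n. a < real n) sequentially"
    using filterlim_real_sequentially by (rule filterlim_at_top_dense[THEN iffD1, rule_format])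
  ultimately have "eventually (\<lambda>n. real (i + j) * tper (1 + real n) (bcur m (1 + real n)) < \<alpha> \<and> a < real n) sequentially"
    by (rule eventually_conj)
  then obtain n where n: "real (i + j) * tper (1 + real n) (bcur m (1 + real n)) < \<alpha>" "a < real n"
    by (auto dest: eventually_happens)
  have "0 < 1 + real n" by simp
  then show ?thesis
    using ttot_le[of "1 + real n" "bcur m (1 + real n)" i j] bcur_dom[OF m, of "1 + real n"] n
    by (intro exI[of _ "1 + real n"]) auto
qed

lemma ttot_start:
  assumes m: "0 < m" "m < 7/2" and j: "0 < j" and \<alpha>: "\<alpha> \<le> real j * (pi / 2)"
  shows "\<exists>a>0. \<alpha> \<le> ttot (Suc j) j a (bcur m a)"
proof -
  obtain l \<beta> where lb: "\<And>a. bcur m a = l * a + \<beta>" "0 < l" "l \<le> 1/2" "0 \<le> \<beta>" "\<beta> < 3" "\<beta> = 0 \<or> l = 1/2"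
    using bcur_cases[OF m] by metis
  show ?thesis
  proof (cases "\<beta> = 0")
    case False
    then have l: "l = 1/2" "0 < \<beta>" using lb by auto
    \<comment> \<open>At a = \<beta> one has b = 3/2 \<beta> >= a, so 4 + a - b <= 4 and each half
      period is at least pi / 2.\<close>
    let ?b = "bcur m \<beta>"
    have dom: "0 < \<beta>" "0 < ?b" "?b < 3 + \<beta> / 2" using bcur_dom[OF m, of \<beta>] l by auto
    have "sqrt (4 + \<beta> - ?b) \<le> sqrt 4" using l by (intro real_sqrt_le_mono) (auto simp: lb(1))
    then have "pi / 2 \<le> pi / sqrt (4 + \<beta> - ?b)" using dom by (intro divide_left_mono) auto
    also have "\<dots> \<le> tper \<beta> ?b" using dom by (intro tper_ge) auto
    finally have "real j * (pi / 2) \<le> real j * tper \<beta> ?b" by (intro mult_left_mono) auto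
    then show ?thesis
      using tpos_pos[OF dom] \<alpha> dom by (intro exI[of _ \<beta>]) (simp add: ttot_eq)
  next
    case True
    \<comment> \<open>With this height the j half periods miss j pi / 2 by at most pi / 16, and one
      positive half bump of length at least 1/2 compensates for that.\<close>
    define a where "a = 1 / real j"
    have a: "0 < a" "a \<le> 1" "real j * a = 1" using j by (auto simp: a_def)
    let ?b = "bcur m a"
    have dom: "0 < a" "0 < ?b" "?b < 3 + a / 2" using bcur_dom[OF m a(1)] a by auto
    have ba: "?b \<le> a" using True lb a by (simp add: lb(1))
    have "sqrt 6 / sqrt 15 \<le> sqrt 6 / sqrt (12 + 3 * a)" using a by (intro divide_left_mono) auto
    moreover have "1/2 \<le> sqrt 6 / sqrt 15"
      unfolding real_sqrt_divide[symmetric] by (rule real_le_rsqrt) (simp add: power2_eq_square)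
    ultimately have tp: "1/2 \<le> tpos a ?b" using tpos_ge[OF dom(1,2) ba dom(3)] by linarith
    have "sqrt (4 + a - ?b) \<le> sqrt ((2 + a / 4)\<^sup>2)"
      using dom by (intro real_sqrt_le_mono) (simp add: power2_eq_square algebra_simps)
    then have "sqrt (4 + a - ?b) \<le> 2 + a / 4" using a by simp
    then have "pi / (2 + a / 4) \<le> pi / sqrt (4 + a - ?b)" using dom a ba by (intro divide_left_mono) auto
    also have "\<dots> \<le> tper a ?b" using dom by (intro tper_ge) auto
    finally have P: "pi / (2 + a / 4) \<le> tper a ?b" .
    have "pi / 2 - pi * a / 16 \<le> pi / (2 + a / 4)"
    proof -
      have "(1/2 - a / 16) * (2 + a / 4) \<le> 1" by (simp add: algebra_simps)
      then have "1/2 - a / 16 \<le> 1 / (2 + a / 4)" using a by (simp add: pos_le_divide_eq)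
      then have "pi * (1/2 - a / 16) \<le> pi * (1 / (2 + a / 4))" by (intro mult_left_mono) auto
      then show ?thesis by (simp add: right_diff_distrib)
    qed
    then have "real j * (pi / 2 - pi * a / 16) \<le> real j * tper a ?b"
      using P by (intro mult_left_mono) auto
    moreover have "real j * (pi / 2 - pi * a / 16) = real j * (pi / 2) - pi / 16 * (real j * a)"
      by (simp add: algebra_simps)
    ultimately have "real j * (pi / 2) - pi / 16 \<le> real j * tper a ?b" using a(3) by simp
    moreover have "pi / 16 < 1/2" using pi_less_4 by simp
    ultimately show ?thesis using tp \<alpha> dom by (intro exI[of _ a]) (simp add: ttot_eq)
  qed
qed

text \<open>At fixed a a higher curve has larger b, which lengthens \<open>tper\<close> and
  \<open>tneg\<close>. So every later curve inherits a point of length at least \<alpha> from the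
  starting point. \<open>tpos\<close> changes in the opposite direction, which is why
  \<open>ttot_start\<close> is needed in the remaining case.\<close>

lemma ttot_curve_mono:
  assumes "0 < m" "m < m'" "m' < 7/2" "0 < a" and ij: "i = j \<or> j = Suc i"
  shows "ttot i j a (bcur m a) \<le> ttot i j a (bcur m' a)"
proof -
  have d: "0 < bcur m a" "bcur m a < bcur m' a" "bcur m' a < 3 + a / 2"
    using assms bcur_dom[of m a] bcur_dom[of m' a] bcur_mono[of a m m'] by auto
  have "real i * tper a (bcur m a) \<le> real i * tper a (bcur m' a)" "tneg a (bcur m a) \<le> tneg a (bcur m' a)"
    using tper_strict_mono[OF assms(4) d] tneg_strict_mono[OF assms(4) d] by (auto intro: mult_left_mono)
  then show ?thesis using d assms(4) ij by (auto simp: ttot_eq)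
qed

text \<open>M is the supremum of the fluxes on the level set, so the point is that this set of
  values is closed downwards. From a point with flux above v the level curve is followed towards
  \<open>m = 7/2\<close>, to a point where a is so large that the flux is below v.\<close>

theorem mixed_type_flux_range:
  assumes \<alpha>: "0 < \<alpha>" "\<alpha> < pi" and i: "0 < i" and j: "0 < j"
    and ij: "i = j \<or> j = Suc i \<or> i = Suc j \<and> \<alpha> \<le> real j * (pi / 2)"
  obtains M where
    "\<And>v. v < M \<Longrightarrow> \<exists>a b. 0 < a \<and> 0 < b \<and> b < 3 + a / 2 \<and> ttot i j a b = \<alpha> \<and> ftot i j a b = v"
    "\<And>a b. 0 < a \<Longrightarrow> 0 < b \<Longrightarrow> b < 3 + a / 2 \<Longrightarrow> ttot i j a b = \<alpha> \<Longrightarrow> ftot i j a b \<le> M"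
proof -
  define h where "h z = ttot i j (snd z) (bcur (fst z) (snd z)) - \<alpha>" for z
  define F where "F z = ftot i j (snd z) (bcur (fst z) (snd z))" for z
  obtain K L where K: "\<And>a b. 0 < a \<Longrightarrow> 0 < b \<Longrightarrow> b < 3 + a / 2 \<Longrightarrow> ttot i j a b = \<alpha> \<Longrightarrow> ftot i j a b \<le> K"
    and L: "\<And>a b v. 0 < a \<Longrightarrow> 0 < b \<Longrightarrow> b < 3 + a / 2 \<Longrightarrow> ttot i j a b = \<alpha> \<Longrightarrow> L v \<le> a \<Longrightarrow> ftot i j a b < v"
    using ftot_bounds[OF \<alpha>(1) i j] by metis
  have ch: "continuous_on curve_dom h"
    unfolding h_def by (intro continuous_intros continuous_on_ttot)
  have cF: "continuous_on curve_dom F"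
    unfolding F_def by (rule continuous_on_ftot)
  have inD: "(m, a) \<in> curve_dom \<longleftrightarrow> 0 < m \<and> m < 7/2 \<and> 0 < a" for m a
    by (auto simp: curve_dom_def)
  \<comment> \<open>Close to \<open>m = 7/2\<close> the length exceeds \<alpha> up to the height A,
    but it drops below \<alpha> eventually; the crossing therefore lies beyond A.\<close>
  have far: "\<exists>m1. m0 < m1 \<and> m1 < 7/2 \<and> (\<exists>a>A. h (m1, a) = 0)" if asm: "m0 < 7/2" "0 < A" for m0 A
  proof -
    obtain m' where m': "0 < m'" "m' < 7/2"
      "\<And>m a. m' < m \<Longrightarrow> m < 7/2 \<Longrightarrow> 0 < a \<Longrightarrow> a \<le> A \<Longrightarrow> \<alpha> < tneg a (bcur m a)"
      using tneg_unbounded[OF asm(2) \<alpha>(1)] by metis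
    define m1 where "m1 = (max m0 m' + 7/2) / 2"
    have m1: "m0 < m1" "m' < m1" "m1 < 7/2" "0 < m1" using asm m' by (auto simp: m1_def)
    have dom: "0 < bcur m1 A" "bcur m1 A < 3 + A / 2" using bcur_dom[OF m1(4,3) asm(2)] by auto
    have "1 * tneg A (bcur m1 A) \<le> real j * tneg A (bcur m1 A)"
      using j tneg_pos[OF asm(2) dom] by (intro mult_right_mono) auto
    moreover have "0 \<le> real i * tpos A (bcur m1 A)" using tpos_pos[OF asm(2) dom] by simp
    ultimately have A: "0 < h (m1, A)"
      using m'(3)[OF m1(2,3) asm(2)] by (simp add: h_def ttot_def)
    obtain a' where a': "a' > A" "h (m1, a') < 0"
      using ttot_curve_eventually_less[OF m1(4,3) \<alpha>(1), of A i j] by (auto simp: h_def)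
    have "continuous_on {A..a'} (\<lambda>a. h (m1, a))"
      by (rule continuous_on_compose2[OF ch]) (use m1 asm in \<open>auto intro!: continuous_intros simp: inD\<close>)
    then obtain a where "A \<le> a" "h (m1, a) = 0"
      using IVT2'[of "\<lambda>a. h (m1, a)" a' 0 A] A a' by auto
    then show ?thesis using A m1 by (intro exI[of _ m1]) (auto simp: order_le_less)
  qed
  define S where "S = {ftot i j a b | a b. 0 < a \<and> 0 < b \<and> b < 3 + a / 2 \<and> ttot i j a b = \<alpha>}"
  have SF: "F (m, a) \<in> S" if "0 < m" "m < 7/2" "0 < a" "h (m, a) = 0" for m a
    unfolding S_def using that bcur_dom[of m a] by (auto simp: F_def h_def)
  have ne: "S \<noteq> {}"
  proof -
    obtain m a where "1 < m" "m < 7/2" "a > 1" "h (m, a) = 0" using far[of 1 1] by auto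
    then have "F (m, a) \<in> S" by (intro SF) auto
    then show ?thesis by auto
  qed
  have bdd: "bdd_above S" unfolding S_def using K by (auto intro!: bdd_aboveI[of _ K])
  have down: "v \<in> S" if y: "y \<in> S" "v < y" for y v
  proof -
    obtain a0 b0 where 0: "0 < a0" "0 < b0" "b0 < 3 + a0 / 2" "ttot i j a0 b0 = \<alpha>" "y = ftot i j a0 b0"
      using y by (auto simp: S_def)
    obtain m0 where m0: "0 < m0" "m0 < 7/2" "bcur m0 a0 = b0" using bcur_exhaust[OF 0(1-3)] .
    have "0 < max 1 (L v)" by (simp add: less_max_iff_disj)
    then obtain m1 a1 where m1: "m0 < m1" "m1 < 7/2" "a1 > max 1 (L v)" "h (m1, a1) = 0"
      using far[OF m0(2)] by metis
    have dom1: "0 < a1" "0 < bcur m1 a1" "bcur m1 a1 < 3 + a1 / 2"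
      using bcur_dom[of m1 a1] m0 m1 by auto
    have "\<exists>m a. m0 < m \<and> m < m1 \<and> (m, a) \<in> curve_dom \<and> h (m, a) = 0 \<and> F (m, a) = v"
    proof (rule level_curve_intermediate_value[OF ch cF, where ?y0.0 = a0 and ?y1.0 = a1])
      fix m a assume ma: "(m, a) \<in> curve_dom"
      show "\<exists>d>0. \<forall>x' y'. \<bar>x' - m\<bar> < d \<and> \<bar>y' - a\<bar> < d \<and> 0 \<le> y' \<longrightarrow> (x', y') \<in> curve_dom"
        using ma by (intro exI[of _ "min (min m (7/2 - m)) a"]) (auto simp: inD abs_if split: if_splits)
      show "\<exists>y'>a. h (m, y') < 0"
        using ttot_curve_eventually_less[OF _ _ \<alpha>(1), of m a i j] ma by (auto simp: h_def inD)
      fix a' assume "h (m, a) \<le> 0" "a < a'"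
      then show "h (m, a') < 0"
        using ttot_curve_crossing[OF _ _ _ _ i j \<alpha>(2) ij, of m a a'] ma by (simp add: h_def inD)
    next
      fix m assume m: "m0 < m" "m < m1"
      then have mm: "0 < m" "m < 7/2" using m0 m1 by auto
      show "\<exists>a. (m, a) \<in> curve_dom \<and> 0 \<le> h (m, a)"
      proof (cases "i = j \<or> j = Suc i")
        case True
        have "\<alpha> \<le> ttot i j a0 (bcur m a0)"
          using ttot_curve_mono[OF m0(1) m(1) mm(2) 0(1) True] 0 m0 by simp
        then show ?thesis using mm 0 by (intro exI[of _ a0]) (simp add: h_def inD)
      next
        case False
        then show ?thesis using ttot_start[OF mm j] ij mm by (auto simp: h_def inD)
      qed
    qed (use 0 m0 m1 y dom1 in \<open>auto simp: inD F_def h_def intro!: L\<close>)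
    then show ?thesis using SF by (auto simp: inD)
  qed
  show ?thesis
  proof (rule that[of "Sup S"])
    fix v assume "v < Sup S"
    then obtain y where "y \<in> S" "v < y" using less_cSup_iff[OF ne bdd] by auto
    then have "v \<in> S" by (rule down)
    then show "\<exists>a b. 0 < a \<and> 0 < b \<and> b < 3 + a / 2 \<and> ttot i j a b = \<alpha> \<and> ftot i j a b = v"
      by (auto simp: S_def)
  next
    fix a b assume "0 < a" "0 < b" "b < 3 + a / 2" "ttot i j a b = \<alpha>"
    then show "ftot i j a b \<le> Sup S" by (intro cSup_upper bdd) (auto simp: S_def)
  qed
qed

section \<open>Profiles of constant sign\<close>

text \<open>The sign of the bump is \<open>e\<close>, its height \<open>a\<close>, and \<open>g = 3 d / (2 a\<^sup>2)\<close> with the energy constant \<open>d\<close>.\<close>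
definition tsing :: "real \<Rightarrow> real \<Rightarrow> real \<Rightarrow> real" where
  "tsing e a g = sqrt (3/2) * bint (e * a) (6 + e * a) g"

definition fsing :: "real \<Rightarrow> real \<Rightarrow> real \<Rightarrow> real" where
  "fsing e a g = sqrt (3/2) * (a * bmom (e * a) (6 + e * a) g)"

lemma sqrt_three_halves_mult: "sqrt (3/2) * (pi / sqrt 6) = pi / 2"
proof -
  have "sqrt (3/2 * 4) = sqrt (3/2) * sqrt 4" by (rule real_sqrt_mult)
  then show ?thesis by simp
qed

lemma bint_linear: "0 < B \<Longrightarrow> bint 0 B 0 = pi / sqrt B"
proof -
  assume "0 < B"
  have "((\<lambda>s. (1 / sqrt B) * (1 / sqrt ((1 - s) * s))) has_integral (1 / sqrt B) * pi) {0<..<1}"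
    by (intro has_integral_mult_right has_integral_inverse_sqrt_arcsine)
  moreover have "1 / sqrt ((1 - s) * quadr 0 B 0 s) = (1 / sqrt B) * (1 / sqrt ((1 - s) * s))" for s
    by (simp add: quadr_def real_sqrt_mult mult_ac)
  ultimately show ?thesis unfolding bint_def by (simp add: integral_unique)
qed

lemma admissible_single_pos: "0 < a \<Longrightarrow> 0 \<le> g \<Longrightarrow> admissible (1 * a) (6 + 1 * a) g"
  by (simp add: admissible_def slope_def)

text \<open>The quadratic exceeds 6 s, which belongs to the linearised equation f'' = c - 4 f with
  half period pi / 2.\<close>

lemma tsing_pos_less_half_pi:
  assumes "0 < a" "0 \<le> g"
  shows "tsing 1 a g < pi / 2"
proof -
  have "bint (1 * a) (6 + 1 * a) g < bint 0 6 0"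
  proof (rule bint_strict_antimono[OF _ admissible_single_pos[OF assms]])
    fix s :: real assume s: "0 < s" "s < 1"
    have "0 < a * s\<^sup>2 + a * s + g" using assms s by (intro add_pos_nonneg add_pos_pos) auto
    then show "quadr 0 6 0 s < quadr (1 * a) (6 + 1 * a) g s" by (simp add: quadr_def algebra_simps)
  qed (simp add: admissible_def slope_def)
  then have "tsing 1 a g < sqrt (3/2) * (pi / sqrt 6)"
    unfolding tsing_def by (intro mult_strict_left_mono) (auto simp: bint_linear)
  then show ?thesis unfolding sqrt_three_halves_mult .
qed

lemma tsing_le:
  assumes "0 \<le> g" "0 < h" "h \<le> slope (e * a) (6 + e * a) g"
  shows "tsing e a g \<le> sqrt (3/2) * pi / sqrt h"
proof -
  have "sqrt (3/2) * bint (e * a) (6 + e * a) g \<le> sqrt (3/2) * (pi / sqrt h)"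
    by (intro mult_left_mono bint_le assms) auto
  then show ?thesis by (simp add: tsing_def)
qed

lemma divide_sqrt_less: "0 < \<alpha> \<Longrightarrow> 0 < c \<Longrightarrow> (c / \<alpha>)\<^sup>2 < h \<Longrightarrow> c / sqrt h < \<alpha>"
proof -
  assume a: "0 < \<alpha>" "0 < c" "(c / \<alpha>)\<^sup>2 < h"
  then have "c / \<alpha> < sqrt h" by (simp add: real_less_rsqrt)
  moreover have "0 < h" using a(3) by (rule le_less_trans[OF zero_le_power2])
  ultimately show ?thesis using a by (simp add: field_simps)
qed

lemma tsing_strict_antimono:
  assumes "admissible (e * a) (6 + e * a) g" "g < g'"
  shows "tsing e a g' < tsing e a g"
  unfolding tsing_def
  by (intro mult_strict_left_mono bint_strict_antimono assms)
     (use assms in \<open>auto simp: admissible_def slope_def quadr_def\<close>)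

lemma tsing_antimono:
  assumes "admissible (e * a) (6 + e * a) g" "g \<le> g'"
  shows "tsing e a g' \<le> tsing e a g"
  using tsing_strict_antimono[OF assms(1), of g'] assms(2) by (cases "g = g'") auto

text \<open>On the level set a flux lies between 0 and 2 a \<alpha>, so small fluxes come from low
  bumps. Low bumps of half length \<alpha> exist because their half length at zero energy tends to
  pi / 2 > \<alpha>, and raising g shortens them.\<close>

theorem positive_type_flux_range:
  assumes \<alpha>: "0 < \<alpha>" "\<alpha> < pi / 2"
  obtains M where "0 < M"
    "\<And>v. 0 < v \<Longrightarrow> v < M \<Longrightarrow> \<exists>a g. 0 < a \<and> 0 < g \<and> tsing 1 a g = \<alpha> \<and> 2 * fsing 1 a g = v"
    "\<And>a g. 0 < a \<Longrightarrow> 0 \<le> g \<Longrightarrow> tsing 1 a g = \<alpha> \<Longrightarrow> 2 * fsing 1 a g \<le> M"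
proof -
  \<comment> \<open>The first coordinate is - a: the level curve lemma expects the larger flux at
    the left end, and low bumps carry small flux.\<close>
  define E :: "(real \<times> real) set" where "E = {..<0} \<times> {0..}"
  have inE: "(x, g) \<in> E \<longleftrightarrow> x < 0 \<and> 0 \<le> g" for x g by (auto simp: E_def)
  define h where "h z = tsing 1 (- fst z) (snd z) - \<alpha>" for z
  define F where "F z = 2 * fsing 1 (- fst z) (snd z)" for z
  define c where "c = sqrt (3/2) * pi"
  have c: "0 < c" by (simp add: c_def)
  have adm: "admissible (1 * a) (6 + 1 * a) g" if "0 < a" "0 \<le> g" for a g
    using that by (rule admissible_single_pos)
  have ch: "continuous_on E h"
    unfolding h_def tsing_def by (intro continuous_intros continuous_on_bint adm) (auto simp: E_def)
  have cF: "continuous_on E F"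
    unfolding F_def fsing_def by (intro continuous_intros continuous_on_bmom adm) (auto simp: E_def)
  have anti_a: "tsing 1 a' 0 < tsing 1 a 0" if "0 < a" "a < a'" for a a'
    unfolding tsing_def using that
    by (intro mult_strict_left_mono bint_strict_antimono adm)
       (auto simp: quadr_def distrib_right intro!: add_strict_mono mult_strict_right_mono)
  have neg: "\<exists>g'>g. h (x, g') < 0" if "x < 0" "0 \<le> g" for x g
  proof -
    define g' where "g' = g + (c / \<alpha>)\<^sup>2 + 1"
    have g': "g < g'" "(c / \<alpha>)\<^sup>2 < g'" using that by (auto simp: g'_def intro: add_nonneg_pos)
    have "tsing 1 (- x) g' \<le> c / sqrt g'"
      unfolding c_def using that g' by (intro tsing_le) (auto simp: slope_def)
    also have "\<dots> < \<alpha>" using \<alpha> c g' by (intro divide_sqrt_less)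
    finally show ?thesis using g' by (auto simp: h_def)
  qed
  have start: "\<exists>a1>0. \<forall>a. 0 < a \<and> a \<le> a1 \<longrightarrow> \<alpha> \<le> tsing 1 a 0"
  proof -
    \<comment> \<open>As the quadratic is at most (6 + 2 a) s, \<open>tsing 1 a 0\<close> is at
      least (pi / 2) / sqrt (1 + a / 3), and at \<open>a1\<close> this bound equals
      \<alpha>.\<close>
    define a1 where "a1 = ((pi / 2 / \<alpha>)\<^sup>2 - 1) * 3"
    have "1 < (pi / 2 / \<alpha>)" using \<alpha> by (simp add: less_divide_eq)
    then have "1 < (pi / 2 / \<alpha>)\<^sup>2" by (simp add: one_less_power)
    then have a1: "0 < a1" by (simp add: a1_def)
    have "\<alpha> \<le> tsing 1 a 0" if a: "0 < a" "a \<le> a1" for a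
    proof -
      have "bint 0 (6 + 2 * a) 0 \<le> bint (1 * a) (6 + 1 * a) 0"
      proof (rule bint_antimono[OF adm])
        fix s :: real assume s: "0 < s" "s < 1"
        have "a * s * s \<le> a * s * 1" using a s by (intro mult_left_mono) auto
        then show "quadr (1 * a) (6 + 1 * a) 0 s \<le> quadr 0 (6 + 2 * a) 0 s"
          by (simp add: quadr_def power2_eq_square algebra_simps)
      qed (use a in \<open>auto simp: admissible_def slope_def\<close>)
      then have "sqrt (3/2) * (pi / sqrt (6 + 2 * a)) \<le> tsing 1 a 0"
        unfolding tsing_def using a by (intro mult_left_mono) (auto simp: bint_linear)
      moreover have "\<alpha> \<le> sqrt (3/2) * (pi / sqrt (6 + 2 * a))"
      proof -
        have "sqrt (6 + 2 * a) \<le> sqrt (6 * (pi / 2 / \<alpha>)\<^sup>2)"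
          using a by (intro real_sqrt_le_mono) (simp add: a1_def)
        also have "\<dots> = sqrt 6 * (pi / 2 / \<alpha>)" using \<alpha> by (simp add: real_sqrt_mult)
        finally have "\<alpha> * sqrt (6 + 2 * a) \<le> \<alpha> * (sqrt 6 * (pi / 2 / \<alpha>))" using \<alpha> by (intro mult_left_mono) auto
        also have "\<dots> = sqrt 6 * (pi / 2)" using \<alpha> by simp
        also have "\<dots> = sqrt (3/2) * pi" unfolding sqrt_three_halves_mult[symmetric] by simp
        finally show ?thesis using a by (simp add: pos_le_divide_eq)
      qed
      ultimately show ?thesis by simp
    qed
    then show ?thesis using a1 by blast
  qed
  then obtain a1 where a1: "0 < a1" "\<And>a. 0 < a \<Longrightarrow> a \<le> a1 \<Longrightarrow> \<alpha> \<le> tsing 1 a 0" by blast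
  have level: "\<exists>g\<ge>0. h (- a, g) = 0" if a: "0 < a" "a \<le> a1" for a
  proof -
    obtain g' where g': "g' > 0" "h (- a, g') < 0" using neg[of "- a" 0] a by auto
    have "continuous_on {0..g'} (\<lambda>g. h (- a, g))"
      by (rule continuous_on_compose2[OF ch]) (use a in \<open>auto intro!: continuous_intros simp: inE\<close>)
    then show ?thesis
      using IVT2'[of "\<lambda>g. h (- a, g)" g' 0 0] g' a1(2)[OF a] by (auto simp: h_def)
  qed
  have Fle: "fsing 1 a g \<le> a * \<alpha>" "0 < fsing 1 a g" if "0 < a" "0 \<le> g" "tsing 1 a g = \<alpha>" for a g
  proof -
    have "sqrt (3/2) * (a * bmom (1 * a) (6 + 1 * a) g) \<le> sqrt (3/2) * (a * bint (1 * a) (6 + 1 * a) g)"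
      using that by (intro mult_left_mono bmom_le_bint adm) auto
    then show "fsing 1 a g \<le> a * \<alpha>" unfolding fsing_def that(3)[symmetric] tsing_def by simp
    show "0 < fsing 1 a g" unfolding fsing_def using that by (intro mult_pos_pos bmom_pos adm) auto
  qed
  define S where "S = {2 * fsing 1 a g | a g. 0 < a \<and> 0 \<le> g \<and> tsing 1 a g = \<alpha>}"
  have bdd: "bdd_above S"
  proof (rule bdd_aboveI[of _ "2 * ((c / \<alpha>)\<^sup>2 * \<alpha>)"])
    fix y assume "y \<in> S"
    then obtain a g where y: "y = 2 * fsing 1 a g" "0 < a" "0 \<le> g" "tsing 1 a g = \<alpha>" by (auto simp: S_def)
    have "a \<le> (c / \<alpha>)\<^sup>2"
    proof (rule ccontr)
      assume "\<not> a \<le> (c / \<alpha>)\<^sup>2"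
      then have "c / sqrt a < \<alpha>" using \<alpha> c by (intro divide_sqrt_less) auto
      moreover have "tsing 1 a g \<le> c / sqrt a"
        unfolding c_def using y by (intro tsing_le) (auto simp: slope_def)
      ultimately show False using y by simp
    qed
    then have "a * \<alpha> \<le> (c / \<alpha>)\<^sup>2 * \<alpha>" using \<alpha> by (intro mult_right_mono) auto
    then show "y \<le> 2 * ((c / \<alpha>)\<^sup>2 * \<alpha>)" using Fle(1)[OF y(2-4)] unfolding y(1) by linarith
  qed
  obtain ga where ga: "0 \<le> ga" "tsing 1 a1 ga = \<alpha>" using level[OF a1(1)] by (auto simp: h_def)
  then have inS: "2 * fsing 1 a1 ga \<in> S" using a1 by (auto simp: S_def)
  show ?thesis
  proof (rule that[of "Sup S"])
    have "2 * fsing 1 a1 ga \<le> Sup S" using inS bdd by (rule cSup_upper)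
    then show "0 < Sup S" using Fle(2)[OF a1(1) ga] by linarith
  next
    fix a g :: real assume "0 < a" "0 \<le> g" "tsing 1 a g = \<alpha>"
    then show "2 * fsing 1 a g \<le> Sup S" by (intro cSup_upper bdd) (auto simp: S_def)
  next
    fix v assume v: "0 < v" "v < Sup S"
    then obtain y where "y \<in> S" "v < y" using inS less_cSup_iff[OF _ bdd] by auto
    then obtain a0 g0 where 0: "v < 2 * fsing 1 a0 g0" "0 < a0" "0 \<le> g0" "tsing 1 a0 g0 = \<alpha>"
      by (auto simp: S_def)
    \<comment> \<open>The last entry bounds the flux at height \<open>a2\<close> by 2 a2 \<alpha> <=
      v / 2.\<close>
    define a2 where "a2 = min a1 (min (a0 / 2) (v / (4 * \<alpha>)))"
    have a2: "0 < a2" "a2 \<le> a1" "a2 < a0" using a1 0 v \<alpha> by (auto simp: a2_def min_def)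
    have "a2 \<le> v / (4 * \<alpha>)" by (simp add: a2_def)
    then have a2v: "4 * (a2 * \<alpha>) \<le> v" using \<alpha> by (simp add: pos_le_divide_eq mult_ac)
    obtain g2 where g2: "0 \<le> g2" "tsing 1 a2 g2 = \<alpha>" using level[OF a2(1,2)] by (auto simp: h_def)
    have "\<exists>x g. - a0 < x \<and> x < - a2 \<and> (x, g) \<in> E \<and> h (x, g) = 0 \<and> F (x, g) = v"
    proof (rule level_curve_intermediate_value[OF ch cF, where ?y0.0 = g0 and ?y1.0 = g2])
      fix x g assume xg: "(x, g) \<in> E"
      show "\<exists>d>0. \<forall>x' y'. \<bar>x' - x\<bar> < d \<and> \<bar>y' - g\<bar> < d \<and> 0 \<le> y' \<longrightarrow> (x', y') \<in> E"
        using xg by (intro exI[of _ "- x"]) (auto simp: inE)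
      show "\<exists>y'>g. h (x, y') < 0" using neg xg by (auto simp: inE)
      fix g' assume "h (x, g) \<le> 0" "g < g'"
      then show "h (x, g') < 0"
        using tsing_strict_antimono[OF adm, of "- x" g g'] xg by (simp add: h_def inE)
    next
      fix x assume x: "- a0 < x" "x < - a2"
      have "\<alpha> \<le> tsing 1 a0 0" using tsing_antimono[OF adm, of a0 0 g0] 0 by simp
      also have "\<dots> < tsing 1 (- x) 0" using x a2 by (intro anti_a) auto
      finally show "\<exists>g. (x, g) \<in> E \<and> 0 \<le> h (x, g)" using x a2 by (intro exI[of _ 0]) (auto simp: inE h_def)
    next
      show "F (- a2, g2) < v" using Fle(1)[OF a2(1) g2] a2v v by (simp add: F_def)
    qed (use 0 a2 g2 in \<open>auto simp: inE h_def F_def\<close>)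
    then obtain x g where xg: "- a0 < x" "x < - a2" "0 \<le> g" "tsing 1 (- x) g = \<alpha>" "2 * fsing 1 (- x) g = v"
      by (auto simp: inE h_def F_def)
    \<comment> \<open>At heights below a0 a bump of zero energy is longer than \<alpha>. The strict
      sign of g is what later allows the profile to be continued past its zeros.\<close>
    have "g \<noteq> 0"
    proof
      assume "g = 0"
      have "\<alpha> \<le> tsing 1 a0 0" using tsing_antimono[OF adm, of a0 0 g0] 0 by simp
      also have "\<dots> < tsing 1 (- x) 0" using xg a2 by (intro anti_a) auto
      finally show False using xg \<open>g = 0\<close> by simp
    qed
    then show "\<exists>a g. 0 < a \<and> 0 < g \<and> tsing 1 a g = \<alpha> \<and> 2 * fsing 1 a g = v"
      using xg a2 by (intro exI[of _ "- x"] exI[of _ g]) auto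
  qed
qed

text \<open>The condition \<open>2 * b - 6 < g\<close> says that the quadratic is positive at s = 1,
  so that the minimum - b is not an equilibrium. Arbitrarily deep bumps fit any angle: as g
  approaches 2 b - 6 they become as long as desired. Their flux tends to minus infinity by
  \<open>bmom_ge\<close>.\<close>

theorem negative_type_flux_range:
  assumes \<alpha>: "0 < \<alpha>"
  obtains M where
    "\<And>v. v < M \<Longrightarrow> \<exists>b g. 0 < b \<and> 0 < g \<and> 2 * b - 6 < g \<and> tsing (-1) b g = \<alpha> \<and> - 2 * fsing (-1) b g = v"
    "\<And>b g. 0 < b \<Longrightarrow> 0 \<le> g \<Longrightarrow> 2 * b - 6 < g \<Longrightarrow> tsing (-1) b g = \<alpha> \<Longrightarrow> - 2 * fsing (-1) b g \<le> M"
proof -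
  define E :: "(real \<times> real) set" where "E = {z. 0 < fst z \<and> 0 \<le> snd z \<and> 2 * fst z - 6 < snd z}"
  have inE: "(b, g) \<in> E \<longleftrightarrow> 0 < b \<and> 0 \<le> g \<and> 2 * b - 6 < g" for b g by (auto simp: E_def)
  define h where "h z = tsing (-1) (fst z) (snd z) - \<alpha>" for z
  define F where "F z = - 2 * fsing (-1) (fst z) (snd z)" for z
  define c where "c = sqrt (3/2) * pi"
  have c: "0 < c" by (simp add: c_def)
  have adm: "admissible (-1 * b) (6 + -1 * b) g" if "0 < b" "0 \<le> g" "2 * b - 6 < g" for b g
    using that by (simp add: admissible_def slope_def)
  have ch: "continuous_on E h"
    unfolding h_def tsing_def by (intro continuous_intros continuous_on_bint adm) (auto simp: E_def)
  have cF: "continuous_on E F"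
    unfolding F_def fsing_def by (intro continuous_intros continuous_on_bmom adm) (auto simp: E_def)
  have mono_b: "tsing (-1) b 0 < tsing (-1) b' 0" if "0 < b" "b < b'" "b' < 3" for b b'
    unfolding tsing_def
  proof (intro mult_strict_left_mono bint_strict_antimono adm)
    fix s :: real assume s: "0 < s" "s < 1"
    have "b * (s\<^sup>2 + s) < b' * (s\<^sup>2 + s)" using that s by (intro mult_strict_right_mono) (auto intro: add_pos_pos)
    then show "quadr (-1 * b') (6 + -1 * b') 0 s < quadr (-1 * b) (6 + -1 * b) 0 s"
      by (simp add: quadr_def algebra_simps)
  qed (use that in auto)
  have neg: "\<exists>g'>g. h (b, g') < 0" if "(b, g) \<in> E" for b g
  proof -
    define g' where "g' = g + 2 * b + (c / \<alpha>)\<^sup>2 + 1"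
    have g': "g < g'" "(c / \<alpha>)\<^sup>2 < 6 - 2 * b + g'"
      using that by (auto simp: g'_def inE add_pos_nonneg add.assoc)
    have "tsing (-1) b g' \<le> c / sqrt (6 - 2 * b + g')"
      unfolding c_def
    proof (rule tsing_le)
      show "0 < 6 - 2 * b + g'" using g'(2) by (rule le_less_trans[OF zero_le_power2])
    qed (use that g' in \<open>auto simp: slope_def inE\<close>)
    also have "\<dots> < \<alpha>" using \<alpha> c g' by (intro divide_sqrt_less)
    finally show ?thesis using g' by (auto simp: h_def)
  qed
  have start: "\<exists>g. (b, g) \<in> E \<and> 0 \<le> h (b, g)" if b: "3 \<le> b" for b
  proof -
    \<comment> \<open>Chosen so that the logarithmic bound ln (1 / \<eta>) / sqrt (3 b) is exactly
      \<alpha>.\<close>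
    define \<eta> where "\<eta> = exp (- (\<alpha> * sqrt (3 * b)))"
    define g where "g = 2 * b - 6 + \<eta>"
    have \<eta>: "0 < \<eta>" by (simp add: \<eta>_def)
    have g: "(b, g) \<in> E" using b \<eta> by (auto simp: inE g_def)
    have "ln (1 / \<eta>) / sqrt (3 * b) \<le> bint (-1 * b) (6 + -1 * b) g"
    proof (rule bint_ge_log)
      show "admissible (-1 * b) (6 + -1 * b) g" using g by (intro adm) (auto simp: inE)
      fix s :: real assume s: "0 < s" "s < 1"
      have "quadr (-1 * b) (6 + -1 * b) g s = (b * s + 2 * b - 6) * (1 - s) + \<eta>"
        by (simp add: quadr_def g_def power2_eq_square algebra_simps)
      also have "\<dots> \<le> (3 * b) * (1 - s) + (3 * b) * \<eta>"
      proof (intro add_mono mult_right_mono)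
        have "b * s \<le> b" using s b by (simp add: mult_left_le)
        then show "b * s + 2 * b - 6 \<le> 3 * b" by simp
        show "\<eta> \<le> 3 * b * \<eta>" using b \<eta> by simp
      qed (use s in auto)
      finally show "quadr (-1 * b) (6 + -1 * b) g s \<le> 3 * b * (1 - s + \<eta>)" by (simp add: distrib_left)
    qed (use \<eta> b in auto)
    moreover have "ln (1 / \<eta>) / sqrt (3 * b) = \<alpha>" using b by (simp add: \<eta>_def ln_div)
    moreover have "bint (-1 * b) (6 + -1 * b) g \<le> tsing (-1) b g"
      unfolding tsing_def using bint_pos[OF adm, of b g] g
        mult_right_mono[of 1 "sqrt (3/2)" "bint (-1 * b) (6 + -1 * b) g"] by (simp add: inE)
    ultimately show ?thesis using g by (intro exI[of _ g]) (simp add: h_def)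
  qed
  have level: "\<exists>g. (b, g) \<in> E \<and> h (b, g) = 0" if b: "3 \<le> b" for b
  proof -
    obtain g where g: "(b, g) \<in> E" "0 \<le> h (b, g)" using start[OF b] by blast
    obtain g' where g': "g' > g" "h (b, g') < 0" using neg[OF g(1)] by auto
    have "continuous_on {g..g'} (\<lambda>g. h (b, g))"
      by (rule continuous_on_compose2[OF ch]) (use g in \<open>auto intro!: continuous_intros simp: inE\<close>)
    then obtain z where "g \<le> z" "h (b, z) = 0"
      using IVT2'[of "\<lambda>g. h (b, g)" g' 0 g] g g' by auto
    then show ?thesis using g by (intro exI[of _ z]) (auto simp: inE)
  qed
  have Fle: "F (b, g) \<le> - (2/3 * \<alpha> * b)" "F (b, g) < 0" if "(b, g) \<in> E" "h (b, g) = 0" for b g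
  proof -
    have a: "admissible (-1 * b) (6 + -1 * b) g" using that by (intro adm) (auto simp: inE)
    have "sqrt (3/2) * (b * (bint (-1 * b) (6 + -1 * b) g / 3)) \<le> sqrt (3/2) * (b * bmom (-1 * b) (6 + -1 * b) g)"
      using that by (intro mult_left_mono bmom_ge a) (auto simp: inE)
    moreover have "sqrt (3/2) * bint (-1 * b) (6 + -1 * b) g = \<alpha>" using that by (simp add: h_def tsing_def)
    ultimately have "b * \<alpha> / 3 \<le> fsing (-1) b g" unfolding fsing_def by (metis mult.left_commute times_divide_eq_right)
    then show "F (b, g) \<le> - (2/3 * \<alpha> * b)" by (simp add: F_def field_simps)
    moreover have "0 < \<alpha> * b" using \<alpha> that by (simp add: inE)
    ultimately show "F (b, g) < 0" by linarith
  qed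
  define S where "S = {F (b, g) | b g. (b, g) \<in> E \<and> h (b, g) = 0}"
  have ne: "S \<noteq> {}" using level[of 3] by (auto simp: S_def)
  have bdd: "bdd_above S" using Fle(2) by (auto simp: S_def intro!: bdd_aboveI[of _ 0] less_imp_le)
  show ?thesis
  proof (rule that[of "Sup S"])
    fix b g :: real assume "0 < b" "0 \<le> g" "2 * b - 6 < g" "tsing (-1) b g = \<alpha>"
    then have "(b, g) \<in> E" "h (b, g) = 0" by (auto simp: inE h_def)
    then have "F (b, g) \<in> S" unfolding S_def by blast
    then have "F (b, g) \<le> Sup S" using bdd by (rule cSup_upper)
    then show "- 2 * fsing (-1) b g \<le> Sup S" by (simp add: F_def)
  next
    fix v assume v: "v < Sup S"
    then obtain y where "y \<in> S" "v < y" using less_cSup_iff[OF ne bdd] by auto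
    then obtain b0 g0 where 0: "v < F (b0, g0)" "(b0, g0) \<in> E" "h (b0, g0) = 0"
      by (auto simp: S_def)
    \<comment> \<open>Deep enough for - (2/3) \<alpha> b2 < v, also when v = 0.\<close>
    define b2 where "b2 = max 3 (b0 + 1) + \<bar>v\<bar> * (3 / \<alpha>)"
    have vpos: "0 \<le> \<bar>v\<bar> * (3 / \<alpha>)" using \<alpha> by simp
    then have b2: "3 \<le> b2" "b0 < b2" by (auto simp: b2_def)
    have "\<alpha> * (\<bar>v\<bar> * (3 / \<alpha>)) \<le> \<alpha> * b2" using \<alpha> b2 by (intro mult_left_mono) (auto simp: b2_def)
    then have "3 * \<bar>v\<bar> \<le> \<alpha> * b2" using \<alpha> by simp
    moreover have "0 < \<alpha> * b2" using \<alpha> b2 by simp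
    ultimately have b2v: "- (2/3 * \<alpha> * b2) < v" by (simp add: abs_if split: if_splits)
    obtain g2 where g2: "(b2, g2) \<in> E" "h (b2, g2) = 0" using level[OF b2(1)] by auto
    \<comment> \<open>For x < 3 the value g = 0 is allowed and is a starting point on the vertical
      line where the length exceeds \<alpha>. From x = 3 on, \<open>start\<close> provides
      one.\<close>
    have le0: "\<alpha> < tsing (-1) x 0" if "b0 < x" "x < 3" for x
    proof -
      have "\<alpha> = tsing (-1) b0 g0" using 0 by (simp add: h_def)
      also have "\<dots> \<le> tsing (-1) b0 0" using that 0 by (intro tsing_antimono adm) (auto simp: inE)
      also have "\<dots> < tsing (-1) x 0" using that 0 by (intro mono_b) (auto simp: inE)
      finally show ?thesis .
    qed
    have "\<exists>x g. b0 < x \<and> x < b2 \<and> (x, g) \<in> E \<and> h (x, g) = 0 \<and> F (x, g) = v"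
    proof (rule level_curve_intermediate_value[OF ch cF, where ?y0.0 = g0 and ?y1.0 = g2])
      fix x g assume xg: "(x, g) \<in> E"
      show "\<exists>d>0. \<forall>x' y'. \<bar>x' - x\<bar> < d \<and> \<bar>y' - g\<bar> < d \<and> 0 \<le> y' \<longrightarrow> (x', y') \<in> E"
        \<comment> \<open>Shifting both coordinates by less than d changes g - 2 x by less than 3
          d.\<close>
        using xg by (intro exI[of _ "min x ((g - 2 * x + 6) / 3)"]) (auto simp: inE abs_if split: if_splits)
      show "\<exists>y'>g. h (x, y') < 0" using neg xg by auto
      fix g' assume "h (x, g) \<le> 0" "g < g'"
      then show "h (x, g') < 0"
        using tsing_strict_antimono[OF adm, of x g g'] xg by (simp add: h_def inE)
    next
      fix x assume x: "b0 < x" "x < b2"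
      show "\<exists>g. (x, g) \<in> E \<and> 0 \<le> h (x, g)"
      proof (cases "x < 3")
        case True
        then show ?thesis using le0[of x] x 0 by (intro exI[of _ 0]) (auto simp: inE h_def)
      qed (use start in auto)
    next
      show "F (b2, g2) < v" using Fle(1)[OF g2] b2v by simp
    qed (use 0 b2 g2 in \<open>auto simp: inE\<close>)
    then obtain x g where xg: "b0 < x" "(x, g) \<in> E" "h (x, g) = 0" "F (x, g) = v" by auto
    have "g \<noteq> 0" using le0[of x] xg by (auto simp: inE h_def)
    then show "\<exists>b g. 0 < b \<and> 0 < g \<and> 2 * b - 6 < g \<and> tsing (-1) b g = \<alpha> \<and> - 2 * fsing (-1) b g = v"
      using xg by (intro exI[of _ x] exI[of _ g]) (auto simp: inE h_def F_def)
  qed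
qed

section \<open>Decomposition of a profile into bumps\<close>

text \<open>Gronwall's argument: on a compact interval k is bounded by some K, and w^2 + w1^2 times
  exp (- (1 + K) x) cannot increase.\<close>

lemma linear_ode_zero_right:
  fixes w w1 k :: "real \<Rightarrow> real"
  assumes w: "\<And>t. t \<in> {l<..<r} \<Longrightarrow> (w has_real_derivative w1 t) (at t)"
    and w1: "\<And>t. t \<in> {l<..<r} \<Longrightarrow> (w1 has_real_derivative k t * w t) (at t)"
    and k: "continuous_on {l<..<r} k" and t0: "t0 \<in> {l<..<r}" "w t0 = 0" "w1 t0 = 0"
    and t: "t0 \<le> t" "t < r"
  shows "w t = 0"
proof -
  have "compact (k ` {t0..t})"
    using t t0 by (intro compact_continuous_image continuous_on_subset[OF k]) auto
  then have "\<exists>K. \<forall>x\<in>{t0..t}. \<bar>k x\<bar> \<le> K"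
    by (auto dest!: compact_imp_bounded simp: bounded_iff)
  then obtain K where K: "\<And>x. x \<in> {t0..t} \<Longrightarrow> \<bar>k x\<bar> \<le> K" by blast
  define E where "E x = ((w x)\<^sup>2 + (w1 x)\<^sup>2) * exp (- (1 + K) * x)" for x
  have "E t \<le> E t0"
  proof (rule DERIV_nonpos_imp_nonincreasing[OF t(1)])
    fix x assume x: "t0 \<le> x" "x \<le> t"
    then have xi: "x \<in> {l<..<r}" using t t0 by auto
    let ?D = "(2 * w x * w1 x + 2 * w1 x * (k x * w x)) * exp (- (1 + K) * x)
        + ((w x)\<^sup>2 + (w1 x)\<^sup>2) * (exp (- (1 + K) * x) * (- (1 + K)))"
    have "(E has_real_derivative ?D) (at x)"
      unfolding E_def by (rule derivative_eq_intros w[OF xi] w1[OF xi] refl | simp)+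
    moreover have "?D \<le> 0"
    proof -
      have "2 * \<bar>w x * w1 x\<bar> \<le> (w x)\<^sup>2 + (w1 x)\<^sup>2"
        using sum_squares_bound[of "\<bar>w x\<bar>" "\<bar>w1 x\<bar>"] by (simp add: abs_mult)
      moreover have "\<bar>1 + k x\<bar> \<le> 1 + K" using K[of x] x by auto
      ultimately have "(2 * \<bar>w x * w1 x\<bar>) * \<bar>1 + k x\<bar> \<le> ((w x)\<^sup>2 + (w1 x)\<^sup>2) * (1 + K)"
        by (intro mult_mono) auto
      moreover have "2 * w x * w1 x + 2 * w1 x * (k x * w x) \<le> (2 * \<bar>w x * w1 x\<bar>) * \<bar>1 + k x\<bar>"
      proof -
        have "2 * w x * w1 x + 2 * w1 x * (k x * w x) = (2 * (w x * w1 x)) * (1 + k x)"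
          by (simp add: algebra_simps)
        also have "\<dots> \<le> \<bar>(2 * (w x * w1 x)) * (1 + k x)\<bar>" by (rule abs_ge_self)
        also have "\<dots> = (2 * \<bar>w x * w1 x\<bar>) * \<bar>1 + k x\<bar>" by (simp only: abs_mult abs_numeral)
        finally show ?thesis .
      qed
      ultimately have "2 * w x * w1 x + 2 * w1 x * (k x * w x) - ((w x)\<^sup>2 + (w1 x)\<^sup>2) * (1 + K) \<le> 0"
        by linarith
      then have "(2 * w x * w1 x + 2 * w1 x * (k x * w x) - ((w x)\<^sup>2 + (w1 x)\<^sup>2) * (1 + K)) * exp (- (1 + K) * x) \<le> 0"
        by (intro mult_nonpos_nonneg) auto
      then show ?thesis by (simp add: algebra_simps)
    qed
    ultimately show "\<exists>y. (E has_real_derivative y) (at x) \<and> y \<le> 0" by blast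
  qed
  also have "E t0 = 0" using t0 by (simp add: E_def)
  finally have "(w t)\<^sup>2 + (w1 t)\<^sup>2 \<le> 0" by (simp add: E_def mult_le_0_iff)
  then show ?thesis using sum_power2_le_zero_iff by blast
qed

lemma DERIV_reflect:
  fixes f :: "real \<Rightarrow> real"
  shows "(f has_real_derivative D) (at (- t)) \<Longrightarrow> ((\<lambda>t. f (- t)) has_real_derivative - D) (at t)"
  by (simp add: DERIV_mirror)

lemma linear_ode_zero:
  fixes w w1 k :: "real \<Rightarrow> real"
  assumes w: "\<And>t. t \<in> {l<..<r} \<Longrightarrow> (w has_real_derivative w1 t) (at t)"
    and w1: "\<And>t. t \<in> {l<..<r} \<Longrightarrow> (w1 has_real_derivative k t * w t) (at t)"
    and k: "continuous_on {l<..<r} k" and t0: "t0 \<in> {l<..<r}" "w t0 = 0" "w1 t0 = 0"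
    and t: "t \<in> {l<..<r}"
  shows "w t = 0"
proof (cases "t0 \<le> t")
  case True
  then show ?thesis using linear_ode_zero_right[OF w w1 k t0] t by auto
next
  case False
  have "w (- (- t)) = 0"
  proof (rule linear_ode_zero_right[where w = "\<lambda>t. w (- t)" and ?w1.0 = "\<lambda>t. - w1 (- t)"
        and k = "\<lambda>t. k (- t)" and l = "- r" and r = "- l" and ?t0.0 = "- t0" and t = "- t"])
    fix t assume "t \<in> {- r<..<- l}"
    then have t: "- t \<in> {l<..<r}" by auto
    show "((\<lambda>t. w (- t)) has_real_derivative - w1 (- t)) (at t)"
      using w[OF t] by (rule DERIV_reflect)
    show "((\<lambda>t. - w1 (- t)) has_real_derivative k (- t) * w (- t)) (at t)"
      using DERIV_minus[OF DERIV_reflect[OF w1[OF t]]] by simp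
  next
    show "continuous_on {- r<..<- l} (\<lambda>t. k (- t))"
      by (rule continuous_on_compose2[OF k]) (auto intro!: continuous_intros)
  qed (use t0 t False in auto)
  then show ?thesis by simp
qed

text \<open>The difference f - f t0 solves a linear equation with continuous coefficient, since the
  difference of the right-hand sides contains it as a factor. The sign e makes the lemma applicable
  to - f, with - c in place of c.\<close>

lemma ode_equilibrium:
  fixes f f1 :: "real \<Rightarrow> real"
  assumes f: "\<And>t. t \<in> {l<..<r} \<Longrightarrow> (f has_real_derivative f1 t) (at t)"
    and f1: "\<And>t. t \<in> {l<..<r} \<Longrightarrow> (f1 has_real_derivative c - 4 * f t - e * (f t)\<^sup>2) (at t)"
    and t0: "t0 \<in> {l<..<r}" "f1 t0 = 0" "c - 4 * f t0 - e * (f t0)\<^sup>2 = 0" and t: "t \<in> {l<..<r}"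
  shows "f t = f t0"
proof -
  have "f t - f t0 = 0"
  proof (rule linear_ode_zero[where w = "\<lambda>t. f t - f t0" and ?w1.0 = f1 and k = "\<lambda>t. - (4 + e * (f t + f t0))" and l = l and r = r])
    fix t assume t: "t \<in> {l<..<r}"
    show "((\<lambda>t. f t - f t0) has_real_derivative f1 t) (at t)"
      using DERIV_diff[OF f[OF t] DERIV_const, of "f t0"] by simp
    have "c - 4 * f t - e * (f t)\<^sup>2 = c - 4 * f t - e * (f t)\<^sup>2 - (c - 4 * f t0 - e * (f t0)\<^sup>2)"
      using t0 by simp
    also have "\<dots> = - (4 + e * (f t + f t0)) * (f t - f t0)"
      by (simp add: power2_eq_square algebra_simps)
    finally show "(f1 has_real_derivative - (4 + e * (f t + f t0)) * (f t - f t0)) (at t)"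
      using f1[OF t] by simp
  next
    have "continuous_on {l<..<r} f"
      using f by (meson DERIV_isCont continuous_at_imp_continuous_on)
    then show "continuous_on {l<..<r} (\<lambda>t. - (4 + e * (f t + f t0)))"
      by (intro continuous_intros)
  qed (use t0 t in auto)
  then show ?thesis by simp
qed

text \<open>Substitution s = f t / a on the descending side: \<open>J\<close> is a primitive of the
  weighted kernel, and J (f t / a) has derivative - sqrt (2/3) v (f t / a). The weight 1 yields the
  length and the weight s the integral of f / a. Derivatives are taken in the interior only, so the
  vanishing speed at the maximum does no harm.\<close>

lemma half_bump_integral:
  fixes f v :: "real \<Rightarrow> real"
  assumes "t0 < r" "0 < a" and adm: "admissible A B C"
    and cf: "continuous_on {t0..r} f" and f0: "f t0 = a" "f r = 0"
    and pos: "\<And>t. t \<in> {t0<..<r} \<Longrightarrow> 0 < f t \<and> f t < a"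
    and der: "\<And>t. t \<in> {t0<..<r} \<Longrightarrow>
      (f has_real_derivative - (a * sqrt (2/3 * ((1 - f t / a) * quadr A B C (f t / a))))) (at t)"
    and v: "continuous_on {0<..<1} v"
    and int: "(\<lambda>s. v s / sqrt ((1 - s) * quadr A B C s)) integrable_on {0<..<1}"
  shows "((\<lambda>t. v (f t / a)) has_integral
    sqrt (3/2) * integral {0<..<1} (\<lambda>s. v s / sqrt ((1 - s) * quadr A B C s))) {t0..r}"
proof -
  define k where "k s = v s / sqrt ((1 - s) * quadr A B C s)" for s
  define J where "J u = integral {0..u} k" for u
  have ki: "k integrable_on {0..1}" using int unfolding k_def by (simp add: integrable_on_Icc_iff_Ioo)
  have cJ: "continuous_on {0..1} J" unfolding J_def by (rule indefinite_integral_continuous_1[OF ki])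
  have "continuous_on {0<..<1} k"
    unfolding k_def using quadr_pos[OF adm]
    by (intro continuous_intros v) (auto simp: less_imp_neq[symmetric])
  then have ck: "isCont k s" if "s \<in> {0<..<1}" for s
    using that by (simp add: continuous_on_eq_continuous_at)
  have dJ: "(J has_real_derivative k s) (at s)" if s: "s \<in> {0<..<1}" for s
  proof -
    have "(J has_vector_derivative k s) (at s within {0..1} - {})"
      unfolding J_def using s ck[OF s]
      by (intro integral_has_vector_derivative_continuous_at ki) (auto intro: continuous_at_imp_continuous_at_within)
    moreover have "at s within {0..1} = at s" using s by (intro at_within_interior) auto
    ultimately show ?thesis by (simp add: has_real_derivative_iff_has_vector_derivative)
  qed
  have "((\<lambda>t. sqrt (2/3) * v (f t / a)) has_integral (- J (f r / a) - - J (f t0 / a))) {t0..r}"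
  proof (rule fundamental_theorem_of_calculus_interior)
    have rng: "f t / a \<in> {0..1}" if "t \<in> {t0..r}" for t
    proof -
      consider "t = t0" | "t = r" | "t \<in> {t0<..<r}" using \<open>t \<in> {t0..r}\<close> by force
      then show ?thesis using pos[of t] f0 \<open>0 < a\<close> by cases auto
    qed
    show "continuous_on {t0..r} (\<lambda>t. - J (f t / a))"
      using \<open>0 < a\<close> rng
      by (intro continuous_intros continuous_on_compose2[OF cJ] cf) auto
  next
    fix t assume t: "t \<in> {t0<..<r}"
    define s where "s = f t / a"
    have s: "s \<in> {0<..<1}" using pos[OF t] \<open>0 < a\<close> by (auto simp: s_def)
    have q: "0 < (1 - s) * quadr A B C s" using quadr_pos[OF adm, of s] s by auto
    let ?f' = "- (a * sqrt (2/3 * ((1 - s) * quadr A B C s)))"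
    have "((\<lambda>t. f t / a) has_real_derivative ?f' / a) (at t)"
      using DERIV_cdivide[OF der[OF t]] unfolding s_def .
    with dJ[OF s] have "((\<lambda>t. J (f t / a)) has_real_derivative k s * (?f' / a)) (at t)"
      unfolding s_def by (rule DERIV_chain2)
    then have "((\<lambda>t. - J (f t / a)) has_real_derivative - (k s * (?f' / a))) (at t)"
      by (rule DERIV_minus)
    moreover have "- (k s * (?f' / a)) = sqrt (2/3) * v s"
    proof -
      have "?f' / a = - (sqrt (2/3) * sqrt ((1 - s) * quadr A B C s))"
        unfolding real_sqrt_mult[of "2/3"] using \<open>0 < a\<close> by simp
      then have "k s * (?f' / a) = - (sqrt (2/3) * (k s * sqrt ((1 - s) * quadr A B C s)))" by simp
      also have "k s * sqrt ((1 - s) * quadr A B C s) = v s"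
      proof -
        have "sqrt ((1 - s) * quadr A B C s) \<noteq> 0"
          using real_sqrt_gt_zero[OF q] by (rule less_imp_neq[symmetric])
        then show ?thesis unfolding k_def using nonzero_eq_divide_eq[THEN iffD1, OF _ refl] by blast
      qed
      finally show ?thesis by simp
    qed
    ultimately show "((\<lambda>t. - J (f t / a)) has_vector_derivative sqrt (2/3) * v (f t / a)) (at t)"
      by (simp add: has_real_derivative_iff_has_vector_derivative s_def)
  qed (use \<open>t0 < r\<close> in simp)
  then have "((\<lambda>t. sqrt (2/3) * v (f t / a)) has_integral J 1) {t0..r}"
    using f0 \<open>0 < a\<close> by (simp add: J_def)
  from has_integral_mult_right[OF this, of "sqrt (3/2)"]
  have "((\<lambda>t. (sqrt (3/2) * sqrt (2/3)) * v (f t / a)) has_integral sqrt (3/2) * J 1) {t0..r}"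
    by (simp only: mult.assoc)
  moreover have "sqrt (3/2) * sqrt (2/3) = 1" by (simp flip: real_sqrt_mult)
  moreover have "J 1 = integral {0<..<1} (\<lambda>s. v s / sqrt ((1 - s) * quadr A B C s))"
    unfolding J_def k_def by (simp add: integral_open_interval_real)
  ultimately show ?thesis by simp
qed

text \<open>The right-hand side of the first integral for e f, with e = 1 or e = -1. Here
  \<open>c\<close> stands for e times the constant in the equation of f.\<close>

definition energy_poly :: "real \<Rightarrow> real \<Rightarrow> real \<Rightarrow> real \<Rightarrow> real" where
  "energy_poly e c d y = d + 2 * c * y - 4 * y\<^sup>2 - 2/3 * e * y ^ 3"

lemma energy_poly_factor:
  assumes "a \<noteq> 0" "energy_poly e c d a = 0"
  shows "energy_poly e c d y =
    2/3 * a\<^sup>2 * ((1 - y / a) * quadr (e * a) (6 + e * a) (3 * d / (2 * a\<^sup>2)) (y / a))"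
proof -
  define s where "s = y / a"
  have y: "y = a * s" using assms by (simp add: s_def)
  have d: "d = 4 * a\<^sup>2 + 2/3 * e * a ^ 3 - 2 * c * a" using assms(2) by (simp add: energy_poly_def)
  define g where "g = 3 * d / (2 * a\<^sup>2)"
  have g: "2/3 * a\<^sup>2 * g = d" using assms(1) by (simp add: g_def)
  have "X * ((1 - s) * quadr (e * a) (6 + e * a) g s)
    = (1 - s) * (X * (e * a * s\<^sup>2 + (6 + e * a) * s) + X * g)" for X
    by (simp add: quadr_def algebra_simps)
  from this[of "2/3 * a\<^sup>2"]
  have "2/3 * a\<^sup>2 * ((1 - s) * quadr (e * a) (6 + e * a) g s)
    = (1 - s) * (2/3 * a\<^sup>2 * (e * a * s\<^sup>2 + (6 + e * a) * s) + 2/3 * a\<^sup>2 * g)" .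
  also have "\<dots> = energy_poly e c d (a * s)"
    unfolding energy_poly_def g unfolding d by (simp add: power2_eq_square power3_eq_cube field_simps)
  finally show ?thesis unfolding g_def y[symmetric] unfolding s_def by (rule sym)
qed

text \<open>After the maximum f1 cannot vanish: a zero of f1 at a value in (0, a) would be a root of
  the energy polynomial there. So f descends strictly and satisfies the first-order equation that
  \<open>half_bump_integral\<close> requires.\<close>

lemma bump_right_half:
  fixes f f1 :: "real \<Rightarrow> real"
  assumes f: "\<And>t. t \<in> {l<..<r} \<Longrightarrow> (f has_real_derivative f1 t) (at t)"
    and f1: "\<And>t. t \<in> {l<..<r} \<Longrightarrow> (f1 has_real_derivative c - 4 * f t - e * (f t)\<^sup>2) (at t)"
    and en: "\<And>t. t \<in> {l<..<r} \<Longrightarrow> (f1 t)\<^sup>2 = energy_poly e c d (f t)"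
    and t0: "t0 \<in> {l<..<r}" "f t0 = a" "f1 t0 = 0" and "0 < a"
    and max: "\<And>t. t \<in> {l<..<r} \<Longrightarrow> 0 < f t \<and> f t \<le> a"
    and conc: "c - 4 * a - e * a\<^sup>2 < 0"
    and Q: "\<And>y. 0 < y \<Longrightarrow> y < a \<Longrightarrow> 0 < energy_poly e c d y" "energy_poly e c d a = 0"
    and adm: "admissible (e * a) (6 + e * a) (3 * d / (2 * a\<^sup>2))"
    and cf: "continuous_on {t0..r} f" and fr: "f r = 0"
  shows "r - t0 = tsing e a (3 * d / (2 * a\<^sup>2))"
    "(f has_integral fsing e a (3 * d / (2 * a\<^sup>2))) {t0..r}"
proof -
  have lr: "t0 < r" "l < t0" using t0 by auto
  obtain h where h: "h > 0" "\<And>x. 0 < x \<Longrightarrow> x < h \<Longrightarrow> f1 (t0 + x) < 0"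
  proof -
    have "\<exists>d>0. \<forall>h>0. h < d \<longrightarrow> f1 t0 > f1 (t0 + h)"
      using DERIV_neg_dec_right[OF f1[OF t0(1)]] conc t0(2) by simp
    then show thesis using that t0(3) by auto
  qed
  have dec: "f t < a" if t: "t \<in> {t0<..<r}" "t < t0 + h" for t
  proof -
    have "f t < f t0"
    proof (rule DERIV_neg_imp_decreasing_open[where a = t0 and b = t])
      fix x assume x: "t0 < x" "x < t"
      show "\<exists>y. (f has_real_derivative y) (at x) \<and> y < 0"
        using f[of x] h(2)[of "x - t0"] x t lr by (intro exI[of _ "f1 x"]) auto
    qed (use t lr in \<open>auto intro: continuous_on_subset[OF cf]\<close>)
    then show ?thesis using t0 by simp
  qed
  \<comment> \<open>A return to the height a would leave a minimum in between, with f1 = 0 at a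
    value strictly between 0 and a.\<close>
  have lt: "f t < a" if t: "t \<in> {t0<..<r}" for t
  proof (rule ccontr)
    assume "\<not> f t < a"
    define t' where "t' = (min t (t0 + h) + t0) / 2"
    have t': "t0 < t'" "t' < t" "t' < t0 + h" using t h by (auto simp: t'_def min_def field_simps)
    have "f t' < a" using dec[of t'] t' t by auto
    have "\<exists>m\<in>{t0..t}. \<forall>y\<in>{t0..t}. f m \<le> f y"
      using t by (intro continuous_attains_inf continuous_on_subset[OF cf]) auto
    then obtain m where m: "m \<in> {t0..t}" "\<And>y. y \<in> {t0..t} \<Longrightarrow> f m \<le> f y" by blast
    have "f m < a" using m(2)[of t'] t' \<open>f t' < a\<close> by auto
    then have mi: "t0 < m" "m < t" using m(1) t0 \<open>\<not> f t < a\<close> by (auto simp: order_le_less)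
    have ml: "m \<in> {l<..<r}" using mi t lr by auto
    have "f1 m = 0"
    proof (rule DERIV_local_min[OF f[OF ml]])
      show "0 < min (m - t0) (t - m)" using mi by simp
      show "\<forall>y. \<bar>m - y\<bar> < min (m - t0) (t - m) \<longrightarrow> f m \<le> f y"
        using m(2) by (auto simp: abs_if split: if_splits)
    qed
    then show False using en[OF ml] Q(1)[of "f m"] max[OF ml] \<open>f m < a\<close> by auto
  qed
  have neg: "f1 t < 0" if t: "t \<in> {t0<..<r}" for t
  proof (rule ccontr)
    assume n: "\<not> f1 t < 0"
    define t' where "t' = (min t (t0 + h) + t0) / 2"
    have t': "t0 < t'" "t' < t" "t' < t0 + h" using t h by (auto simp: t'_def min_def field_simps)
    have "f1 t' < 0" using h(2)[of "t' - t0"] t' by auto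
    moreover have "continuous_on {t'..t} f1"
      using t t' lr by (intro continuous_at_imp_continuous_on ballI DERIV_isCont[OF f1]) auto
    ultimately obtain x where x: "t' \<le> x" "x \<le> t" "f1 x = 0"
      using IVT'[of f1 t' 0 t] n t' by auto
    then have xi: "x \<in> {t0<..<r}" using t' t by auto
    then show False using en[of x] Q(1)[of "f x"] max[of x] lt[OF xi] x lr by auto
  qed
  have der: "(f has_real_derivative - (a * sqrt (2/3 * ((1 - f t / a) * quadr (e * a) (6 + e * a) (3 * d / (2 * a\<^sup>2)) (f t / a))))) (at t)"
    if t: "t \<in> {t0<..<r}" for t
  proof -
    have ti: "t \<in> {l<..<r}" using t lr by auto
    have "energy_poly e c d (f t) = a\<^sup>2 * (2/3 * ((1 - f t / a) * quadr (e * a) (6 + e * a) (3 * d / (2 * a\<^sup>2)) (f t / a)))"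
      using \<open>0 < a\<close> Q(2) by (subst energy_poly_factor[of a]) auto
    then have "sqrt ((f1 t)\<^sup>2) = a * sqrt (2/3 * ((1 - f t / a) * quadr (e * a) (6 + e * a) (3 * d / (2 * a\<^sup>2)) (f t / a)))"
      unfolding en[OF ti] using \<open>0 < a\<close> by (simp only: real_sqrt_mult real_sqrt_abs abs_of_pos)
    then have "- (a * sqrt (2/3 * ((1 - f t / a) * quadr (e * a) (6 + e * a) (3 * d / (2 * a\<^sup>2)) (f t / a)))) = f1 t"
      using neg[OF t] by simp
    then show ?thesis using f[OF ti] by (simp only:)
  qed
  have pos: "0 < f t \<and> f t < a" if "t \<in> {t0<..<r}" for t
    using that lt max[of t] lr by auto
  note hb = half_bump_integral[OF lr(1) \<open>0 < a\<close> adm cf t0(2) fr pos der]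
  have "((\<lambda>t. 1) has_integral tsing e a (3 * d / (2 * a\<^sup>2))) {t0..r}"
    unfolding tsing_def bint_def by (rule hb[where v = "\<lambda>_. 1"]) (auto intro!: kernel_integrable adm)
  moreover have "((\<lambda>t. 1) has_integral (r - t0)) {t0..r}"
    using has_integral_const_real[of "1::real" t0 r] lr by simp
  ultimately show "r - t0 = tsing e a (3 * d / (2 * a\<^sup>2))" by (rule has_integral_unique[symmetric])
  have "((\<lambda>t. f t / a) has_integral sqrt (3/2) * bmom (e * a) (6 + e * a) (3 * d / (2 * a\<^sup>2))) {t0..r}"
    unfolding bmom_def by (rule hb[where v = "\<lambda>s. s"]) (auto intro!: moment_kernel_integrable adm continuous_intros)
  from has_integral_mult_right[OF this, of a]
  show "(f has_integral fsing e a (3 * d / (2 * a\<^sup>2))) {t0..r}"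
    using \<open>0 < a\<close> by (simp add: fsing_def mult_ac)
qed

text \<open>The height is the first positive root of the energy polynomial, hence determined by e, c
  and d; this later forces equal heights of all bumps of one sign. The left half is the right half
  of the reflected function.\<close>

lemma bump:
  fixes f f1 :: "real \<Rightarrow> real"
  assumes e: "e = 1 \<or> e = -1" and lr: "l < r"
    and cf: "continuous_on {l..r} f" and fl: "f l = 0" and fr: "f r = 0"
    and pos: "\<And>t. t \<in> {l<..<r} \<Longrightarrow> 0 < f t"
    and f: "\<And>t. t \<in> {l<..<r} \<Longrightarrow> (f has_real_derivative f1 t) (at t)"
    and f1: "\<And>t. t \<in> {l<..<r} \<Longrightarrow> (f1 has_real_derivative c - 4 * f t - e * (f t)\<^sup>2) (at t)"
    and en: "\<And>t. t \<in> {l<..<r} \<Longrightarrow> (f1 t)\<^sup>2 = energy_poly e c d (f t)"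
    and d: "0 \<le> d"
  obtains a where "0 < a" "energy_poly e c d a = 0"
    "\<forall>y. 0 < y \<longrightarrow> y < a \<longrightarrow> 0 < energy_poly e c d y"
    "admissible (e * a) (6 + e * a) (3 * d / (2 * a\<^sup>2))"
    "r - l = 2 * tsing e a (3 * d / (2 * a\<^sup>2))"
    "(f has_integral 2 * fsing e a (3 * d / (2 * a\<^sup>2))) {l..r}"
proof -
  have "\<exists>t0\<in>{l..r}. \<forall>y\<in>{l..r}. f y \<le> f t0"
    using lr by (intro continuous_attains_sup cf) auto
  then obtain t0 where t0: "t0 \<in> {l..r}" "\<And>y. y \<in> {l..r} \<Longrightarrow> f y \<le> f t0" by blast
  define a where "a = f t0"
  have "0 < f ((l + r) / 2)" using lr by (intro pos) auto
  then have a: "0 < a" using t0(2)[of "(l + r) / 2"] lr by (auto simp: a_def)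
  then have t0i: "t0 \<in> {l<..<r}" using t0(1) fl fr by (auto simp: a_def order_le_less)
  have f10: "f1 t0 = 0"
  proof (rule DERIV_local_max[OF f[OF t0i]])
    show "0 < min (t0 - l) (r - t0)" using t0i by simp
    show "\<forall>y. \<bar>t0 - y\<bar> < min (t0 - l) (r - t0) \<longrightarrow> f y \<le> f t0"
      using t0(2) by (auto simp: abs_if split: if_splits)
  qed
  then have Qa: "energy_poly e c d a = 0" using en[OF t0i] by (simp add: a_def)
  define g where "g = 3 * d / (2 * a\<^sup>2)"
  have g: "0 \<le> g" "a * (a * g) = 3/2 * d" using d a by (auto simp: g_def power2_eq_square)
  have "a * (a * g) + 3 * c * a = 6 * a\<^sup>2 + e * a ^ 3"
    using Qa unfolding g(2) by (simp add: energy_poly_def)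
  then have "a * (a * g + 3 * c) = a * (6 * a + e * a\<^sup>2)"
    by (simp add: power2_eq_square power3_eq_cube algebra_simps)
  then have ag: "a * g + 3 * c = 6 * a + e * a\<^sup>2" using a by simp
  \<comment> \<open>At a maximum the second derivative cannot be positive. If it were zero, f would
    be constant and could not reach 0 at r.\<close>
  have conc: "c - 4 * a - e * a\<^sup>2 < 0"
  proof (rule ccontr)
    assume n: "\<not> c - 4 * a - e * a\<^sup>2 < 0"
    show False
    proof (cases "c - 4 * a - e * a\<^sup>2 = 0")
      case True
      have const: "f t = a" if "t \<in> {l<..<r}" for t
        using ode_equilibrium[OF f f1 t0i f10 _ that] True by (simp add: a_def)
      have "(f \<longlongrightarrow> f r) (at_left r)"
        using cf lr by (auto simp: continuous_on_Icc_at_leftD)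
      moreover have "eventually (\<lambda>t. f t = a) (at_left r)"
        using const lr by (auto simp: eventually_at_left_field)
      then have "(f \<longlongrightarrow> f r) (at_left r) \<longleftrightarrow> ((\<lambda>t. a) \<longlongrightarrow> f r) (at_left r)"
        by (rule tendsto_cong)
      ultimately have "((\<lambda>t. a) \<longlongrightarrow> f r) (at_left r)" by simp
      then show False using a fr by (simp add: tendsto_const_iff)
    next
      case False
      then have "0 < c - 4 * f t0 - e * (f t0)\<^sup>2" using n by (simp add: a_def)
      then have "\<exists>h>0. \<forall>x>0. x < h \<longrightarrow> f1 t0 < f1 (t0 + x)"
        by (rule DERIV_pos_inc_right[OF f1[OF t0i]])
      then obtain h where h: "h > 0" "\<And>x. 0 < x \<Longrightarrow> x < h \<Longrightarrow> 0 < f1 (t0 + x)" using f10 by auto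
      define t where "t = t0 + min h (r - t0) / 2"
      have t: "t0 < t" "t < r" "t < t0 + h" using h t0i by (auto simp: t_def min_def field_simps)
      have "f t0 < f t"
      proof (rule DERIV_pos_imp_increasing_open[OF t(1)])
        fix x assume x: "t0 < x" "x < t"
        show "\<exists>y. (f has_real_derivative y) (at x) \<and> 0 < y"
          using f[of x] h(2)[of "x - t0"] x t t0i by (intro exI[of _ "f1 x"]) auto
      qed (use t t0i in \<open>auto intro: continuous_on_subset[OF cf]\<close>)
      then show False using t0(2)[of t] t t0i by auto
    qed
  qed
  have adm: "admissible (e * a) (6 + e * a) g"
  proof -
    \<comment> \<open>Strict concavity at the maximum amounts to positivity of the quadratic at s =
      1, which for e = -1 is the substance of admissibility.\<close>
    have "a * (6 + 2 * e * a + g) = - 3 * (c - 4 * a - e * a\<^sup>2)"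
      using ag by (simp add: power2_eq_square algebra_simps)
    then have "0 < a * (6 + 2 * e * a + g)" using conc by simp
    then have "0 < 6 + 2 * e * a + g" using a by (simp add: zero_less_mult_iff)
    then show ?thesis using g(1) a e by (auto simp: admissible_def slope_def)
  qed
  have Q: "0 < energy_poly e c d y" if y: "0 < y" "y < a" for y
  proof -
    have "0 < quadr (e * a) (6 + e * a) g (y / a)" using adm y a by (intro quadr_pos) auto
    then show ?thesis using a y Qa unfolding g_def
      by (subst energy_poly_factor[of a]) (auto intro!: mult_pos_pos)
  qed
  have mx: "0 < f t \<and> f t \<le> a" if "t \<in> {l<..<r}" for t
    using pos[OF that] t0(2)[of t] that by (auto simp: a_def)
  have R: "r - t0 = tsing e a g" "(f has_integral fsing e a g) {t0..r}"
    unfolding g_def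
    by (rule bump_right_half[OF f f1 en t0i a_def[symmetric] f10 a mx conc Q Qa adm[unfolded g_def] _ fr];
        use t0i in \<open>auto intro: continuous_on_subset[OF cf]\<close>)+
  have L: "- l - - t0 = tsing e a g" "((\<lambda>t. f (- t)) has_integral fsing e a g) {- t0..- l}"
    unfolding g_def
  proof -
    have f': "((\<lambda>t. f (- t)) has_real_derivative - f1 (- t)) (at t)" if "t \<in> {- r<..<- l}" for t
      using that by (intro DERIV_reflect f) auto
    have f1': "((\<lambda>t. - f1 (- t)) has_real_derivative c - 4 * f (- t) - e * (f (- t))\<^sup>2) (at t)" if "t \<in> {- r<..<- l}" for t
    proof -
      have "- t \<in> {l<..<r}" using that by auto
      from DERIV_minus[OF DERIV_reflect[OF f1[OF this]]] show ?thesis by simp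
    qed
    have en': "(- f1 (- t))\<^sup>2 = energy_poly e c d (f (- t))" if "t \<in> {- r<..<- l}" for t
    proof -
      have "- t \<in> {l<..<r}" using that by auto
      from en[OF this] show ?thesis by simp
    qed
    have mx': "0 < f (- t) \<and> f (- t) \<le> a" if "t \<in> {- r<..<- l}" for t
      using that by (intro mx) auto
    have c': "continuous_on {- t0..- l} (\<lambda>t. f (- t))"
      by (rule continuous_on_compose2[OF cf]) (use t0i in \<open>auto intro!: continuous_intros\<close>)
    have t0': "- t0 \<in> {- r<..<- l}" "f (- (- t0)) = a" "- f1 (- (- t0)) = 0" "f (- (- l)) = 0"
      using t0i f10 fl by (auto simp: a_def)
    note left = bump_right_half[where f = "\<lambda>t. f (- t)" and ?f1.0 = "\<lambda>t. - f1 (- t)", OF f' f1' en' t0'(1,2,3) a mx' conc Q Qa adm[unfolded g_def] c' t0'(4)]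
    show "- l - - t0 = tsing e a (3 * d / (2 * a\<^sup>2))"
      by (rule left(1))
    show "((\<lambda>t. f (- t)) has_integral fsing e a (3 * d / (2 * a\<^sup>2))) {- t0..- l}"
      by (rule left(2))
  qed
  from L(2) have "(f has_integral fsing e a g) {l..t0}"
    by (simp add: has_integral_reflect_real)
  from has_integral_combine[OF _ _ this R(2)]
  have "(f has_integral fsing e a g + fsing e a g) {l..r}" using t0i by auto
  moreover have "r - l = tsing e a g + tsing e a g" using L(1) R(1) by simp
  ultimately show ?thesis using that[OF a Qa _ adm[unfolded g_def]] Q by (simp add: g_def)
qed

text \<open>An end point of a component must be a zero of g by maximality: otherwise it could be
  added to the interval.\<close>

lemma component_of_positive_set:
  fixes g :: "real \<Rightarrow> real"
  assumes cg: "continuous_on {p..q} g" and gp: "g p = 0" and gq: "g q = 0"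
    and C: "C \<in> components {t \<in> {p<..<q}. 0 < g t}"
  obtains l r where "p \<le> l" "l < r" "r \<le> q" "C = {l<..<r}" "g l = 0" "g r = 0"
    "\<And>t. t \<in> {l<..<r} \<Longrightarrow> 0 < g t"
proof -
  let ?S = "{t \<in> {p<..<q}. 0 < g t}"
  have "continuous_on {p<..<q} g" by (rule continuous_on_subset[OF cg]) auto
  then have "open ({p<..<q} \<inter> g -` {0<..})"
    by (intro continuous_open_preimage) auto
  then have oS: "open ?S" by (simp add: vimage_def Int_def conj_commute)
  have oC: "open C" using C oS by (rule open_components[rotated])
  have ne: "C \<noteq> {}" and conC: "connected C" and sub: "C \<subseteq> ?S"
    using C in_components_nonempty in_components_connected in_components_subset by blast+
  have bdd: "bdd_above C" "bdd_below C"
    using sub by (auto intro!: bdd_aboveI[of _ q] bdd_belowI[of _ p])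
  define l r where "l = Inf C" and "r = Sup C"
  have sub2: "{l<..<r} \<subseteq> C"
  proof
    fix x assume x: "x \<in> {l<..<r}"
    obtain y where "y \<in> C" "y < x" using x cInf_less_iff[OF ne bdd(2)] by (auto simp: l_def)
    moreover obtain z where "z \<in> C" "x < z" using x less_cSup_iff[OF ne bdd(1)] by (auto simp: r_def)
    ultimately show "x \<in> C" using connectedD_interval[OF conC, of y z x] by simp
  qed
  have notl: "l \<notin> C" and notr: "r \<notin> C"
  proof -
    show "l \<notin> C"
    proof
      assume "l \<in> C"
      then obtain e where "e > 0" "ball l e \<subseteq> C" using oC openE by blast
      then have "l - e / 2 \<in> C" by (auto simp: dist_real_def)
      then have "l \<le> l - e / 2" unfolding l_def by (intro cInf_lower bdd)
      then show False using \<open>e > 0\<close> by simp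
    qed
    show "r \<notin> C"
    proof
      assume "r \<in> C"
      then obtain e where "e > 0" "ball r e \<subseteq> C" using oC openE by blast
      then have "r + e / 2 \<in> C" by (auto simp: dist_real_def)
      then have "r + e / 2 \<le> r" unfolding r_def by (intro cSup_upper bdd)
      then show False using \<open>e > 0\<close> by simp
    qed
  qed
  have Ceq: "C = {l<..<r}"
  proof (rule antisym[OF _ sub2], rule subsetI)
    fix x assume x: "x \<in> C"
    then have "l \<le> x" "x \<le> r" using bdd by (auto simp: l_def r_def intro: cInf_lower cSup_upper)
    then show "x \<in> {l<..<r}" using x notl notr by (auto simp: order_le_less)
  qed
  have lr: "l < r" using ne Ceq by auto
  have inc: "{l<..<r} \<subseteq> {p<..<q}" using sub Ceq by auto
  then have pq: "p \<le> l" "r \<le> q" using lr by (auto simp: greaterThanLessThan_subseteq_greaterThanLessThan)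
  have pos: "0 < g t" if "t \<in> {l<..<r}" for t using that sub Ceq by auto
  have clos: "0 \<le> g t" if "t \<in> {l..r}" for t
  proof -
    have "{l..r} = closure {l<..<r}" using lr by simp
    moreover have "continuous_on (closure {l<..<r}) g"
      using lr pq by (auto intro: continuous_on_subset[OF cg])
    ultimately show ?thesis using continuous_ge_on_closure[of "{l<..<r}" g t 0] pos that by (auto intro: less_imp_le)
  qed
  have ends: "g x = 0" if x: "x = l \<or> x = r" for x
  proof (rule ccontr)
    assume "g x \<noteq> 0"
    then have gx: "0 < g x" using clos[of x] x lr by auto
    then have "x \<in> {p<..<q}" using x pq lr gp gq by (auto simp: order_le_less)
    then have "insert x C \<subseteq> ?S" using gx sub by auto
    moreover have "connected (insert x C)"
    proof -
      have "insert x C = {l..<r} \<or> insert x C = {l<..r}" using x lr unfolding Ceq by auto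
      then show ?thesis by (metis connected_Ico connected_Ioc)
    qed
    ultimately have "insert x C \<subseteq> C"
      using C ne by (intro components_maximal[OF C]) auto
    then show False using x notl notr by auto
  qed
  show ?thesis using that[of l r] lr pq Ceq ends pos by auto
qed

text \<open>No derivative is assumed at the end point \<alpha>, so d >= 0 comes from a limit: the
  square of f1 is nonnegative while f tends to 0.\<close>

lemma energy_conserved:
  fixes f f1 :: "real \<Rightarrow> real"
  assumes "0 < \<alpha>" and cf: "continuous_on {-\<alpha>..\<alpha>} f" and fr: "f \<alpha> = 0"
    and f: "\<And>t. t \<in> {-\<alpha><..<\<alpha>} \<Longrightarrow> (f has_real_derivative f1 t) (at t)"
    and f1: "\<And>t. t \<in> {-\<alpha><..<\<alpha>} \<Longrightarrow> (f1 has_real_derivative c - 4 * f t - (f t)\<^sup>2) (at t)"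
  obtains d where "0 \<le> d" "\<And>t. t \<in> {-\<alpha><..<\<alpha>} \<Longrightarrow> (f1 t)\<^sup>2 = energy_poly 1 c d (f t)"
proof -
  define H where "H t = (f1 t)\<^sup>2 - energy_poly 1 c 0 (f t)" for t
  have Hd: "(H has_real_derivative 0) (at t)" if t: "t \<in> {-\<alpha><..<\<alpha>}" for t
  proof -
    have p: "((\<lambda>t. (f1 t)\<^sup>2) has_real_derivative 2 * f1 t * (c - 4 * f t - (f t)\<^sup>2)) (at t)"
      "((\<lambda>t. (f t)\<^sup>2) has_real_derivative 2 * f t * f1 t) (at t)"
      "((\<lambda>t. (f t) ^ 3) has_real_derivative 3 * (f t)\<^sup>2 * f1 t) (at t)"
      using DERIV_power[OF f1[OF t], of 2] DERIV_power[OF f[OF t], of 2] DERIV_power[OF f[OF t], of 3]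
      by (simp_all add: mult_ac power2_eq_square)
    have "(H has_real_derivative 2 * f1 t * (c - 4 * f t - (f t)\<^sup>2)
        - (0 + 2 * c * f1 t - 4 * (2 * f t * f1 t) - 2/3 * 1 * (3 * (f t)\<^sup>2 * f1 t))) (at t)"
      unfolding H_def energy_poly_def
      by (intro DERIV_diff DERIV_add DERIV_cmult DERIV_const p f[OF t])
    then show ?thesis by (rule DERIV_cong) (simp add: algebra_simps)
  qed
  have "\<exists>K. \<forall>t\<in>{-\<alpha><..<\<alpha>}. H t = K"
    by (rule has_field_derivative_zero_constant) (auto intro: has_field_derivative_at_within[OF Hd])
  then have const: "H t = H 0" if "t \<in> {-\<alpha><..<\<alpha>}" for t
    using that \<open>0 < \<alpha>\<close> by (metis greaterThanLessThan_iff neg_less_0_iff_less)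
  have en: "(f1 t)\<^sup>2 = energy_poly 1 c (H 0) (f t)" if "t \<in> {-\<alpha><..<\<alpha>}" for t
    using const[OF that] by (simp add: H_def energy_poly_def)
  have "(f \<longlongrightarrow> f \<alpha>) (at_left \<alpha>)"
    using \<open>0 < \<alpha>\<close> by (intro continuous_on_Icc_at_leftD[OF cf]) simp
  then have "((\<lambda>t. - energy_poly 1 c 0 (f t)) \<longlongrightarrow> - energy_poly 1 c 0 (f \<alpha>)) (at_left \<alpha>)"
    unfolding energy_poly_def by (intro tendsto_intros)
  then have "((\<lambda>t. - energy_poly 1 c 0 (f t)) \<longlongrightarrow> 0) (at_left \<alpha>)" by (simp add: fr energy_poly_def)
  moreover have "eventually (\<lambda>t. - energy_poly 1 c 0 (f t) \<le> H 0) (at_left \<alpha>)"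
  proof -
    have "eventually (\<lambda>t. t \<in> {-\<alpha><..<\<alpha>}) (at_left \<alpha>)"
      using \<open>0 < \<alpha>\<close> by (intro eventually_at_left_real) simp
    then show ?thesis
    proof eventually_elim
      case (elim t)
      show ?case using const[OF elim] zero_le_power2[of "f1 t"] unfolding H_def[of t] by linarith
    qed
  qed
  ultimately have "0 \<le> H 0" by (intro tendsto_upperbound[of _ 0 "at_left \<alpha>"]) auto
  then show ?thesis using that en by blast
qed

text \<open>Where f and f1 both vanish, the second derivative is c, and c = 0 would make f vanish
  identically. So f1 has a simple zero there, while zeros of f accumulating at the point would by
  Rolle produce further zeros of f1.\<close>

lemma zeros_isolated:
  fixes f f1 :: "real \<Rightarrow> real"
  assumes f: "\<And>t. t \<in> {p<..<q} \<Longrightarrow> (f has_real_derivative f1 t) (at t)"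
    and f1: "\<And>t. t \<in> {p<..<q} \<Longrightarrow> (f1 has_real_derivative c - 4 * f t - (f t)\<^sup>2) (at t)"
    and nz: "\<exists>t\<in>{p<..<q}. f t \<noteq> 0" and z: "z \<in> {p<..<q}"
  shows "eventually (\<lambda>t. f t \<noteq> 0) (at z)"
proof -
  have simple: "eventually (\<lambda>t. h t \<noteq> h z) (at z)"
    if "(h has_real_derivative D) (at z)" "D \<noteq> 0" for h :: "real \<Rightarrow> real" and D
  proof -
    have "((\<lambda>t. (h t - h z) / (t - z)) \<longlongrightarrow> D) (at z)"
      using that(1) by (simp add: has_field_derivative_iff)
    then have "eventually (\<lambda>t. (h t - h z) / (t - z) \<noteq> 0) (at z)"
      using that(2) by (rule tendsto_imp_eventually_ne)
    then show ?thesis by eventually_elim auto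
  qed
  consider "f z \<noteq> 0" | "f z = 0" "f1 z \<noteq> 0" | "f z = 0" "f1 z = 0" by blast
  then show ?thesis
  proof cases
    case 1
    have "isCont f z" using f[OF z] by (rule DERIV_isCont)
    then show ?thesis using 1 unfolding isCont_def by (rule tendsto_imp_eventually_ne)
  next
    case 2
    then show ?thesis using simple[OF f[OF z]] by simp
  next
    case 3
    have "c \<noteq> 0"
    proof
      assume "c = 0"
      obtain t where t: "t \<in> {p<..<q}" "f t \<noteq> 0" using nz by blast
      have "f t = f z"
        by (rule ode_equilibrium[where f = f and ?f1.0 = f1 and e = 1 and c = c and l = p and r = q and ?t0.0 = z and t = t])
           (use f f1 z t 3 \<open>c = 0\<close> in auto)
      then show False using t 3 by simp
    qed
    then have "eventually (\<lambda>t. f1 t \<noteq> 0) (at z)" using simple[OF f1[OF z]] 3 by simp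
    then obtain e where e: "e > 0" "\<And>t. t \<noteq> z \<Longrightarrow> \<bar>t - z\<bar> < e \<Longrightarrow> f1 t \<noteq> 0"
      unfolding eventually_at by (auto simp: dist_real_def)
    define e' where "e' = min e (min (z - p) (q - z))"
    have e': "e' > 0" using e z by (simp add: e'_def)
    have nz': "f t \<noteq> 0" if t: "t \<noteq> z" "\<bar>t - z\<bar> < e'" for t
    proof
      assume ft: "f t = 0"
      have in_dom: "x \<in> {p<..<q}" if "\<bar>x - z\<bar> \<le> \<bar>t - z\<bar>" for x
        using that t by (auto simp: e'_def)
      define x1 x2 where "x1 = min t z" and "x2 = max t z"
      have x12: "x1 < x2" "f x1 = f x2" using t ft 3 by (auto simp: x1_def x2_def min_def max_def)
      have "\<exists>x>x1. x < x2 \<and> (f has_real_derivative 0) (at x)"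
      proof (rule Rolle[OF x12])
        show "continuous_on {x1..x2} f"
          by (intro continuous_at_imp_continuous_on ballI DERIV_isCont[OF f] in_dom) (auto simp: x1_def x2_def)
        show "f differentiable (at x)" if "x1 < x" "x < x2" for x
          using f[of x] in_dom[of x] that real_differentiable_def by (auto simp: x1_def x2_def)
      qed
      then obtain x where x: "x1 < x" "x < x2" "(f has_real_derivative 0) (at x)" by blast
      have "\<bar>x - z\<bar> \<le> \<bar>t - z\<bar>" "x \<noteq> z" using x by (auto simp: x1_def x2_def)
      then have "f1 x = 0" "f1 x \<noteq> 0"
        using DERIV_unique[OF f[OF in_dom] x(3)] e(2)[of x] t by (auto simp: e'_def)
      then show False by simp
    qed
    show ?thesis unfolding eventually_at using e' nz' by (auto simp: dist_real_def)
  qed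
qed

lemma negligible_zeros:
  fixes f f1 :: "real \<Rightarrow> real"
  assumes f: "\<And>t. t \<in> {p<..<q} \<Longrightarrow> (f has_real_derivative f1 t) (at t)"
    and f1: "\<And>t. t \<in> {p<..<q} \<Longrightarrow> (f1 has_real_derivative c - 4 * f t - (f t)\<^sup>2) (at t)"
    and nz: "\<exists>t\<in>{p<..<q}. f t \<noteq> 0"
  shows "negligible {t \<in> {p<..<q}. f t = 0}"
proof -
  let ?Z = "{t. f t = 0}"
  have "?Z sparse_in {p<..<q}"
    unfolding sparse_in_def
  proof
    fix z assume z: "z \<in> {p<..<q}"
    from zeros_isolated[OF f f1 nz z] obtain e where
      e: "e > 0" "\<And>t. t \<noteq> z \<Longrightarrow> dist t z < e \<Longrightarrow> f t \<noteq> 0"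
      unfolding eventually_at by blast
    have "\<not> y islimpt ?Z" if y: "y \<in> ball z e" for y
    proof
      assume "y islimpt ?Z"
      then have "\<exists>t\<in>?Z. t \<in> ball z e - {z} \<union> (if y = z then {z} else {}) \<and> t \<noteq> y"
      proof (rule islimptE)
        show "y \<in> ball z e - {z} \<union> (if y = z then {z} else {})" using y by auto
        show "open (ball z e - {z} \<union> (if y = z then {z} else {}))"
          using y by (auto simp: insert_absorb intro: open_Diff)
      qed auto
      then show False using e(2) by (auto simp: dist_commute split: if_splits)
    qed
    then show "\<exists>B. z \<in> B \<and> open B \<and> (\<forall>y\<in>B. \<not> y islimpt ?Z)"
      using e(1) by (intro exI[of _ "ball z e"]) auto
  qed
  then have "countable ({p<..<q} \<inter> ?Z)" by (intro sparse_imp_countable) auto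
  then have "negligible (\<Union> ((\<lambda>x. {x}) ` ({p<..<q} \<inter> ?Z)))"
    by (intro negligible_countable_Union) auto
  then show ?thesis by (simp add: Int_def)
qed

text \<open>c and d are the same for all bumps, so bumps of one sign share their height, length and
  integral. Since the zeros of f form a negligible set, these quantities add up to the length 2
  \<alpha> and to the flux.\<close>

lemma profile_decomposition:
  fixes f f1 :: "real \<Rightarrow> real"
  assumes "0 < \<alpha>" and cf: "continuous_on {-\<alpha>..\<alpha>} f" and fl: "f (- \<alpha>) = 0" and fr: "f \<alpha> = 0"
    and f: "\<And>t. t \<in> {-\<alpha><..<\<alpha>} \<Longrightarrow> (f has_real_derivative f1 t) (at t)"
    and f1: "\<And>t. t \<in> {-\<alpha><..<\<alpha>} \<Longrightarrow> (f1 has_real_derivative c - 4 * f t - (f t)\<^sup>2) (at t)"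
    and nz: "\<exists>t\<in>{-\<alpha><..<\<alpha>}. f t \<noteq> 0"
    and fin: "finite (components {t \<in> {-\<alpha><..<\<alpha>}. 0 < f t})" "finite (components {t \<in> {-\<alpha><..<\<alpha>}. f t < 0})"
    and i: "i = card (components {t \<in> {-\<alpha><..<\<alpha>}. 0 < f t})"
    and j: "j = card (components {t \<in> {-\<alpha><..<\<alpha>}. f t < 0})"
  obtains d a b where "0 \<le> d"
    "0 < i \<Longrightarrow> 0 < a \<and> energy_poly 1 c d a = 0 \<and> admissible (1 * a) (6 + 1 * a) (3 * d / (2 * a\<^sup>2))"
    "0 < j \<Longrightarrow> 0 < b \<and> energy_poly (-1) (- c) d b = 0 \<and> admissible (-1 * b) (6 + -1 * b) (3 * d / (2 * b\<^sup>2))"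
    "\<alpha> = real i * tsing 1 a (3 * d / (2 * a\<^sup>2)) + real j * tsing (-1) b (3 * d / (2 * b\<^sup>2))"
    "(f has_integral 2 * (real i * fsing 1 a (3 * d / (2 * a\<^sup>2)) - real j * fsing (-1) b (3 * d / (2 * b\<^sup>2)))) {-\<alpha>..\<alpha>}"
proof -
  let ?P = "components {t \<in> {-\<alpha><..<\<alpha>}. 0 < f t}" and ?N = "components {t \<in> {-\<alpha><..<\<alpha>}. f t < 0}"
  obtain d where d: "0 \<le> d" "\<And>t. t \<in> {-\<alpha><..<\<alpha>} \<Longrightarrow> (f1 t)\<^sup>2 = energy_poly 1 c d (f t)"
    using energy_conserved[OF \<open>0 < \<alpha>\<close> cf fr f f1] by blast
  define good where "good e c' a \<longleftrightarrow> 0 < a \<and> energy_poly e c' d a = 0 \<and>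
    (\<forall>y. 0 < y \<longrightarrow> y < a \<longrightarrow> 0 < energy_poly e c' d y) \<and>
    admissible (e * a) (6 + e * a) (3 * d / (2 * a\<^sup>2))" for e c' a
  have good_unique: "a = a'" if "good e c' a" "good e c' a'" for e c' a a'
    using that unfolding good_def by (metis less_irrefl linorder_neqE)
  have piece: "\<exists>a. good e (e * c) a \<and>
      ((\<lambda>t. 1) has_integral 2 * tsing e a (3 * d / (2 * a\<^sup>2))) C \<and>
      (f has_integral e * (2 * fsing e a (3 * d / (2 * a\<^sup>2)))) C"
    if e: "e = 1 \<or> e = -1" and C: "C \<in> components {t \<in> {-\<alpha><..<\<alpha>}. 0 < e * f t}" for e :: real and C
  proof -
    have ce: "continuous_on {-\<alpha>..\<alpha>} (\<lambda>t. e * f t)" by (intro continuous_intros cf)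
    obtain l r where lr: "- \<alpha> \<le> l" "l < r" "r \<le> \<alpha>" "C = {l<..<r}" "e * f l = 0" "e * f r = 0"
      "\<And>t. t \<in> {l<..<r} \<Longrightarrow> 0 < e * f t"
      using component_of_positive_set[OF ce _ _ C] fl fr by auto
    have ee: "e * e = 1" "e\<^sup>2 = 1" "e ^ 3 = e" using e by (auto simp: power3_eq_cube)
    have t: "t \<in> {-\<alpha><..<\<alpha>}" if "t \<in> {l<..<r}" for t using that lr by auto
    have c1: "continuous_on {l..r} (\<lambda>t. e * f t)" using lr by (intro continuous_on_subset[OF ce]) auto
    have c2: "((\<lambda>t. e * f t) has_real_derivative e * f1 x) (at x)" if "x \<in> {l<..<r}" for x
      by (rule DERIV_cmult[OF f[OF t[OF that]]])
    have c3: "((\<lambda>t. e * f1 t) has_real_derivative e * c - 4 * (e * f x) - e * (e * f x)\<^sup>2) (at x)"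
      if "x \<in> {l<..<r}" for x
      using DERIV_cmult[OF f1[OF t[OF that]], of e] e by (elim disjE) (simp_all add: algebra_simps)
    have c4: "(e * f1 x)\<^sup>2 = energy_poly e (e * c) d (e * f x)" if "x \<in> {l<..<r}" for x
      using d(2)[OF t[OF that]] e by (elim disjE) (simp_all add: energy_poly_def)
    obtain a where a: "0 < a" "energy_poly e (e * c) d a = 0"
      "\<forall>y. 0 < y \<longrightarrow> y < a \<longrightarrow> 0 < energy_poly e (e * c) d y"
      "admissible (e * a) (6 + e * a) (3 * d / (2 * a\<^sup>2))"
      "r - l = 2 * tsing e a (3 * d / (2 * a\<^sup>2))"
      "((\<lambda>t. e * f t) has_integral 2 * fsing e a (3 * d / (2 * a\<^sup>2))) {l..r}"
      using bump[OF e lr(2) c1 lr(5,6) lr(7) c2 c3 c4 d(1)] by blast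
    have "((\<lambda>t. 1) has_integral 2 * tsing e a (3 * d / (2 * a\<^sup>2))) {l..r}"
      using has_integral_const_real[of "1::real" l r] lr(2) a(5) by simp
    moreover have "((\<lambda>t. e * (e * f t)) has_integral e * (2 * fsing e a (3 * d / (2 * a\<^sup>2)))) {l..r}"
      by (intro has_integral_mult_right a)
    then have "(f has_integral e * (2 * fsing e a (3 * d / (2 * a\<^sup>2)))) {l..r}"
      unfolding mult.assoc[symmetric] ee by simp
    ultimately show ?thesis
      using a unfolding lr(4) has_integral_Icc_iff_Ioo good_def by blast
  qed
  have pieceP: "\<exists>a. good 1 c a \<and> ((\<lambda>t. 1) has_integral 2 * tsing 1 a (3 * d / (2 * a\<^sup>2))) C \<and>
      (f has_integral 2 * fsing 1 a (3 * d / (2 * a\<^sup>2))) C" if "C \<in> ?P" for C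
    using piece[of 1 C] that by simp
  have pieceN: "\<exists>a. good (-1) (- c) a \<and> ((\<lambda>t. 1) has_integral 2 * tsing (-1) a (3 * d / (2 * a\<^sup>2))) C \<and>
      (f has_integral - (2 * fsing (-1) a (3 * d / (2 * a\<^sup>2)))) C" if "C \<in> ?N" for C
    using piece[of "-1" C] that by simp
  \<comment> \<open>Unspecified if there is no positive bump; the terms containing it then carry the
    factor i = 0. The same holds for \<open>b\<close> and j.\<close>
  define a where "a = (SOME a. good 1 c a)"
  define b where "b = (SOME b. good (-1) (- c) b)"
  have ga: "good 1 c a" if "?P \<noteq> {}" using that pieceP someI[of "good 1 c"] unfolding a_def by blast
  have gb: "good (-1) (- c) b" if "?N \<noteq> {}" using that pieceN someI[of "good (-1) (- c)"] unfolding b_def by blast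
  have P: "((\<lambda>t. 1) has_integral 2 * tsing 1 a (3 * d / (2 * a\<^sup>2))) C"
    "(f has_integral 2 * fsing 1 a (3 * d / (2 * a\<^sup>2))) C" if CC: "C \<in> ?P" for C
  proof -
    obtain a' where a': "good 1 c a'" "((\<lambda>t. 1) has_integral 2 * tsing 1 a' (3 * d / (2 * a'\<^sup>2))) C"
      "(f has_integral 2 * fsing 1 a' (3 * d / (2 * a'\<^sup>2))) C" using pieceP[OF CC] by blast
    have "a' = a" using CC by (intro good_unique[OF a'(1) ga]) blast
    with a' show "((\<lambda>t. 1) has_integral 2 * tsing 1 a (3 * d / (2 * a\<^sup>2))) C"
      "(f has_integral 2 * fsing 1 a (3 * d / (2 * a\<^sup>2))) C" by simp_all
  qed
  have N: "((\<lambda>t. 1) has_integral 2 * tsing (-1) b (3 * d / (2 * b\<^sup>2))) C"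
    "(f has_integral - (2 * fsing (-1) b (3 * d / (2 * b\<^sup>2)))) C" if CC: "C \<in> ?N" for C
  proof -
    obtain b' where b': "good (-1) (- c) b'" "((\<lambda>t. 1) has_integral 2 * tsing (-1) b' (3 * d / (2 * b'\<^sup>2))) C"
      "(f has_integral - (2 * fsing (-1) b' (3 * d / (2 * b'\<^sup>2)))) C" using pieceN[OF CC] by blast
    have "b' = b" using CC by (intro good_unique[OF b'(1) gb]) blast
    with b' show "((\<lambda>t. 1) has_integral 2 * tsing (-1) b (3 * d / (2 * b\<^sup>2))) C"
      "(f has_integral - (2 * fsing (-1) b (3 * d / (2 * b\<^sup>2)))) C" by simp_all
  qed
  have disj: "?P \<inter> ?N = {}"
  proof (rule ccontr)
    assume "?P \<inter> ?N \<noteq> {}"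
    then obtain C where C: "C \<in> ?P" "C \<in> ?N" by blast
    obtain x where "x \<in> C" using in_components_nonempty[OF C(1)] by blast
    then have "0 < f x" "f x < 0" using in_components_subset[OF C(1)] in_components_subset[OF C(2)] by auto
    then show False by simp
  qed
  have pw: "pairwise (\<lambda>S S'. negligible (S \<inter> S')) (?P \<union> ?N)"
  proof (rule pairwiseI)
    fix S S' assume S: "S \<in> ?P \<union> ?N" "S' \<in> ?P \<union> ?N" "S \<noteq> S'"
    have "S \<inter> S' = {}"
    proof (cases "S \<in> ?P \<longleftrightarrow> S' \<in> ?P")
      case True
      then show ?thesis using S disj components_nonoverlap by blast
    next
      case False
      have "T \<inter> T' = {}" if "T \<in> ?P" "T' \<in> ?N" for T T'
        using in_components_subset[OF that(1)] in_components_subset[OF that(2)] by force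
      then show ?thesis using False S by blast
    qed
    then show "negligible (S \<inter> S')" by simp
  qed
  \<comment> \<open>To be applied with w = 1 for the length and with w = f for the flux.\<close>
  have total: "(w has_integral real i * x + real j * y) {-\<alpha>..\<alpha>}"
    if wP: "\<And>C. C \<in> ?P \<Longrightarrow> (w has_integral x) C" and wN: "\<And>C. C \<in> ?N \<Longrightarrow> (w has_integral y) C"
    for w :: "real \<Rightarrow> real" and x y
  proof -
    have "(w has_integral (\<Sum>C\<in>?P \<union> ?N. if C \<in> ?P then x else y)) (\<Union>(?P \<union> ?N))"
      using fin wP wN by (intro has_integral_Union pw) auto
    moreover have "(\<Sum>C\<in>?P \<union> ?N. if C \<in> ?P then x else y) = real i * x + real j * y"
    proof -
      have "(\<Sum>C\<in>?P \<union> ?N. if C \<in> ?P then x else y)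
          = (\<Sum>C\<in>?P. if C \<in> ?P then x else y) + (\<Sum>C\<in>?N. if C \<in> ?P then x else y)"
        using fin disj by (intro sum.union_disjoint) auto
      also have "(\<Sum>C\<in>?P. if C \<in> ?P then x else y) = (\<Sum>C\<in>?P. x)" by (intro sum.cong) auto
      also have "(\<Sum>C\<in>?N. if C \<in> ?P then x else y) = (\<Sum>C\<in>?N. y)"
        using disj by (intro sum.cong) auto
      finally show ?thesis by (simp add: i j)
    qed
    ultimately have w: "(w has_integral real i * x + real j * y) (\<Union>?P \<union> \<Union>?N)" by (simp add: Union_Un_distrib)
    have "negligible ({t \<in> {-\<alpha><..<\<alpha>}. f t = 0} \<union> {-\<alpha>, \<alpha>})"
      using negligible_zeros[OF f f1 nz] by (intro negligible_Un) auto
    then have n1: "negligible {x \<in> {-\<alpha>..\<alpha>} - (\<Union>?P \<union> \<Union>?N). w x \<noteq> 0}"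
      by (rule negligible_subset) (auto simp: Union_components[symmetric] order_le_less)
    have "{x \<in> (\<Union>?P \<union> \<Union>?N) - {-\<alpha>..\<alpha>}. w x \<noteq> 0} = {}"
      by (auto simp: Union_components[symmetric])
    then have n2: "negligible {x \<in> (\<Union>?P \<union> \<Union>?N) - {-\<alpha>..\<alpha>}. w x \<noteq> 0}"
      by (simp only: negligible_empty)
    from w show ?thesis unfolding has_integral_spike_set_eq[OF n2 n1] .
  qed
  have "((\<lambda>t. 1) has_integral real i * (2 * tsing 1 a (3 * d / (2 * a\<^sup>2))) + real j * (2 * tsing (-1) b (3 * d / (2 * b\<^sup>2)))) {-\<alpha>..\<alpha>}"
    by (rule total) (fact P N)+
  moreover have "((\<lambda>t. 1) has_integral 2 * \<alpha>) {-\<alpha>..\<alpha>}"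
    using has_integral_const_real[of "1::real" "-\<alpha>" \<alpha>] \<open>0 < \<alpha>\<close> by simp
  ultimately have T: "2 * \<alpha> = real i * (2 * tsing 1 a (3 * d / (2 * a\<^sup>2))) + real j * (2 * tsing (-1) b (3 * d / (2 * b\<^sup>2)))"
    by (rule has_integral_unique[symmetric])
  have F: "(f has_integral real i * (2 * fsing 1 a (3 * d / (2 * a\<^sup>2))) + real j * - (2 * fsing (-1) b (3 * d / (2 * b\<^sup>2)))) {-\<alpha>..\<alpha>}"
    by (rule total) (fact P N)+
  show ?thesis
  proof (rule that[of d a b])
    show "0 \<le> d" by (rule d)
    show "0 < a \<and> energy_poly 1 c d a = 0 \<and> admissible (1 * a) (6 + 1 * a) (3 * d / (2 * a\<^sup>2))" if "0 < i"
      using ga that fin i unfolding good_def by (auto simp: card_gt_0_iff)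
    show "0 < b \<and> energy_poly (-1) (- c) d b = 0 \<and> admissible (-1 * b) (6 + -1 * b) (3 * d / (2 * b\<^sup>2))" if "0 < j"
      using gb that fin j unfolding good_def by (auto simp: card_gt_0_iff)
    show "\<alpha> = real i * tsing 1 a (3 * d / (2 * a\<^sup>2)) + real j * tsing (-1) b (3 * d / (2 * b\<^sup>2))"
      using T by simp
    show "(f has_integral 2 * (real i * fsing 1 a (3 * d / (2 * a\<^sup>2)) - real j * fsing (-1) b (3 * d / (2 * b\<^sup>2)))) {-\<alpha>..\<alpha>}"
      using F by (simp add: algebra_simps)
  qed
qed

section \<open>Construction of profiles\<close>

text \<open>Separation of variables: \<open>\<tau> y\<close> is the time at which y is reached, the
  integral of 1 / V, and \<open>\<psi>\<close> is its inverse.\<close>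

lemma autonomous_time_change:
  fixes V :: "real \<Rightarrow> real"
  assumes pq: "p < q" and cV: "continuous_on {p..q} V" and pos: "\<And>y. y \<in> {p..q} \<Longrightarrow> 0 < V y"
  obtains \<tau> \<psi> where "continuous_on {p..q} \<tau>" "strict_mono_on {p..q} \<tau>"
    "\<And>y. y \<in> {p..q} \<Longrightarrow> \<psi> (\<tau> y) = y"
    "\<And>t. t \<in> {\<tau> p<..<\<tau> q} \<Longrightarrow> \<psi> t \<in> {p<..<q} \<and> \<tau> (\<psi> t) = t"
    "\<And>t. t \<in> {\<tau> p<..<\<tau> q} \<Longrightarrow> (\<psi> has_real_derivative V (\<psi> t)) (at t)"
proof -
  define W where "W y = 1 / V y" for y
  have cW: "continuous_on {p..q} W" unfolding W_def using pos by (intro continuous_intros cV) force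
  have Wpos: "0 < W y" if "y \<in> {p..q}" for y using pos[OF that] by (simp add: W_def)
  define \<tau> where "\<tau> y = integral {p..y} W" for y
  have c\<tau>: "continuous_on {p..q} \<tau>"
    unfolding \<tau>_def by (intro indefinite_integral_continuous_1 integrable_continuous_real cW)
  have d\<tau>: "(\<tau> has_real_derivative W y) (at y)" if y: "y \<in> {p<..<q}" for y
  proof -
    have "(\<tau> has_real_derivative W y) (at y within {p..q})"
      unfolding \<tau>_def using y by (intro integral_has_real_derivative cW) auto
    moreover have "at y within {p..q} = at y" using y by (intro at_within_interior) auto
    ultimately show ?thesis by simp
  qed
  have mono: "\<tau> y < \<tau> y'" if "y \<in> {p..q}" "y' \<in> {p..q}" "y < y'" for y y'
  proof (rule DERIV_pos_imp_increasing_open[OF that(3)])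
    fix x assume x: "y < x" "x < y'"
    then have "x \<in> {p<..<q}" using that by auto
    then show "\<exists>D. (\<tau> has_real_derivative D) (at x) \<and> 0 < D" using d\<tau> Wpos by force
  qed (use that in \<open>auto intro: continuous_on_subset[OF c\<tau>]\<close>)
  have sm: "strict_mono_on {p..q} \<tau>" using mono by (auto intro!: strict_mono_onI)
  have inj: "inj_on \<tau> {p..q}" using sm by (rule strict_mono_on_imp_inj_on)
  define \<psi> where "\<psi> = inv_into {p..q} \<tau>"
  have left: "\<psi> (\<tau> y) = y" if "y \<in> {p..q}" for y
    unfolding \<psi>_def using inj that by (rule inv_into_f_f)
  have right: "\<psi> t \<in> {p<..<q} \<and> \<tau> (\<psi> t) = t" if t: "t \<in> {\<tau> p<..<\<tau> q}" for t
  proof -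
    obtain y where y: "p \<le> y" "y \<le> q" "\<tau> y = t"
      using IVT'[of \<tau> p t q] t pq c\<tau> by auto
    then have "y \<noteq> p" "y \<noteq> q" using t by auto
    then show ?thesis using left[of y] y by auto
  qed
  have der: "(\<psi> has_real_derivative V (\<psi> t)) (at t)" if t: "t \<in> {\<tau> p<..<\<tau> q}" for t
  proof -
    define y where "y = \<psi> t"
    have y: "y \<in> {p<..<q}" "\<tau> y = t" using right[OF t] by (auto simp: y_def)
    have "isCont \<psi> (\<tau> y)"
    proof (rule isCont_inverse_function2[where f = \<tau> and g = \<psi> and x = y and a = "(p + y) / 2" and b = "(y + q) / 2"])
      show "\<psi> (\<tau> z) = z" if "(p + y) / 2 \<le> z" "z \<le> (y + q) / 2" for z
        using that y by (intro left) auto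
      show "isCont \<tau> z" if "(p + y) / 2 \<le> z" "z \<le> (y + q) / 2" for z
        using that y by (intro DERIV_isCont[OF d\<tau>]) auto
    qed (use y in auto)
    then have "(\<psi> has_real_derivative inverse (W y)) (at t)"
      unfolding y(2)
      by (rule DERIV_inverse_function[where f = \<tau> and a = "\<tau> p" and b = "\<tau> q", rotated -1])
         (use d\<tau>[OF y(1)] Wpos[of y] y right t in \<open>auto simp: y_def[symmetric]\<close>)
    then show ?thesis by (simp add: W_def y_def)
  qed
  show ?thesis by (rule that[OF c\<tau> sm left right der])
qed

text \<open>With y' = sqrt (R y), the function f = \<phi> (y) has second derivative \<phi>2 R +
  \<phi>1 R1 / 2, so the profile equation becomes the pointwise identity \<open>eq\<close>. Since R
  is positive, a turning point of f is an ordinary point of the motion of y.\<close>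

lemma autonomous_ode:
  fixes \<phi> \<phi>1 \<phi>2 R R1 :: "real \<Rightarrow> real"
  assumes pq: "p < q" and cR: "continuous_on {p..q} R" and Rpos: "\<And>y. y \<in> {p..q} \<Longrightarrow> 0 < R y"
    and R1: "\<And>y. y \<in> {p<..<q} \<Longrightarrow> (R has_real_derivative R1 y) (at y)"
    and \<phi>1: "\<And>y. y \<in> {p<..<q} \<Longrightarrow> (\<phi> has_real_derivative \<phi>1 y) (at y)"
    and \<phi>2: "\<And>y. y \<in> {p<..<q} \<Longrightarrow> (\<phi>1 has_real_derivative \<phi>2 y) (at y)"
    and eq: "\<And>y. y \<in> {p<..<q} \<Longrightarrow> \<phi>2 y * R y + \<phi>1 y * R1 y / 2 = c - 4 * \<phi> y - (\<phi> y)\<^sup>2"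
    and en: "\<And>y. y \<in> {p<..<q} \<Longrightarrow> (\<phi>1 y)\<^sup>2 * R y = energy_poly 1 c d (\<phi> y)"
  obtains \<tau> f f1 where "strict_mono_on {p..q} \<tau>" "continuous_on {p..q} \<tau>"
    "\<forall>y\<in>{p<..<q}. f (\<tau> y) = \<phi> y"
    "\<forall>t\<in>{\<tau> p<..<\<tau> q}. \<exists>y\<in>{p<..<q}. \<tau> y = t"
    "\<forall>t\<in>{\<tau> p<..<\<tau> q}. (f has_real_derivative f1 t) (at t)"
    "\<forall>t\<in>{\<tau> p<..<\<tau> q}. (f1 has_real_derivative c - 4 * f t - (f t)\<^sup>2) (at t)"
    "\<forall>t\<in>{\<tau> p<..<\<tau> q}. (f1 t)\<^sup>2 = energy_poly 1 c d (f t)"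
proof -
  obtain \<tau> \<psi> where \<tau>: "continuous_on {p..q} \<tau>" "strict_mono_on {p..q} \<tau>"
    "\<And>y. y \<in> {p..q} \<Longrightarrow> \<psi> (\<tau> y) = y"
    "\<And>t. t \<in> {\<tau> p<..<\<tau> q} \<Longrightarrow> \<psi> t \<in> {p<..<q} \<and> \<tau> (\<psi> t) = t"
    "\<And>t. t \<in> {\<tau> p<..<\<tau> q} \<Longrightarrow> (\<psi> has_real_derivative sqrt (R (\<psi> t))) (at t)"
    by (rule autonomous_time_change[OF pq, of "\<lambda>y. sqrt (R y)"])
       (auto intro: continuous_intros cR Rpos)
  define f where "f t = \<phi> (\<psi> t)" for t
  define f1 where "f1 t = \<phi>1 (\<psi> t) * sqrt (R (\<psi> t))" for t
  have f: "(f has_real_derivative f1 t) (at t)" if "t \<in> {\<tau> p<..<\<tau> q}" for t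
    unfolding f_def f1_def using \<tau>(4,5)[OF that] by (intro DERIV_chain2[OF \<phi>1]) auto
  have f1: "(f1 has_real_derivative c - 4 * f t - (f t)\<^sup>2) (at t)" if t: "t \<in> {\<tau> p<..<\<tau> q}" for t
  proof -
    define y where "y = \<psi> t"
    have y: "y \<in> {p<..<q}" using \<tau>(4)[OF t] by (simp add: y_def)
    have Ry: "0 < R y" using y by (intro Rpos) auto
    note d\<psi> = \<tau>(5)[OF t, folded y_def]
    have a: "((\<lambda>t. \<phi>1 (\<psi> t)) has_real_derivative \<phi>2 y * sqrt (R y)) (at t)"
      using y d\<psi> unfolding y_def by (intro DERIV_chain2[OF \<phi>2])
    have "((\<lambda>t. R (\<psi> t)) has_real_derivative R1 y * sqrt (R y)) (at t)"
      using y d\<psi> unfolding y_def by (intro DERIV_chain2[OF R1])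
    with DERIV_real_sqrt[of "R (\<psi> t)"] Ry
    have b: "((\<lambda>t. sqrt (R (\<psi> t))) has_real_derivative inverse (sqrt (R y)) / 2 * (R1 y * sqrt (R y))) (at t)"
      unfolding y_def by (intro DERIV_chain2[of sqrt]) auto
    have "(f1 has_real_derivative \<phi>2 y * sqrt (R y) * sqrt (R (\<psi> t))
        + inverse (sqrt (R y)) / 2 * (R1 y * sqrt (R y)) * \<phi>1 (\<psi> t)) (at t)"
      unfolding f1_def by (rule DERIV_mult[OF a b])
    moreover have "\<phi>2 y * sqrt (R y) * sqrt (R (\<psi> t)) + inverse (sqrt (R y)) / 2 * (R1 y * sqrt (R y)) * \<phi>1 (\<psi> t)
        = \<phi>2 y * R y + \<phi>1 y * R1 y / 2"
      using Ry by (simp add: y_def[symmetric] field_simps)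
    ultimately show ?thesis using eq[OF y] by (simp add: f_def y_def)
  qed
  show ?thesis
  proof (rule that[OF \<tau>(2,1)]; intro ballI)
    show "f (\<tau> y) = \<phi> y" if "y \<in> {p<..<q}" for y using \<tau>(3)[of y] that by (simp add: f_def)
    show "\<exists>y\<in>{p<..<q}. \<tau> y = t" if "t \<in> {\<tau> p<..<\<tau> q}" for t using \<tau>(4)[OF that] by blast
    show "(f1 t)\<^sup>2 = energy_poly 1 c d (f t)" if "t \<in> {\<tau> p<..<\<tau> q}" for t
      using \<tau>(4)[OF that] en[of "\<psi> t"] Rpos[of "\<psi> t"] by (simp add: f_def f1_def power_mult_distrib)
  qed (rule f f1; assumption)+
qed

lemma components_alternating:
  fixes z :: "nat \<Rightarrow> real" and f :: "real \<Rightarrow> real"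
  assumes z: "\<And>k. k < N \<Longrightarrow> z k < z (Suc k)" and f0: "\<And>k. k \<le> N \<Longrightarrow> f (z k) = 0"
    and pos: "\<And>k t. k < N \<Longrightarrow> P k \<Longrightarrow> t \<in> {z k<..<z (Suc k)} \<Longrightarrow> 0 < f t"
    and neg: "\<And>k t. k < N \<Longrightarrow> \<not> P k \<Longrightarrow> t \<in> {z k<..<z (Suc k)} \<Longrightarrow> f t < 0"
  shows "components {t \<in> {z 0<..<z N}. 0 < f t} = (\<lambda>k. {z k<..<z (Suc k)}) ` {k. k < N \<and> P k}"
    and "card (components {t \<in> {z 0<..<z N}. 0 < f t}) = card {k. k < N \<and> P k}"
    and "finite (components {t \<in> {z 0<..<z N}. 0 < f t})"
proof -
  have mono: "z k \<le> z l" if "k \<le> l" "l \<le> N" for k l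
    using that
  proof (induction l)
    case (Suc l)
    then show ?case using z[of l] by (cases "k = Suc l") auto
  qed simp
  have cover: "\<exists>k<N. t \<in> {z k<..<z (Suc k)}" if t: "t \<in> {z 0<..<z N}" "f t \<noteq> 0" for t
  proof -
    define k where "k = Max {k. k \<le> N \<and> z k \<le> t}"
    have fin: "finite {k. k \<le> N \<and> z k \<le> t}" by simp
    have "0 \<in> {k. k \<le> N \<and> z k \<le> t}" using t by simp
    then have k: "k \<le> N" "z k \<le> t" using Max_in[OF fin] unfolding k_def by blast+
    have kN: "k < N" using k t by (cases "k = N") auto
    have "\<not> z (Suc k) \<le> t"
    proof
      assume "z (Suc k) \<le> t"
      then have "Suc k \<le> k" using kN fin unfolding k_def by (intro Max_ge) auto
      then show False by simp
    qed
    moreover have "z k \<noteq> t" using f0[of k] k t by auto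
    ultimately show ?thesis using k kN by (intro exI[of _ k]) auto
  qed
  have disj: "k = l" if "k < N" "l < N" "t \<in> {z k<..<z (Suc k)}" "t \<in> {z l<..<z (Suc l)}" for k l t
  proof (rule ccontr)
    assume "k \<noteq> l"
    then consider "Suc k \<le> l" | "Suc l \<le> k" by linarith
    then show False using mono[of "Suc k" l] mono[of "Suc l" k] that by cases auto
  qed
  have inj: "inj_on (\<lambda>k. {z k<..<z (Suc k)}) {k. k < N \<and> P k}"
  proof (rule inj_onI)
    fix k l assume kl: "k \<in> {k. k < N \<and> P k}" "l \<in> {k. k < N \<and> P k}" "{z k<..<z (Suc k)} = {z l<..<z (Suc l)}"
    obtain t where "t \<in> {z k<..<z (Suc k)}" using z[of k] kl(1) dense by (metis greaterThanLessThan_iff mem_Collect_eq)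
    then show "k = l" using kl by (intro disj[of k l t]) auto
  qed
  show eq: "components {t \<in> {z 0<..<z N}. 0 < f t} = (\<lambda>k. {z k<..<z (Suc k)}) ` {k. k < N \<and> P k}"
  proof (rule components_open_unique)
    show "pairwise disjnt ((\<lambda>k. {z k<..<z (Suc k)}) ` {k. k < N \<and> P k})"
    proof (rule pairwiseI)
      fix S T assume "S \<in> (\<lambda>k. {z k<..<z (Suc k)}) ` {k. k < N \<and> P k}"
        "T \<in> (\<lambda>k. {z k<..<z (Suc k)}) ` {k. k < N \<and> P k}" "S \<noteq> T"
      then obtain k l where kl: "k < N" "l < N" "S = {z k<..<z (Suc k)}" "T = {z l<..<z (Suc l)}" "k \<noteq> l" by auto
      then show "disjnt S T" using disj[of k l] unfolding disjnt_def by blast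
    qed
    show "\<Union> ((\<lambda>k. {z k<..<z (Suc k)}) ` {k. k < N \<and> P k}) = {t \<in> {z 0<..<z N}. 0 < f t}"
    proof (intro set_eqI iffI)
      fix t assume "t \<in> \<Union> ((\<lambda>k. {z k<..<z (Suc k)}) ` {k. k < N \<and> P k})"
      then obtain k where k: "k < N" "P k" "t \<in> {z k<..<z (Suc k)}" by auto
      then show "t \<in> {t \<in> {z 0<..<z N}. 0 < f t}"
        using pos[OF k] mono[of 0 k] mono[of "Suc k" N] by auto
    next
      fix t assume t: "t \<in> {t \<in> {z 0<..<z N}. 0 < f t}"
      then obtain k where k: "k < N" "t \<in> {z k<..<z (Suc k)}" using cover[of t] by auto
      then have "P k" using neg[of k t] t by (cases "P k") auto
      then show "t \<in> \<Union> ((\<lambda>k. {z k<..<z (Suc k)}) ` {k. k < N \<and> P k})" using k by auto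
    qed
    fix X assume "X \<in> (\<lambda>k. {z k<..<z (Suc k)}) ` {k. k < N \<and> P k}"
    then obtain k where "k < N" "X = {z k<..<z (Suc k)}" by auto
    then show "open X \<and> connected X \<and> X \<noteq> {}" using z[of k] by auto
  qed
  show "card (components {t \<in> {z 0<..<z N}. 0 < f t}) = card {k. k < N \<and> P k}"
    unfolding eq by (rule card_image[OF inj])
  show "finite (components {t \<in> {z 0<..<z N}. 0 < f t})" unfolding eq by simp
qed

definition first_root :: "real \<Rightarrow> real \<Rightarrow> real \<Rightarrow> real \<Rightarrow> bool" where
  "first_root e c d a \<longleftrightarrow> 0 < a \<and> energy_poly e c d a = 0 \<and> (\<forall>y. 0 < y \<longrightarrow> y < a \<longrightarrow> 0 < energy_poly e c d y)"

lemma first_root_unique: "first_root e c d a \<Longrightarrow> first_root e c d a' \<Longrightarrow> a = a'"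
  unfolding first_root_def by (cases a a' rule: linorder_cases) force+

text \<open>The equation is required slightly beyond \<open>\<plusminus> \<alpha>\<close>, because smoothness up to the boundary of the sector
  needs an extension of the field.\<close>
definition has_profile :: "real \<Rightarrow> nat \<Rightarrow> nat \<Rightarrow> real \<Rightarrow> bool" where
  "has_profile \<alpha> i j v \<longleftrightarrow> (\<exists>c f f1 \<eta>. 0 < \<eta> \<and>
     (\<forall>t\<in>{-\<alpha>-\<eta><..<\<alpha>+\<eta>}. (f has_real_derivative f1 t) (at t)) \<and>
     (\<forall>t\<in>{-\<alpha>-\<eta><..<\<alpha>+\<eta>}. (f1 has_real_derivative c - 4 * f t - (f t)\<^sup>2) (at t)) \<and>
     f (- \<alpha>) = 0 \<and> f \<alpha> = 0 \<and>
     finite (components {t \<in> {-\<alpha><..<\<alpha>}. 0 < f t}) \<and> card (components {t \<in> {-\<alpha><..<\<alpha>}. 0 < f t}) = i \<and>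
     finite (components {t \<in> {-\<alpha><..<\<alpha>}. f t < 0}) \<and> card (components {t \<in> {-\<alpha><..<\<alpha>}. f t < 0}) = j \<and>
     (f has_integral v) {-\<alpha>..\<alpha>})"

text \<open>Lengths and integrals are not computed in the variable y: each arc is a bump of f, and
  \<open>bump\<close> returns them in terms of a height that \<open>first_root_unique\<close>
  identifies as a or b. A shift of time then places the arcs on [- \<alpha>, \<alpha>]. As all z k
  lie strictly inside (p, q), the margin demanded by \<open>has_profile\<close> is left
  over.\<close>

lemma arcs_profile:
  fixes \<phi> \<phi>1 \<phi>2 R R1 :: "real \<Rightarrow> real" and z :: "nat \<Rightarrow> real"
  assumes pq: "p < q" and cR: "continuous_on {p..q} R" and Rpos: "\<And>y. y \<in> {p..q} \<Longrightarrow> 0 < R y"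
    and R1: "\<And>y. y \<in> {p<..<q} \<Longrightarrow> (R has_real_derivative R1 y) (at y)"
    and \<phi>1: "\<And>y. y \<in> {p<..<q} \<Longrightarrow> (\<phi> has_real_derivative \<phi>1 y) (at y)"
    and \<phi>2: "\<And>y. y \<in> {p<..<q} \<Longrightarrow> (\<phi>1 has_real_derivative \<phi>2 y) (at y)"
    and eq: "\<And>y. y \<in> {p<..<q} \<Longrightarrow> \<phi>2 y * R y + \<phi>1 y * R1 y / 2 = c - 4 * \<phi> y - (\<phi> y)\<^sup>2"
    and en: "\<And>y. y \<in> {p<..<q} \<Longrightarrow> (\<phi>1 y)\<^sup>2 * R y = energy_poly 1 c d (\<phi> y)"
    and d: "0 \<le> d" and z: "\<And>k. k \<le> N \<Longrightarrow> z k \<in> {p<..<q}" "\<And>k. k < N \<Longrightarrow> z k < z (Suc k)"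
    and \<phi>0: "\<And>k. k \<le> N \<Longrightarrow> \<phi> (z k) = 0"
    and pos: "\<And>k y. k < N \<Longrightarrow> P k \<Longrightarrow> y \<in> {z k<..<z (Suc k)} \<Longrightarrow> 0 < \<phi> y"
    and neg: "\<And>k y. k < N \<Longrightarrow> \<not> P k \<Longrightarrow> y \<in> {z k<..<z (Suc k)} \<Longrightarrow> \<phi> y < 0"
    and rA: "\<And>k. k < N \<Longrightarrow> P k \<Longrightarrow> first_root 1 c d a"
    and rB: "\<And>k. k < N \<Longrightarrow> \<not> P k \<Longrightarrow> first_root (-1) (- c) d b"
    and i: "i = card {k. k < N \<and> P k}" and j: "j = card {k. k < N \<and> \<not> P k}"
    and \<alpha>: "\<alpha> = real i * tsing 1 a (3 * d / (2 * a\<^sup>2)) + real j * tsing (-1) b (3 * d / (2 * b\<^sup>2))"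
  shows "has_profile \<alpha> i j (2 * (real i * fsing 1 a (3 * d / (2 * a\<^sup>2)) - real j * fsing (-1) b (3 * d / (2 * b\<^sup>2))))"
proof -
  obtain \<tau> f f1 where \<tau>: "strict_mono_on {p..q} \<tau>" "continuous_on {p..q} \<tau>"
    and sol: "\<forall>y\<in>{p<..<q}. f (\<tau> y) = \<phi> y"
    "\<forall>t\<in>{\<tau> p<..<\<tau> q}. \<exists>y\<in>{p<..<q}. \<tau> y = t"
    "\<forall>t\<in>{\<tau> p<..<\<tau> q}. (f has_real_derivative f1 t) (at t)"
    "\<forall>t\<in>{\<tau> p<..<\<tau> q}. (f1 has_real_derivative c - 4 * f t - (f t)\<^sup>2) (at t)"
    "\<forall>t\<in>{\<tau> p<..<\<tau> q}. (f1 t)\<^sup>2 = energy_poly 1 c d (f t)"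
    by (rule autonomous_ode[OF pq cR Rpos R1 \<phi>1 \<phi>2 eq en]; (assumption | rule that; assumption))
  note f\<tau> = bspec[OF sol(1)] and surj = bspec[OF sol(2)] and f = bspec[OF sol(3)]
    and f1 = bspec[OF sol(4)] and fen = bspec[OF sol(5)]
  define \<zeta> where "\<zeta> k = \<tau> (z k)" for k
  have \<tau>less: "\<tau> x < \<tau> y \<longleftrightarrow> x < y" if "x \<in> {p..q}" "y \<in> {p..q}" for x y
    using strict_mono_on_less[OF \<tau>(1) that] .
  have \<zeta>in: "\<zeta> k \<in> {\<tau> p<..<\<tau> q}" if "k \<le> N" for k
    using z(1)[OF that] \<tau>less[of p "z k"] \<tau>less[of "z k" q] pq by (auto simp: \<zeta>_def)
  have \<zeta>less: "\<zeta> k < \<zeta> (Suc k)" if "k < N" for k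
    using z(1)[of k] z(1)[of "Suc k"] z(2)[OF that] \<tau>less[of "z k" "z (Suc k)"] that by (auto simp: \<zeta>_def)
  have f\<zeta>: "f (\<zeta> k) = 0" if "k \<le> N" for k
    using f\<tau>[OF z(1)[OF that]] \<phi>0[OF that] by (simp add: \<zeta>_def)
  have arc: "\<exists>y\<in>{z k<..<z (Suc k)}. \<tau> y = t \<and> f t = \<phi> y" if k: "k < N" and t: "t \<in> {\<zeta> k<..<\<zeta> (Suc k)}" for k t
  proof -
    have "t \<in> {\<tau> p<..<\<tau> q}" using t \<zeta>in[of k] \<zeta>in[of "Suc k"] k by auto
    then obtain y where y: "y \<in> {p<..<q}" "\<tau> y = t" using surj by blast
    then show ?thesis
      using t z(1)[of k] z(1)[of "Suc k"] k \<tau>less[of "z k" y] \<tau>less[of y "z (Suc k)"] f\<tau>[OF y(1)]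
      by (intro bexI[of _ y]) (auto simp: \<zeta>_def)
  qed
  have fpos: "0 < f t" if "k < N" "P k" "t \<in> {\<zeta> k<..<\<zeta> (Suc k)}" for k t
    using arc[OF that(1,3)] pos[OF that(1,2)] by auto
  have fneg: "f t < 0" if "k < N" "\<not> P k" "t \<in> {\<zeta> k<..<\<zeta> (Suc k)}" for k t
    using arc[OF that(1,3)] neg[OF that(1,2)] by auto
  define T S where "T k = (if P k then 2 * tsing 1 a (3 * d / (2 * a\<^sup>2)) else 2 * tsing (-1) b (3 * d / (2 * b\<^sup>2)))"
    and "S k = (if P k then 2 * fsing 1 a (3 * d / (2 * a\<^sup>2)) else - (2 * fsing (-1) b (3 * d / (2 * b\<^sup>2))))" for k
  have sub: "t \<in> {\<tau> p<..<\<tau> q}" if "k < N" "t \<in> {\<zeta> k..\<zeta> (Suc k)}" for k t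
    using that \<zeta>in[of k] \<zeta>in[of "Suc k"] by auto
  have cf: "continuous_on X f" if "X \<subseteq> {\<tau> p<..<\<tau> q}" for X
    using that by (intro continuous_at_imp_continuous_on ballI DERIV_isCont[OF f]) auto
  have bumps: "\<zeta> (Suc k) - \<zeta> k = T k \<and> (f has_integral S k) {\<zeta> k..\<zeta> (Suc k)}" if k: "k < N" for k
  proof -
    \<comment> \<open>Negative arcs are treated as bumps of - f.\<close>
    define e :: real where "e = (if P k then 1 else -1)"
    have e: "e = 1 \<or> e = -1" "e * e = 1" by (auto simp: e_def)
    have c1: "continuous_on {\<zeta> k..\<zeta> (Suc k)} (\<lambda>t. e * f t)"
      using sub[OF k] by (intro continuous_intros cf) auto
    have e0: "e * f (\<zeta> k) = 0" "e * f (\<zeta> (Suc k)) = 0" using f\<zeta> k by auto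
    have e1: "0 < e * f t" if "t \<in> {\<zeta> k<..<\<zeta> (Suc k)}" for t
      using fpos[OF k _ that] fneg[OF k _ that] by (simp add: e_def)
    have c2: "((\<lambda>t. e * f t) has_real_derivative e * f1 x) (at x)" if "x \<in> {\<zeta> k<..<\<zeta> (Suc k)}" for x
      using that by (intro DERIV_cmult[OF f[OF sub[OF k]]]) auto
    have c3: "((\<lambda>t. e * f1 t) has_real_derivative e * c - 4 * (e * f x) - e * (e * f x)\<^sup>2) (at x)"
      if x: "x \<in> {\<zeta> k<..<\<zeta> (Suc k)}" for x
    proof -
      have "x \<in> {\<tau> p<..<\<tau> q}" using x by (intro sub[OF k]) auto
      from DERIV_cmult[OF f1[OF this], of e] show ?thesis using e(1) by (elim disjE) (simp_all add: algebra_simps)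
    qed
    have c4: "(e * f1 x)\<^sup>2 = energy_poly e (e * c) d (e * f x)" if x: "x \<in> {\<zeta> k<..<\<zeta> (Suc k)}" for x
    proof -
      have "x \<in> {\<tau> p<..<\<tau> q}" using x by (intro sub[OF k]) auto
      from fen[OF this] show ?thesis using e(1) by (elim disjE) (simp_all add: energy_poly_def)
    qed
    obtain a' where a': "0 < a'" "energy_poly e (e * c) d a' = 0"
      "\<forall>y. 0 < y \<longrightarrow> y < a' \<longrightarrow> 0 < energy_poly e (e * c) d y"
      "\<zeta> (Suc k) - \<zeta> k = 2 * tsing e a' (3 * d / (2 * a'\<^sup>2))"
      "((\<lambda>t. e * f t) has_integral 2 * fsing e a' (3 * d / (2 * a'\<^sup>2))) {\<zeta> k..\<zeta> (Suc k)}"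
      using bump[OF e(1) \<zeta>less[OF k] c1 e0 e1 c2 c3 c4 d] by blast
    have fr: "first_root e (e * c) d a'" using a' by (simp add: first_root_def)
    have "((\<lambda>t. e * (e * f t)) has_integral e * (2 * fsing e a' (3 * d / (2 * a'\<^sup>2)))) {\<zeta> k..\<zeta> (Suc k)}"
      by (intro has_integral_mult_right a')
    then have I: "(f has_integral e * (2 * fsing e a' (3 * d / (2 * a'\<^sup>2)))) {\<zeta> k..\<zeta> (Suc k)}"
      unfolding mult.assoc[symmetric] e(2) by simp
    show ?thesis
    proof (cases "P k")
      case True
      then have "a' = a" using fr rA[OF k True] by (intro first_root_unique[of 1 c d]) (auto simp: e_def)
      then show ?thesis using I a'(4) True by (simp add: e_def T_def S_def)
    next
      case False
      then have "a' = b" using fr rB[OF k False] by (intro first_root_unique[of "-1" "- c" d]) (auto simp: e_def)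
      then show ?thesis using I a'(4) False by (simp add: e_def T_def S_def)
    qed
  qed
  have tele: "n \<le> N \<Longrightarrow> \<zeta> 0 \<le> \<zeta> n \<and> \<zeta> n - \<zeta> 0 = (\<Sum>k<n. T k) \<and> (f has_integral (\<Sum>k<n. S k)) {\<zeta> 0..\<zeta> n}" for n
  proof (induction n)
    case 0
    then show ?case by (simp add: has_integral_refl)
  next
    case (Suc n)
    then have IH: "\<zeta> 0 \<le> \<zeta> n" "\<zeta> n - \<zeta> 0 = (\<Sum>k<n. T k)" "(f has_integral (\<Sum>k<n. S k)) {\<zeta> 0..\<zeta> n}"
      and n: "n < N" by auto
    have "(f has_integral (\<Sum>k<n. S k) + S n) {\<zeta> 0..\<zeta> (Suc n)}"
      using bumps[OF n] \<zeta>less[OF n] IH by (intro has_integral_combine[of "\<zeta> 0" "\<zeta> n"]) auto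
    then show ?case using IH bumps[OF n] \<zeta>less[OF n] by auto
  qed
  have sums: "(\<Sum>k<N. if P k then x else y) = real i * x + real j * y" for x y :: real
  proof -
    have "{..<N} \<inter> {k. P k} = {k. k < N \<and> P k}" "{..<N} \<inter> - {k. P k} = {k. k < N \<and> \<not> P k}" by auto
    then show ?thesis by (simp add: sum.If_cases i j)
  qed
  have len: "\<zeta> N - \<zeta> 0 = 2 * \<alpha>"
    using tele[of N] unfolding T_def sums \<alpha> by (simp add: algebra_simps)
  have int: "(f has_integral 2 * (real i * fsing 1 a (3 * d / (2 * a\<^sup>2)) - real j * fsing (-1) b (3 * d / (2 * b\<^sup>2)))) {\<zeta> 0..\<zeta> N}"
  proof -
    have "(f has_integral (\<Sum>k<N. S k)) {\<zeta> 0..\<zeta> N}" using tele[OF order_refl] by blast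
    then show ?thesis unfolding S_def sums by (simp add: algebra_simps)
  qed
  \<comment> \<open>The midpoint of the chain, which has length 2 \<alpha> by
    \<open>len\<close>.\<close>
  define m where "m = (\<zeta> 0 + \<zeta> N) / 2"
  have m: "- \<alpha> + m = \<zeta> 0" "\<alpha> + m = \<zeta> N" using len by (auto simp: m_def field_simps)
  define F F1 where "F t = f (m + t)" and "F1 t = f1 (m + t)" for t
  define \<eta> where "\<eta> = min (\<zeta> 0 - \<tau> p) (\<tau> q - \<zeta> N)"
  have \<eta>: "0 < \<eta>" using \<zeta>in[of 0] \<zeta>in[of N] by (auto simp: \<eta>_def)
  have dom: "m + t \<in> {\<tau> p<..<\<tau> q}" if "t \<in> {-\<alpha>-\<eta><..<\<alpha>+\<eta>}" for t
    using that m by (auto simp: \<eta>_def)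
  have shift: "((\<lambda>t. g (m + t)) has_real_derivative D) (at t)" if "(g has_real_derivative D) (at (m + t))" for g D t
    using that DERIV_shift[of g D t m] by (simp add: add.commute)
  have z': "\<zeta> k - m < \<zeta> (Suc k) - m" if "k < N" for k using \<zeta>less[OF that] by simp
  have F0: "F (\<zeta> k - m) = 0" if "k \<le> N" for k using f\<zeta>[OF that] by (simp add: F_def)
  have Fpos: "0 < F t" if "k < N" "P k" "t \<in> {\<zeta> k - m<..<\<zeta> (Suc k) - m}" for k t
    unfolding F_def using that by (intro fpos[of k]) auto
  have Fneg: "F t < 0" if "k < N" "\<not> P k" "t \<in> {\<zeta> k - m<..<\<zeta> (Suc k) - m}" for k t
    unfolding F_def using that by (intro fneg[of k]) auto
  have ends: "\<zeta> 0 - m = - \<alpha>" "\<zeta> N - m = \<alpha>" using m by auto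
  have compP: "card (components {t \<in> {-\<alpha><..<\<alpha>}. 0 < F t}) = i" "finite (components {t \<in> {-\<alpha><..<\<alpha>}. 0 < F t})"
    using components_alternating(2,3)[of N "\<lambda>k. \<zeta> k - m" F P, OF z' F0 Fpos Fneg] unfolding ends i by auto
  have "card (components {t \<in> {\<zeta> 0 - m<..<\<zeta> N - m}. 0 < - F t}) = card {k. k < N \<and> \<not> P k} \<and>
    finite (components {t \<in> {\<zeta> 0 - m<..<\<zeta> N - m}. 0 < - F t})"
    by (intro conjI components_alternating(2,3)[of N "\<lambda>k. \<zeta> k - m" "\<lambda>t. - F t" "\<lambda>k. \<not> P k"])
       (use z' F0 Fpos Fneg in auto)
  then have compN: "card (components {t \<in> {-\<alpha><..<\<alpha>}. F t < 0}) = j" "finite (components {t \<in> {-\<alpha><..<\<alpha>}. F t < 0})"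
    unfolding ends j by auto
  show ?thesis
    unfolding has_profile_def
  proof (rule exI[of _ c], rule exI[of _ F], rule exI[of _ F1], rule exI[of _ \<eta>], intro conjI ballI)
    show "(F has_real_derivative F1 t) (at t)" if "t \<in> {-\<alpha>-\<eta><..<\<alpha>+\<eta>}" for t
      unfolding F_def F1_def by (rule shift[OF f[OF dom[OF that]]])
    show "(F1 has_real_derivative c - 4 * F t - (F t)\<^sup>2) (at t)" if "t \<in> {-\<alpha>-\<eta><..<\<alpha>+\<eta>}" for t
      unfolding F_def F1_def by (rule shift[OF f1[OF dom[OF that]]])
    show "F (- \<alpha>) = 0" "F \<alpha> = 0" using F0[of 0] F0[of N] unfolding ends by auto
    show "(F has_integral 2 * (real i * fsing 1 a (3 * d / (2 * a\<^sup>2)) - real j * fsing (-1) b (3 * d / (2 * b\<^sup>2)))) {-\<alpha>..\<alpha>}"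
    proof -
      have "F = f \<circ> (+) m" by (simp add: fun_eq_iff F_def)
      then show ?thesis using int by (simp only: has_integral_shift_Icc_real m)
    qed
  qed (use \<eta> compP compN in auto)
qed

lemma energy_poly_reflect: "energy_poly (-1) (- c) d y = energy_poly 1 c d (- y)"
  by (simp add: energy_poly_def)

text \<open>The constants \<open>c, d\<close> for which \<open>a, - b, - 6 - a + b\<close> are the roots of the energy polynomial.\<close>
definition energy_c :: "real \<Rightarrow> real \<Rightarrow> real" where
  "energy_c a b = 2 * (a - b) + (a\<^sup>2 - a * b + b\<^sup>2) / 3"

definition energy_d :: "real \<Rightarrow> real \<Rightarrow> real" where
  "energy_d a b = 2/3 * (a * b * (6 + a - b))"

lemma energy_poly_roots:
  "energy_poly 1 (energy_c a b) (energy_d a b) y = 2/3 * ((a - y) * (y + b) * (y + 6 + a - b))"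
  unfolding energy_poly_def energy_c_def energy_d_def
  by (simp add: power2_eq_square power3_eq_cube field_simps)

lemma energy_d_quotients:
  assumes "0 < a" "0 < b"
  shows "3 * energy_d a b / (2 * a\<^sup>2) = b * (6 + a - b) / a"
    "3 * energy_d a b / (2 * b\<^sup>2) = a * (6 + a - b) / b"
  using assms by (simp_all add: energy_d_def power2_eq_square divide_simps)

lemma tsing_mixed:
  assumes "0 < a" "0 < b"
  shows "tsing 1 a (3 * energy_d a b / (2 * a\<^sup>2)) = tpos a b"
    "tsing (-1) b (3 * energy_d a b / (2 * b\<^sup>2)) = tneg a b"
    "fsing 1 a (3 * energy_d a b / (2 * a\<^sup>2)) = fpos a b"
    "fsing (-1) b (3 * energy_d a b / (2 * b\<^sup>2)) = - fneg a b"
  unfolding energy_d_quotients[OF assms] tsing_def fsing_def tpos_def tneg_def fpos_def fneg_def by simp_all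

lemma first_root_mixed:
  assumes "0 < a" "0 < b" "b < 3 + a / 2"
  shows "first_root 1 (energy_c a b) (energy_d a b) a" "first_root (-1) (- energy_c a b) (energy_d a b) b"
proof -
  have "0 < 2/3 * ((a - y) * (y + b) * (y + 6 + a - b))" if "0 < y" "y < a" for y
    using assms that by (intro mult_pos_pos) auto
  then show "first_root 1 (energy_c a b) (energy_d a b) a"
    using assms unfolding first_root_def energy_poly_roots by auto
  have "0 < 2/3 * ((a - - y) * (- y + b) * (- y + 6 + a - b))" if "0 < y" "y < b" for y
    using assms that by (intro mult_pos_pos) auto
  then show "first_root (-1) (- energy_c a b) (energy_d a b) b"
    using assms unfolding first_root_def energy_poly_reflect energy_poly_roots by auto
qed

text \<open>Two roots fix the cubic: the difference of the two root equations is divisible by a + b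
  and yields c, and then d follows. Admissibility puts - b strictly above the third root.\<close>

lemma energy_of_extrema:
  assumes a: "0 < a" "energy_poly 1 c d a = 0" and b: "0 < b" "energy_poly (-1) (- c) d b = 0"
    and adm: "admissible (-1 * b) (6 + -1 * b) (3 * d / (2 * b\<^sup>2))"
  shows "d = energy_d a b" "b < 3 + a / 2"
proof -
  have 1: "d = 4 * a\<^sup>2 + 2/3 * a ^ 3 - 2 * c * a" "d = 4 * b\<^sup>2 - 2/3 * b ^ 3 + 2 * c * b"
    using a(2) b(2) by (auto simp: energy_poly_def)
  have "(a + b) * (2 * c) = (a + b) * (2 * energy_c a b)"
    using 1 unfolding energy_c_def by (simp add: power2_eq_square power3_eq_cube field_simps)
  then have "2 * c = 2 * energy_c a b" using a b by (simp only: mult_left_cancel)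
  then have c: "c = energy_c a b" by simp
  show d: "d = energy_d a b"
    unfolding 1(1) c energy_c_def energy_d_def by (simp add: power2_eq_square power3_eq_cube field_simps)
  have "0 < 6 - 2 * b + a * (6 + a - b) / b"
    using adm a b unfolding d energy_d_quotients[OF a(1) b(1)] by (simp add: admissible_def slope_def)
  also have "\<dots> = (a / b + 1) * (6 + a - 2 * b)" using b by (simp add: field_simps)
  finally have "0 < (a / b + 1) * (6 + a - 2 * b)" .
  moreover have "0 < a / b + 1" using a b by (intro add_pos_pos divide_pos_pos) auto
  ultimately show "b < 3 + a / 2" by (simp add: zero_less_mult_iff)
qed

text \<open>The offset \<open>s\<close> records the sign of the first bump of a chain, even for
  positive.\<close>

lemma card_parity:
  "card {k. k < 2 * m \<and> even (s + k)} = m" "card {k. k < 2 * m \<and> odd (s + k)} = m" for s m :: nat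
proof (induction m)
  case (Suc m)
  have e: "{k. k < 2 * Suc m \<and> even (s + k)} = insert (if even s then 2 * m else Suc (2 * m)) {k. k < 2 * m \<and> even (s + k)}"
    by (auto simp: less_Suc_eq)
  have o: "{k. k < 2 * Suc m \<and> odd (s + k)} = insert (if even s then Suc (2 * m) else 2 * m) {k. k < 2 * m \<and> odd (s + k)}"
    by (auto simp: less_Suc_eq)
  show "card {k. k < 2 * Suc m \<and> even (s + k)} = Suc m" "card {k. k < 2 * Suc m \<and> odd (s + k)} = Suc m"
    unfolding e o using Suc by (auto simp: card_insert_if)
qed simp_all

lemma card_parity_odd:
  fixes s m :: nat
  shows "card {k. k < Suc (2 * m) \<and> even (s + k)} = (if even s then Suc m else m)"
    "card {k. k < Suc (2 * m) \<and> odd (s + k)} = (if even s then m else Suc m)"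
proof -
  have e: "{k. k < Suc (2 * m) \<and> even (s + k)} = (if even s then insert (2 * m) else id) {k. k < 2 * m \<and> even (s + k)}"
    by (auto simp: less_Suc_eq)
  have o: "{k. k < Suc (2 * m) \<and> odd (s + k)} = (if even s then id else insert (2 * m)) {k. k < 2 * m \<and> odd (s + k)}"
    by (auto simp: less_Suc_eq)
  show "card {k. k < Suc (2 * m) \<and> even (s + k)} = (if even s then Suc m else m)"
    unfolding e using card_parity(1)[of m s] by (auto simp: card_insert_if)
  show "card {k. k < Suc (2 * m) \<and> odd (s + k)} = (if even s then m else Suc m)"
    unfolding o using card_parity(2)[of m s] by (auto simp: card_insert_if)
qed

lemma sin_square_shift: "(sin (y - real m * pi))\<^sup>2 = (sin y)\<^sup>2"
proof -
  have "sin (y - real m * pi) = sin y * (- 1) ^ m"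
    by (simp add: sin_diff sin_npi cos_npi)
  then show ?thesis by (simp add: power_mult_distrib flip: power_mult)
qed

lemma sin_square_less:
  assumes "0 < w" "w < pi / 2" "\<bar>u\<bar> < w"
  shows "(sin u)\<^sup>2 < (sin w)\<^sup>2"
proof -
  have "sin \<bar>u\<bar> < sin w" "0 \<le> sin \<bar>u\<bar>" using assms by (auto intro!: sin_monotone_2pi sin_ge_zero)
  then have "(sin \<bar>u\<bar>)\<^sup>2 < (sin w)\<^sup>2" by (intro power_strict_mono) auto
  then show ?thesis by (simp add: abs_if split: if_splits)
qed

lemma sin_square_greater:
  assumes "0 < w" "w < pi / 2" "w < u" "u < pi - w"
  shows "(sin w)\<^sup>2 < (sin u)\<^sup>2"
proof -
  have "sin w < sin u"
  proof (cases "u \<le> pi / 2")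
    case False
    have "sin w < sin (pi - u)" using assms False by (intro sin_monotone_2pi) auto
    then show ?thesis by simp
  qed (use assms in \<open>auto intro!: sin_monotone_2pi\<close>)
  moreover have "0 < sin w" using assms by (intro sin_gt_zero) auto
  ultimately show ?thesis by (intro power_strict_mono) auto
qed

text \<open>The substitution \<open>f = a - (a + b) sin\<^sup>2 y\<close> turns the first-order equation into
  \<open>y'\<^sup>2 = (6 + 2 a - b - (a + b) sin\<^sup>2 y) / 6\<close>, whose right-hand side has no zeros.\<close>
lemma mixed_profile_exists:
  assumes ab: "0 < a" "0 < b" "b < 3 + a / 2" and ij: "i = j \<or> j = Suc i \<or> i = Suc j"
    and T: "ttot i j a b = \<alpha>"
  shows "has_profile \<alpha> i j (ftot i j a b)"
proof -
  \<comment> \<open>The chain starts with a negative bump exactly if there is one more of that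
    sign.\<close>
  define s where "s = (if j = Suc i then 1 else 0 :: nat)"
  define N where "N = i + j"
  have cards: "card {k. k < N \<and> even (s + k)} = i" "card {k. k < N \<and> odd (s + k)} = j"
  proof -
    consider "i = j" "s = 0" "N = 2 * j" | "j = Suc i" "s = 1" "N = Suc (2 * i)" | "i = Suc j" "s = 0" "N = Suc (2 * j)"
      using ij by (auto simp: s_def N_def)
    then show "card {k. k < N \<and> even (s + k)} = i" "card {k. k < N \<and> odd (s + k)} = j"
      using card_parity[of j 0] card_parity_odd[of i 1] card_parity_odd[of j 0] by (cases; simp)+
  qed
  \<comment> \<open>\<phi> vanishes where the square of sin y is a / (a + b), that is at m pi - w
    and m pi + w.\<close>
  define w where "w = arcsin (sqrt (a / (a + b)))"
  have sw: "sin w = sqrt (a / (a + b))" unfolding w_def using ab by (intro sin_arcsin) (auto simp: order_trans[of "-1" 0])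
  have sw2: "(sin w)\<^sup>2 = a / (a + b)" using ab by (simp add: sw)
  have w: "0 < w" "w < pi / 2"
  proof -
    have "0 < sqrt (a / (a + b))" "sqrt (a / (a + b)) < 1" using ab by auto
    then show "0 < w" "w < pi / 2"
      using arcsin_less_mono[of 0 "sqrt (a / (a + b))"] arcsin_less_mono[of "sqrt (a / (a + b))" 1] by (auto simp: w_def)
  qed
  \<comment> \<open>The zeros of \<phi> in increasing order from - w on. The arc that follows an
    even index surrounds a multiple of pi, where \<phi> = a, so it is positive.\<close>
  define zz where "zz k = real (k div 2) * pi + (if even k then - w else w)" for k :: nat
  define R where "R y = (6 + 2 * a - b - (a + b) * (sin y)\<^sup>2) / 6" for y
  define R1 where "R1 y = - ((a + b) * (2 * sin y * cos y)) / 6" for y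
  define \<phi> where "\<phi> y = a - (a + b) * (sin y)\<^sup>2" for y
  define \<phi>1 where "\<phi>1 y = - ((a + b) * (2 * sin y * cos y))" for y
  define \<phi>2 where "\<phi>2 y = - ((a + b) * (2 * (cos y * cos y - sin y * sin y)))" for y
  have c2: "(cos y)\<^sup>2 = 1 - (sin y)\<^sup>2" for y :: real by (simp add: cos_squared_eq)
  have ratio: "(a + b) * (a / (a + b)) = a" using ab by simp
  have \<phi>_pos: "0 < \<phi> y" if "\<bar>y - real m * pi\<bar> < w" for y m
  proof -
    have "(sin y)\<^sup>2 < a / (a + b)"
      using sin_square_less[OF w that] unfolding sin_square_shift sw2 .
    then have "(a + b) * (sin y)\<^sup>2 < (a + b) * (a / (a + b))" using ab by (intro mult_strict_left_mono) auto
    then show ?thesis using ratio by (simp add: \<phi>_def)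
  qed
  have \<phi>_neg: "\<phi> y < 0" if "w < y - real m * pi" "y - real m * pi < pi - w" for y m
  proof -
    have "a / (a + b) < (sin y)\<^sup>2"
      using sin_square_greater[OF w that] unfolding sin_square_shift sw2 .
    then have "(a + b) * (a / (a + b)) < (a + b) * (sin y)\<^sup>2" using ab by (intro mult_strict_left_mono) auto
    then show ?thesis using ratio by (simp add: \<phi>_def)
  qed
  have zz_even: "zz (2 * m) = real m * pi - w" "zz (Suc (2 * m)) = real m * pi + w" for m
    by (auto simp: zz_def)
  have parity_cases: thesis if "\<And>m. k = 2 * m \<Longrightarrow> thesis" "\<And>m. k = Suc (2 * m) \<Longrightarrow> thesis" for k :: nat and thesis
    using that by (metis oddE Suc_eq_plus1 evenE)
  have zz0: "\<phi> (zz k) = 0" for k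
  proof -
    have "(sin (zz k))\<^sup>2 = (sin w)\<^sup>2"
      unfolding sin_square_shift[of "zz k" "k div 2", symmetric] by (simp add: zz_def)
    then show ?thesis using ratio by (simp add: \<phi>_def sw2)
  qed
  have zzless: "zz k < zz (Suc k)" for k
    by (rule parity_cases[of k]) (use w zz_even in \<open>auto simp: zz_def algebra_simps\<close>)
  have zzrange: "- pi < zz k" "zz k < (real k + 1) * pi" for k
  proof -
    have X: "0 \<le> real (k div 2) * pi" "real (k div 2) * pi \<le> real k * pi" by (auto intro!: mult_right_mono)
    have "zz k = real (k div 2) * pi - w \<or> zz k = real (k div 2) * pi + w" by (simp add: zz_def)
    then show "- pi < zz k" "zz k < (real k + 1) * pi"
      unfolding distrib_right mult_1 using X w by (elim disjE; linarith)+
  qed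
  have zzpos: "0 < \<phi> y" if "even k" "y \<in> {zz k<..<zz (Suc k)}" for k y
  proof -
    obtain m where m: "k = 2 * m" using \<open>even k\<close> by (elim evenE)
    show ?thesis using that(2) unfolding m zz_even by (intro \<phi>_pos[where y = y and m = m]) (auto simp: abs_if)
  qed
  have zzneg: "\<phi> y < 0" if "odd k" "y \<in> {zz k<..<zz (Suc k)}" for k y
  proof -
    obtain m where m: "k = Suc (2 * m)" using \<open>odd k\<close> by (elim oddE) simp
    have "zz (Suc k) = (real m * pi + pi) - w" using zz_even(1)[of "Suc m"] by (simp add: m distrib_right)
    then show ?thesis using that(2) unfolding m zz_even by (intro \<phi>_neg[where y = y and m = m]) auto
  qed
  have main: "has_profile \<alpha> i j (2 * (real i * fsing 1 a (3 * energy_d a b / (2 * a\<^sup>2))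
      - real j * fsing (-1) b (3 * energy_d a b / (2 * b\<^sup>2))))"
  proof (rule arcs_profile[where R = R and ?R1.0 = R1 and \<phi> = \<phi> and ?\<phi>1.0 = \<phi>1 and ?\<phi>2.0 = \<phi>2
        and c = "energy_c a b" and p = "- pi" and q = "(real (s + N) + 1) * pi" and N = N
        and z = "\<lambda>k. zz (s + k)" and P = "\<lambda>k. even (s + k)"])
    have "0 < (real (s + N) + 1) * pi" by simp
    then show "- pi < (real (s + N) + 1) * pi" using pi_gt_zero by linarith
    show "continuous_on {- pi..(real (s + N) + 1) * pi} R" unfolding R_def by (intro continuous_intros) auto
    show "0 < R y" for y
    proof -
      have "(sin y)\<^sup>2 \<le> 1" by (simp add: abs_square_le_1)
      then have "(a + b) * (sin y)\<^sup>2 \<le> (a + b) * 1" using ab by (intro mult_left_mono) auto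
      also have "\<dots> < 6 + 2 * a - b" using ab by simp
      finally show ?thesis by (simp add: R_def)
    qed
    have sq: "((\<lambda>y. (sin y)\<^sup>2) has_real_derivative 2 * sin y * cos y) (at y)" for y :: real
      using DERIV_power[OF DERIV_sin[of y], of 2] by (simp add: mult_ac)
    show "(R has_real_derivative R1 y) (at y)" for y
      unfolding R_def R1_def
      using DERIV_cdivide[OF DERIV_diff[OF DERIV_const[of "6 + 2 * a - b"] DERIV_cmult[OF sq[of y], of "a + b"]], of 6] by simp
    show "(\<phi> has_real_derivative \<phi>1 y) (at y)" for y
      unfolding \<phi>_def \<phi>1_def
      using DERIV_diff[OF DERIV_const[of a] DERIV_cmult[OF sq[of y], of "a + b"]] by simp
    show "(\<phi>1 has_real_derivative \<phi>2 y) (at y)" for y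
      unfolding \<phi>1_def \<phi>2_def
      by (auto intro!: derivative_eq_intros simp: algebra_simps)
    show "\<phi>2 y * R y + \<phi>1 y * R1 y / 2 = energy_c a b - 4 * \<phi> y - (\<phi> y)\<^sup>2" for y
    proof -
      define S where "S = (sin y)\<^sup>2"
      have p: "\<phi>2 y = - ((a + b) * (2 * (1 - 2 * S)))"
        using c2[of y] unfolding \<phi>2_def S_def by (simp add: power2_eq_square)
      have "\<phi>1 y * R1 y = (a + b)\<^sup>2 * 4 / 6 * ((sin y)\<^sup>2 * (cos y)\<^sup>2)"
        unfolding \<phi>1_def R1_def by (simp add: power2_eq_square)
      then have q: "\<phi>1 y * R1 y = (a + b)\<^sup>2 * 4 / 6 * (S * (1 - S))" unfolding c2 S_def .
      show ?thesis unfolding p q R_def \<phi>_def S_def[symmetric] energy_c_def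
        by (simp add: power2_eq_square field_simps)
    qed
    show "(\<phi>1 y)\<^sup>2 * R y = energy_poly 1 (energy_c a b) (energy_d a b) (\<phi> y)" for y
    proof -
      define S where "S = (sin y)\<^sup>2"
      have "(\<phi>1 y)\<^sup>2 = (a + b)\<^sup>2 * 4 * ((sin y)\<^sup>2 * (cos y)\<^sup>2)"
        unfolding \<phi>1_def by (simp add: power2_eq_square)
      then have p: "(\<phi>1 y)\<^sup>2 = (a + b)\<^sup>2 * 4 * (S * (1 - S))" unfolding c2 S_def .
      show ?thesis unfolding energy_poly_roots p R_def \<phi>_def S_def[symmetric]
        by (simp add: power2_eq_square field_simps)
    qed
    show "0 \<le> energy_d a b" unfolding energy_d_def using ab by auto
    show "zz (s + k) \<in> {- pi<..<(real (s + N) + 1) * pi}" if "k \<le> N" for k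
    proof -
      have "(real (s + k) + 1) * pi \<le> (real (s + N) + 1) * pi" using that by (intro mult_right_mono) auto
      from less_le_trans[OF zzrange(2) this] show ?thesis using zzrange(1)[of "s + k"] by simp
    qed
    show "\<alpha> = real i * tsing 1 a (3 * energy_d a b / (2 * a\<^sup>2)) + real j * tsing (-1) b (3 * energy_d a b / (2 * b\<^sup>2))"
      using T by (simp add: tsing_mixed ab ttot_def)
    show "0 < \<phi> y" if "even (s + k)" "y \<in> {zz (s + k)<..<zz (s + Suc k)}" for k y
      using that(2) by (intro zzpos[OF that(1)]) simp
    show "\<phi> y < 0" if "odd (s + k)" "y \<in> {zz (s + k)<..<zz (s + Suc k)}" for k y
      using that(2) by (intro zzneg[OF that(1)]) simp
    show "i = card {k. k < N \<and> even (s + k)}" "j = card {k. k < N \<and> odd (s + k)}"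
      by (simp_all only: cards)
  qed (use zz0 zzless first_root_mixed[OF ab] in auto)
  then show ?thesis by (simp add: tsing_mixed ab ftot_def)
qed

text \<open>For a single bump, \<open>f = \<plusminus> (a - y\<^sup>2)\<close> desingularises the first-order equation at the maximum.\<close>
lemma single_profile_exists:
  assumes e: "e = 1 \<or> e = -1" and a: "0 < a" and g: "0 < g" and adm: "admissible (e * a) (6 + e * a) g"
    and T: "tsing e a g = \<alpha>"
  shows "has_profile \<alpha> (if e = 1 then 1 else 0) (if e = 1 then 0 else 1) (e * (2 * fsing e a g))"
proof -
  \<comment> \<open>The constant for which a is a root of the cubic whose value at zero is
    \<open>d\<close>. The equation for f itself has the constant e c0.\<close>
  define c0 where "c0 = (6 * a + e * a\<^sup>2 - a * g) / 3"
  define d where "d = 2/3 * a\<^sup>2 * g"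
  have dg: "3 * d / (2 * a\<^sup>2) = g" using a by (simp add: d_def)
  have c0: "3 * c0 = 6 * a + e * a\<^sup>2 - a * g" by (simp add: c0_def)
  have "energy_poly e c0 d a = 4 * a\<^sup>2 * 0"
  proof -
    have "energy_poly e c0 d a = 2/3 * a * (a * g + 3 * c0 - 6 * a - e * a\<^sup>2)"
      by (simp add: energy_poly_def d_def power2_eq_square power3_eq_cube algebra_simps)
    then show ?thesis by (simp add: c0)
  qed
  then have root: "energy_poly e c0 d a = 0" by simp
  have fac: "energy_poly e c0 d y = 2/3 * a\<^sup>2 * ((1 - y / a) * quadr (e * a) (6 + e * a) g (y / a))" for y
    using energy_poly_factor[OF _ root, of y] a by (simp add: dg)
  have fr: "first_root e c0 d a"
    unfolding first_root_def
  proof (intro conjI allI impI)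
    fix y assume y: "0 < y" "y < a"
    then have "0 < quadr (e * a) (6 + e * a) g (y / a)" using adm by (intro quadr_pos) auto
    then show "0 < energy_poly e c0 d y" unfolding fac using y a by (intro mult_pos_pos) auto
  qed (use a root in auto)
  define q where "q x = e * x\<^sup>2 + (6 + e * a) * x + a * g" for x
  have qq: "q x = a * quadr (e * a) (6 + e * a) g (x / a)" for x
    using a by (simp add: q_def quadr_def power2_eq_square field_simps)
  have qpos: "0 < q x" if "0 \<le> x" "x \<le> a" for x
  proof (cases "x = 0")
    case True
    then show ?thesis using a g by (simp add: q_def)
  next
    case False
    then have "0 < quadr (e * a) (6 + e * a) g (x / a)" using that adm a by (intro quadr_pos) auto
    then show ?thesis unfolding qq using a by simp
  qed
  \<comment> \<open>Since q 0 = a g > 0, q stays positive slightly below 0, and the profile can be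
    continued beyond the ends of its bump.\<close>
  obtain h where h: "h > 0" "\<And>x. - h \<le> x \<Longrightarrow> x \<le> 0 \<Longrightarrow> 0 < q x"
  proof -
    have "isCont q 0" unfolding q_def by (intro continuous_intros)
    then have "eventually (\<lambda>x. 0 < q x) (at 0)"
      using qpos[of 0] a unfolding isCont_def by (auto dest: order_tendstoD(1))
    then obtain h where h: "h > 0" "\<And>x. x \<noteq> 0 \<Longrightarrow> \<bar>x\<bar> < h \<Longrightarrow> 0 < q x"
      unfolding eventually_at by (auto simp: dist_real_def)
    show thesis
    proof (rule that[of "h / 2"])
      fix x assume "- (h / 2) \<le> x" "x \<le> 0"
      then show "0 < q x" using h qpos[of 0] a by (cases "x = 0") auto
    qed (use h in simp)
  qed
  define Y where "Y = sqrt (a + h)"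
  have Y: "sqrt a < Y" "0 < Y" using a h by (auto simp: Y_def)
  have y2: "- h \<le> a - y\<^sup>2" "a - y\<^sup>2 \<le> a" if "y \<in> {- Y..Y}" for y
  proof -
    have "\<bar>y\<bar> \<le> Y" using that by auto
    then have "y\<^sup>2 \<le> Y\<^sup>2" using abs_le_square_iff[of y Y] Y by simp
    then show "- h \<le> a - y\<^sup>2" using a h by (simp add: Y_def)
  qed simp
  define R where "R y = q (a - y\<^sup>2) / 6" for y
  define R1 where "R1 y = (e * (2 * (a - y\<^sup>2) * (- 2 * y)) + (6 + e * a) * (- 2 * y)) / 6" for y
  define c where "c = e * c0"
  have ee: "e * e = 1" using e by auto
  have ec: "e * c = c0" unfolding c_def mult.assoc[symmetric] ee by simp
  define z where "z k = (if k = 0 then - sqrt a else sqrt a)" for k :: nat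
  have refl: "energy_poly 1 c d (e * x) = energy_poly e c0 d x" for x
    using e unfolding c_def energy_poly_def by (elim disjE) simp_all
  have inside: "0 < a - y\<^sup>2" if "- sqrt a < y" "y < sqrt a" for y
  proof -
    have "\<bar>y\<bar> < sqrt a" using that by auto
    then have "\<bar>y\<bar>\<^sup>2 < (sqrt a)\<^sup>2" by (intro power_strict_mono) auto
    then show ?thesis using a by simp
  qed
  have main: "has_profile \<alpha> (if e = 1 then 1 else 0) (if e = 1 then 0 else 1)
    (2 * (real (if e = 1 then 1 else 0) * fsing 1 a (3 * d / (2 * a\<^sup>2)) - real (if e = 1 then 0 else 1) * fsing (-1) a (3 * d / (2 * a\<^sup>2))))"
  proof (rule arcs_profile[where R = R and ?R1.0 = R1 and \<phi> = "\<lambda>y. e * (a - y\<^sup>2)" and ?\<phi>1.0 = "\<lambda>y. e * (- 2 * y)"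
        and ?\<phi>2.0 = "\<lambda>y. - 2 * e" and c = c and p = "- Y" and q = Y and N = 1 and z = z and P = "\<lambda>k. e = 1"])
    show "- Y < Y" using Y by simp
    show "continuous_on {- Y..Y} R" unfolding R_def q_def by (intro continuous_intros) auto
    show "0 < R y" if "y \<in> {- Y..Y}" for y
      using y2[OF that] h(2)[of "a - y\<^sup>2"] qpos[of "a - y\<^sup>2"] unfolding R_def by (cases "a - y\<^sup>2 \<le> 0") auto
    show "(R has_real_derivative R1 y) (at y)" for y
      unfolding R_def R1_def q_def by (auto intro!: derivative_eq_intros simp: power2_eq_square field_simps)
    show "((\<lambda>y. e * (a - y\<^sup>2)) has_real_derivative e * (- 2 * y)) (at y)" for y
      by (auto intro!: derivative_eq_intros)
    show "((\<lambda>y. e * (- 2 * y)) has_real_derivative - 2 * e) (at y)" for y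
      by (auto intro!: derivative_eq_intros)
    show "- 2 * e * R y + e * (- 2 * y) * R1 y / 2 = c - 4 * (e * (a - y\<^sup>2)) - (e * (a - y\<^sup>2))\<^sup>2" for y
    proof -
      define x where "x = a - y\<^sup>2"
      have y: "y * y = a - x" by (simp add: x_def power2_eq_square)
      have "y * R1 y = - ((y * y) * (2 * e * x + 6 + e * a)) / 3"
        unfolding R1_def x_def[symmetric] by (simp add: field_simps)
      then have yR: "y * R1 y = - ((a - x) * (2 * e * x + 6 + e * a)) / 3" unfolding y .
      have "- 2 * e * R y + e * (- 2 * y) * R1 y / 2 = - (e * (q x / 3)) - e * (y * R1 y)"
        by (simp add: R_def x_def)
      also have "\<dots> = e * (((a - x) * (2 * e * x + 6 + e * a)) / 3 - q x / 3)"
        unfolding yR by (simp add: field_simps)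
      also have "\<dots> = e * (c0 - 4 * x) - (e * e) * x\<^sup>2"
        unfolding q_def c0_def by (simp add: power2_eq_square field_simps)
      finally show ?thesis unfolding x_def[symmetric] c_def by (simp add: power2_eq_square algebra_simps)
    qed
    show "(e * (- 2 * y))\<^sup>2 * R y = energy_poly 1 c d (e * (a - y\<^sup>2))" for y
    proof -
      define x where "x = a - y\<^sup>2"
      have y: "y\<^sup>2 = a - x" by (simp add: x_def)
      have "(e * (- 2 * y))\<^sup>2 = (e * e) * (4 * y\<^sup>2)" by (simp add: power2_eq_square)
      then have "(e * (- 2 * y))\<^sup>2 * R y = 2/3 * ((a - x) * q x)"
        unfolding ee y R_def x_def[symmetric] by simp
      also have "(a - x) * q x = a\<^sup>2 * ((1 - x / a) * quadr (e * a) (6 + e * a) g (x / a))"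
        unfolding qq using a by (simp add: power2_eq_square field_simps)
      finally show ?thesis unfolding refl x_def[symmetric] fac by simp
    qed
    show "0 \<le> d" using g by (simp add: d_def)
    show "\<alpha> = real (if e = 1 then 1 else 0) * tsing 1 a (3 * d / (2 * a\<^sup>2)) + real (if e = 1 then 0 else 1) * tsing (-1) a (3 * d / (2 * a\<^sup>2))"
      using T e by (auto simp: dg)
    show "z k \<in> {- Y<..<Y}" "e * (a - (z k)\<^sup>2) = 0" for k
    proof -
      have "0 < sqrt a" using a by simp
      then have "- sqrt a < Y" "- Y < sqrt a" using Y by linarith+
      then show "z k \<in> {- Y<..<Y}" "e * (a - (z k)\<^sup>2) = 0" using Y a by (auto simp: z_def)
    qed
    show "z k < z (Suc k)" if "k < 1" for k using that a by (auto simp: z_def)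
    show "0 < e * (a - y\<^sup>2)" if "k < 1" "e = 1" "y \<in> {z k<..<z (Suc k)}" for k y
      using that inside[of y] by (auto simp: z_def)
    show "e * (a - y\<^sup>2) < 0" if "k < 1" "e \<noteq> 1" "y \<in> {z k<..<z (Suc k)}" for k y
      using that inside[of y] e by (auto simp: z_def)
    show "first_root 1 c d a" if "e = 1" using fr that by (simp add: c_def)
    show "first_root (-1) (- c) d a" if "e \<noteq> 1"
      using fr that e by (auto simp: c_def)
  qed auto
  then show ?thesis using e by (auto simp: dg)
qed

section \<open>Radial fields on the sector\<close>

lemma Ck_on_cong:
  assumes "open S" "\<And>x. x \<in> S \<Longrightarrow> f x = g x" "Ck_on k f S"
  shows "Ck_on k g S"
  using assms
proof (induction k arbitrary: f g)
  case 0
  then show ?case using continuous_on_eq[of S f g] by simp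
next
  case (Suc k)
  have der: "(g has_derivative frechet_derivative f (at x)) (at x)" if "x \<in> S" for x
  proof (rule has_derivative_transform_within_open[OF _ Suc.prems(1) that])
    have "f differentiable (at x)" using Suc.prems(3) that by simp
    then show "(f has_derivative frechet_derivative f (at x)) (at x)" by (simp add: frechet_derivative_works)
  qed (rule Suc.prems(2))
  have eq: "frechet_derivative f (at x) v = frechet_derivative g (at x) v" if "x \<in> S" for x v
    using frechet_derivative_at[OF der[OF that]] by simp
  show ?case
    unfolding Ck_on.simps
  proof (intro conjI ballI allI)
    show "g differentiable (at x)" if "x \<in> S" for x using der[OF that] unfolding differentiable_def by blast
    show "Ck_on k (\<lambda>x. frechet_derivative g (at x) v) S" for v
      using Suc.IH[of "\<lambda>x. frechet_derivative f (at x) v" "\<lambda>x. frechet_derivative g (at x) v"] Suc.prems eq by simp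
  qed
qed

section \<open>The polar angle and the geometry of the sector\<close>

definition sq :: "real^2 \<Rightarrow> real" where
  "sq x = (x $ 1)\<^sup>2 + (x $ 2)\<^sup>2"

definition ang :: "real^2 \<Rightarrow> real" where
  "ang x = Im (Ln (Complex (x $ 1) (x $ 2)))"

text \<open>The plane without the closed negative half axis, on which the principal argument
  \<open>ang\<close> is smooth. Because \<alpha> < pi, it contains the closed sector minus its
  vertex.\<close>

definition slit :: "(real^2) set" where
  "slit = {x. - norm x < x $ 1}"

lemma norm_real2: "norm (x :: real^2) = sqrt (sq x)"
  by (simp add: norm_vec_def L2_set_def sum_2 sq_def)

lemma sq_polar: "sq (polar r \<theta>) = r\<^sup>2"
  by (simp add: sq_def polar_def power_mult_distrib flip: distrib_left)

lemma norm_polar: "0 < r \<Longrightarrow> norm (polar r \<theta>) = r"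
  by (simp add: norm_real2 sq_polar)

lemma sq_pos: "x \<noteq> 0 \<Longrightarrow> 0 < sq x"
  using norm_real2[of x] zero_less_norm_iff[of x] by simp

lemma open_slit: "open slit"
  unfolding slit_def by (intro open_Collect_less continuous_intros)

lemma slit_nonzero: "x \<in> slit \<Longrightarrow> x \<noteq> 0"
  by (auto simp: slit_def)

lemma slit_complex: "x \<in> slit \<Longrightarrow> Complex (x $ 1) (x $ 2) \<notin> \<real>\<^sub>\<le>\<^sub>0"
proof
  assume x: "x \<in> slit" "Complex (x $ 1) (x $ 2) \<in> \<real>\<^sub>\<le>\<^sub>0"
  then have "x $ 2 = 0" "x $ 1 \<le> 0" by (auto simp: complex_nonpos_Reals_iff)
  then have "norm x = - x $ 1" by (simp add: norm_real2 sq_def)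
  then show False using x by (simp add: slit_def)
qed

lemma ang_polar: "0 < r \<Longrightarrow> - pi < \<theta> \<Longrightarrow> \<theta> < pi \<Longrightarrow> ang (polar r \<theta>) = \<theta>"
proof -
  assume r: "0 < r" "- pi < \<theta>" "\<theta> < pi"
  have "Complex (polar r \<theta> $ 1) (polar r \<theta> $ 2) = exp (Complex (ln r) \<theta>)"
    using r by (simp add: complex_eq_iff polar_def Re_exp Im_exp)
  then show ?thesis using r by (simp add: ang_def Ln_exp)
qed

lemma polar_ang:
  assumes "x \<in> slit"
  shows "polar (norm x) (ang x) = x" "- pi < ang x" "ang x < pi"
proof -
  let ?z = "Complex (x $ 1) (x $ 2)"
  have z: "?z \<noteq> 0" using slit_complex[OF assms] by auto
  have n: "cmod ?z = norm x" by (simp add: norm_real2 sq_def cmod_def)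
  have "exp (Ln ?z) = ?z" using z by simp
  then have "x $ 1 = exp (Re (Ln ?z)) * cos (ang x)" "x $ 2 = exp (Re (Ln ?z)) * sin (ang x)"
    unfolding ang_def using Re_exp[of "Ln ?z"] Im_exp[of "Ln ?z"] by simp_all
  moreover have "0 < norm x" using z unfolding n[symmetric] by simp
  then have "exp (Re (Ln ?z)) = norm x" using z by (simp add: Re_Ln n)
  ultimately show "polar (norm x) (ang x) = x" by (simp add: vec_eq_iff forall_2 polar_def)
  show "- pi < ang x" using mpi_less_Im_Ln[OF z] by (simp add: ang_def)
  have "Im (Ln ?z) \<noteq> pi" using slit_complex[OF assms] z Im_Ln_eq_pi[OF z] by (auto simp: complex_nonpos_Reals_iff)
  then show "ang x < pi" using Im_Ln_le_pi[OF z] by (simp add: ang_def)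
qed

lemma has_derivative_nth: "((\<lambda>x::real^2. x $ i) has_derivative (\<lambda>v. v $ i)) (at x within S)"
  by (rule bounded_linear_imp_has_derivative[OF bounded_linear_vec_nth])

text \<open>The complex logarithm has derivative 1 / z, and the imaginary part of v / z is the
  formula stated.\<close>

lemma has_derivative_ang:
  assumes "x \<in> slit"
  shows "(ang has_derivative (\<lambda>v. (x $ 1 * v $ 2 - x $ 2 * v $ 1) / sq x)) (at x)"
proof -
  let ?z = "Complex (x $ 1) (x $ 2)"
  let ?c = "\<lambda>v::real^2. Complex (v $ 1) (v $ 2)"
  have cz: "?c v = complex_of_real (v $ 1) + \<i> * complex_of_real (v $ 2)" for v by (simp add: complex_eq_iff)
  have "(?c has_derivative ?c) (at x)"
    unfolding cz by (auto intro!: derivative_eq_intros has_derivative_nth)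
  moreover have "(Ln has_derivative (\<lambda>w. inverse ?z * w)) (at ?z)"
    using has_field_derivative_Ln[OF slit_complex[OF assms]] unfolding has_field_derivative_def .
  ultimately have "((\<lambda>v. Ln (?c v)) has_derivative (\<lambda>v. inverse ?z * ?c v)) (at x)"
    by (rule has_derivative_compose)
  then have "((\<lambda>v. Im (Ln (?c v))) has_derivative (\<lambda>v. Im (inverse ?z * ?c v))) (at x)"
    by (rule has_derivative_Im)
  moreover have "Im (inverse ?z * ?c v) = (x $ 1 * v $ 2 - x $ 2 * v $ 1) / sq x" for v
    unfolding inverse_eq_divide mult.commute[of "1 / ?z"] by (simp add: sq_def Im_divide mult.commute)
  ultimately show ?thesis unfolding ang_def[abs_def] by simp
qed

text \<open>Cosine decreases on [0, pi], so the condition on the angle becomes a strict inequality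
  between continuous functions of x. Openness and a bound for the closure can then be read
  off.\<close>

lemma sector_eq:
  assumes "0 < \<alpha>" "\<alpha> < pi"
  shows "sector \<alpha> = {x. norm x * cos \<alpha> < x $ 1}"
proof (intro set_eqI iffI)
  fix x assume "x \<in> sector \<alpha>"
  then obtain r \<theta> where x: "x = polar r \<theta>" "r > 0" "- \<alpha> < \<theta>" "\<theta> < \<alpha>" by (auto simp: sector_def)
  have "cos \<alpha> < cos \<bar>\<theta>\<bar>" using x assms by (intro cos_monotone_0_pi) auto
  then have "r * cos \<alpha> < r * cos \<theta>" using x by (simp add: abs_if split: if_splits)
  then show "x \<in> {x. norm x * cos \<alpha> < x $ 1}" using x by (simp add: norm_polar) (simp add: polar_def)
next
  fix x :: "real^2" assume "x \<in> {x. norm x * cos \<alpha> < x $ 1}"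
  then have x: "norm x * cos \<alpha> < x $ 1" by simp
  then have nz: "0 < norm x" by (cases "x = 0") auto
  have "- 1 < cos \<alpha>" using cos_monotone_0_pi[of \<alpha> pi] assms by simp
  then have "- norm x < norm x * cos \<alpha>" using nz mult_strict_left_mono[of "-1" "cos \<alpha>" "norm x"] by simp
  then have s: "x \<in> slit" using x by (simp add: slit_def)
  have "x $ 1 = norm x * cos (ang x)" using polar_ang(1)[OF s] by (metis polar_def vector_2(1))
  then have "cos \<alpha> < cos \<bar>ang x\<bar>" using x nz by (simp add: abs_if)
  then have "\<bar>ang x\<bar> < \<alpha>" using cos_mono_less_eq[of \<alpha> "\<bar>ang x\<bar>"] polar_ang[OF s] assms by auto
  then show "x \<in> sector \<alpha>" unfolding sector_def using nz polar_ang(1)[OF s]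
    by (intro CollectI exI[of _ "norm x"] exI[of _ "ang x"]) auto
qed

lemma open_sector: "0 < \<alpha> \<Longrightarrow> \<alpha> < pi \<Longrightarrow> open (sector \<alpha>)"
  unfolding sector_eq by (intro open_Collect_less continuous_intros)

lemma closure_sector_subset:
  assumes "0 < \<alpha>" "\<alpha> < pi"
  shows "closure (sector \<alpha>) \<subseteq> {x. norm x * cos \<alpha> \<le> x $ 1}"
  unfolding sector_eq[OF assms]
  by (intro closure_minimal closed_Collect_le continuous_intros) auto

lemma closure_sector_slit:
  assumes "0 < \<alpha>" "\<alpha> < pi" "x \<in> closure (sector \<alpha>) - {0}"
  shows "x \<in> slit" "\<bar>ang x\<bar> \<le> \<alpha>" "0 < norm x"
proof -
  have x: "norm x * cos \<alpha> \<le> x $ 1" "0 < norm x" using closure_sector_subset[OF assms(1,2)] assms(3) by auto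
  have "- 1 < cos \<alpha>" using cos_monotone_0_pi[of \<alpha> pi] assms by simp
  then have "- norm x < norm x * cos \<alpha>" using x mult_strict_left_mono[of "-1" "cos \<alpha>" "norm x"] by simp
  then show s: "x \<in> slit" using x by (simp add: slit_def)
  have "x $ 1 = norm x * cos (ang x)" using polar_ang(1)[OF s] by (metis polar_def vector_2(1))
  then have "cos \<alpha> \<le> cos \<bar>ang x\<bar>" using x by (simp add: abs_if)
  then show "\<bar>ang x\<bar> \<le> \<alpha>" using cos_mono_le_eq[of \<alpha> "\<bar>ang x\<bar>"] polar_ang[OF s] assms by auto
qed (use assms in auto)

lemma polar_in_sector: "r > 0 \<Longrightarrow> - \<alpha> < \<theta> \<Longrightarrow> \<theta> < \<alpha> \<Longrightarrow> polar r \<theta> \<in> sector \<alpha>"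
  unfolding sector_def by blast

lemma sector_slit:
  assumes "0 < \<alpha>" "\<alpha> < pi" "x \<in> sector \<alpha>"
  shows "x \<in> slit" "- \<alpha> < ang x" "ang x < \<alpha>"
proof -
  obtain r \<theta> where x: "x = polar r \<theta>" "r > 0" "- \<alpha> < \<theta>" "\<theta> < \<alpha>" using assms(3) by (auto simp: sector_def)
  then have a: "ang x = \<theta>" using assms ang_polar[of r \<theta>] by auto
  show "- \<alpha> < ang x" "ang x < \<alpha>" using a x by auto
  have "x \<noteq> 0" using norm_polar[of r \<theta>] x by auto
  then show "x \<in> slit" using assms closure_sector_slit(1)[OF assms(1,2)] closure_subset by blast
qed

lemma continuous_on_polar: "continuous_on S (polar r)"
proof -
  have "polar r = (\<lambda>\<theta>. (r * cos \<theta>) *\<^sub>R axis 1 1 + (r * sin \<theta>) *\<^sub>R axis 2 1)"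
    by (simp add: fun_eq_iff polar_def vec_eq_iff forall_2 axis_def)
  then show ?thesis by (simp only:) (intro continuous_intros)
qed

lemma polar_boundary:
  assumes "0 < \<alpha>" "\<alpha> < pi" "\<bar>\<theta>\<bar> \<le> \<alpha>" "r > 0"
  shows "polar r \<theta> \<in> closure (sector \<alpha>) - {0}"
    and "\<bar>\<theta>\<bar> = \<alpha> \<Longrightarrow> polar r \<theta> \<in> frontier (sector \<alpha>) - {0}"
proof -
  have "polar r ` closure {-\<alpha><..<\<alpha>} \<subseteq> closure (sector \<alpha>)"
    by (rule image_closure_subset[OF continuous_on_polar])
       (use assms closure_subset[of "sector \<alpha>"] polar_in_sector in auto)
  moreover have "\<theta> \<in> closure {-\<alpha><..<\<alpha>}" using assms by auto
  ultimately have c: "polar r \<theta> \<in> closure (sector \<alpha>)" by blast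
  have nz: "polar r \<theta> \<noteq> 0" using norm_polar[OF assms(4), of \<theta>] assms by auto
  show "polar r \<theta> \<in> closure (sector \<alpha>) - {0}" using c nz by simp
  assume a: "\<bar>\<theta>\<bar> = \<alpha>"
  have "polar r \<theta> \<notin> sector \<alpha>"
  proof
    assume "polar r \<theta> \<in> sector \<alpha>"
    then have "- \<alpha> < ang (polar r \<theta>)" "ang (polar r \<theta>) < \<alpha>" using sector_slit assms by blast+
    moreover have "ang (polar r \<theta>) = \<theta>" using assms by (intro ang_polar) auto
    ultimately show False using a by auto
  qed
  then show "polar r \<theta> \<in> frontier (sector \<alpha>) - {0}"
    using c nz open_sector[OF assms(1,2)] by (simp add: frontier_def interior_open)
qed

lemma frechet_derivative_cong:
  assumes "open S" "x \<in> S" "\<And>y. y \<in> S \<Longrightarrow> f y = g y"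
  shows "frechet_derivative f (at x) = frechet_derivative g (at x)"
proof -
  have "(f has_derivative D) (at x) \<longleftrightarrow> (g has_derivative D) (at x)" for D
    using has_derivative_transform_within_open[of f D x UNIV S g] has_derivative_transform_within_open[of g D x UNIV S f] assms
    by auto
  then show ?thesis by (simp add: frechet_derivative_def)
qed

lemma pderiv_at_cong:
  assumes "open S" "x \<in> S" "\<And>y. y \<in> S \<Longrightarrow> f y = g y"
  shows "pderiv_at i f x = pderiv_at i g x"
  unfolding pderiv_at_def using frechet_derivative_cong[OF assms] by simp

lemma pderiv_at_eq: "(f has_derivative D) (at x) \<Longrightarrow> pderiv_at i f x = D (axis i 1)"
  unfolding pderiv_at_def using frechet_derivative_at by metis

lemma vector2_axis: "(vector [p, q] :: real^2) = p *\<^sub>R axis 1 1 + q *\<^sub>R axis 2 1"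
  by (simp add: vec_eq_iff forall_2 axis_def)

lemma has_derivative_vector2:
  fixes A B :: "'a::real_normed_vector \<Rightarrow> real"
  assumes "(A has_derivative A') F" "(B has_derivative B') F"
  shows "((\<lambda>x. vector [A x, B x] :: real^2) has_derivative (\<lambda>v. vector [A' v, B' v])) F"
  unfolding vector2_axis by (intro has_derivative_add has_derivative_scaleR_left assms)

lemma has_derivative_sq: "(sq has_derivative (\<lambda>v. 2 * (x $ 1 * v $ 1 + x $ 2 * v $ 2))) (at x)"
  unfolding sq_def[abs_def] by (auto intro!: derivative_eq_intros has_derivative_nth)

lemma has_derivative_div_sq:
  assumes "(N has_derivative N') (at x)" "x \<noteq> 0"
  shows "((\<lambda>x. N x / sq x) has_derivative
    (\<lambda>v. (N' v * sq x - N x * (2 * (x $ 1 * v $ 1 + x $ 2 * v $ 2))) / (sq x)\<^sup>2)) (at x)"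
proof -
  have "sq x \<noteq> 0" using sq_pos[OF assms(2)] by simp
  from has_derivative_divide'[OF assms(1) has_derivative_sq this] show ?thesis
    by (simp add: power2_eq_square)
qed

lemma has_derivative_div_sq2:
  assumes "(N has_derivative N') (at x)" "x \<noteq> 0"
  shows "((\<lambda>x. N x / (sq x)\<^sup>2) has_derivative
    (\<lambda>v. (N' v * sq x - N x * (4 * (x $ 1 * v $ 1 + x $ 2 * v $ 2))) / (sq x) ^ 3)) (at x)"
proof -
  have s: "sq x \<noteq> 0" using sq_pos[OF assms(2)] by simp
  have d: "((\<lambda>x. (N x / sq x) / sq x) has_derivative
    (\<lambda>v. (((N' v * sq x - N x * (2 * (x $ 1 * v $ 1 + x $ 2 * v $ 2))) / (sq x)\<^sup>2) * sq x
      - (N x / sq x) * (2 * (x $ 1 * v $ 1 + x $ 2 * v $ 2))) / (sq x)\<^sup>2)) (at x)"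
    by (intro has_derivative_div_sq assms)
  have e: "(((N' v * sq x - N x * (2 * d)) / (sq x)\<^sup>2) * sq x - (N x / sq x) * (2 * d)) / (sq x)\<^sup>2
      = (N' v * sq x - N x * (4 * d)) / (sq x) ^ 3" for v d
    using s by (simp add: power2_eq_square power3_eq_cube field_simps)
  have "(\<lambda>x. N x / (sq x)\<^sup>2) = (\<lambda>x. (N x / sq x) / sq x)"
    by (simp add: fun_eq_iff power2_eq_square)
  then show ?thesis using d unfolding e by (simp only:)
qed

lemma has_derivative_comp_ang:
  assumes "(f has_real_derivative d) (at (ang x))" "x \<in> slit"
  shows "((\<lambda>x. f (ang x)) has_derivative (\<lambda>v. d * ((x $ 1 * v $ 2 - x $ 2 * v $ 1) / sq x))) (at x)"
  using has_derivative_compose[OF has_derivative_ang[OF assms(2)], of f "\<lambda>h. d * h"] assms(1)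
  unfolding has_field_derivative_def by simp

definition angular_cone :: "real set \<Rightarrow> (real^2) set" where
  "angular_cone J = {x \<in> slit. ang x \<in> J}"

lemma open_angular_cone: "open J \<Longrightarrow> open (angular_cone J)"
proof -
  assume "open J"
  have "continuous_on slit ang"
    by (intro continuous_at_imp_continuous_on ballI has_derivative_continuous[OF has_derivative_ang])
  then have "open (slit \<inter> ang -` J)"
    using open_slit \<open>open J\<close> by (intro continuous_open_preimage)
  then show ?thesis by (simp add: angular_cone_def Int_def vimage_def)
qed

section \<open>Differential operators on the fields f e_r / r and P / r^2\<close>

definition rfield :: "(real \<Rightarrow> real) \<Rightarrow> real^2 \<Rightarrow> real^2" where
  "rfield f x = vector [f (ang x) * x $ 1 / sq x, f (ang x) * x $ 2 / sq x]"

definition pfield :: "(real \<Rightarrow> real) \<Rightarrow> real^2 \<Rightarrow> real" where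
  "pfield P x = P (ang x) / sq x"

text \<open>Together with \<open>rfield_d2\<close> the first partial derivatives in closed form over
  the common denominator r^4, so that the Laplacian takes only one more differentiation of an
  explicit formula.\<close>

definition rfield_d1 :: "(real \<Rightarrow> real) \<Rightarrow> (real \<Rightarrow> real) \<Rightarrow> real^2 \<Rightarrow> real^2" where
  "rfield_d1 f f1 x = vector
    [(- f1 (ang x) * (x $ 1 * x $ 2) + f (ang x) * ((x $ 2)\<^sup>2 - (x $ 1)\<^sup>2)) / (sq x)\<^sup>2,
     (- f1 (ang x) * (x $ 2)\<^sup>2 - 2 * f (ang x) * (x $ 1 * x $ 2)) / (sq x)\<^sup>2]"

definition rfield_d2 :: "(real \<Rightarrow> real) \<Rightarrow> (real \<Rightarrow> real) \<Rightarrow> real^2 \<Rightarrow> real^2" where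
  "rfield_d2 f f1 x = vector
    [(f1 (ang x) * (x $ 1)\<^sup>2 - 2 * f (ang x) * (x $ 1 * x $ 2)) / (sq x)\<^sup>2,
     (f1 (ang x) * (x $ 1 * x $ 2) + f (ang x) * ((x $ 1)\<^sup>2 - (x $ 2)\<^sup>2)) / (sq x)\<^sup>2]"

lemma axis_simps: "(axis 1 1 :: real^2) $ 1 = 1" "(axis 1 1 :: real^2) $ 2 = 0"
    "(axis 2 1 :: real^2) $ 1 = 0" "(axis 2 1 :: real^2) $ 2 = 1"
  by (simp_all add: axis_def)

lemma vector2_eqI: "p = p' \<Longrightarrow> q = q' \<Longrightarrow> (vector [p, q] :: real^2) = vector [p', q']"
  by simp

lemma pderiv_rfield:
  assumes x: "x \<in> slit" and f: "(f has_real_derivative f1 (ang x)) (at (ang x))"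
  shows "pderiv_at 1 (rfield f) x = rfield_d1 f f1 x" "pderiv_at 2 (rfield f) x = rfield_d2 f f1 x"
proof -
  have nz: "x \<noteq> 0" using slit_nonzero[OF x] .
  have s: "sq x \<noteq> 0" using sq_pos[OF nz] by simp
  have S: "sq x = (x $ 1)\<^sup>2 + (x $ 2)\<^sup>2" by (simp add: sq_def)
  have clear: "(u + d * (w / sq x) * z) * sq x = u * sq x + d * w * z" for u d w z
    using s by (simp add: distrib_right)
  note D = has_derivative_comp_ang[OF f x]
  note d = has_derivative_vector2[OF has_derivative_div_sq[OF has_derivative_mult[OF D has_derivative_nth] nz]
      has_derivative_div_sq[OF has_derivative_mult[OF D has_derivative_nth] nz], of 1 2]
  show "pderiv_at 1 (rfield f) x = rfield_d1 f f1 x"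
    unfolding rfield_def[abs_def] pderiv_at_eq[OF d] rfield_d1_def axis_simps clear
    by (rule vector2_eqI; rule arg_cong[where f = "\<lambda>z. z / (sq x)\<^sup>2"]) (simp_all add: S power2_eq_square algebra_simps)
  show "pderiv_at 2 (rfield f) x = rfield_d2 f f1 x"
    unfolding rfield_def[abs_def] pderiv_at_eq[OF d] rfield_d2_def axis_simps clear
    by (rule vector2_eqI; rule arg_cong[where f = "\<lambda>z. z / (sq x)\<^sup>2"]) (simp_all add: S power2_eq_square algebra_simps)
qed

lemma pderiv_pfield:
  assumes x: "x \<in> slit" and P: "(P has_real_derivative P1) (at (ang x))"
  shows "pderiv_at 1 (pfield P) x = (- P1 * x $ 2 - 2 * P (ang x) * x $ 1) / (sq x)\<^sup>2"
    "pderiv_at 2 (pfield P) x = (P1 * x $ 1 - 2 * P (ang x) * x $ 2) / (sq x)\<^sup>2"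
proof -
  have nz: "x \<noteq> 0" using slit_nonzero[OF x] .
  have s: "sq x \<noteq> 0" using sq_pos[OF nz] by simp
  note d = has_derivative_div_sq[OF has_derivative_comp_ang[OF P x] nz]
  show "pderiv_at 1 (pfield P) x = (- P1 * x $ 2 - 2 * P (ang x) * x $ 1) / (sq x)\<^sup>2"
    "pderiv_at 2 (pfield P) x = (P1 * x $ 1 - 2 * P (ang x) * x $ 2) / (sq x)\<^sup>2"
    unfolding pfield_def[abs_def] pderiv_at_eq[OF d] axis_simps using s by (simp_all add: mult_ac)
qed

text \<open>In the polar frame the result is (f'' e_r + 2 f' e_theta) / r^3: the terms in f without
  derivative cancel, since those from the radial part are offset by the curvature of the
  frame.\<close>

lemma laplacian_rfield:
  assumes J: "open J" and x: "x \<in> angular_cone J"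
    and f: "\<And>t. t \<in> J \<Longrightarrow> (f has_real_derivative f1 t) (at t)"
    and f1: "(f1 has_real_derivative f2) (at (ang x))"
  shows "laplacian (rfield f) x = vector
    [(f2 * x $ 1 - 2 * f1 (ang x) * x $ 2) / (sq x)\<^sup>2, (f2 * x $ 2 + 2 * f1 (ang x) * x $ 1) / (sq x)\<^sup>2]"
proof -
  have sl: "x \<in> slit" "ang x \<in> J" using x by (auto simp: angular_cone_def)
  have nz: "x \<noteq> 0" using slit_nonzero[OF sl(1)] .
  have s: "sq x \<noteq> 0" using sq_pos[OF nz] by simp
  define p q where "p = x $ 1" and "q = x $ 2"
  define W where "W v = (x $ 1 * v $ 2 - x $ 2 * v $ 1) / sq x" for v :: "real^2"
  have W: "W (axis 1 1) = - q / sq x" "W (axis 2 1) = p / sq x" by (simp_all add: W_def axis_simps p_def q_def)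
  have F: "((\<lambda>x. f (ang x)) has_derivative (\<lambda>v. f1 (ang x) * W v)) (at x)"
    unfolding W_def by (rule has_derivative_comp_ang[OF f[OF sl(2)] sl(1)])
  have F1: "((\<lambda>x. f1 (ang x)) has_derivative (\<lambda>v. f2 * W v)) (at x)"
    unfolding W_def by (rule has_derivative_comp_ang[OF f1 sl(1)])
  have m: "((\<lambda>x::real^2. x $ 1 * x $ 2) has_derivative (\<lambda>v. p * v $ 2 + v $ 1 * q)) (at x)"
    "((\<lambda>x::real^2. (x $ 1)\<^sup>2) has_derivative (\<lambda>v. 2 * p * v $ 1)) (at x)"
    "((\<lambda>x::real^2. (x $ 2)\<^sup>2) has_derivative (\<lambda>v. 2 * q * v $ 2)) (at x)"
    unfolding p_def q_def by (auto intro!: derivative_eq_intros has_derivative_nth)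
  have pd: "pderiv_at i (pderiv_at 1 (rfield f)) x = pderiv_at i (rfield_d1 f f1) x"
    "pderiv_at i (pderiv_at 2 (rfield f)) x = pderiv_at i (rfield_d2 f f1) x" for i
    by (rule pderiv_at_cong[OF open_angular_cone[OF J] x]; use f in \<open>auto simp: angular_cone_def intro!: pderiv_rfield\<close>)+
  note a1 = has_derivative_add[OF has_derivative_mult[OF has_derivative_minus[OF F1] m(1)] has_derivative_mult[OF F has_derivative_diff[OF m(3,2)]]]
  note a2 = has_derivative_diff[OF has_derivative_mult[OF has_derivative_minus[OF F1] m(3)]
      has_derivative_mult[OF has_derivative_mult[OF has_derivative_const[of 2] F] m(1)]]
  note b1 = has_derivative_diff[OF has_derivative_mult[OF F1 m(2)]
      has_derivative_mult[OF has_derivative_mult[OF has_derivative_const[of 2] F] m(1)]]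
  note b2 = has_derivative_add[OF has_derivative_mult[OF F1 m(1)] has_derivative_mult[OF F has_derivative_diff[OF m(2,3)]]]
  note A = has_derivative_vector2[OF has_derivative_div_sq2[OF a1 nz] has_derivative_div_sq2[OF a2 nz]]
  note B = has_derivative_vector2[OF has_derivative_div_sq2[OF b1 nz] has_derivative_div_sq2[OF b2 nz]]
  define g g1 where "g = f (ang x)" and "g1 = f1 (ang x)"
  define S where "S = sq x"
  have S0: "S \<noteq> 0" using s by (simp add: S_def)
  have Seq: "S = p\<^sup>2 + q\<^sup>2" by (simp add: S_def sq_def p_def q_def)
  have sum: "(u / S ^ 3) + (v / S ^ 3) = w / S\<^sup>2" if "u + v = w * S" for u v w
    using S0 that by (simp add: add_divide_distrib[symmetric] power2_eq_square power3_eq_cube)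
  have 1: "pderiv_at 1 (rfield_d1 f f1) x = vector
      [((f2 * q / S * (p * q) - g1 * q + (g1 * (- q / S)) * (q\<^sup>2 - p\<^sup>2) - 2 * g * p) * S - (- g1 * (p * q) + g * (q\<^sup>2 - p\<^sup>2)) * (4 * p)) / S ^ 3,
       ((f2 * q / S * q\<^sup>2 - 2 * (g1 * (- q / S)) * (p * q) - 2 * g * q) * S - (- g1 * q\<^sup>2 - 2 * g * (p * q)) * (4 * p)) / S ^ 3]"
    unfolding rfield_d1_def[abs_def] pderiv_at_eq[OF A] axis_simps W p_def[symmetric] q_def[symmetric] g_def[symmetric] g1_def[symmetric] S_def[symmetric]
    by (rule vector2_eqI) (simp_all add: algebra_simps)
  have 2: "pderiv_at 2 (rfield_d2 f f1) x = vector
      [((f2 * p / S * p\<^sup>2 - 2 * (g1 * (p / S)) * (p * q) - 2 * g * p) * S - (g1 * p\<^sup>2 - 2 * g * (p * q)) * (4 * q)) / S ^ 3,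
       ((f2 * p / S * (p * q) + g1 * p + (g1 * (p / S)) * (p\<^sup>2 - q\<^sup>2) - 2 * g * q) * S - (g1 * (p * q) + g * (p\<^sup>2 - q\<^sup>2)) * (4 * q)) / S ^ 3]"
    unfolding rfield_d2_def[abs_def] pderiv_at_eq[OF B] axis_simps W p_def[symmetric] q_def[symmetric] g_def[symmetric] g1_def[symmetric] S_def[symmetric]
    by (rule vector2_eqI) (simp_all add: algebra_simps)
  have add_vec: "(vector [u, v] :: real^2) + vector [u', v'] = vector [u + u', v + v']" for u v u' v'
    by (simp add: vec_eq_iff forall_2)
  have "laplacian (rfield f) x = pderiv_at 1 (rfield_d1 f f1) x + pderiv_at 2 (rfield_d2 f f1) x"
    unfolding laplacian_def sum_2 pd ..
  also have "\<dots> = vector [(f2 * p - 2 * g1 * q) / S\<^sup>2, (f2 * q + 2 * g1 * p) / S\<^sup>2]"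
    unfolding 1 2 add_vec
  proof (intro vector2_eqI sum)
    show "((f2 * q / S * (p * q) - g1 * q + (g1 * (- q / S)) * (q\<^sup>2 - p\<^sup>2) - 2 * g * p) * S - (- g1 * (p * q) + g * (q\<^sup>2 - p\<^sup>2)) * (4 * p))
      + ((f2 * p / S * p\<^sup>2 - 2 * (g1 * (p / S)) * (p * q) - 2 * g * p) * S - (g1 * p\<^sup>2 - 2 * g * (p * q)) * (4 * q))
      = (f2 * p - 2 * g1 * q) * S"
    proof -
      have "(f2 * q / S * (p * q) - g1 * q + (g1 * (- q / S)) * (q\<^sup>2 - p\<^sup>2) - 2 * g * p) * S
          = f2 * q * (p * q) - g1 * q * S - g1 * q * (q\<^sup>2 - p\<^sup>2) - 2 * g * p * S"
        "(f2 * p / S * p\<^sup>2 - 2 * (g1 * (p / S)) * (p * q) - 2 * g * p) * S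
          = f2 * p * p\<^sup>2 - 2 * g1 * p * (p * q) - 2 * g * p * S"
        using S0 by (simp_all add: algebra_simps)
      then show ?thesis by (simp only:) (simp add: Seq power2_eq_square algebra_simps)
    qed
    show "((f2 * q / S * q\<^sup>2 - 2 * (g1 * (- q / S)) * (p * q) - 2 * g * q) * S - (- g1 * q\<^sup>2 - 2 * g * (p * q)) * (4 * p))
      + ((f2 * p / S * (p * q) + g1 * p + (g1 * (p / S)) * (p\<^sup>2 - q\<^sup>2) - 2 * g * q) * S - (g1 * (p * q) + g * (p\<^sup>2 - q\<^sup>2)) * (4 * q))
      = (f2 * q + 2 * g1 * p) * S"
    proof -
      have "(f2 * q / S * q\<^sup>2 - 2 * (g1 * (- q / S)) * (p * q) - 2 * g * q) * S
          = f2 * q * q\<^sup>2 + 2 * g1 * q * (p * q) - 2 * g * q * S"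
        "(f2 * p / S * (p * q) + g1 * p + (g1 * (p / S)) * (p\<^sup>2 - q\<^sup>2) - 2 * g * q) * S
          = f2 * p * (p * q) + g1 * p * S + g1 * p * (p\<^sup>2 - q\<^sup>2) - 2 * g * q * S"
        using S0 by (simp_all add: algebra_simps)
      then show ?thesis by (simp only:) (simp add: Seq power2_eq_square algebra_simps)
    qed
  qed
  finally show ?thesis unfolding p_def q_def g1_def S_def .
qed

lemma divergence_rfield:
  assumes x: "x \<in> slit" and f: "(f has_real_derivative f1 (ang x)) (at (ang x))"
  shows "divergence (rfield f) x = 0"
  unfolding divergence_def sum_2 pderiv_rfield[where f = f and ?f1.0 = f1, OF x f] rfield_d1_def rfield_d2_def
  by (simp add: add_divide_distrib[symmetric] algebra_simps)

text \<open>A radial field transports only along rays, and (f / r) times the radial derivative of f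
  / r is - f^2 / r^3.\<close>

lemma convection_rfield:
  assumes x: "x \<in> slit" and f: "(f has_real_derivative f1 (ang x)) (at (ang x))"
  shows "convection (rfield f) x = vector [- (f (ang x))\<^sup>2 * x $ 1 / (sq x)\<^sup>2, - (f (ang x))\<^sup>2 * x $ 2 / (sq x)\<^sup>2]"
proof -
  define p q g g1 S where "p = x $ 1" and "q = x $ 2" and "g = f (ang x)" and "g1 = f1 (ang x)" and "S = sq x"
  have S0: "S \<noteq> 0" using sq_pos[OF slit_nonzero[OF x]] by (simp add: S_def)
  have Seq: "S = p\<^sup>2 + q\<^sup>2" by (simp add: S_def sq_def p_def q_def)
  have sm: "(vector [u, v] :: real^2) $ 1 *\<^sub>R vector [w, z] + (vector [u, v] :: real^2) $ 2 *\<^sub>R vector [w', z']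
      = (vector [u * w + v * w', u * z + v * z'] :: real^2)" for u v w z w' z' :: real
    by (simp add: vec_eq_iff forall_2)
  have frac: "g * u / S * (a / S\<^sup>2) + g * v / S * (b / S\<^sup>2) = c / S\<^sup>2" if "g * (u * a + v * b) = c * S" for u v a b c
  proof -
    have "g * u / S * (a / S\<^sup>2) + g * v / S * (b / S\<^sup>2) = (g * (u * a + v * b)) / (S * S\<^sup>2)"
      by (simp add: algebra_simps add_divide_distrib)
    then show ?thesis using that S0 by simp
  qed
  show ?thesis
    unfolding convection_def sum_2 pderiv_rfield[where f = f and ?f1.0 = f1, OF x f] rfield_d1_def rfield_d2_def rfield_def sm
      p_def[symmetric] q_def[symmetric] g_def[symmetric] g1_def[symmetric] S_def[symmetric]
    by (intro vector2_eqI frac) (simp_all add: Seq power2_eq_square algebra_simps)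
qed

text \<open>Multiplied by r^3, the left-hand side is - h e_r + k e_theta with the \<open>h\<close>
  and \<open>k\<close> of the proof, so it vanishes only if both do. The condition on P1 integrates
  to P = 2 f + const, and the other one then is the profile equation.\<close>

lemma NS_rfield_iff:
  assumes J: "open J" and x: "x \<in> angular_cone J"
    and f: "\<And>t. t \<in> J \<Longrightarrow> (f has_real_derivative f1 t) (at t)"
    and f1: "(f1 has_real_derivative f2) (at (ang x))"
    and P: "(P has_real_derivative P1) (at (ang x))"
  shows "- laplacian (rfield f) x + convection (rfield f) x + gradient (pfield P) x = 0 \<longleftrightarrow>
    f2 + (f (ang x))\<^sup>2 + 2 * P (ang x) = 0 \<and> P1 = 2 * f1 (ang x)"
proof -
  have sl: "x \<in> slit" "ang x \<in> J" using x by (auto simp: angular_cone_def)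
  have S: "0 < sq x" using sq_pos[OF slit_nonzero[OF sl(1)]] .
  define p q g g1 h k where "p = x $ 1" and "q = x $ 2" and "g = f (ang x)" and "g1 = f1 (ang x)"
    and "h = f2 + g\<^sup>2 + 2 * P (ang x)" and "k = P1 - 2 * g1"
  let ?V = "- laplacian (rfield f) x + convection (rfield f) x + gradient (pfield P) x"
  have merge: "- (u / D) + v / D + w / D = (- u + v + w) / D" for u v w D :: real
    by (simp add: add_divide_distrib diff_divide_distrib)
  have lap: "laplacian (rfield f) x = vector
    [(f2 * x $ 1 - 2 * f1 (ang x) * x $ 2) / (sq x)\<^sup>2, (f2 * x $ 2 + 2 * f1 (ang x) * x $ 1) / (sq x)\<^sup>2]"
    by (rule laplacian_rfield[where ?f1.0 = f1, OF J x f f1])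
  have V: "?V $ 1 = - ((f2 * p - 2 * g1 * q) / (sq x)\<^sup>2) + (- g\<^sup>2 * p) / (sq x)\<^sup>2 + (- P1 * q - 2 * P (ang x) * p) / (sq x)\<^sup>2"
    "?V $ 2 = - ((f2 * q + 2 * g1 * p) / (sq x)\<^sup>2) + (- g\<^sup>2 * q) / (sq x)\<^sup>2 + (P1 * p - 2 * P (ang x) * q) / (sq x)\<^sup>2"
    unfolding lap convection_rfield[where f = f and ?f1.0 = f1, OF sl(1) f[OF sl(2)]] gradient_def
    by (simp_all add: pderiv_pfield[OF sl(1) P] p_def q_def g_def g1_def)
  have "?V $ 1 = (- (h * p) - k * q) / (sq x)\<^sup>2" "?V $ 2 = (- (h * q) + k * p) / (sq x)\<^sup>2"
    unfolding V merge by (rule arg_cong[where f = "\<lambda>z. z / (sq x)\<^sup>2"], simp add: h_def k_def algebra_simps)+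
  then have "- laplacian (rfield f) x + convection (rfield f) x + gradient (pfield P) x = 0 \<longleftrightarrow>
      - (h * p) - k * q = 0 \<and> - (h * q) + k * p = 0"
    using S by (simp add: vec_eq_iff forall_2)
  also have "\<dots> \<longleftrightarrow> h = 0 \<and> k = 0"
  proof
    assume a: "- (h * p) - k * q = 0 \<and> - (h * q) + k * p = 0"
    have pq: "sq x = p * p + q * q" by (simp add: sq_def p_def q_def power2_eq_square)
    have "h * sq x = - (p * (- (h * p) - k * q)) - q * (- (h * q) + k * p)" unfolding pq by (simp add: algebra_simps)
    moreover have "k * sq x = - (q * (- (h * p) - k * q)) + p * (- (h * q) + k * p)" unfolding pq by (simp add: algebra_simps)
    ultimately show "h = 0 \<and> k = 0" using a S by simp
  qed simp
  finally show ?thesis by (simp add: h_def k_def g_def g1_def)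
qed

text \<open>A class of functions closed under differentiation, since \<open>f1' = c - 4 f - f\<^sup>2\<close> is a polynomial in \<open>f\<close>.\<close>
inductive angular_rational :: "(real \<Rightarrow> real) \<Rightarrow> (real \<Rightarrow> real) \<Rightarrow> (real^2 \<Rightarrow> real) \<Rightarrow> bool" for f f1 where
  const: "angular_rational f f1 (\<lambda>x. k)"
| nth: "angular_rational f f1 (\<lambda>x. x $ i)"
| inv_sq: "angular_rational f f1 (\<lambda>x. 1 / sq x)"
| ang: "angular_rational f f1 (\<lambda>x. f (ang x))"
| ang1: "angular_rational f f1 (\<lambda>x. f1 (ang x))"
| add: "angular_rational f f1 g \<Longrightarrow> angular_rational f f1 h \<Longrightarrow> angular_rational f f1 (\<lambda>x. g x + h x)"
| mult: "angular_rational f f1 g \<Longrightarrow> angular_rational f f1 h \<Longrightarrow> angular_rational f f1 (\<lambda>x. g x * h x)"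

lemma angular_rational_derivative:
  assumes f: "\<And>t. t \<in> J \<Longrightarrow> (f has_real_derivative f1 t) (at t)"
    and f1: "\<And>t. t \<in> J \<Longrightarrow> (f1 has_real_derivative c - 4 * f t - (f t)\<^sup>2) (at t)"
    and g: "angular_rational f f1 g"
  shows "\<exists>G. (\<forall>x\<in>angular_cone J. (g has_derivative G x) (at x)) \<and> (\<forall>v. angular_rational f f1 (\<lambda>x. G x v))"
  using g
proof induction
  case (const k)
  show ?case by (rule exI[of _ "\<lambda>x v. 0"]) (auto intro: angular_rational.const)
next
  case (nth i)
  show ?case by (rule exI[of _ "\<lambda>x v. v $ i"]) (auto intro: angular_rational.const has_derivative_nth)
next
  case inv_sq
  let ?G = "\<lambda>x v. ((- 2 * v $ 1) * x $ 1 + (- 2 * v $ 2) * x $ 2) * ((1 / sq x) * (1 / sq x))"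
  have "((\<lambda>x. 1 / sq x) has_derivative ?G x) (at x)" if "x \<in> angular_cone J" for x
  proof -
    have "x \<noteq> 0" using that slit_nonzero by (auto simp: angular_cone_def)
    from has_derivative_div_sq[OF has_derivative_const this, of 1]
    show ?thesis by (rule has_derivative_eq_rhs) (simp add: fun_eq_iff power2_eq_square algebra_simps flip: add_divide_distrib)
  qed
  moreover have "angular_rational f f1 (\<lambda>x. ?G x v)" for v
    by (intro angular_rational.intros)
  ultimately show ?case by (intro exI[of _ ?G]) blast
next
  case ang
  let ?G = "\<lambda>x v. f1 (ang x) * ((v $ 2 * x $ 1 + (- v $ 1) * x $ 2) * (1 / sq x))"
  have "((\<lambda>x. f (ang x)) has_derivative ?G x) (at x)" if "x \<in> angular_cone J" for x
    using that by (intro has_derivative_eq_rhs[OF has_derivative_comp_ang[OF f]]) (auto simp: angular_cone_def algebra_simps diff_divide_distrib)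
  moreover have "angular_rational f f1 (\<lambda>x. ?G x v)" for v
    by (intro angular_rational.intros)
  ultimately show ?case by (intro exI[of _ ?G]) blast
next
  case ang1
  let ?G = "\<lambda>x v. (c + ((-4) * f (ang x) + (-1) * (f (ang x) * f (ang x)))) * ((v $ 2 * x $ 1 + (- v $ 1) * x $ 2) * (1 / sq x))"
  have "((\<lambda>x. f1 (ang x)) has_derivative ?G x) (at x)" if "x \<in> angular_cone J" for x
    using that by (intro has_derivative_eq_rhs[OF has_derivative_comp_ang[OF f1]])
      (auto simp: angular_cone_def fun_eq_iff power2_eq_square mult_ac)
  moreover have "angular_rational f f1 (\<lambda>x. ?G x v)" for v
    by (intro angular_rational.intros)
  ultimately show ?case by (intro exI[of _ ?G]) blast
next
  case (add g h)
  then obtain G H where "\<forall>x\<in>angular_cone J. (g has_derivative G x) (at x)" "\<forall>v. angular_rational f f1 (\<lambda>x. G x v)"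
    "\<forall>x\<in>angular_cone J. (h has_derivative H x) (at x)" "\<forall>v. angular_rational f f1 (\<lambda>x. H x v)" by blast
  then show ?case
    by (intro exI[of _ "\<lambda>x v. G x v + H x v"]) (auto intro: has_derivative_add angular_rational.add)
next
  case (mult g h)
  then obtain G H where "\<forall>x\<in>angular_cone J. (g has_derivative G x) (at x)" "\<forall>v. angular_rational f f1 (\<lambda>x. G x v)"
    "\<forall>x\<in>angular_cone J. (h has_derivative H x) (at x)" "\<forall>v. angular_rational f f1 (\<lambda>x. H x v)" by blast
  then show ?case using mult.hyps
    by (intro exI[of _ "\<lambda>x v. g x * H x v + G x v * h x"])
      (auto intro!: has_derivative_mult angular_rational.add angular_rational.mult)
qed

text \<open>Two scalar coefficients with constant vectors serve both targets: the coordinate axes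
  for the velocity, and 1 and 0 for the pressure. The induction passes to directional derivatives,
  whose coefficients stay in the class.\<close>

lemma angular_rational_Ck:
  fixes a b :: "'b::real_normed_vector"
  assumes J: "open J" and f: "\<And>t. t \<in> J \<Longrightarrow> (f has_real_derivative f1 t) (at t)"
    and f1: "\<And>t. t \<in> J \<Longrightarrow> (f1 has_real_derivative c - 4 * f t - (f t)\<^sup>2) (at t)"
    and "angular_rational f f1 g" "angular_rational f f1 h"
  shows "Ck_on k (\<lambda>x. g x *\<^sub>R a + h x *\<^sub>R b) (angular_cone J)"
  using assms(4,5)
proof (induction k arbitrary: g h)
  case (0 g h)
  obtain G H where "\<forall>x\<in>angular_cone J. (g has_derivative G x) (at x)" "\<forall>x\<in>angular_cone J. (h has_derivative H x) (at x)"
    using angular_rational_derivative[where J = J, OF f f1] 0 by metis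
  then have "continuous_on (angular_cone J) g" "continuous_on (angular_cone J) h"
    by (auto intro!: continuous_at_imp_continuous_on has_derivative_continuous)
  then show ?case by (simp add: continuous_intros)
next
  case (Suc k g h)
  obtain G where G: "\<forall>x\<in>angular_cone J. (g has_derivative G x) (at x)" "\<forall>v. angular_rational f f1 (\<lambda>x. G x v)"
    using angular_rational_derivative[where J = J, OF f f1 Suc.prems(1)] by auto
  obtain H where H: "\<forall>x\<in>angular_cone J. (h has_derivative H x) (at x)" "\<forall>v. angular_rational f f1 (\<lambda>x. H x v)"
    using angular_rational_derivative[where J = J, OF f f1 Suc.prems(2)] by auto
  have D: "((\<lambda>x. g x *\<^sub>R a + h x *\<^sub>R b) has_derivative (\<lambda>v. G x v *\<^sub>R a + H x v *\<^sub>R b)) (at x)" if "x \<in> angular_cone J" for x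
    using that G(1) H(1) by (intro has_derivative_add has_derivative_scaleR_left) auto
  show ?case
    unfolding Ck_on.simps
  proof (intro conjI ballI allI)
    show "(\<lambda>x. g x *\<^sub>R a + h x *\<^sub>R b) differentiable (at x)" if "x \<in> angular_cone J" for x
      using D[OF that] unfolding differentiable_def by blast
    show "Ck_on k (\<lambda>x. frechet_derivative (\<lambda>x. g x *\<^sub>R a + h x *\<^sub>R b) (at x) v) (angular_cone J)" for v
    proof (rule Ck_on_cong[OF open_angular_cone[OF J]])
      show "G x v *\<^sub>R a + H x v *\<^sub>R b = frechet_derivative (\<lambda>x. g x *\<^sub>R a + h x *\<^sub>R b) (at x) v" if "x \<in> angular_cone J" for x
        using frechet_derivative_at[OF D[OF that]] by metis
      show "Ck_on k (\<lambda>x. G x v *\<^sub>R a + H x v *\<^sub>R b) (angular_cone J)" using G(2) H(2) by (intro Suc.IH) auto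
    qed
  qed
qed

lemma smooth_rfield_pfield:
  assumes J: "open J" and f: "\<And>t. t \<in> J \<Longrightarrow> (f has_real_derivative f1 t) (at t)"
    and f1: "\<And>t. t \<in> J \<Longrightarrow> (f1 has_real_derivative c - 4 * f t - (f t)\<^sup>2) (at t)"
  shows "smooth_on_open (rfield f) (angular_cone J)" "smooth_on_open (pfield (\<lambda>t. 2 * f t + C)) (angular_cone J)"
proof -
  have "Ck_on k (rfield f) (angular_cone J)" for k
  proof (rule Ck_on_cong[OF open_angular_cone[OF J]])
    show "Ck_on k (\<lambda>x. (f (ang x) * x $ 1 * (1 / sq x)) *\<^sub>R (axis 1 1 :: real^2)
        + (f (ang x) * x $ 2 * (1 / sq x)) *\<^sub>R axis 2 1) (angular_cone J)"
      by (rule angular_rational_Ck[OF J f f1]) (intro angular_rational.intros | assumption)+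
  qed (simp add: rfield_def vector2_axis)
  then show "smooth_on_open (rfield f) (angular_cone J)" using open_angular_cone[OF J] by (simp add: smooth_on_open_def)
  have "Ck_on k (pfield (\<lambda>t. 2 * f t + C)) (angular_cone J)" for k
  proof (rule Ck_on_cong[OF open_angular_cone[OF J]])
    show "Ck_on k (\<lambda>x. ((2 * f (ang x) + C) * (1 / sq x)) *\<^sub>R (1::real) + 0 *\<^sub>R 0) (angular_cone J)"
      by (rule angular_rational_Ck[OF J f f1]) (intro angular_rational.intros | assumption)+
  qed (simp add: pfield_def)
  then show "smooth_on_open (pfield (\<lambda>t. 2 * f t + C)) (angular_cone J)" using open_angular_cone[OF J] by (simp add: smooth_on_open_def)
qed

lemma scale_polar: "c *\<^sub>R polar r \<theta> = polar (c * r) \<theta>"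
  by (simp add: polar_def vec_eq_iff forall_2)

lemma scale_slit:
  assumes "x \<in> slit" "0 < c"
  shows "ang (c *\<^sub>R x) = ang x" "sq (c *\<^sub>R x) = c\<^sup>2 * sq x"
proof -
  have "0 < norm x" using slit_nonzero[OF assms(1)] by simp
  then have "ang (polar (c * norm x) (ang x)) = ang x" using polar_ang(2,3)[OF assms(1)] assms(2) by (intro ang_polar) auto
  then show "ang (c *\<^sub>R x) = ang x" using scale_polar[of c "norm x" "ang x"] polar_ang(1)[OF assms(1)] by simp
  show "sq (c *\<^sub>R x) = c\<^sup>2 * sq x" by (simp add: sq_def power_mult_distrib distrib_left)
qed

lemma rfield_polar:
  assumes "0 < r" "- pi < \<theta>" "\<theta> < pi"
  shows "rfield f (polar r \<theta>) = (f \<theta> / r) *\<^sub>R e_r \<theta>"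
  using assms by (simp add: rfield_def ang_polar sq_polar) (simp add: polar_def e_r_def vec_eq_iff forall_2 power2_eq_square)

lemma e_r_inner [simp]: "e_r \<theta> \<bullet> e_r \<theta> = 1"
  by (simp add: e_r_def inner_vec_def sum_2 flip: power2_eq_square)

lemma profile_imp_solution:
  assumes \<alpha>: "0 < \<alpha>" "\<alpha> < pi" and ij: "(i, j) \<noteq> (0, 0)" and prof: "has_profile \<alpha> i j v"
  shows "\<exists>u. has_type \<alpha> u i j \<and> flux \<alpha> u = v"
proof -
  obtain c f f1 \<eta> where \<eta>: "0 < \<eta>"
    and f: "\<forall>t\<in>{-\<alpha>-\<eta><..<\<alpha>+\<eta>}. (f has_real_derivative f1 t) (at t)"
    and f1: "\<forall>t\<in>{-\<alpha>-\<eta><..<\<alpha>+\<eta>}. (f1 has_real_derivative c - 4 * f t - (f t)\<^sup>2) (at t)"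
    and f0: "f (- \<alpha>) = 0" "f \<alpha> = 0"
    and ci: "finite (components {t \<in> {-\<alpha><..<\<alpha>}. 0 < f t})" "card (components {t \<in> {-\<alpha><..<\<alpha>}. 0 < f t}) = i"
    and cj: "finite (components {t \<in> {-\<alpha><..<\<alpha>}. f t < 0})" "card (components {t \<in> {-\<alpha><..<\<alpha>}. f t < 0}) = j"
    and int: "(f has_integral v) {-\<alpha>..\<alpha>}"
    using prof unfolding has_profile_def by blast
  \<comment> \<open>An interval larger than [- \<alpha>, \<alpha>]: its cone is an open
    neighbourhood of the closed sector minus the vertex, as smoothness up to the boundary
    requires.\<close>
  define J where "J = {-\<alpha>-\<eta><..<\<alpha>+\<eta>}"
  \<comment> \<open>The constant - c / 2 is the one for which f'' + f^2 + 2 P vanishes.\<close>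
  define P where "P = (\<lambda>t. 2 * f t + - c / 2)"
  have J: "open J" by (simp add: J_def)
  note f' = f[folded J_def, rule_format] and f1' = f1[folded J_def, rule_format]
  have cl: "closure (sector \<alpha>) - {0} \<subseteq> angular_cone J"
    using closure_sector_slit[OF \<alpha>] \<eta> by (force simp: angular_cone_def J_def)
  have z: "0 \<notin> sector \<alpha>" using sector_slit(1)[OF \<alpha>] slit_nonzero by blast
  then have sc: "sector \<alpha> \<subseteq> angular_cone J" using cl closure_subset[of "sector \<alpha>"] by blast
  have "NS_solution \<alpha> (rfield f) (pfield P)"
    unfolding NS_solution_def
  proof (intro conjI ballI)
    show "smooth_up_to (rfield f) (closure (sector \<alpha>) - {0})" "smooth_up_to (pfield P) (closure (sector \<alpha>) - {0})"
      unfolding smooth_up_to_def P_def using cl smooth_rfield_pfield[OF J f' f1'] by blast+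
    fix x assume "x \<in> sector \<alpha>"
    then have x: "x \<in> angular_cone J" "x \<in> slit" "ang x \<in> J" using sc by (auto simp: angular_cone_def)
    have P: "(P has_real_derivative 2 * f1 (ang x)) (at (ang x))"
      unfolding P_def using f'[OF x(3)] by (auto intro!: derivative_eq_intros)
    show "- laplacian (rfield f) x + convection (rfield f) x + gradient (pfield P) x = 0"
      by (subst NS_rfield_iff[where f = f and ?f1.0 = f1, OF J x(1) f' f1'[OF x(3)] P]) (simp_all add: P_def)
    show "divergence (rfield f) x = 0"
      using divergence_rfield[where f = f and ?f1.0 = f1, OF x(2) f'[OF x(3)]] .
  qed
  moreover have "no_slip \<alpha> (rfield f)"
    unfolding no_slip_def
  proof
    fix x assume x: "x \<in> frontier (sector \<alpha>) - {0}"
    then have x': "x \<in> closure (sector \<alpha>) - {0}" "x \<notin> sector \<alpha>"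
      using open_sector[OF \<alpha>] by (auto simp: frontier_def interior_open)
    have "\<not> (- \<alpha> < ang x \<and> ang x < \<alpha>)"
      using polar_in_sector[of "norm x" \<alpha> "ang x"] polar_ang(1) closure_sector_slit[OF \<alpha> x'(1)] x'(2) by auto
    then have "ang x = \<alpha> \<or> ang x = - \<alpha>" using closure_sector_slit(2)[OF \<alpha> x'(1)] by auto
    then show "rfield f x = 0" using f0 by (auto simp: rfield_def vec_eq_iff forall_2)
  qed
  moreover have "self_similar \<alpha> (rfield f) (pfield P)"
    unfolding self_similar_def
  proof (intro ballI allI impI conjI)
    fix x and k :: real assume x: "x \<in> sector \<alpha>" and k: "0 < k"
    note s = scale_slit[OF sector_slit(1)[OF \<alpha> x] k]
    show "rfield f x = k *\<^sub>R rfield f (k *\<^sub>R x)" "pfield P x = k\<^sup>2 * pfield P (k *\<^sub>R x)"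
      using k by (simp_all add: rfield_def pfield_def s vec_eq_iff forall_2 power2_eq_square)
  qed
  ultimately have SS: "SS_solution \<alpha> (rfield f)" unfolding SS_solution_def by blast
  have pr: "profile (rfield f) t = f t" if "t \<in> {-\<alpha>..\<alpha>}" for t
    using that \<alpha> by (simp add: profile_def u_rad_def rfield_polar)
  have sets: "{t \<in> {-\<alpha><..<\<alpha>}. 0 < profile (rfield f) t} = {t \<in> {-\<alpha><..<\<alpha>}. 0 < f t}"
    "{t \<in> {-\<alpha><..<\<alpha>}. profile (rfield f) t < 0} = {t \<in> {-\<alpha><..<\<alpha>}. f t < 0}" using pr by force+
  have "\<exists>t\<in>{-\<alpha><..<\<alpha>}. f t \<noteq> 0"
  proof (rule ccontr)
    assume "\<not> ?thesis"
    then have "{t \<in> {-\<alpha><..<\<alpha>}. 0 < f t} = {}" "{t \<in> {-\<alpha><..<\<alpha>}. f t < 0} = {}" by force+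
    then have "i = 0" "j = 0" using ci(2)[symmetric] cj(2)[symmetric] by (simp_all only: components_empty card.empty)
    then show False using ij by simp
  qed
  then obtain t where t: "t \<in> {-\<alpha><..<\<alpha>}" "f t \<noteq> 0" by blast
  have "rfield f (polar 1 t) = f t *\<^sub>R e_r t" using t \<alpha> by (simp add: rfield_polar)
  moreover have "e_r t \<noteq> 0" using e_r_inner[of t] by (metis inner_zero_left zero_neq_one)
  ultimately have nz: "\<exists>x\<in>sector \<alpha>. rfield f x \<noteq> 0"
    using t polar_in_sector[of 1 \<alpha> t] by (intro bexI[of _ "polar 1 t"]) auto
  have "has_type \<alpha> (rfield f) i j"
    unfolding has_type_def maximal_intervals_eq_components sets
    using SS ij nz ci cj \<alpha> by (auto simp: rfield_polar u_rad_def)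
  moreover have "flux \<alpha> (rfield f) = v"
  proof -
    have "flux \<alpha> (rfield f) = integral {-\<alpha>..\<alpha>} f"
      unfolding flux_def using pr by (intro integral_cong) (simp add: profile_def)
    then show ?thesis using int by (simp add: integral_unique)
  qed
  ultimately show ?thesis by blast
qed

section \<open>From self-similar solutions to the profile equation\<close>

lemma polar_1: "polar 1 \<theta> = e_r \<theta>"
  by (simp add: polar_def e_r_def)

lemma e_r_axis: "e_r \<theta> = cos \<theta> *\<^sub>R axis 1 1 + sin \<theta> *\<^sub>R axis 2 1"
  and e_theta_axis: "e_theta \<theta> = (- sin \<theta>) *\<^sub>R axis 1 1 + cos \<theta> *\<^sub>R axis 2 1"
  by (simp_all add: e_r_def e_theta_def vector2_axis)

lemma has_vector_derivative_e_r: "(e_r has_vector_derivative e_theta \<theta>) (at \<theta>)"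
  unfolding e_r_axis[abs_def] e_theta_axis by (auto intro!: derivative_eq_intros)

lemma has_vector_derivative_e_theta: "(e_theta has_vector_derivative - e_r \<theta>) (at \<theta>)"
  unfolding e_theta_axis[abs_def] e_r_axis by (auto intro!: derivative_eq_intros)

lemma inner_nth2: "(x::real^2) \<bullet> y = x $ 1 * y $ 1 + x $ 2 * y $ 2"
  by (simp add: inner_vec_def sum_2)

lemma has_derivative_inner_real:
  fixes g h :: "real \<Rightarrow> 'a::real_inner"
  assumes "(g has_vector_derivative g') (at t)" "(h has_vector_derivative h') (at t)"
  shows "((\<lambda>t. g t \<bullet> h t) has_real_derivative g t \<bullet> h' + g' \<bullet> h t) (at t)"
  using has_derivative_inner[OF assms[unfolded has_vector_derivative_def]]
  unfolding has_field_derivative_def by (rule has_derivative_eq_rhs) (simp add: fun_eq_iff algebra_simps)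

text \<open>A trace is invariant under rotation; for the derivative of u this is the divergence in
  the frame e_r, e_theta.\<close>

lemma trace_rotated:
  assumes "linear D"
  shows "D (e_r \<theta>) \<bullet> e_r \<theta> + D (e_theta \<theta>) \<bullet> e_theta \<theta> = D (axis 1 1) $ 1 + D (axis 2 1) $ 2"
proof -
  have c: "cos \<theta> * (cos \<theta> * a) + sin \<theta> * (sin \<theta> * a) = a" for a :: real
    using sin_cos_squared_add[of \<theta>] by (metis add.commute distrib_right mult.assoc mult_1 power2_eq_square)
  have l: "D (e_r \<theta>) = cos \<theta> *\<^sub>R D (axis 1 1) + sin \<theta> *\<^sub>R D (axis 2 1)"
    "D (e_theta \<theta>) = (- sin \<theta>) *\<^sub>R D (axis 1 1) + cos \<theta> *\<^sub>R D (axis 2 1)"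
    unfolding e_r_axis e_theta_axis linear_add[OF assms] linear_scale[OF assms] by simp_all
  have n: "e_r \<theta> $ 1 = cos \<theta>" "e_r \<theta> $ 2 = sin \<theta>" "e_theta \<theta> $ 1 = - sin \<theta>" "e_theta \<theta> $ 2 = cos \<theta>"
    by (simp_all add: e_r_def e_theta_def)
  show ?thesis
    unfolding l inner_nth2 n using c[of "D (axis 1 1) $ 1"] c[of "D (axis 2 1) $ 2"]
    by (simp add: algebra_simps)
qed

text \<open>Euler's identity for homogeneity of degree -1, obtained by differentiating u (k x) = u x
  / k at k = 1.\<close>

lemma self_similar_derivative:
  assumes ss: "\<And>k. 0 < k \<Longrightarrow> u x = k *\<^sub>R u (k *\<^sub>R x)" and D: "(u has_derivative D) (at x)"
  shows "D x = - (u x :: 'a::real_normed_vector)"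
proof -
  have "((\<lambda>k::real. k *\<^sub>R x) has_derivative (\<lambda>k. k *\<^sub>R x)) (at 1)" by (auto intro!: derivative_eq_intros)
  then have "((\<lambda>k. u (k *\<^sub>R x)) has_derivative (\<lambda>k. D (k *\<^sub>R x))) (at 1)"
    by (rule has_derivative_compose) (use D in simp)
  moreover have "D (k *\<^sub>R x) = k *\<^sub>R D x" for k using linear_scale[OF has_derivative_linear[OF D]] by simp
  ultimately have "((\<lambda>k. u (k *\<^sub>R x)) has_vector_derivative D x) (at 1)" by (simp add: has_vector_derivative_def)
  moreover have "((\<lambda>k. u (k *\<^sub>R x)) has_vector_derivative - u x) (at 1)"
  proof (rule has_vector_derivative_transform_within_open[where S = "{0<..}"])
    show "((\<lambda>k. inverse k *\<^sub>R u x) has_vector_derivative - u x) (at (1::real))"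
      by (auto intro!: derivative_eq_intros)
    show "inverse k *\<^sub>R u x = u (k *\<^sub>R x)" if "k \<in> {0<..}" for k :: real
      using ss[of k] that by simp
  qed auto
  ultimately show ?thesis by (rule vector_derivative_unique_at)
qed

text \<open>On the unit circle the divergence in the polar frame and Euler's identity make the
  angular derivative of the component u_theta vanish, and the no-slip condition makes the component
  itself zero. Then u and p coincide on the sector with \<open>rfield f\<close> and
  \<open>pfield P\<close>, and \<open>NS_rfield_iff\<close> is used in the reverse direction. The
  smooth extensions supply differentiability inside and continuity up to the boundary.\<close>

lemma SS_solution_profile:
  assumes \<alpha>: "0 < \<alpha>" "\<alpha> < pi" and SS: "SS_solution \<alpha> u"
  shows "\<forall>r \<theta>. r > 0 \<and> - \<alpha> < \<theta> \<and> \<theta> < \<alpha> \<longrightarrow> u_ang u r \<theta> = 0"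
    and "continuous_on {-\<alpha>..\<alpha>} (profile u)" "profile u (- \<alpha>) = 0" "profile u \<alpha> = 0"
    and "\<exists>c f1. \<forall>t\<in>{-\<alpha><..<\<alpha>}. (profile u has_real_derivative f1 t) (at t) \<and>
           (f1 has_real_derivative c - 4 * profile u t - (profile u t)\<^sup>2) (at t)"
proof -
  obtain p where NS: "NS_solution \<alpha> u p" and ns: "no_slip \<alpha> u" and sim: "self_similar \<alpha> u p"
    using SS unfolding SS_solution_def by blast
  obtain U g where U: "closure (sector \<alpha>) - {0} \<subseteq> U" "open U" "\<forall>k. Ck_on k g U" "\<forall>x\<in>closure (sector \<alpha>) - {0}. g x = u x"
    using NS unfolding NS_solution_def smooth_up_to_def smooth_on_open_def by blast
  obtain W q where W: "closure (sector \<alpha>) - {0} \<subseteq> W" "open W" "\<forall>k. Ck_on k q W" "\<forall>x\<in>closure (sector \<alpha>) - {0}. q x = p x"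
    using NS unfolding NS_solution_def smooth_up_to_def smooth_on_open_def by blast
  let ?S = "sector \<alpha>"
  have oS: "open ?S" by (rule open_sector[OF \<alpha>])
  have Sc: "x \<in> closure ?S - {0}" if "x \<in> ?S" for x
    using that sector_slit(1)[OF \<alpha> that] slit_nonzero closure_subset by blast
  have SU: "x \<in> U" "x \<in> W" "g x = u x" "q x = p x" if "x \<in> ?S" for x using Sc[OF that] U W by auto
  define D where "D x = frechet_derivative u (at x)" for x
  have gd: "g differentiable (at x)" if "x \<in> U" for x using U(3)[rule_format, of "Suc 0"] that by simp
  have Dg: "frechet_derivative g (at x) = D x" if "x \<in> ?S" for x
    unfolding D_def by (rule frechet_derivative_cong[OF oS that]) (use SU in auto)
  have D: "(u has_derivative D x) (at x)" if "x \<in> ?S" for x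
    using has_derivative_transform_within_open[OF _ oS that, of g "D x" UNIV u]
      gd[OF SU(1)[OF that]] Dg[OF that] SU(3) by (auto simp: frechet_derivative_works)
  have DD: "(\<lambda>x. D x v) differentiable (at x)" if x: "x \<in> ?S" for x v
  proof -
    have "(\<lambda>x. frechet_derivative g (at x) v) differentiable (at x)"
      using U(3)[rule_format, of "Suc (Suc 0)"] SU(1)[OF x] by simp
    then obtain E where "((\<lambda>x. frechet_derivative g (at x) v) has_derivative E) (at x)" by (auto simp: differentiable_def)
    then have "((\<lambda>x. D x v) has_derivative E) (at x)"
      by (rule has_derivative_transform_within_open[OF _ oS x]) (simp add: Dg)
    then show ?thesis by (auto simp: differentiable_def)
  qed
  have pd: "p differentiable (at x)" if x: "x \<in> ?S" for x
  proof -
    have "q differentiable (at x)" using W(3)[rule_format, of "Suc 0"] SU(2)[OF x] by simp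
    then obtain E where "(q has_derivative E) (at x)" by (auto simp: differentiable_def)
    then have "(p has_derivative E) (at x)"
      by (rule has_derivative_transform_within_open[OF _ oS x]) (simp add: SU)
    then show ?thesis by (auto simp: differentiable_def)
  qed
  have ssu: "u x = k *\<^sub>R u (k *\<^sub>R x)" "p x = k\<^sup>2 * p (k *\<^sub>R x)" if "x \<in> ?S" "0 < k" for x k
    using sim that unfolding self_similar_def by auto
  have eS: "e_r t \<in> ?S" if "t \<in> {-\<alpha><..<\<alpha>}" for t
    using polar_in_sector[of 1 \<alpha> t] that by (simp add: polar_1)
  have eC: "e_r t \<in> closure ?S - {0}" if "t \<in> {-\<alpha>..\<alpha>}" for t
    using polar_boundary(1)[OF \<alpha>, of t 1] that by (simp add: polar_1 abs_le_iff)
  have bd: "u (e_r \<alpha>) = 0" "u (e_r (- \<alpha>)) = 0"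
    using ns polar_boundary(2)[OF \<alpha>, of _ 1] \<alpha> unfolding no_slip_def by (simp_all add: polar_1)
  have ce: "continuous_on X e_r" for X
    using has_vector_derivative_continuous[OF has_vector_derivative_e_r] by (auto intro: continuous_at_imp_continuous_on)
  have ct: "continuous_on X e_theta" for X
    using has_vector_derivative_continuous[OF has_vector_derivative_e_theta] by (auto intro: continuous_at_imp_continuous_on)
  have cu: "continuous_on {-\<alpha>..\<alpha>} (\<lambda>t. u (e_r t))"
  proof (rule continuous_on_eq)
    have "continuous_on U g" using U(3)[rule_format, of 0] by simp
    then show "continuous_on {-\<alpha>..\<alpha>} (\<lambda>t. g (e_r t))"
      using eC U(1) by (intro continuous_on_compose2[OF _ ce]) auto
    show "g (e_r t) = u (e_r t)" if "t \<in> {-\<alpha>..\<alpha>}" for t using eC[OF that] U(4) by blast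
  qed
  have pr: "profile u t = u (e_r t) \<bullet> e_r t" for t by (simp add: profile_def u_rad_def polar_1)
  define f where "f = profile u"
  define h where "h t = u (e_r t) \<bullet> e_theta t" for t
  have cf: "continuous_on {-\<alpha>..\<alpha>} f" and ch: "continuous_on {-\<alpha>..\<alpha>} h"
    unfolding f_def h_def pr by (intro continuous_intros cu ce ct)+
  have f0: "f (- \<alpha>) = 0" "f \<alpha> = 0" and h0: "h (- \<alpha>) = 0" unfolding f_def h_def pr by (simp_all add: bd)
  show "continuous_on {-\<alpha>..\<alpha>} (profile u)" "profile u (- \<alpha>) = 0" "profile u \<alpha> = 0" using cf f0 by (simp_all add: f_def)
  have du: "((\<lambda>t. u (e_r t)) has_vector_derivative D (e_r t) (e_theta t)) (at t)" if t: "t \<in> {-\<alpha><..<\<alpha>}" for t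
  proof -
    have "((\<lambda>t. u (e_r t)) has_derivative (\<lambda>k. D (e_r t) (k *\<^sub>R e_theta t))) (at t)"
      using has_derivative_compose[OF has_vector_derivative_e_r[unfolded has_vector_derivative_def] D[OF eS[OF t]]] .
    then show ?thesis unfolding has_vector_derivative_def linear_scale[OF has_derivative_linear[OF D[OF eS[OF t]]]] .
  qed
  have h': "(h has_real_derivative 0) (at t)" if t: "t \<in> {-\<alpha><..<\<alpha>}" for t
  proof -
    have x: "e_r t \<in> ?S" using eS[OF t] .
    have "divergence u (e_r t) = 0" using NS x unfolding NS_solution_def by blast
    then have "D (e_r t) (axis 1 1) $ 1 + D (e_r t) (axis 2 1) $ 2 = 0"
      by (simp add: divergence_def sum_2 pderiv_at_def D_def)
    then have "D (e_r t) (e_r t) \<bullet> e_r t + D (e_r t) (e_theta t) \<bullet> e_theta t = 0"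
      using trace_rotated[OF has_derivative_linear[OF D[OF x]]] by simp
    moreover have "D (e_r t) (e_r t) = - u (e_r t)"
      using self_similar_derivative[OF ssu(1)[OF x] D[OF x]] .
    ultimately have "u (e_r t) \<bullet> - e_r t + D (e_r t) (e_theta t) \<bullet> e_theta t = 0" by simp
    then show ?thesis unfolding h_def
      using has_derivative_inner_real[OF du[OF t] has_vector_derivative_e_theta] by (simp only:)
  qed
  have hz: "h t = 0" if "t \<in> {-\<alpha>..\<alpha>}" for t
  proof -
    have "h t = h (- \<alpha>)"
    proof (cases "t = - \<alpha>")
      case False
      then show ?thesis using that ch h'
        by (intro DERIV_isconst2[of "- \<alpha>" t h t]) (auto intro: continuous_on_subset)
    qed simp
    then show ?thesis using h0 by simp
  qed
  have up: "u (e_r t) = f t *\<^sub>R e_r t" if "t \<in> {-\<alpha>..\<alpha>}" for t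
    using polar_decomposition[of u 1 t] hz[OF that] by (simp add: polar_1 h_def u_ang_def f_def profile_def)
  have upol: "u (polar r t) = (f t / r) *\<^sub>R e_r t" if "0 < r" "t \<in> {-\<alpha><..<\<alpha>}" for r t
  proof -
    have "u (e_r t) = r *\<^sub>R u (polar r t)"
      using ssu(1)[OF eS[OF that(2)] that(1)] scale_polar[of r 1 t] by (simp add: polar_1)
    then have "r *\<^sub>R u (polar r t) = f t *\<^sub>R e_r t" using up that by simp
    then have "inverse r *\<^sub>R (r *\<^sub>R u (polar r t)) = inverse r *\<^sub>R (f t *\<^sub>R e_r t)" by simp
    then show ?thesis using that by (simp add: divide_inverse mult.commute)
  qed
  have orth: "e_r t \<bullet> e_theta t = 0" for t by (simp add: e_r_def e_theta_def inner_nth2)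
  show "\<forall>r \<theta>. r > 0 \<and> - \<alpha> < \<theta> \<and> \<theta> < \<alpha> \<longrightarrow> u_ang u r \<theta> = 0"
    by (simp add: u_ang_def upol orth)
  define f1 where "f1 t = D (e_r t) (e_theta t) \<bullet> e_r t" for t
  have f1: "(f has_real_derivative f1 t) (at t)" if t: "t \<in> {-\<alpha><..<\<alpha>}" for t
    using has_derivative_inner_real[OF du[OF t] has_vector_derivative_e_r] hz[of t] t
    unfolding f_def pr[abs_def] f1_def by (simp add: h_def)
  \<comment> \<open>f1 contains the derivative of u in the moving direction e_theta. Expanding that
    direction in the fixed axes reduces the claim to differentiability of derivatives in constant
    directions.\<close>
  have "\<exists>f2. (f1 has_real_derivative f2) (at t)" if t: "t \<in> {-\<alpha><..<\<alpha>}" for t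
  proof -
    define A where "A v s = D (e_r s) v \<bullet> e_r s" for v s
    have "A v differentiable (at t)" for v
    proof -
      have "e_r differentiable (at t)"
        using has_vector_derivative_e_r[of t] unfolding has_vector_derivative_def differentiable_def by blast
      then show ?thesis unfolding A_def
        using differentiable_compose[where f = "\<lambda>x. D x v" and g = e_r, OF DD[OF eS[OF t]]] by (intro differentiable_inner) auto
    qed
    then have A: "A v field_differentiable (at t)" for v
      using real_differentiable_def[of "A v" t] by (auto simp: field_differentiable_def)
    have "(\<lambda>s. - sin s * A (axis 1 1) s + cos s * A (axis 2 1) s) field_differentiable (at t)"
      by (intro field_differentiable_add field_differentiable_mult field_differentiable_minus A field_differentiable_at_sin field_differentiable_at_cos)
    then obtain d where "((\<lambda>s. - sin s * A (axis 1 1) s + cos s * A (axis 2 1) s) has_real_derivative d) (at t)"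
      by (auto simp: field_differentiable_def)
    then have "(f1 has_real_derivative d) (at t)"
    proof (rule has_field_derivative_transform_within_open[where S = "{-\<alpha><..<\<alpha>}"])
      show "- sin s * A (axis 1 1) s + cos s * A (axis 2 1) s = f1 s" if "s \<in> {-\<alpha><..<\<alpha>}" for s
      proof -
        note l = has_derivative_linear[OF D[OF eS[OF that]]]
        show ?thesis unfolding f1_def A_def e_theta_axis linear_add[OF l] linear_scale[OF l]
          by (simp add: inner_add_left inner_diff_left)
      qed
    qed (use t in auto)
    then show ?thesis by blast
  qed
  then obtain f2 where f2: "(f1 has_real_derivative f2 t) (at t)" if "t \<in> {-\<alpha><..<\<alpha>}" for t by metis
  define P where "P t = p (e_r t)" for t
  have "\<exists>P1. (P has_real_derivative P1) (at t)" if t: "t \<in> {-\<alpha><..<\<alpha>}" for t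
  proof -
    have "e_r differentiable (at t)"
      using has_vector_derivative_e_r[of t] unfolding has_vector_derivative_def differentiable_def by blast
    then have "P differentiable (at t)"
      unfolding P_def using differentiable_compose[where f = p and g = e_r, OF pd[OF eS[OF t]]] by auto
    then show ?thesis using real_differentiable_def[of P t] by auto
  qed
  then obtain P1 where P1: "(P has_real_derivative P1 t) (at t)" if "t \<in> {-\<alpha><..<\<alpha>}" for t by metis
  have uR: "rfield f x = u x" and pP: "pfield P x = p x" if x: "x \<in> ?S" for x
  proof -
    obtain r t where rt: "x = polar r t" "0 < r" "t \<in> {-\<alpha><..<\<alpha>}" using x by (auto simp: sector_def)
    show "rfield f x = u x" using upol[OF rt(2,3)] rt \<alpha> by (simp add: rfield_polar)
    have "P t = r\<^sup>2 * p x" using ssu(2)[OF eS[OF rt(3)] rt(2)] scale_polar[of r 1 t] by (simp add: polar_1 P_def rt(1))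
    then show "pfield P x = p x" using rt \<alpha> by (simp add: pfield_def sq_polar ang_polar)
  qed
  have key: "f2 t + (f t)\<^sup>2 + 2 * P t = 0 \<and> P1 t = 2 * f1 t" if t: "t \<in> {-\<alpha><..<\<alpha>}" for t
  proof -
    let ?J = "{-\<alpha><..<\<alpha>}"
    have x: "e_r t \<in> ?S" using eS[OF t] .
    have a: "ang (e_r t) = t" using ang_polar[of 1 t] t \<alpha> by (simp add: polar_1)
    have xc: "e_r t \<in> angular_cone ?J" using sector_slit(1)[OF \<alpha> x] t by (simp add: angular_cone_def a)
    have "pderiv_at i (rfield f) y = pderiv_at i u y" if "y \<in> ?S" for i y
      by (rule pderiv_at_cong[OF oS that uR])
    note p1 = this
    have "pderiv_at i (pderiv_at k (rfield f)) (e_r t) = pderiv_at i (pderiv_at k u) (e_r t)" for i k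
      by (rule pderiv_at_cong[OF oS x p1])
    then have "laplacian (rfield f) (e_r t) = laplacian u (e_r t)" by (simp add: laplacian_def)
    moreover have "convection (rfield f) (e_r t) = convection u (e_r t)"
      by (simp add: convection_def p1[OF x] uR[OF x])
    moreover have "gradient (pfield P) (e_r t) = gradient p (e_r t)"
      unfolding gradient_def using pderiv_at_cong[OF oS x pP] by simp
    ultimately have "- laplacian (rfield f) (e_r t) + convection (rfield f) (e_r t) + gradient (pfield P) (e_r t) = 0"
      using NS x unfolding NS_solution_def by simp
    then show ?thesis
      using NS_rfield_iff[where f = f and ?f1.0 = f1 and ?f2.0 = "f2 t" and ?P1.0 = "P1 t" and J = ?J, OF _ xc] f1 f2[OF t] P1[OF t]
      unfolding a by simp
  qed
  \<comment> \<open>The relation P' = 2 f' is integrated; the constant of the profile equation is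
    then - 2 C.\<close>
  obtain C where C: "P t = 2 * f t + C" if "t \<in> {-\<alpha><..<\<alpha>}" for t
  proof -
    have "\<exists>C. \<forall>t\<in>{-\<alpha><..<\<alpha>}. P t - 2 * f t = C"
    proof (rule has_field_derivative_zero_constant)
      show "((\<lambda>t. P t - 2 * f t) has_field_derivative 0) (at t within {-\<alpha><..<\<alpha>})" if "t \<in> {-\<alpha><..<\<alpha>}" for t
        using DERIV_diff[OF P1[OF that] DERIV_cmult[OF f1[OF that], of 2]] key[OF that]
        by (auto intro: has_field_derivative_at_within)
    qed simp
    then show thesis using that by (metis add.commute diff_add_cancel)
  qed
  have "f2 t = - 2 * C - 4 * profile u t - (profile u t)\<^sup>2" if "t \<in> {-\<alpha><..<\<alpha>}" for t
    using key[OF that] C[OF that] unfolding f_def by simp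
  then show "\<exists>c f1. \<forall>t\<in>{-\<alpha><..<\<alpha>}. (profile u has_real_derivative f1 t) (at t) \<and>
           (f1 has_real_derivative c - 4 * profile u t - (profile u t)\<^sup>2) (at t)"
    using f1 f2 unfolding f_def[symmetric] by (intro exI[of _ "- 2 * C"] exI[of _ f1]) auto
qed

section \<open>The range of the flux\<close>

text \<open>All nonexistence claims pass through this lemma: a solution of the given type yields
  parameters whose half lengths add up to \<alpha>, and the flux bounds for such parameters
  apply.\<close>

lemma has_type_parameters:
  assumes \<alpha>: "0 < \<alpha>" "\<alpha> < pi" and T: "has_type \<alpha> u i j"
  obtains c d a b where "0 \<le> d"
    "0 < i \<Longrightarrow> 0 < a \<and> energy_poly 1 c d a = 0 \<and> admissible (1 * a) (6 + 1 * a) (3 * d / (2 * a\<^sup>2))"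
    "0 < j \<Longrightarrow> 0 < b \<and> energy_poly (-1) (- c) d b = 0 \<and> admissible (-1 * b) (6 + -1 * b) (3 * d / (2 * b\<^sup>2))"
    "\<alpha> = real i * tsing 1 a (3 * d / (2 * a\<^sup>2)) + real j * tsing (-1) b (3 * d / (2 * b\<^sup>2))"
    "flux \<alpha> u = 2 * (real i * fsing 1 a (3 * d / (2 * a\<^sup>2)) - real j * fsing (-1) b (3 * d / (2 * b\<^sup>2)))"
proof -
  have SS: "SS_solution \<alpha> u" using T by (simp add: has_type_def)
  note P = SS_solution_profile[OF \<alpha> SS]
  obtain c f1 where ode: "\<forall>t\<in>{-\<alpha><..<\<alpha>}. (profile u has_real_derivative f1 t) (at t) \<and>
      (f1 has_real_derivative c - 4 * profile u t - (profile u t)\<^sup>2) (at t)" using P(5) by blast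
  have nz: "\<exists>t\<in>{-\<alpha><..<\<alpha>}. profile u t \<noteq> 0"
  proof -
    obtain x where x: "x \<in> sector \<alpha>" "u x \<noteq> 0" using T by (auto simp: has_type_def)
    then obtain r t where rt: "x = polar r t" "r > 0" "- \<alpha> < t" "t < \<alpha>" by (auto simp: sector_def)
    then have "u x = u_rad u r t *\<^sub>R e_r t" using T by (auto simp: has_type_def)
    then have "u_rad u r t \<noteq> 0" using x by auto
    then show ?thesis using profile_eq[OF SS rt(2-4)] rt by (intro bexI[of _ t]) auto
  qed
  have fin: "finite (components {t \<in> {-\<alpha><..<\<alpha>}. 0 < profile u t})" "finite (components {t \<in> {-\<alpha><..<\<alpha>}. profile u t < 0})"
    and card: "i = card (components {t \<in> {-\<alpha><..<\<alpha>}. 0 < profile u t})" "j = card (components {t \<in> {-\<alpha><..<\<alpha>}. profile u t < 0})"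
    using T by (simp_all add: has_type_def maximal_intervals_eq_components)
  obtain d a b where par: "0 \<le> d"
    "0 < i \<Longrightarrow> 0 < a \<and> energy_poly 1 c d a = 0 \<and> admissible (1 * a) (6 + 1 * a) (3 * d / (2 * a\<^sup>2))"
    "0 < j \<Longrightarrow> 0 < b \<and> energy_poly (-1) (- c) d b = 0 \<and> admissible (-1 * b) (6 + -1 * b) (3 * d / (2 * b\<^sup>2))"
    "\<alpha> = real i * tsing 1 a (3 * d / (2 * a\<^sup>2)) + real j * tsing (-1) b (3 * d / (2 * b\<^sup>2))"
    "(profile u has_integral 2 * (real i * fsing 1 a (3 * d / (2 * a\<^sup>2)) - real j * fsing (-1) b (3 * d / (2 * b\<^sup>2)))) {-\<alpha>..\<alpha>}"
    using profile_decomposition[where f = "profile u" and ?f1.0 = f1 and c = c, OF \<alpha>(1) P(2-4) _ _ nz fin card] ode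
    by blast
  have "flux \<alpha> u = 2 * (real i * fsing 1 a (3 * d / (2 * a\<^sup>2)) - real j * fsing (-1) b (3 * d / (2 * b\<^sup>2)))"
    using integral_unique[OF par(5)] by (simp add: flux_def profile_def[abs_def])
  with par(1-4) show thesis by (intro that)
qed

lemma flux_range_mixed:
  assumes \<alpha>: "0 < \<alpha>" "\<alpha> < pi" and i: "0 < i" and j: "0 < j"
    and ij: "i = j \<or> j = Suc i \<or> i = Suc j \<and> \<alpha> \<le> real j * (pi / 2)"
  shows "\<exists>M. (\<forall>v. v < M \<longrightarrow> (\<exists>u. has_type \<alpha> u i j \<and> flux \<alpha> u = v)) \<and>
    (\<forall>v. v > M \<longrightarrow> \<not> (\<exists>u. has_type \<alpha> u i j \<and> flux \<alpha> u = v))"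
proof -
  obtain M where ex: "\<And>v. v < M \<Longrightarrow> \<exists>a b. 0 < a \<and> 0 < b \<and> b < 3 + a / 2 \<and> ttot i j a b = \<alpha> \<and> ftot i j a b = v"
    and le: "\<And>a b. 0 < a \<Longrightarrow> 0 < b \<Longrightarrow> b < 3 + a / 2 \<Longrightarrow> ttot i j a b = \<alpha> \<Longrightarrow> ftot i j a b \<le> M"
    using mixed_type_flux_range[OF \<alpha> i j ij] by blast
  have "\<exists>u. has_type \<alpha> u i j \<and> flux \<alpha> u = v" if v: "v < M" for v
  proof -
    obtain a b where ab: "0 < a" "0 < b" "b < 3 + a / 2" "ttot i j a b = \<alpha>" "ftot i j a b = v" using ex[OF v] by blast
    have "has_profile \<alpha> i j v" using mixed_profile_exists[OF ab(1-3) _ ab(4)] ij ab(5) by blast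
    then show ?thesis using i by (intro profile_imp_solution[OF \<alpha>]) auto
  qed
  moreover have "flux \<alpha> u \<le> M" if T: "has_type \<alpha> u i j" for u
  proof -
    obtain c d a b where p: "0 < a" "energy_poly 1 c d a = 0" "0 < b" "energy_poly (-1) (- c) d b = 0"
      "admissible (-1 * b) (6 + -1 * b) (3 * d / (2 * b\<^sup>2))"
      "\<alpha> = real i * tsing 1 a (3 * d / (2 * a\<^sup>2)) + real j * tsing (-1) b (3 * d / (2 * b\<^sup>2))"
      "flux \<alpha> u = 2 * (real i * fsing 1 a (3 * d / (2 * a\<^sup>2)) - real j * fsing (-1) b (3 * d / (2 * b\<^sup>2)))"
      using has_type_parameters[OF \<alpha> T] i j by metis
    \<comment> \<open>As both signs occur, d and the inequality b < 3 + a / 2 are recovered from the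
      two extrema.\<close>
    note e = energy_of_extrema[OF p(1-5)]
    have "ttot i j a b = \<alpha>" "flux \<alpha> u = ftot i j a b"
      using p(6,7) unfolding e(1) tsing_mixed[OF p(1,3)] ttot_def ftot_def by simp_all
    then show ?thesis using le[OF p(1,3) e(2)] by simp
  qed
  ultimately show ?thesis by (intro exI[of _ M]) (auto simp: not_less[symmetric])
qed

lemma has_type_positive_parameters:
  assumes \<alpha>: "0 < \<alpha>" "\<alpha> < pi" and T: "has_type \<alpha> u 1 0"
  obtains a g where "0 < a" "0 \<le> g" "tsing 1 a g = \<alpha>" "flux \<alpha> u = 2 * fsing 1 a g"
proof -
  obtain c d a b where "0 \<le> d" "0 < a" "\<alpha> = tsing 1 a (3 * d / (2 * a\<^sup>2))" "flux \<alpha> u = 2 * fsing 1 a (3 * d / (2 * a\<^sup>2))"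
    by (rule has_type_parameters[OF \<alpha> T]) auto
  then show thesis by (intro that[of a "3 * d / (2 * a\<^sup>2)"]) auto
qed

lemma flux_range_positive:
  assumes \<alpha>: "0 < \<alpha>" "\<alpha> < pi / 2"
  shows "\<exists>M>0. (\<forall>v. 0 < v \<and> v < M \<longrightarrow> (\<exists>u. has_type \<alpha> u 1 0 \<and> flux \<alpha> u = v)) \<and>
    (\<forall>v. v > M \<longrightarrow> \<not> (\<exists>u. has_type \<alpha> u 1 0 \<and> flux \<alpha> u = v))"
proof -
  have \<alpha>': "\<alpha> < pi" using \<alpha> by simp
  obtain M where M: "0 < M"
    and ex: "\<And>v. 0 < v \<Longrightarrow> v < M \<Longrightarrow> \<exists>a g. 0 < a \<and> 0 < g \<and> tsing 1 a g = \<alpha> \<and> 2 * fsing 1 a g = v"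
    and le: "\<And>a g. 0 < a \<Longrightarrow> 0 \<le> g \<Longrightarrow> tsing 1 a g = \<alpha> \<Longrightarrow> 2 * fsing 1 a g \<le> M"
    using positive_type_flux_range[OF \<alpha>] by blast
  have "\<exists>u. has_type \<alpha> u 1 0 \<and> flux \<alpha> u = v" if v: "0 < v" "v < M" for v
  proof -
    obtain a g where ag: "0 < a" "0 < g" "tsing 1 a g = \<alpha>" "2 * fsing 1 a g = v" using ex[OF v] by blast
    have "admissible (1 * a) (6 + 1 * a) g" using ag by (simp add: admissible_def slope_def)
    then have "has_profile \<alpha> 1 0 v" using single_profile_exists[of 1 a g \<alpha>] ag by simp
    then show ?thesis by (intro profile_imp_solution \<alpha>(1) \<alpha>') auto
  qed
  moreover have "flux \<alpha> u \<le> M" if "has_type \<alpha> u 1 0" for u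
    by (rule has_type_positive_parameters[OF \<alpha>(1) \<alpha>' that]) (use le in auto)
  ultimately show ?thesis using M by (intro exI[of _ M]) (auto simp: not_less[symmetric])
qed

lemma flux_range_negative:
  assumes \<alpha>: "0 < \<alpha>" "\<alpha> < pi"
  shows "\<exists>M. (\<forall>v. v < M \<longrightarrow> (\<exists>u. has_type \<alpha> u 0 1 \<and> flux \<alpha> u = v)) \<and>
    (\<forall>v. v > M \<longrightarrow> \<not> (\<exists>u. has_type \<alpha> u 0 1 \<and> flux \<alpha> u = v))"
proof -
  obtain M where
    ex: "\<And>v. v < M \<Longrightarrow> \<exists>b g. 0 < b \<and> 0 < g \<and> 2 * b - 6 < g \<and> tsing (-1) b g = \<alpha> \<and> - 2 * fsing (-1) b g = v"
    and le: "\<And>b g. 0 < b \<Longrightarrow> 0 \<le> g \<Longrightarrow> 2 * b - 6 < g \<Longrightarrow> tsing (-1) b g = \<alpha> \<Longrightarrow> - 2 * fsing (-1) b g \<le> M"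
    using negative_type_flux_range[OF \<alpha>(1)] by blast
  have adm: "admissible (-1 * b) (6 + -1 * b) g \<longleftrightarrow> 0 \<le> g \<and> 2 * b - 6 < g" if "0 < b" for b g
    using that by (auto simp: admissible_def slope_def)
  have "\<exists>u. has_type \<alpha> u 0 1 \<and> flux \<alpha> u = v" if v: "v < M" for v
  proof -
    obtain b g where bg: "0 < b" "0 < g" "2 * b - 6 < g" "tsing (-1) b g = \<alpha>" "- 2 * fsing (-1) b g = v" using ex[OF v] by blast
    then have "has_profile \<alpha> 0 1 v" using single_profile_exists[of "-1" b g \<alpha>] adm[of b g] by simp
    then show ?thesis by (intro profile_imp_solution \<alpha>) auto
  qed
  moreover have "flux \<alpha> u \<le> M" if T: "has_type \<alpha> u 0 1" for u
  proof -
    obtain c d a b where "0 \<le> d" "0 < b \<and> energy_poly (-1) (- c) d b = 0 \<and> admissible (-1 * b) (6 + -1 * b) (3 * d / (2 * b\<^sup>2))"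
      "\<alpha> = tsing (-1) b (3 * d / (2 * b\<^sup>2))" "flux \<alpha> u = - 2 * fsing (-1) b (3 * d / (2 * b\<^sup>2))"
      by (rule has_type_parameters[OF \<alpha> T]) auto
    then show ?thesis using le[of b "3 * d / (2 * b\<^sup>2)"] adm[of b "3 * d / (2 * b\<^sup>2)"] by simp
  qed
  ultimately show ?thesis by (intro exI[of _ M]) (auto simp: not_less[symmetric])
qed

theorem theorem1p2:
  fixes \<alpha> :: real
  assumes "0 < \<alpha>" and "\<alpha> < pi"
  shows
    "(\<forall>u. SS_solution \<alpha> u \<longrightarrow> (\<forall>r \<theta>. r > 0 \<and> - \<alpha> < \<theta> \<and> \<theta> < \<alpha> \<longrightarrow> u_ang u r \<theta> = 0))
     \<and>
     ((pi / 2 \<le> \<alpha> \<longrightarrow> \<not> (\<exists>u. has_type \<alpha> u 1 0)) \<and>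
      (\<alpha> < pi / 2 \<longrightarrow>
        (\<exists>\<Phi>max::real. \<Phi>max > 0 \<and>
          (\<forall>\<Phi>. 0 < \<Phi> \<and> \<Phi> < \<Phi>max \<longrightarrow> (\<exists>u. has_type \<alpha> u 1 0 \<and> flux \<alpha> u = \<Phi>)) \<and>
          (\<forall>\<Phi>. \<Phi> > \<Phi>max \<longrightarrow> \<not> (\<exists>u. has_type \<alpha> u 1 0 \<and> flux \<alpha> u = \<Phi>)))))
     \<and>
     (\<forall>mp mn :: nat.
        \<bar>int mp - int mn\<bar> \<le> 1 \<and> (mp, mn) \<noteq> (0, 0) \<and> (mp, mn) \<noteq> (1, 0) \<and> (mp, mn) \<noteq> (2, 1) \<longrightarrow>
        (\<exists>\<Phi>max::real.
          (\<forall>\<Phi>. \<Phi> < \<Phi>max \<longrightarrow> (\<exists>u. has_type \<alpha> u mp mn \<and> flux \<alpha> u = \<Phi>)) \<and>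
          (\<forall>\<Phi>. \<Phi> > \<Phi>max \<longrightarrow> \<not> (\<exists>u. has_type \<alpha> u mp mn \<and> flux \<alpha> u = \<Phi>))))
     \<and>
     (\<alpha> \<le> pi / 2 \<longrightarrow>
        (\<exists>\<Phi>max::real.
          (\<forall>\<Phi>. \<Phi> < \<Phi>max \<longrightarrow> (\<exists>u. has_type \<alpha> u 2 1 \<and> flux \<alpha> u = \<Phi>)) \<and>
          (\<forall>\<Phi>. \<Phi> > \<Phi>max \<longrightarrow> \<not> (\<exists>u. has_type \<alpha> u 2 1 \<and> flux \<alpha> u = \<Phi>))))"
proof (intro conjI allI impI)
  show "u_ang u r \<theta> = 0" if "SS_solution \<alpha> u" "r > 0 \<and> - \<alpha> < \<theta> \<and> \<theta> < \<alpha>" for u r \<theta>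
    using SS_solution_profile(1)[OF assms that(1)] that(2) by blast
  show "\<not> (\<exists>u. has_type \<alpha> u 1 0)" if "pi / 2 \<le> \<alpha>"
  proof
    assume "\<exists>u. has_type \<alpha> u 1 0"
    then obtain u a g where "0 < a" "0 \<le> g" "tsing 1 a g = \<alpha>" using has_type_positive_parameters[OF assms] by metis
    then show False using tsing_pos_less_half_pi[of a g] that by simp
  qed
  show "\<exists>\<Phi>max>0. (\<forall>\<Phi>. 0 < \<Phi> \<and> \<Phi> < \<Phi>max \<longrightarrow> (\<exists>u. has_type \<alpha> u 1 0 \<and> flux \<alpha> u = \<Phi>)) \<and>
          (\<forall>\<Phi>. \<Phi> > \<Phi>max \<longrightarrow> \<not> (\<exists>u. has_type \<alpha> u 1 0 \<and> flux \<alpha> u = \<Phi>))" if "\<alpha> < pi / 2"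
    by (rule flux_range_positive[OF assms(1) that])
  show "\<exists>\<Phi>max. (\<forall>\<Phi>. \<Phi> < \<Phi>max \<longrightarrow> (\<exists>u. has_type \<alpha> u mp mn \<and> flux \<alpha> u = \<Phi>)) \<and>
          (\<forall>\<Phi>. \<Phi> > \<Phi>max \<longrightarrow> \<not> (\<exists>u. has_type \<alpha> u mp mn \<and> flux \<alpha> u = \<Phi>))"
    if m: "\<bar>int mp - int mn\<bar> \<le> 1 \<and> (mp, mn) \<noteq> (0, 0) \<and> (mp, mn) \<noteq> (1, 0) \<and> (mp, mn) \<noteq> (2, 1)" for mp mn
  \<comment> \<open>With mp = 0 only (0, 1) is left. Otherwise mn is positive as well, because (1,
    0) is excluded, and both signs occur.\<close>
  proof (cases "mp = 0")
    case True
    then have "mn = 1" using m by auto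
    then show ?thesis using flux_range_negative[OF assms] True by simp
  next
    case False
    \<comment> \<open>Without (1, 0) and (2, 1) one has mn >= 2, so mn pi / 2 >= pi > \<alpha> and
      the restriction on the angle holds automatically.\<close>
    have "\<alpha> \<le> real mn * (pi / 2)" if "mp = Suc mn"
    proof -
      have "mn \<noteq> 0" "mn \<noteq> 1" using m that by auto
      then have "2 \<le> mn" by linarith
      then have "2 \<le> real mn" by simp
      then have "2 * (pi / 2) \<le> real mn * (pi / 2)" by (intro mult_right_mono) auto
      moreover have "2 * (pi / 2) = pi" by simp
      ultimately show ?thesis using assms(2) by linarith
    qed
    then show ?thesis using m False by (intro flux_range_mixed assms) auto
  qed
  show "\<exists>\<Phi>max. (\<forall>\<Phi>. \<Phi> < \<Phi>max \<longrightarrow> (\<exists>u. has_type \<alpha> u 2 1 \<and> flux \<alpha> u = \<Phi>)) \<and>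
          (\<forall>\<Phi>. \<Phi> > \<Phi>max \<longrightarrow> \<not> (\<exists>u. has_type \<alpha> u 2 1 \<and> flux \<alpha> u = \<Phi>))" if "\<alpha> \<le> pi / 2"
    using that by (intro flux_range_mixed assms) auto
qed

end
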